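(* Let $r\ge 3$ and $n\ge 20$ be integers, and let $\mathcal{H}^{(r)}_n$ be the set of all connected $r$-uniform hypergraphs with exactly $n$ edges (up to isomorphism). Let $$G\in\mathcal{H}^{(r)}_n\setminus\{A^{(r)}_n,\ F^{(r)}_{1,1,n-3},\ G^{(r)}_{1,1:n-6:1,1},\ F^{(r)}_{1,2,n-4},\ E^{(r)}_{1,1,n-2},\ G^{(r)}_{1,2:n-7:1,1},\ BD^{(r)}_{n},\ C_n^{(r)},\ \widetilde{D}^{(r)}_n,\ G^{(r)}_{1,2:n-8:1,2},\ \widetilde{BD}^{(r)}_n\}.$$ Then $\rho(G)>(r-1)!\sqrt[r]{4}$. Moreover, $$\rho(A^{(r)}_n)<\rho(F^{(r)}_{1,1,n-3})<\rho(G^{(r)}_{1,1:n-6:1,1})<\rho(F^{(r)}_{1,2,n-4})<\rho(E^{(r)}_{1,1,n-2})<\rho(G^{(r)}_{1,2:n-7:1,1})<\rho(BD^{(r)}_{n})$$ and $$\rho(BD^{(r)}_{n})<\rho(C_n^{(r)})=\rho(\widetilde{D}^{(r)}_n)=\rho(G^{(r)}_{1,2:n-8:1,2})=\rho(\widetilde{BD}^{(r)}_n)=(r-1)!\sqrt[r]{4}.$$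
   Context: An $r$-uniform hypergraph ($r$-graph) $H=(V,E)$ has a finite vertex set $V$ and a set $E$ of $r$-element subsets of $V$ (edges). The degree of a vertex is the number of edges containing it. The spectral radius $\rho(H)$ of an $r$-graph $H$ on vertices $v_1,\dots,v_\nu$ is the maximum of $P_H(x)=r!\sum_{\{v_{i_1},\dots,v_{i_r}\}\in E(H)}x_{i_1}\cdots x_{i_r}$ over all $x\in\mathbb{R}^\nu$ with $\sum_i|x_i|^r=1$. Extension: extending an $r$-graph once means adding to each edge one new vertex (distinct new vertices for distinct edges, each belonging only to that edge); the result is an $(r+1)$-graph. $A_k^{(r)}$ (path of length $k$) is obtained from the ordinary path graph with $k$ edges $v_0v_1,\dots,v_{k-1}v_k$ by extending $r-2$ times. "Attaching a path of length $k$ at a vertex $v$" of a hypergraph means adding a copy of $A_k^{(r)}$, otherwise disjoint, with its end vertex $v_0$ identified with $v$. A pendant edge at $v$ is an attached path of length $1$. The following 3-graphs are used; for $r\ge3$, the version with superscript $(r)$ is obtained from the 3-graph by extending $r-3$ times. - $E^{(3)}_{i,j,k}$: three paths of lengths $i,j,k$ attached at one common vertex. - $F^{(3)}_{i,j,k}$: a single edge with three vertices, with paths of lengths $i,j,k$ attached at its three vertices, one at each. - $G^{(3)}_{i,j:k:l,m}$: a path $A^{(3)}_{k+2}$ with edges $e_1,\dots,e_{k+2}$, with paths of lengths $i,j$ attached at the two degree-one vertices of $e_1$ (one at each) and paths of lengths $l,m$ attached at the two degree-one vertices of $e_{k+2}$ (one at each). - $BD^{(3)}_n$: a path $A^{(3)}_{n-4}$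 with edges $e_1,\dots,e_{n-4}$, with one pendant edge at each of the two degree-one vertices of $e_1$, and two pendant edges attached at one and the same degree-one vertex of $e_{n-4}$. - $C_n^{(r)}$: the ordinary cycle graph with $n$ edges extended $r-2$ times. - $\widetilde{D}^{(3)}_n$: a path $A^{(3)}_{n-4}$ with end vertices $v_0,v_{n-4}$, with two pendant edges attached at $v_0$ and two pendant edges attached at $v_{n-4}$. - $\widetilde{BD}^{(3)}_n$: a path $A^{(3)}_{n-5}$ with edges $e_1,\dots,e_{n-5}$, with a path of length $1$ and a path of length $2$ attached at the two degree-one vertices of $e_1$ (one at each), and two pendant edges attached at one and the same degree-one vertex of $e_{n-5}$. All eleven hypergraphs listed in the claim have exactly $n$ edges. *)

theory Defs
  imports "HOL-Analysis.Analysis" "HOL-Library.Nat_Bijection"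
begin

section \<open>Uniform hypergraphs\<close>

record 'a hypergraph =
  verts :: "'a set"
  edges :: "'a set set"

definition r_graph :: "nat \<Rightarrow> 'a hypergraph \<Rightarrow> bool" where
  "r_graph r H \<longleftrightarrow> finite (verts H) \<and> (\<forall>e\<in>edges H. e \<subseteq> verts H \<and> card e = r)"

definition hdegree :: "'a hypergraph \<Rightarrow> 'a \<Rightarrow> nat" where
  "hdegree H v = card {e \<in> edges H. v \<in> e}"

definition connected_hypergraph :: "'a hypergraph \<Rightarrow> bool" where
  "connected_hypergraph H \<longleftrightarrow> verts H \<noteq> {} \<and>
     (\<forall>u\<in>verts H. \<forall>v\<in>verts H. (u, v) \<in> {(x, y). \<exists>e\<in>edges H. x \<in> e \<and> y \<in> e}\<^sup>*)"

definition hypergraph_iso :: "'a hypergraph \<Rightarrow> 'b hypergraph \<Rightarrow> bool" where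
  "hypergraph_iso G H \<longleftrightarrow>
     (\<exists>f. bij_betw f (verts G) (verts H) \<and> edges H = (\<lambda>e. f ` e) ` edges G)"

definition connected_r_graphs :: "nat \<Rightarrow> nat \<Rightarrow> 'a hypergraph set" where
  "connected_r_graphs r n =
     {G. r_graph r G \<and> connected_hypergraph G \<and> card (edges G) = n}"

section \<open>The spectral radius\<close>

definition poly_form :: "nat \<Rightarrow> 'a hypergraph \<Rightarrow> ('a \<Rightarrow> real) \<Rightarrow> real" where
  "poly_form r H x = fact r * (\<Sum>e\<in>edges H. \<Prod>v\<in>e. x v)"

text \<open>
  \<open>GREATEST\<close> is the maximum of the set of values. That it is attained for every \<open>r\<close>-graph with
  \<open>r \<ge> 1\<close> and at least one vertex is shown in \<open>spectral_radius_attained\<close> below. Vectors indexed by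
  the vertices are functions on the whole vertex type; only their values on \<open>verts H\<close> matter.
\<close>
definition spectral_radius :: "nat \<Rightarrow> 'a hypergraph \<Rightarrow> real" where
  "spectral_radius r H =
     (GREATEST p. \<exists>x. (\<Sum>v\<in>verts H. \<bar>x v\<bar> ^ r) = 1 \<and> p = poly_form r H x)"

lemma spectral_radius_attained:
  assumes "r_graph r H" "verts H \<noteq> {}" "r \<ge> 1"
  shows "\<exists>x. (\<Sum>v\<in>verts H. \<bar>x v\<bar> ^ r) = 1 \<and> spectral_radius r H = poly_form r H x"
    and "(\<Sum>v\<in>verts H. \<bar>y v\<bar> ^ r) = 1 \<Longrightarrow> poly_form r H y \<le> spectral_radius r H"
proof -
  define V where "V = verts H"
  have fin: "finite V" using assms(1) by (simp add: r_graph_def V_def)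
  define B where "B = PiE UNIV (\<lambda>v. if v \<in> V then {-1..1::real} else {0})"
  define N where "N = (\<lambda>x::'a \<Rightarrow> real. \<Sum>v\<in>V. \<bar>x v\<bar> ^ r)"
  have "compactin (product_topology (\<lambda>_. euclidean) UNIV) B"
    unfolding B_def compactin_PiE by auto
  then have cB: "compact B"
    by (simp add: euclidean_product_topology)
  have cont_comp: "continuous_on UNIV (\<lambda>x::'a \<Rightarrow> real. x v)" for v
    by (intro continuous_on_product_coordinates)
  have contN: "continuous_on UNIV N"
    unfolding N_def by (intro continuous_intros cont_comp)
  have contP: "continuous_on UNIV (poly_form r H)"
    unfolding poly_form_def by (intro continuous_intros cont_comp)
  have "closed (N -` {1})"
    using contN by (simp add: continuous_on_closed_vimage)
  with cB have cS: "compact (B \<inter> N -` {1})" by (rule compact_Int_closed)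
  obtain w where w: "w \<in> V" using assms(2) V_def by auto
  have "N (\<lambda>v. if v = w then 1 else 0) = (\<Sum>v\<in>V. if v = w then 1 else 0)"
    unfolding N_def using assms(3) by (intro sum.cong) auto
  also have "\<dots> = 1" using w fin by simp
  finally have "(\<lambda>v. if v = w then 1 else 0) \<in> B \<inter> N -` {1}"
    using w by (auto simp: B_def)
  then have ne: "B \<inter> N -` {1} \<noteq> {}" by blast
  obtain x where x: "x \<in> B \<inter> N -` {1}"
    and xmax: "\<And>y. y \<in> B \<inter> N -` {1} \<Longrightarrow> poly_form r H y \<le> poly_form r H x"
    using continuous_attains_sup[OF cS ne continuous_on_subset[OF contP]] by blast
  have max: "poly_form r H y \<le> poly_form r H x" if y: "N y = 1" for y
  proof -
    define z where "z = (\<lambda>v. if v \<in> V then y v else 0)"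
    have Nz: "N z = 1" using y by (simp add: N_def z_def)
    have "\<bar>y v\<bar> \<le> 1" if "v \<in> V" for v
    proof -
      have "\<bar>y v\<bar> ^ r \<le> N y" unfolding N_def
        using that fin by (intro member_le_sum) auto
      then have "\<bar>y v\<bar> ^ r \<le> 1 ^ r" using y by simp
      then show ?thesis using assms(3) by (subst (asm) power_mono_iff) auto
    qed
    then have "z \<in> B" by (force simp: z_def B_def abs_le_iff)
    moreover have "(\<Prod>v\<in>e. z v) = (\<Prod>v\<in>e. y v)" if "e \<in> edges H" for e
      using assms(1) that by (intro prod.cong) (auto simp: z_def V_def r_graph_def)
    then have "poly_form r H z = poly_form r H y" by (simp add: poly_form_def)
    ultimately show ?thesis using xmax[of z] Nz by simp
  qed
  have eq: "spectral_radius r H = poly_form r H x"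
    unfolding spectral_radius_def
  proof (rule Greatest_equality)
    show "\<exists>xa. (\<Sum>v\<in>verts H. \<bar>xa v\<bar> ^ r) = 1 \<and> poly_form r H x = poly_form r H xa"
      using x by (auto simp: N_def V_def)
  qed (use max in \<open>auto simp: N_def V_def\<close>)
  show "\<exists>x. (\<Sum>v\<in>verts H. \<bar>x v\<bar> ^ r) = 1 \<and> spectral_radius r H = poly_form r H x"
    using eq x by (auto simp: N_def V_def)
  show "poly_form r H y \<le> spectral_radius r H" if "(\<Sum>v\<in>verts H. \<bar>y v\<bar> ^ r) = 1"
    using eq max[of y] that by (auto simp: N_def V_def)
qed

section \<open>Extension\<close>

text \<open>
  The special hypergraphs are realised on vertices of type \<^typ>\<open>nat\<close>. The vertex added to the edge
  \<open>e\<close> is larger than all old vertices, and different for different edges because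
  \<^const>\<open>set_encode\<close> is injective on finite sets. Old vertices keep their names.
\<close>
definition new_vertex :: "nat hypergraph \<Rightarrow> nat set \<Rightarrow> nat" where
  "new_vertex H e = Suc (Max (verts H)) + set_encode e"

definition extend :: "nat hypergraph \<Rightarrow> nat hypergraph" where
  "extend H = \<lparr>verts = verts H \<union> new_vertex H ` edges H,
               edges = (\<lambda>e. insert (new_vertex H e) e) ` edges H\<rparr>"

lemma new_vertex_fresh:
  assumes "finite (verts H)"
  shows "new_vertex H e \<notin> verts H"
  using Max_ge[OF assms, of "new_vertex H e"] by (auto simp: new_vertex_def)

lemma inj_on_new_vertex:
  assumes "r_graph r H"
  shows "inj_on (new_vertex H) (edges H)"
proof (rule inj_onI)
  fix e f assume ef: "e \<in> edges H" "f \<in> edges H" "new_vertex H e = new_vertex H f"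
  then have "finite e" "finite f"
    using assms by (auto simp: r_graph_def intro: finite_subset)
  then show "e = f" using ef by (simp add: new_vertex_def set_encode_eq)
qed

lemma r_graph_extend:
  assumes "r_graph r H"
  shows "r_graph (Suc r) (extend H)" "card (edges (extend H)) = card (edges H)"
proof -
  have fV: "finite (verts H)" and sub: "\<And>e. e \<in> edges H \<Longrightarrow> e \<subseteq> verts H"
    and cd: "\<And>e. e \<in> edges H \<Longrightarrow> card e = r"
    using assms by (auto simp: r_graph_def)
  have fE: "finite (edges H)"
    using sub by (intro finite_subset[OF _ finite_Pow_iff[THEN iffD2, OF fV]]) auto
  have fresh: "new_vertex H f \<notin> e" if "e \<in> edges H" for e f
    using new_vertex_fresh[OF fV] sub[OF that] by auto
  have fe: "finite e" if "e \<in> edges H" for e using sub[OF that] fV by (rule finite_subset)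
  show "r_graph (Suc r) (extend H)"
    using fV fE sub cd fresh fe by (auto simp: r_graph_def extend_def)
  have "inj_on (\<lambda>e. insert (new_vertex H e) e) (edges H)"
    by (intro inj_onI) (metis fresh insert_ident insert_iff inj_on_new_vertex[OF assms, THEN inj_onD])
  then show "card (edges (extend H)) = card (edges H)"
    by (simp add: extend_def card_image)
qed

section \<open>Paths, cycles and attaching paths\<close>

definition path_graph :: "nat \<Rightarrow> nat hypergraph" where
  "path_graph k = \<lparr>verts = {0..k}, edges = (\<lambda>i. {i, Suc i}) ` {0..<k}\<rparr>"

text \<open>The end vertices of \<open>A_hyp r k\<close> are \<open>0\<close> and \<open>k\<close>.\<close>
definition A_hyp :: "nat \<Rightarrow> nat \<Rightarrow> nat hypergraph" where
  "A_hyp r k = (extend ^^ (r - 2)) (path_graph k)"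

definition cycle_graph :: "nat \<Rightarrow> nat hypergraph" where
  "cycle_graph n = \<lparr>verts = {0..<n}, edges = (\<lambda>i. {i, Suc i mod n}) ` {0..<n}\<rparr>"

definition C_hyp :: "nat \<Rightarrow> nat \<Rightarrow> nat hypergraph" where
  "C_hyp r n = (extend ^^ (r - 2)) (cycle_graph n)"

text \<open>
  The end vertex \<open>0\<close> of the path is sent to \<open>v\<close>, all its other vertices are shifted beyond the
  vertices of \<open>H\<close>.
\<close>
definition attach_path :: "nat \<Rightarrow> nat \<Rightarrow> nat \<Rightarrow> nat hypergraph \<Rightarrow> nat hypergraph" where
  "attach_path r k v H =
     (let \<phi> = (\<lambda>w. if w = 0 then v else Suc (Max (verts H)) + w)
      in \<lparr>verts = verts H \<union> \<phi> ` verts (A_hyp r k),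
          edges = edges H \<union> (\<lambda>e. \<phi> ` e) ` edges (A_hyp r k)\<rparr>)"

section \<open>The special hypergraphs\<close>

text \<open>
  In \<open>A_hyp 3 k\<close> with \<open>k \<ge> 2\<close> the two degree-one vertices of the first edge are the end vertex \<open>0\<close>
  and \<open>first_tip k\<close>, those of the last edge are the end vertex \<open>k\<close> and \<open>last_tip k\<close>
  (\<open>degree_one_first\<close> and \<open>degree_one_last\<close> below).
\<close>
definition first_tip :: "nat \<Rightarrow> nat" where
  "first_tip k = new_vertex (path_graph k) {0, 1}"

definition last_tip :: "nat \<Rightarrow> nat" where
  "last_tip k = new_vertex (path_graph k) {k - 1, k}"

definition E3 :: "nat \<Rightarrow> nat \<Rightarrow> nat \<Rightarrow> nat hypergraph" where
  "E3 i j k = attach_path 3 k 0 (attach_path 3 j 0 (attach_path 3 i 0 \<lparr>verts = {0}, edges = {}\<rparr>))"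

definition F3 :: "nat \<Rightarrow> nat \<Rightarrow> nat \<Rightarrow> nat hypergraph" where
  "F3 i j k = attach_path 3 k 2 (attach_path 3 j 1 (attach_path 3 i 0
     \<lparr>verts = {0, 1, 2}, edges = {{0, 1, 2}}\<rparr>))"

definition G3 :: "nat \<Rightarrow> nat \<Rightarrow> nat \<Rightarrow> nat \<Rightarrow> nat \<Rightarrow> nat hypergraph" where
  "G3 i j k l m =
     attach_path 3 m (last_tip (k + 2)) (attach_path 3 l (k + 2)
       (attach_path 3 j (first_tip (k + 2)) (attach_path 3 i 0 (A_hyp 3 (k + 2)))))"

definition BD3 :: "nat \<Rightarrow> nat hypergraph" where
  "BD3 n =
     attach_path 3 1 (n - 4) (attach_path 3 1 (n - 4)
       (attach_path 3 1 (first_tip (n - 4)) (attach_path 3 1 0 (A_hyp 3 (n - 4)))))"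

definition Dtilde3 :: "nat \<Rightarrow> nat hypergraph" where
  "Dtilde3 n =
     attach_path 3 1 (n - 4) (attach_path 3 1 (n - 4)
       (attach_path 3 1 0 (attach_path 3 1 0 (A_hyp 3 (n - 4)))))"

definition BDtilde3 :: "nat \<Rightarrow> nat hypergraph" where
  "BDtilde3 n =
     attach_path 3 1 (n - 5) (attach_path 3 1 (n - 5)
       (attach_path 3 2 (first_tip (n - 5)) (attach_path 3 1 0 (A_hyp 3 (n - 5)))))"

definition E_hyp :: "nat \<Rightarrow> nat \<Rightarrow> nat \<Rightarrow> nat \<Rightarrow> nat hypergraph" where
  "E_hyp r i j k = (extend ^^ (r - 3)) (E3 i j k)"

definition F_hyp :: "nat \<Rightarrow> nat \<Rightarrow> nat \<Rightarrow> nat \<Rightarrow> nat hypergraph" where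
  "F_hyp r i j k = (extend ^^ (r - 3)) (F3 i j k)"

definition G_hyp :: "nat \<Rightarrow> nat \<Rightarrow> nat \<Rightarrow> nat \<Rightarrow> nat \<Rightarrow> nat \<Rightarrow> nat hypergraph" where
  "G_hyp r i j k l m = (extend ^^ (r - 3)) (G3 i j k l m)"

definition BD_hyp :: "nat \<Rightarrow> nat \<Rightarrow> nat hypergraph" where
  "BD_hyp r n = (extend ^^ (r - 3)) (BD3 n)"

definition Dtilde_hyp :: "nat \<Rightarrow> nat \<Rightarrow> nat hypergraph" where
  "Dtilde_hyp r n = (extend ^^ (r - 3)) (Dtilde3 n)"

definition BDtilde_hyp :: "nat \<Rightarrow> nat \<Rightarrow> nat hypergraph" where
  "BDtilde_hyp r n = (extend ^^ (r - 3)) (BDtilde3 n)"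

lemma r_graph_path_graph: "r_graph 2 (path_graph k)"
  by (auto simp: r_graph_def path_graph_def)

lemma edges_A_hyp_3:
  "edges (A_hyp 3 k) =
     (\<lambda>i. {i, Suc i, new_vertex (path_graph k) {i, Suc i}}) ` {0..<k}"
  by (auto simp: A_hyp_def extend_def path_graph_def image_image insert_commute)

lemma new_vertex_path_graph_eq:
  "new_vertex (path_graph k) {i, Suc i} = new_vertex (path_graph k) {j, Suc j} \<longleftrightarrow> i = j"
  by (auto simp: new_vertex_def set_encode_eq doubleton_eq_iff)

lemma new_vertex_path_graph_gt: "k < new_vertex (path_graph k) e"
proof -
  have "Max {0..k} = k" by (intro Max_eqI) auto
  then show ?thesis by (simp add: new_vertex_def path_graph_def)
qed

lemma hdegree_A_hyp_3:
  "hdegree (A_hyp 3 k) v =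
     card {i \<in> {0..<k}. v = i \<or> v = Suc i \<or> v = new_vertex (path_graph k) {i, Suc i}}"
proof -
  let ?E = "\<lambda>i. {i, Suc i, new_vertex (path_graph k) {i, Suc i}}"
  have inj: "inj_on ?E {0..<k}"
  proof (rule inj_onI)
    fix i j assume ij: "i \<in> {0..<k}" "j \<in> {0..<k}" "?E i = ?E j"
    then have "new_vertex (path_graph k) {i, Suc i} \<in> ?E j" by blast
    with new_vertex_path_graph_gt[of k "{i, Suc i}"] ij show "i = j"
      by (auto simp: new_vertex_path_graph_eq)
  qed
  have "{e \<in> edges (A_hyp 3 k). v \<in> e} = ?E ` {i \<in> {0..<k}. v \<in> ?E i}"
    unfolding edges_A_hyp_3 by blast
  then have "hdegree (A_hyp 3 k) v = card {i \<in> {0..<k}. v \<in> ?E i}"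
    unfolding hdegree_def using card_image[OF inj_on_subset[OF inj]]
    by (metis (no_types, lifting) mem_Collect_eq subsetI)
  then show ?thesis by simp
qed

lemma hdegree_A_hyp_3_new:
  assumes "i < k"
  shows "hdegree (A_hyp 3 k) (new_vertex (path_graph k) {i, Suc i}) = 1"
proof -
  have "{j \<in> {0..<k}. new_vertex (path_graph k) {i, Suc i} = j
           \<or> new_vertex (path_graph k) {i, Suc i} = Suc j
           \<or> new_vertex (path_graph k) {i, Suc i} = new_vertex (path_graph k) {j, Suc j}} = {i}"
    using assms new_vertex_path_graph_gt[of k "{i, Suc i}"]
    by (auto simp: new_vertex_path_graph_eq)
  then show ?thesis by (simp add: hdegree_A_hyp_3)
qed

lemma hdegree_A_hyp_3_old:
  assumes "v \<le> k" "k \<ge> 1"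
  shows "hdegree (A_hyp 3 k) v = (if v = 0 \<or> v = k then 1 else 2)"
proof -
  have new: "v \<noteq> new_vertex (path_graph k) e" for e
    using assms new_vertex_path_graph_gt[of k e] by auto
  have "{i \<in> {0..<k}. v = i \<or> v = Suc i \<or> v = new_vertex (path_graph k) {i, Suc i}}
      = (if v = 0 then {0} else if v = k then {v - 1} else {v - 1, v})"
    using assms new by auto
  then have "hdegree (A_hyp 3 k) v = card (if v = 0 then {0} else if v = k then {v - 1} else {v - 1, v})"
    by (simp only: hdegree_A_hyp_3)
  moreover have "card {v - 1, v} = 2" if "v \<noteq> 0"
    using that by simp
  ultimately show ?thesis by (cases "v = 0"; cases "v = k") simp_all
qed

lemma degree_one_first:
  assumes "k \<ge> 2"
  shows "{0, 1, first_tip k} \<in> edges (A_hyp 3 k)"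
    and "{v \<in> {0, 1, first_tip k}. hdegree (A_hyp 3 k) v = 1} = {0, first_tip k}"
    and "first_tip k \<noteq> 0"
proof -
  have "{0, 1, first_tip k} = {0, Suc 0, new_vertex (path_graph k) {0, Suc 0}}"
    by (simp add: first_tip_def)
  then show "{0, 1, first_tip k} \<in> edges (A_hyp 3 k)"
    unfolding edges_A_hyp_3 using assms by (intro image_eqI[of _ _ 0]) simp_all
  have "hdegree (A_hyp 3 k) 0 = 1" "hdegree (A_hyp 3 k) 1 = 2" "hdegree (A_hyp 3 k) (first_tip k) = 1"
    using assms hdegree_A_hyp_3_old[of 0 k] hdegree_A_hyp_3_old[of 1 k] hdegree_A_hyp_3_new[of 0 k]
    by (simp_all add: first_tip_def)
  then show "{v \<in> {0, 1, first_tip k}. hdegree (A_hyp 3 k) v = 1} = {0, first_tip k}"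
    by fastforce
  show "first_tip k \<noteq> 0"
    using new_vertex_path_graph_gt[of k "{0, 1}"] unfolding first_tip_def by linarith
qed

lemma degree_one_last:
  assumes "k \<ge> 2"
  shows "{k - 1, k, last_tip k} \<in> edges (A_hyp 3 k)"
    and "{v \<in> {k - 1, k, last_tip k}. hdegree (A_hyp 3 k) v = 1} = {k, last_tip k}"
    and "last_tip k \<noteq> k"
proof -
  have k: "Suc (k - 1) = k" "k - 1 < k" using assms by simp_all
  have tip: "last_tip k = new_vertex (path_graph k) {k - 1, Suc (k - 1)}"
    unfolding last_tip_def k(1) ..
  have "{k - 1, k, last_tip k} = {k - 1, Suc (k - 1), new_vertex (path_graph k) {k - 1, Suc (k - 1)}}"
    unfolding tip k(1) ..
  then show "{k - 1, k, last_tip k} \<in> edges (A_hyp 3 k)"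
    unfolding edges_A_hyp_3 using k(2) by (intro image_eqI[of _ _ "k - 1"]) simp_all
  have "hdegree (A_hyp 3 k) k = 1" "hdegree (A_hyp 3 k) (k - 1) = 2"
    using assms hdegree_A_hyp_3_old[of k k] hdegree_A_hyp_3_old[of "k - 1" k] by simp_all
  moreover have "hdegree (A_hyp 3 k) (last_tip k) = 1"
    unfolding tip by (rule hdegree_A_hyp_3_new[OF k(2)])
  ultimately show "{v \<in> {k - 1, k, last_tip k}. hdegree (A_hyp 3 k) v = 1} = {k, last_tip k}"
    by fastforce
  show "last_tip k \<noteq> k"
    using new_vertex_path_graph_gt[of k "{k - 1, k}"] unfolding last_tip_def by linarith
qed

end

theory Submission imports Defs begin

text \<open>
  Give every edge \<open>e\<close> a weight \<open>w e > 0\<close> and the label \<open>\<Prod>v\<in>e. w e / load v\<close>, where the load of a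
  vertex is the total weight of its edges. If all labels are at most (at least, equal to) \<open>\<alpha>\<close>, then
  the spectral radius is at least (at most, equal to) \<open>(r - 1)! root r (1/\<alpha>)\<close>; the labels
  survive extension, because a new vertex contributes the factor \<open>1\<close>.

  For a lower bound it suffices to label a subfamily of the edges. Hanging a new edge of
  relative weight \<open>t\<close> on an old one multiplies the old label by \<open>1 / (1 + t)\<close> and gives the new edge a
  label at most \<open>t / (1 + t)\<close> as soon as the two edges meet, however they meet. So \<open>\<rho> > (r - 1)! root r 4\<close>
  already follows from a few patterns of meeting edges. If none of them occurs, then either the edges
  form a cycle, or at most two edges lie outside a longest induced path, at most one near each end and
  only in one of three positions. Such a hypergraph is linear and has the Helly property, hence it
  is determined by its intersection graph.

  For the comparison put \<open>\<alpha> = 1 / (4 cos\<^sup>2 \<theta>)\<close>. The labels along a path are then the values of one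
  function at points in arithmetic progression with difference \<open>\<theta>\<close>, and the label condition for a
  hypergraph becomes an inequality for a single phase. Three of the hypergraphs are labelled exactly
  at \<open>\<theta> = \<pi>/(n+2)\<close>, \<open>\<pi>/(2n-2)\<close>, \<open>\<pi>/(2n)\<close>; together with \<open>\<pi>/(n+8)\<close> and \<open>\<pi>/(2n+8)\<close> these
  values separate the chain, and the limit \<open>\<theta> = 0\<close> gives the critical value.
\<close>

section \<open>Edge weights, labels and the spectral radius\<close>

text \<open>Both bounds rest on one splitting. The \<open>r\<close>-th roots of the loads form the
  test vector for the lower bound; for the upper bound, \<open>\<bar>x v\<bar> ^ r\<close> is
  divided among the edges at \<open>v\<close> in proportion to their weights, and the
  arithmetic-geometric mean inequality is applied on every edge. At the critical label 1/4 a leg of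
  k edges costs its root the factor (k+2)/(2(k+1)), a fork at most 9/16. Most excluded patterns are
  products of such factors at one root that do not exceed 1/4. A product equal to 1/4 excludes
  proper subfamilies only, so edges must be counted: the largest such pattern, one hung edge with
  legs of 3 and 14 path edges, has 19 edges and fills a path of 18. This explains the bound 20. In
  the comparison, an end with factor 1 - 2\<alpha> has the exact phase pi/2 + \<theta>. An end with
  pendant edges at two different vertices, factor (1 - \<alpha>)^2, is only located: for small
  \<theta> its balanced phase lies a little below 8\<theta>. Hypergraphs with such an end are
  therefore not evaluated but enclosed between angles at which the phase of this end is an explicit
  multiple of \<theta> on the desired side of 8\<theta>.\<close>

definition load :: "'a set set \<Rightarrow> ('a set \<Rightarrow> real) \<Rightarrow> 'a \<Rightarrow> real" where
  "load S w v = (\<Sum>e\<in>{e\<in>S. v \<in> e}. w e)"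

definition pot :: "'a set set \<Rightarrow> ('a set \<Rightarrow> real) \<Rightarrow> 'a set \<Rightarrow> real" where
  "pot S w e = (\<Prod>v\<in>e. w e / load S w v)"

definition weighting :: "'a set set \<Rightarrow> ('a set \<Rightarrow> real) \<Rightarrow> bool" where
  "weighting S w \<longleftrightarrow> finite S \<and> (\<forall>e\<in>S. finite e \<and> 0 < w e)"

lemma load_ge:
  assumes "weighting S w" "e \<in> S" "v \<in> e"
  shows "w e \<le> load S w v"
  unfolding load_def using assms by (intro member_le_sum) (auto simp: weighting_def intro: less_imp_le)

lemma load_pos:
  assumes "weighting S w" "e \<in> S" "v \<in> e"
  shows "0 < load S w v"
  using load_ge[OF assms] assms by (auto simp: weighting_def intro: less_le_trans)

lemma pot_pos: "weighting S w \<Longrightarrow> e \<in> S \<Longrightarrow> 0 < pot S w e"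
  unfolding pot_def by (intro prod_pos ballI divide_pos_pos) (auto simp: weighting_def intro: load_pos)

lemma pot_remove:
  assumes "finite e" "x \<in> e"
  shows "pot S w e = w e / load S w x * (\<Prod>v\<in>e - {x}. w e / load S w v)"
  unfolding pot_def by (rule prod.remove[OF assms])

lemma load_insert:
  assumes "finite S" "g \<notin> S"
  shows "load (insert g S) (w(g := u)) v = load S w v + (if v \<in> g then u else 0)"
proof -
  have "{e \<in> insert g S. v \<in> e} = (if v \<in> g then insert g {e\<in>S. v \<in> e} else {e\<in>S. v \<in> e})"
    by auto
  moreover have "sum (w(g := u)) {e\<in>S. v \<in> e} = sum w {e\<in>S. v \<in> e}"
    using assms by (intro sum.cong) auto
  ultimately show ?thesis using assms by (auto simp: load_def)
qed

text \<open>Upper bounds are enough for lower bounds on the spectral radius, and they survive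
  unknown further incidences between the edges. Exact labels are reserved for the special
  hypergraphs, whose incidences are known.\<close>

definition labelled_le :: "'a set set \<Rightarrow> ('a set \<Rightarrow> real) \<Rightarrow> bool" where
  "labelled_le S p \<longleftrightarrow> (\<exists>w. weighting S w \<and> (\<forall>e\<in>S. pot S w e \<le> p e))"

definition labelled_eq :: "'a set set \<Rightarrow> ('a set \<Rightarrow> real) \<Rightarrow> bool" where
  "labelled_eq S p \<longleftrightarrow> (\<exists>w. weighting S w \<and> (\<forall>e\<in>S. pot S w e = p e))"

lemma labelled_eq_cong:
  "labelled_eq S p \<Longrightarrow> (\<And>e. e \<in> S \<Longrightarrow> p e = q e) \<Longrightarrow> labelled_eq S q"
  unfolding labelled_eq_def by metis

lemma labelled_eq_imp_le: "labelled_eq S p \<Longrightarrow> labelled_le S p"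
  unfolding labelled_eq_def labelled_le_def by (blast intro: eq_refl)

lemma labelled_eq_single:
  assumes "finite e"
  shows "labelled_eq {e} (\<lambda>_. 1)"
proof -
  have "load {e} (\<lambda>_. 1) v = 1" if "v \<in> e" for v
  proof -
    have "{f \<in> {e}. v \<in> f} = {e}" using that by auto
    then show ?thesis by (simp add: load_def)
  qed
  then show ?thesis using assms
    unfolding labelled_eq_def by (intro exI[of _ "\<lambda>_. 1"]) (auto simp: weighting_def pot_def)
qed

text \<open>The weight of \<open>g\<close> is tuned at one common vertex \<open>x\<close>, where it
  takes the share \<open>1 - b\<close> of the load and leaves \<open>b\<close> to the old edges.
  Every further common vertex only raises the loads of old edges, hence lowers their labels, and the
  other factors of the new label are at most 1.\<close>

lemma labelled_le_hang:
  assumes L: "labelled_le S p" and a: "a \<in> S" and g: "g \<notin> S" "finite g" "a \<inter> g \<noteq> {}"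
    and b: "0 < b" "b < 1"
  shows "labelled_le (insert g S) (p(g := 1 - b, a := p a * b))"
proof -
  obtain w where w: "weighting S w" "\<And>e. e \<in> S \<Longrightarrow> pot S w e \<le> p e"
    using L by (auto simp: labelled_le_def)
  have fS: "finite S" using w by (simp add: weighting_def)
  obtain x where x: "x \<in> a" "x \<in> g" using g by auto
  define t where "t = (1 - b) / b"
  have t: "t > 0" "1 / (1 + t) = b" "t / (1 + t) = 1 - b" using b by (auto simp: t_def field_simps)
  define u where "u = t * load S w x"
  have lx: "load S w x > 0" using load_pos[OF w(1) a x(1)] .
  have u: "u > 0" using lx t by (simp add: u_def)
  let ?w = "w(g := u)" and ?S = "insert g S"
  have w': "weighting ?S ?w" using w(1) u g by (auto simp: weighting_def)
  have l: "load ?S ?w v = load S w v + (if v \<in> g then u else 0)" for v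
    using load_insert[OF fS g(1)] .
  have le: "w e / load ?S ?w v \<le> w e / load S w v" if "e \<in> S" "v \<in> e" for e v
    using load_pos[OF w(1) that] w(1) u that by (intro divide_left_mono) (auto simp: l weighting_def intro!: mult_pos_pos add_pos_pos)
  have nn: "0 \<le> w e / load ?S ?w v" if "e \<in> S" "v \<in> e" for e v
    using load_pos[OF w(1) that] w(1) u that by (intro divide_nonneg_pos) (auto simp: l weighting_def intro: less_imp_le add_pos_pos)
  have old: "pot ?S ?w e \<le> pot S w e" if "e \<in> S" for e
    using that g(1) le nn unfolding pot_def by (intro prod_mono) auto
  have A: "pot ?S ?w a \<le> p a * b"
  proof -
    have fa: "finite a" using w(1) a by (auto simp: weighting_def)
    have "pot ?S ?w a = w a / load ?S ?w x * (\<Prod>v\<in>a - {x}. w a / load ?S ?w v)"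
      using pot_remove[OF fa x(1), of ?S ?w] a g(1) by auto
    also have "\<dots> \<le> (w a / load S w x * b) * (\<Prod>v\<in>a - {x}. w a / load S w v)"
    proof (rule mult_mono)
      have "load ?S ?w x = load S w x * (1 + t)" unfolding l using x by (simp add: u_def algebra_simps)
      then have "w a / load ?S ?w x = w a / load S w x * (1 / (1 + t))" by simp
      then show "w a / load ?S ?w x \<le> w a / load S w x * b" using t by simp
      show "(\<Prod>v\<in>a - {x}. w a / load ?S ?w v) \<le> (\<Prod>v\<in>a - {x}. w a / load S w v)"
        using le nn a by (intro prod_mono) auto
      show "0 \<le> w a / load S w x * b" using lx w(1) a b by (auto simp: weighting_def intro: less_imp_le)
      show "0 \<le> (\<Prod>v\<in>a - {x}. w a / load ?S ?w v)" using nn a by (intro prod_nonneg) auto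
    qed
    also have "\<dots> = pot S w a * b" using pot_remove[OF fa x(1), of S w] by simp
    also have "\<dots> \<le> p a * b" using w(2)[OF a] b by simp
    finally show ?thesis .
  qed
  have G: "pot ?S ?w g \<le> 1 - b"
  proof -
    have "pot ?S ?w g = u / load ?S ?w x * (\<Prod>v\<in>g - {x}. u / load ?S ?w v)"
      using pot_remove[OF g(2) x(2), of ?S ?w] by simp
    also have "\<dots> \<le> u / load ?S ?w x * 1"
    proof (rule mult_left_mono)
      show "(\<Prod>v\<in>g - {x}. u / load ?S ?w v) \<le> 1"
      proof (rule prod_le_1)
        fix v assume v: "v \<in> g - {x}"
        have "u \<le> load ?S ?w v" "0 < load ?S ?w v" using load_ge[OF w', of g v] load_pos[OF w', of g v] v by auto
        then show "0 \<le> u / load ?S ?w v \<and> u / load ?S ?w v \<le> 1" using u by auto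
      qed
      show "0 \<le> u / load ?S ?w x" using load_pos[OF w', of g x] x u by (intro divide_nonneg_pos) auto
    qed
    also have "u / load ?S ?w x = t / (1 + t)"
    proof -
      have "load ?S ?w x = load S w x * (1 + t)" unfolding l using x by (simp add: u_def algebra_simps)
      then show ?thesis using lx by (simp only: u_def) simp
    qed
    finally show ?thesis unfolding t(3) mult_1_right .
  qed
  show ?thesis unfolding labelled_le_def
  proof (intro exI conjI ballI)
    show "weighting ?S ?w" by fact
    fix e assume "e \<in> ?S"
    then show "pot ?S ?w e \<le> (p(g := 1 - b, a := p a * b)) e"
      using A G a g(1) old[of e] w(2)[of e] by fastforce
  qed
qed

text \<open>With a single common vertex the estimates become equalities: the other vertices of
  \<open>g\<close> lie in no old edge and contribute the factor 1, and among the old edges only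
  those through \<open>x\<close> lose the factor \<open>b\<close>.\<close>

lemma labelled_eq_hang:
  assumes L: "labelled_eq S p" and x: "g \<inter> \<Union>S = {x}" and g: "g \<notin> S" "finite g"
    and b: "0 < b" "b < 1"
  shows "labelled_eq (insert g S) (\<lambda>e. if e = g then 1 - b else if x \<in> e then p e * b else p e)"
proof -
  obtain w where w: "weighting S w" "\<And>e. e \<in> S \<Longrightarrow> pot S w e = p e"
    using L by (auto simp: labelled_eq_def)
  have fS: "finite S" using w by (simp add: weighting_def)
  obtain a where a: "a \<in> S" "x \<in> a" using x by auto
  have xg: "x \<in> g" using x by auto
  define t where "t = (1 - b) / b"
  have t: "t > 0" "1 / (1 + t) = b" "t / (1 + t) = 1 - b" using b by (auto simp: t_def field_simps)
  define u where "u = t * load S w x"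
  have lx: "load S w x > 0" using load_pos[OF w(1) a] .
  have u: "u > 0" using lx t by (simp add: u_def)
  let ?w = "w(g := u)" and ?S = "insert g S"
  have w': "weighting ?S ?w" using w(1) u g by (auto simp: weighting_def)
  have l: "load ?S ?w v = load S w v + (if v \<in> g then u else 0)" for v
    using load_insert[OF fS g(1)] .
  have llx: "load ?S ?w x = load S w x * (1 + t)" unfolding l using xg by (simp add: u_def algebra_simps)
  have rest: "load ?S ?w v = load S w v" if "e \<in> S" "v \<in> e" "v \<noteq> x" for e v
    using that x by (auto simp: l)
  have G: "pot ?S ?w g = 1 - b"
  proof -
    have "load ?S ?w v = u" if "v \<in> g - {x}" for v
    proof -
      have "v \<notin> \<Union>S" using that x by auto
      then have "{e \<in> S. v \<in> e} = {}" by auto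
      then have "load S w v = 0" by (simp only: load_def sum.empty)
      then show ?thesis using that by (simp add: l)
    qed
    then have "pot ?S ?w g = u / load ?S ?w x" using u by (simp add: pot_remove[OF g(2) xg])
    also have "\<dots> = t / (1 + t)" unfolding llx using lx by (simp add: u_def)
    finally show ?thesis using t by simp
  qed
  have A: "pot ?S ?w e = (if x \<in> e then p e * b else p e)" if e: "e \<in> S" for e
  proof (cases "x \<in> e")
    case True
    have fe: "finite e" using w(1) e by (auto simp: weighting_def)
    have eg: "e \<noteq> g" using e g by auto
    have "pot ?S ?w e = w e / load ?S ?w x * (\<Prod>v\<in>e - {x}. w e / load ?S ?w v)"
      using pot_remove[OF fe True, of ?S ?w] eg by simp
    also have "(\<Prod>v\<in>e - {x}. w e / load ?S ?w v) = (\<Prod>v\<in>e - {x}. w e / load S w v)"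
      using rest[OF e] by (intro prod.cong) auto
    also have "w e / load ?S ?w x = w e / load S w x * (1 / (1 + t))" by (simp add: llx)
    also have "w e / load S w x * (1 / (1 + t)) * (\<Prod>v\<in>e - {x}. w e / load S w v) = pot S w e * b"
      using pot_remove[OF fe True, of S w] t(2) by simp
    finally show ?thesis unfolding w(2)[OF e] using True by (simp only: if_True)
  next
    case False
    have eg: "e \<noteq> g" using e g by auto
    have "pot ?S ?w e = pot S w e" unfolding pot_def using eg rest[OF e] False
      by (intro prod.cong) auto
    then show ?thesis using False w(2)[OF e] by simp
  qed
  show ?thesis unfolding labelled_eq_def
    using w' A G g(1) by (intro exI[of _ ?w]) auto
qed

section \<open>Linked edge sets and the two bounds for the spectral radius\<close>

definition linked :: "'a set set \<Rightarrow> bool" where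
  "linked E \<longleftrightarrow> (\<forall>S. S \<subseteq> E \<and> S \<noteq> {} \<and> S \<noteq> E \<longrightarrow> (\<exists>e\<in>S. \<exists>f\<in>E - S. e \<inter> f \<noteq> {}))"

lemma linkedD:
  "linked E \<Longrightarrow> S \<subseteq> E \<Longrightarrow> S \<noteq> {} \<Longrightarrow> S \<noteq> E \<Longrightarrow> \<exists>e\<in>S. \<exists>f\<in>E - S. e \<inter> f \<noteq> {}"
  by (auto simp: linked_def)

lemma finite_edges: "r_graph r H \<Longrightarrow> finite (edges H)"
  by (rule finite_subset[of _ "Pow (verts H)"]) (auto simp: r_graph_def)

lemma r_graph_edgeD:
  assumes "r_graph r H" "e \<in> edges H"
  shows "e \<subseteq> verts H" "card e = r" "finite e"
  using assms by (auto simp: r_graph_def intro: finite_subset)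

text \<open>Homogeneity: both sides scale with the \<open>r\<close>-th power of a factor, so the
  vector can be normalised unless it vanishes on all vertices, and then every edge product is
  zero.\<close>

lemma poly_form_le_spectral_radius:
  assumes H: "r_graph r H" and r: "r \<ge> 1" and ne: "verts H \<noteq> {}"
  shows "poly_form r H y \<le> spectral_radius r H * (\<Sum>v\<in>verts H. \<bar>y v\<bar> ^ r)"
proof -
  define N where "N = (\<Sum>v\<in>verts H. \<bar>y v\<bar> ^ r)"
  have fV: "finite (verts H)" using H by (simp add: r_graph_def)
  have N0: "N \<ge> 0" by (auto simp: N_def intro: sum_nonneg)
  show ?thesis
  proof (cases "N = 0")
    case True
    then have z: "y v = 0" if "v \<in> verts H" for v
      using that fV r by (simp add: N_def sum_nonneg_eq_0_iff)
    have "(\<Prod>v\<in>e. y v) = 0" if e: "e \<in> edges H" for e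
    proof -
      have "e \<noteq> {}" using r_graph_edgeD[OF H e] r by auto
      then obtain v where "v \<in> e" by auto
      then show ?thesis using r_graph_edgeD[OF H e] z by (intro prod_zero) auto
    qed
    then show ?thesis using True by (simp add: poly_form_def N_def)
  next
    case False
    define s where "s = root r N"
    have s: "s > 0" "s ^ r = N" using N0 False r by (auto simp: s_def)
    have "(\<Sum>v\<in>verts H. \<bar>y v / s\<bar> ^ r) = N / s ^ r"
      unfolding N_def sum_divide_distrib abs_divide power_divide using s(1) by simp
    then have "(\<Sum>v\<in>verts H. \<bar>y v / s\<bar> ^ r) = 1" using s False by simp
    from spectral_radius_attained(2)[OF H ne r this]
    have "poly_form r H (\<lambda>v. y v / s) \<le> spectral_radius r H" .
    moreover have "poly_form r H (\<lambda>v. y v / s) = poly_form r H y / N"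
    proof -
      have "(\<Prod>v\<in>e. y v / s) = (\<Prod>v\<in>e. y v) / N" if "e \<in> edges H" for e
        using r_graph_edgeD[OF H that] s by (simp add: prod_dividef)
      then show ?thesis by (simp add: poly_form_def sum_divide_distrib[symmetric])
    qed
    ultimately show ?thesis using N0 False by (simp add: N_def[symmetric] divide_le_eq)
  qed
qed

text \<open>The spectral radius forced by labels that all equal \<alpha>; the label 1/4 gives the
  critical value \<open>fact (r - 1) * root r 4\<close>.\<close>

definition rho_value :: "nat \<Rightarrow> real \<Rightarrow> real" where
  "rho_value r \<alpha> = fact (r - 1) * root r (1 / \<alpha>)"

lemma prod_root: "0 < r \<Longrightarrow> (\<Prod>v\<in>e. root r (f v)) = root r (\<Prod>v\<in>e. f v)"
  by (induction e rule: infinite_finite_induct) (auto simp: real_root_mult)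

lemma sum_load:
  assumes fV: "finite V" and S: "finite S" "\<And>e. e \<in> S \<Longrightarrow> e \<subseteq> V"
  shows "(\<Sum>v\<in>V. \<Sum>e\<in>{e\<in>S. v \<in> e}. f v e) = (\<Sum>e\<in>S. \<Sum>v\<in>e. f v e)"
proof -
  have "(\<Sum>v\<in>V. \<Sum>e\<in>{e\<in>S. v \<in> e}. f v e) = (\<Sum>e\<in>S. \<Sum>v\<in>{v\<in>V. v \<in> e}. f v e)"
    using sum.swap_restrict[OF fV S(1)] .
  also have "\<dots> = (\<Sum>e\<in>S. \<Sum>v\<in>e. f v e)"
  proof (rule sum.cong)
    fix e assume "e \<in> S"
    then have "{v\<in>V. v \<in> e} = e" using S(2) by auto
    then show "(\<Sum>v\<in>{v\<in>V. v \<in> e}. f v e) = (\<Sum>v\<in>e. f v e)" by simp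
  qed simp
  finally show ?thesis .
qed

lemma pot_eq:
  assumes "weighting S w" "e \<in> S" "card e = r"
  shows "(\<Prod>v\<in>e. load S w v) = w e ^ r / pot S w e"
proof -
  have "pot S w e = w e ^ r / (\<Prod>v\<in>e. load S w v)"
    using assms by (simp add: pot_def prod_dividef)
  moreover have "(\<Prod>v\<in>e. load S w v) > 0" using load_pos[OF assms(1,2)] by (intro prod_pos) auto
  moreover have "w e > 0" using assms by (auto simp: weighting_def)
  ultimately show ?thesis by simp
qed

text \<open>The test vector is the \<open>r\<close>-th root of the load. Double counting makes its
  norm \<open>r\<close> times the total weight, because every edge has \<open>r\<close> vertices; on
  an edge of \<open>S\<close> its product is \<open>w e * root r (1 / pot S w e)\<close>, and the
  remaining edges contribute nonnegatively.\<close>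

lemma spectral_radius_ge_aux:
  assumes H: "r_graph r H" and r: "r \<ge> 1" and S: "S \<subseteq> edges H" "S \<noteq> {}"
    and w: "weighting S w"
  shows "fact (r - 1) * (\<Sum>e\<in>S. w e * root r (1 / pot S w e)) \<le> spectral_radius r H * (\<Sum>e\<in>S. w e)"
proof -
  have fS: "finite S" using w by (simp add: weighting_def)
  have fV: "finite (verts H)" using H by (simp add: r_graph_def)
  have wp: "w e > 0" if "e \<in> S" for e using w that by (auto simp: weighting_def)
  define x where "x v = root r (load S w v)" for v
  have l0: "load S w v \<ge> 0" for v unfolding load_def using wp by (intro sum_nonneg) (auto intro: less_imp_le)
  have N: "(\<Sum>v\<in>verts H. \<bar>x v\<bar> ^ r) = real r * (\<Sum>e\<in>S. w e)"
  proof -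
    have "(\<Sum>v\<in>verts H. \<bar>x v\<bar> ^ r) = (\<Sum>v\<in>verts H. load S w v)"
      using r l0 by (intro sum.cong) (auto simp: x_def)
    also have "\<dots> = (\<Sum>e\<in>S. \<Sum>v\<in>e. w e)"
      unfolding load_def using sum_load[OF fV fS, of "\<lambda>v e. w e"] S r_graph_edgeD[OF H] by blast
    also have "\<dots> = (\<Sum>e\<in>S. real r * w e)"
      using S r_graph_edgeD[OF H] by (intro sum.cong) auto
    finally show ?thesis by (simp add: sum_distrib_left)
  qed
  have pe: "(\<Prod>v\<in>e. x v) = w e * root r (1 / pot S w e)" if e: "e \<in> S" for e
  proof -
    have "card e = r" using r_graph_edgeD[OF H] S e by auto
    then have "(\<Prod>v\<in>e. x v) = root r (w e ^ r * (1 / pot S w e))"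
      unfolding x_def using r pot_eq[OF w e] by (simp add: prod_root)
    also have "\<dots> = w e * root r (1 / pot S w e)"
      using r wp[OF e] by (subst real_root_mult) (simp add: real_root_power_cancel less_imp_le)
    finally show ?thesis .
  qed
  have ne: "verts H \<noteq> {}"
  proof -
    obtain e where e: "e \<in> edges H" using S by auto
    then have "e \<noteq> {}" "e \<subseteq> verts H" using r_graph_edgeD[OF H e] r by auto
    then show ?thesis by auto
  qed
  have "fact r * (\<Sum>e\<in>S. w e * root r (1 / pot S w e)) \<le> poly_form r H x"
  proof -
    have "(\<Sum>e\<in>S. w e * root r (1 / pot S w e)) = (\<Sum>e\<in>S. \<Prod>v\<in>e. x v)" using pe by simp
    also have "\<dots> \<le> (\<Sum>e\<in>edges H. \<Prod>v\<in>e. x v)"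
      using finite_edges[OF H] S l0 r by (intro sum_mono2) (auto simp: x_def intro!: prod_nonneg)
    finally show ?thesis by (simp add: poly_form_def)
  qed
  also have "\<dots> \<le> spectral_radius r H * (real r * (\<Sum>e\<in>S. w e))"
    using poly_form_le_spectral_radius[OF H r ne, of x] N by simp
  finally have "real r * (fact (r - 1) * (\<Sum>e\<in>S. w e * root r (1 / pot S w e)))
      \<le> real r * (spectral_radius r H * (\<Sum>e\<in>S. w e))"
    using fact_reduce[of r, where 'a=real] r by (simp add: mult_ac)
  then show ?thesis using r by (simp only: mult_le_cancel_left_pos of_nat_0_less_iff)
qed

lemma spectral_radius_ge:
  assumes H: "r_graph r H" and r: "r \<ge> 1" and S: "S \<subseteq> edges H" "S \<noteq> {}"
    and w: "weighting S w" and \<alpha>: "\<And>e. e \<in> S \<Longrightarrow> pot S w e \<le> \<alpha>"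
  shows "rho_value r \<alpha> \<le> spectral_radius r H"
    and "e0 \<in> S \<Longrightarrow> pot S w e0 < \<alpha> \<Longrightarrow> rho_value r \<alpha> < spectral_radius r H"
proof -
  have fS: "finite S" using w by (simp add: weighting_def)
  have wp: "w e > 0" if "e \<in> S" for e using w that by (auto simp: weighting_def)
  have W: "(\<Sum>e\<in>S. w e) > 0" using wp S fS by (intro sum_pos) auto
  have le: "w e * root r (1 / \<alpha>) \<le> w e * root r (1 / pot S w e)" if "e \<in> S" for e
    using wp[OF that] \<alpha>[OF that] pot_pos[OF w that] r
    by (intro mult_left_mono) (auto intro!: divide_left_mono mult_pos_pos)
  have "(\<Sum>e\<in>S. w e) * root r (1 / \<alpha>) \<le> (\<Sum>e\<in>S. w e * root r (1 / pot S w e))"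
    unfolding sum_distrib_right using le by (intro sum_mono) auto
  then have "fact (r - 1) * ((\<Sum>e\<in>S. w e) * root r (1 / \<alpha>)) \<le> spectral_radius r H * (\<Sum>e\<in>S. w e)"
    using spectral_radius_ge_aux[OF H r S w] by (meson fact_ge_zero mult_left_mono order_trans)
  then have "rho_value r \<alpha> * (\<Sum>e\<in>S. w e) \<le> spectral_radius r H * (\<Sum>e\<in>S. w e)"
    by (simp add: rho_value_def mult_ac)
  then show "rho_value r \<alpha> \<le> spectral_radius r H" using W by simp
  show "rho_value r \<alpha> < spectral_radius r H" if e0: "e0 \<in> S" "pot S w e0 < \<alpha>"
  proof -
    have "w e0 * root r (1 / \<alpha>) < w e0 * root r (1 / pot S w e0)"
      using wp[OF e0(1)] e0(2) pot_pos[OF w e0(1)] r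
      by (intro mult_strict_left_mono) (auto intro!: divide_strict_left_mono mult_pos_pos)
    then have "(\<Sum>e\<in>S. w e) * root r (1 / \<alpha>) < (\<Sum>e\<in>S. w e * root r (1 / pot S w e))"
      unfolding sum_distrib_right using le e0(1) fS by (intro sum_strict_mono_ex1) auto
    then have "fact (r - 1) * ((\<Sum>e\<in>S. w e) * root r (1 / \<alpha>)) < fact (r - 1) * (\<Sum>e\<in>S. w e * root r (1 / pot S w e))"
      by (intro mult_strict_left_mono) auto
    then have "fact (r - 1) * ((\<Sum>e\<in>S. w e) * root r (1 / \<alpha>)) < spectral_radius r H * (\<Sum>e\<in>S. w e)"
      using spectral_radius_ge_aux[OF H r S w] by (rule less_le_trans)
    then have "rho_value r \<alpha> * (\<Sum>e\<in>S. w e) < spectral_radius r H * (\<Sum>e\<in>S. w e)"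
      by (simp add: rho_value_def mult_ac)
    then show ?thesis using W by simp
  qed
qed

text \<open>For a maximising vector, \<open>a e v\<close> is the part of
  \<open>\<bar>x v\<bar> ^ r\<close> that the edge \<open>e\<close> receives. The mean
  \<open>A e\<close> of these parts dominates their geometric mean, which is the edge product up to
  the root of \<open>pot\<close>; over all edges the means add up to at most
  \<open>1 / r\<close>.\<close>

lemma spectral_radius_le:
  assumes H: "r_graph r H" and r: "r \<ge> 1" and ne: "verts H \<noteq> {}"
    and w: "weighting (edges H) w" and \<alpha>: "\<And>e. e \<in> edges H \<Longrightarrow> \<alpha> \<le> pot (edges H) w e" "0 < \<alpha>"
  shows "spectral_radius r H \<le> rho_value r \<alpha>"
    and "linked (edges H) \<Longrightarrow> e0 \<in> edges H \<Longrightarrow> \<alpha> < pot (edges H) w e0 \<Longrightarrow> spectral_radius r H < rho_value r \<alpha>"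
proof -
  let ?E = "edges H"
  have fE: "finite ?E" using finite_edges[OF H] .
  have fV: "finite (verts H)" using H by (simp add: r_graph_def)
  obtain x where x: "(\<Sum>v\<in>verts H. \<bar>x v\<bar> ^ r) = 1" "spectral_radius r H = poly_form r H x"
    using spectral_radius_attained(1)[OF H ne r] by blast
  define a where "a e v = \<bar>x v\<bar> ^ r * (w e / load ?E w v)" for e v
  define A where "A e = (\<Sum>v\<in>e. a e v / real r)" for e
  define T where "T e = (\<Prod>v\<in>e. \<bar>x v\<bar>)" for e
  have wp: "w e > 0" if "e \<in> ?E" for e using w that by (auto simp: weighting_def)
  have ann: "a e v \<ge> 0" if "e \<in> ?E" "v \<in> e" for e v
    unfolding a_def using wp[OF that(1)] load_pos[OF w that] by (intro mult_nonneg_nonneg) auto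
  have A0: "A e \<ge> 0" if "e \<in> ?E" for e using ann[OF that] by (auto simp: A_def intro!: sum_nonneg)
  have TA: "T e \<le> A e * root r (1 / pot ?E w e)" if e: "e \<in> ?E" for e
  proof -
    have ce: "card e = r" "finite e" "e \<noteq> {}" using r_graph_edgeD[OF H e] r by auto
    have "T e = root r (\<Prod>v\<in>e. \<bar>x v\<bar> ^ r)"
      using r by (simp add: T_def prod_root[symmetric] real_root_power_cancel)
    also have "(\<Prod>v\<in>e. \<bar>x v\<bar> ^ r) = (\<Prod>v\<in>e. a e v) * (1 / pot ?E w e)"
    proof -
      have "(\<Prod>v\<in>e. a e v) = (\<Prod>v\<in>e. \<bar>x v\<bar> ^ r) * pot ?E w e"
        unfolding a_def pot_def by (rule prod.distrib)
      then show ?thesis using pot_pos[OF w e] by simp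
    qed
    also have "root r \<dots> = root r (\<Prod>v\<in>e. a e v) * root r (1 / pot ?E w e)"
      by (rule real_root_mult)
    also have "\<dots> \<le> A e * root r (1 / pot ?E w e)"
    proof (rule mult_right_mono)
      have P0: "(\<Prod>v\<in>e. a e v) \<ge> 0" using ann[OF e] by (intro prod_nonneg) auto
      have "root r (\<Prod>v\<in>e. a e v) = (\<Prod>v\<in>e. a e v) powr (1 / real r)"
        using P0 r by (simp add: root_powr_inverse)
      also have "\<dots> \<le> A e" using arith_geom_mean[OF ce(2,3), of "a e"] ann[OF e] ce by (simp add: A_def)
      finally show "root r (\<Prod>v\<in>e. a e v) \<le> A e" .
      show "0 \<le> root r (1 / pot ?E w e)" using pot_pos[OF w e] r by simp
    qed
    finally show ?thesis .
  qed
  have rr: "root r (1 / pot ?E w e) \<le> root r (1 / \<alpha>)" if "e \<in> ?E" for e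
    using \<alpha>(1)[OF that] \<alpha>(2) r by (auto intro!: divide_left_mono mult_pos_pos intro: less_le_trans)
  have TA': "T e \<le> A e * root r (1 / \<alpha>)" if "e \<in> ?E" for e
    using TA[OF that] mult_left_mono[OF rr[OF that] A0[OF that]] by linarith
  have SA: "(\<Sum>e\<in>?E. A e) \<le> 1 / real r"
  proof -
    have "(\<Sum>e\<in>?E. A e) = (\<Sum>v\<in>verts H. \<Sum>e\<in>{e\<in>?E. v \<in> e}. a e v / real r)"
      unfolding A_def using sum_load[OF fV fE, of "\<lambda>v e. a e v / real r"] r_graph_edgeD[OF H] by simp
    also have "\<dots> \<le> (\<Sum>v\<in>verts H. \<bar>x v\<bar> ^ r / real r)"
    proof (rule sum_mono)
      fix v
      show "(\<Sum>e\<in>{e\<in>?E. v \<in> e}. a e v / real r) \<le> \<bar>x v\<bar> ^ r / real r"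
      proof (cases "{e\<in>?E. v \<in> e} = {}")
        case True
        then show ?thesis by (simp only: sum.empty) simp
      next
        case False
        then have "load ?E w v > 0" using load_pos[OF w] by blast
        moreover have "(\<Sum>e\<in>{e\<in>?E. v \<in> e}. a e v / real r)
            = \<bar>x v\<bar> ^ r / real r * ((\<Sum>e\<in>{e\<in>?E. v \<in> e}. w e) / load ?E w v)"
          unfolding a_def sum_distrib_left sum_divide_distrib by (intro sum.cong) auto
        ultimately show ?thesis by (simp add: load_def)
      qed
    qed
    also have "\<dots> = 1 / real r" using x(1) by (simp add: sum_divide_distrib[symmetric])
    finally show ?thesis .
  qed
  have r0: "root r (1 / \<alpha>) > 0" using \<alpha>(2) r by simp
  have fr: "fact r * (1 / real r) = (fact (r - 1) :: real)"
    using fact_reduce[of r, where 'a=real] r by (simp add: field_simps)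
  have xT: "poly_form r H x \<le> fact r * (\<Sum>e\<in>?E. T e)"
    unfolding poly_form_def T_def
    by (intro mult_left_mono sum_mono) (auto simp: abs_prod[symmetric])
  have up: "(\<Sum>e\<in>?E. A e * root r (1 / \<alpha>)) \<le> 1 / real r * root r (1 / \<alpha>)"
    unfolding sum_distrib_right[symmetric] using SA r0 by (intro mult_right_mono) auto
  have rv: "rho_value r \<alpha> = fact r * (1 / real r * root r (1 / \<alpha>))"
    unfolding rho_value_def fr[symmetric] by simp
  have "(\<Sum>e\<in>?E. T e) \<le> (\<Sum>e\<in>?E. A e * root r (1 / \<alpha>))" using TA' by (rule sum_mono)
  with up have "(\<Sum>e\<in>?E. T e) \<le> 1 / real r * root r (1 / \<alpha>)" by linarith
  then have "fact r * (\<Sum>e\<in>?E. T e) \<le> rho_value r \<alpha>" unfolding rv by (intro mult_left_mono) auto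
  with xT x(2) show le: "spectral_radius r H \<le> rho_value r \<alpha>" by linarith
  show "spectral_radius r H < rho_value r \<alpha>" if L: "linked ?E" and e0: "e0 \<in> ?E" "\<alpha> < pot ?E w e0"
  proof (rule ccontr)
    assume "\<not> ?thesis"
    then have "rho_value r \<alpha> \<le> poly_form r H x" using x(2) by simp
    then have "fact r * (1 / real r * root r (1 / \<alpha>)) \<le> fact r * (\<Sum>e\<in>?E. T e)" using xT rv by linarith
    then have "1 / real r * root r (1 / \<alpha>) \<le> (\<Sum>e\<in>?E. T e)" by (simp only: mult_le_cancel_left_pos fact_gt_zero)
    then have ge: "(\<Sum>e\<in>?E. A e * root r (1 / \<alpha>)) \<le> (\<Sum>e\<in>?E. T e)" using up by linarith
    \<comment> \<open>If the value is attained there is no slack in the sum, so every edgewise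
      estimate is an equality.\<close>
    have eq: "T e = A e * root r (1 / \<alpha>)" if "e \<in> ?E" for e
    proof (rule ccontr)
      assume "T e \<noteq> A e * root r (1 / \<alpha>)"
      then have "T e < A e * root r (1 / \<alpha>)" using TA'[OF that] by simp
      then have "(\<Sum>e\<in>?E. T e) < (\<Sum>e\<in>?E. A e * root r (1 / \<alpha>))"
        using that fE TA' by (intro sum_strict_mono_ex1) auto
      then show False using ge by simp
    qed
    \<comment> \<open>The larger label at \<open>e0\<close> gives a strictly better estimate there
      unless its share is zero.\<close>
    have Z0: "A e0 = 0"
    proof (rule ccontr)
      assume "A e0 \<noteq> 0"
      then have "A e0 > 0" using A0[OF e0(1)] by simp
      moreover have "root r (1 / pot ?E w e0) < root r (1 / \<alpha>)"
        using e0(2) \<alpha>(2) r by (auto intro!: divide_strict_left_mono mult_pos_pos)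
      ultimately have "A e0 * root r (1 / pot ?E w e0) < A e0 * root r (1 / \<alpha>)" by simp
      then show False using TA[OF e0(1)] eq[OF e0(1)] by simp
    qed
    \<comment> \<open>The zeros spread: \<open>x\<close> vanishes on the edges of \<open>Z\<close>,
      so an edge that meets one of them has product 0 and, by the equalities, share 0. Linkedness
      makes \<open>Z\<close> everything, against the positive value of the maximum.\<close>
    define Z where "Z = {e\<in>?E. A e = 0}"
    have Zx: "x v = 0" if "e \<in> Z" "v \<in> e" for e v
    proof -
      have e: "e \<in> ?E" "A e = 0" "finite e" using that r_graph_edgeD[OF H] by (auto simp: Z_def)
      have "a e v / real r = 0"
        using e(2) that(2) ann[OF e(1)] e(3) by (auto simp: A_def sum_nonneg_eq_0_iff)
      then have "a e v = 0" using r by simp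
      then show ?thesis using wp[OF e(1)] load_pos[OF w e(1) that(2)] r by (auto simp: a_def)
    qed
    have "Z = ?E"
    proof (rule ccontr)
      assume "Z \<noteq> ?E"
      then obtain e f where ef: "e \<in> Z" "f \<in> ?E - Z" "e \<inter> f \<noteq> {}"
      proof -
        have "Z \<subseteq> ?E" "e0 \<in> Z" using Z0 e0(1) by (auto simp: Z_def)
        then show ?thesis using linkedD[OF L, of Z] \<open>Z \<noteq> ?E\<close> that by blast
      qed
      then obtain v where v: "v \<in> e" "v \<in> f" by auto
      have "T f = 0" unfolding T_def using v Zx[OF ef(1)] r_graph_edgeD[OF H] ef(2) by (intro prod_zero) auto
      then have "A f = 0" using eq[of f] ef(2) r0 by simp
      then show False using ef(2) by (simp add: Z_def)
    qed
    then have "A e = 0" if "e \<in> ?E" for e using that by (auto simp: Z_def)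
    then have "(\<Sum>e\<in>?E. T e) = 0" using eq by simp
    then have "1 / real r * root r (1 / \<alpha>) \<le> 0" using \<open>1 / real r * root r (1 / \<alpha>) \<le> (\<Sum>e\<in>?E. T e)\<close> by linarith
    then show False using r0 r by (simp add: mult_le_0_iff divide_le_0_iff)
  qed
qed

lemma rho_value_less:
  assumes "r \<ge> 1" "0 < \<beta>" "\<beta> < \<alpha>"
  shows "rho_value r \<alpha> < rho_value r \<beta>"
  unfolding rho_value_def using assms
  by (intro mult_strict_left_mono) (auto intro!: divide_strict_left_mono)

section \<open>Hanging paths and forks; supercritical families\<close>

fun consecutive :: "'a set \<Rightarrow> 'a set list \<Rightarrow> bool" where
  "consecutive a [] \<longleftrightarrow> True"
| "consecutive a (g # gs) \<longleftrightarrow> a \<inter> g \<noteq> {} \<and> consecutive g gs"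

text \<open>All edges but the root \<open>a\<close> are already good for the critical value; only
  the bound \<open>c\<close> at the root has to be pushed down to 1/4. Excluding a pattern thus
  becomes a product of numerical factors.\<close>

definition rooted_le :: "'a set set \<Rightarrow> 'a set \<Rightarrow> real \<Rightarrow> bool" where
  "rooted_le S a c \<longleftrightarrow> a \<in> S \<and> (\<exists>p. labelled_le S p \<and> p a \<le> c \<and> (\<forall>e\<in>S - {a}. p e \<le> 1/4))"

lemma labelled_le_leg:
  assumes "labelled_le S p" "a \<in> S" "consecutive a gs" "distinct gs" "set gs \<inter> S = {}"
    "\<And>g. g \<in> set gs \<Longrightarrow> finite g"
  shows "\<exists>q. labelled_le (S \<union> set gs) q \<and> (\<forall>e\<in>S - {a}. q e = p e) \<and>
    q a = p a * ((length gs + 2) / (2 * (length gs + 1))) \<and> (\<forall>g\<in>set gs. q g \<le> 1/4)"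
  using assms
proof (induction gs arbitrary: S p a)
  case Nil
  then show ?case by (intro exI[of _ p]) auto
next
  case (Cons g gs)
  define m where "m = real (length gs)"
  define b where "b = (m + 3) / (2 * (m + 2))"
  have m0: "m \<ge> 0" by (simp add: m_def)
  have b: "0 < b" "b < 1" "1 - b = (m + 1) / (2 * (m + 2))" using m0 by (auto simp: b_def field_simps)
  have g: "g \<notin> S" "finite g" "a \<inter> g \<noteq> {}" "g \<noteq> a" using Cons.prems by auto
  have "labelled_le (insert g S) (p(g := 1 - b, a := p a * b))"
    by (rule labelled_le_hang) (use Cons.prems g b in auto)
  note step = this
  have c: "consecutive g gs" "distinct gs" "set gs \<inter> insert g S = {}" "\<And>h. h \<in> set gs \<Longrightarrow> finite h"
    using Cons.prems by auto
  obtain q where q: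
    "labelled_le (insert g S \<union> set gs) q" "\<forall>e\<in>insert g S - {g}. q e = (p(g := 1 - b, a := p a * b)) e"
    "q g = (p(g := 1 - b, a := p a * b)) g * ((length gs + 2) / (2 * (length gs + 1)))" "\<forall>h\<in>set gs. q h \<le> 1/4"
    using Cons.IH[OF step insertI1 c] by blast
  have "q g = (1 - b) * ((m + 2) / (2 * (m + 1)))" using q(3) g by (simp add: m_def add_ac)
  also have "\<dots> = 1/4" unfolding b(3) using m0 by (simp add: divide_simps) (simp add: algebra_simps)
  finally have qg: "q g = 1/4" .
  have qa: "q a = p a * ((length (g # gs) + 2) / (2 * (length (g # gs) + 1)))"
    using q(2) Cons.prems(2) g by (simp add: b_def m_def add_ac)
  have qS: "\<forall>e\<in>S - {a}. q e = p e" using q(2) g(1) by auto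
  have "\<forall>h\<in>set (g # gs). q h \<le> 1/4" using q(4) qg by simp
  moreover have "labelled_le (S \<union> set (g # gs)) q" using q(1) by simp
  ultimately show ?case using qS qa by blast
qed

lemma rooted_le_single: "finite a \<Longrightarrow> rooted_le {a} a 1"
  unfolding rooted_le_def by (intro conjI exI[of _ "\<lambda>_. 1"] labelled_eq_imp_le labelled_eq_single) simp_all

lemma rooted_le_leg:
  assumes "rooted_le S a c" "consecutive a gs" "distinct gs" "set gs \<inter> S = {}"
    "\<And>g. g \<in> set gs \<Longrightarrow> finite g"
  shows "rooted_le (S \<union> set gs) a (c * ((length gs + 2) / (2 * (length gs + 1))))"
proof -
  obtain p where p: "a \<in> S" "labelled_le S p" "p a \<le> c" "\<forall>e\<in>S - {a}. p e \<le> 1/4"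
    using assms(1) unfolding rooted_le_def by blast
  let ?k = "(length gs + 2) / (2 * (length gs + 1)) :: real"
  obtain q where q: "labelled_le (S \<union> set gs) q" "\<forall>e\<in>S - {a}. q e = p e" "q a = p a * ?k" "\<forall>g\<in>set gs. q g \<le> 1/4"
    using labelled_le_leg[OF p(2,1) assms(2-5)] by blast
  have "p a * ?k \<le> c * ?k" using p(3) by (intro mult_right_mono) auto
  then have "q a \<le> c * ?k" using q(3) by simp
  moreover have "q e \<le> 1/4" if "e \<in> S \<union> set gs - {a}" for e
    using that q(2,4) p(4) by (cases "e \<in> S") simp_all
  ultimately show ?thesis unfolding rooted_le_def using q(1) p(1) by blast
qed

lemma labelled_le_fork:
  assumes "labelled_le S p" "a \<in> S" "consecutive a gs" "distinct (h1 # h2 # gs)"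
    "(set gs \<union> {h1, h2}) \<inter> S = {}" "last (a # gs) \<inter> h1 \<noteq> {}" "last (a # gs) \<inter> h2 \<noteq> {}"
    "\<And>g. g \<in> set gs \<union> {h1, h2} \<Longrightarrow> finite g"
  shows "\<exists>q. labelled_le (S \<union> set gs \<union> {h1, h2}) q \<and> (\<forall>e\<in>S - {a}. q e = p e) \<and>
    q a = p a * (if gs = [] then 9/16 else 5/9) \<and> (\<forall>g\<in>set gs \<union> {h1, h2}. q g \<le> 1/4)"
  using assms
proof (induction gs arbitrary: S p a)
  case Nil
  have h: "h1 \<noteq> a" "h2 \<noteq> a" using Nil.prems by auto
  have "labelled_le (insert h1 S) (p(h1 := 1 - 3/4, a := p a * (3/4)))" (is "labelled_le _ ?p")
    by (rule labelled_le_hang) (use Nil.prems in auto)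
  then have "labelled_le (insert h2 (insert h1 S)) (?p(h2 := 1 - 3/4, a := ?p a * (3/4)))"
    by (rule labelled_le_hang) (use Nil.prems in auto)
  moreover have "S \<union> set [] \<union> {h1, h2} = insert h2 (insert h1 S)" by auto
  moreover define q where "q = ?p(h2 := 1 - 3/4, a := ?p a * (3/4))"
  ultimately have q: "labelled_le (S \<union> set [] \<union> {h1, h2}) q" by (simp only:)
  have "q h1 = 1/4" "q h2 = 1/4" "q a = p a * (9/16)" using h Nil.prems(4) by (simp_all add: q_def)
  moreover have "q e = p e" if "e \<in> S - {a}" for e
  proof -
    have "e \<noteq> a" "e \<noteq> h1" "e \<noteq> h2" using that Nil.prems(5) by auto
    then show ?thesis by (simp add: q_def)
  qed
  ultimately show ?case using q by (intro exI[of _ q]) simp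
next
  case (Cons g gs)
  have g: "g \<notin> S" "finite g" "a \<inter> g \<noteq> {}" "g \<noteq> a" "g \<noteq> h1" "g \<noteq> h2" using Cons.prems by auto
  have "labelled_le (insert g S) (p(g := 1 - 5/9, a := p a * (5/9)))" (is "labelled_le _ ?p")
    by (rule labelled_le_hang) (use Cons.prems g in auto)
  note step = this
  have c: "consecutive g gs" "distinct (h1 # h2 # gs)" "(set gs \<union> {h1, h2}) \<inter> insert g S = {}"
    "last (g # gs) \<inter> h1 \<noteq> {}" "last (g # gs) \<inter> h2 \<noteq> {}"
    "\<And>h. h \<in> set gs \<union> {h1, h2} \<Longrightarrow> finite h"
    using Cons.prems by (auto split: if_splits)
  obtain q where q:
    "labelled_le (insert g S \<union> set gs \<union> {h1, h2}) q" "\<forall>e\<in>insert g S - {g}. q e = (p(g := 1 - 5/9, a := p a * (5/9))) e"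
    "q g = (p(g := 1 - 5/9, a := p a * (5/9))) g * (if gs = [] then 9/16 else 5/9)" "\<forall>h\<in>set gs \<union> {h1, h2}. q h \<le> 1/4"
    using Cons.IH[OF step insertI1 c] by blast
  \<comment> \<open>The label 4/9 becomes 4/9 times 9/16, exactly 1/4, if the fork sits on
    \<open>g\<close> itself, and 4/9 times 5/9 = 20/81 otherwise.\<close>
  have qg: "q g \<le> 1/4" using q(3) g by (cases "gs = []") simp_all
  have qa: "q a = p a * (if g # gs = [] then 9/16 else 5/9)" using q(2) Cons.prems(2) g by simp
  have qS: "\<forall>e\<in>S - {a}. q e = p e" using q(2) g(1) by auto
  have "\<forall>h\<in>set (g # gs) \<union> {h1, h2}. q h \<le> 1/4" using q(4) qg by simp
  moreover have "S \<union> set (g # gs) \<union> {h1, h2} = insert g S \<union> set gs \<union> {h1, h2}" by auto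
  then have "labelled_le (S \<union> set (g # gs) \<union> {h1, h2}) q" using q(1) by (simp only:)
  ultimately show ?case using qS qa by blast
qed

text \<open>
  The labels on the chain are the constants \<open>4/9\<close> and \<open>5/9\<close>: an edge with two further edges
  hanging on it forces at least \<open>4/9 = (1/4) / (3/4)\<^sup>2\<close>, and this value persists along a chain
  because \<open>(1/4) / (5/9) \<ge> 4/9\<close>.
\<close>
lemma rooted_le_fork:
  assumes "rooted_le S a c" "consecutive a gs" "distinct (h1 # h2 # gs)"
    "(set gs \<union> {h1, h2}) \<inter> S = {}" "last (a # gs) \<inter> h1 \<noteq> {}" "last (a # gs) \<inter> h2 \<noteq> {}"
    "\<And>g. g \<in> set gs \<union> {h1, h2} \<Longrightarrow> finite g"
  shows "rooted_le (S \<union> set gs \<union> {h1, h2}) a (c * (if gs = [] then 9/16 else 5/9))"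
proof -
  obtain p where p: "a \<in> S" "labelled_le S p" "p a \<le> c" "\<forall>e\<in>S - {a}. p e \<le> 1/4"
    using assms(1) unfolding rooted_le_def by blast
  let ?k = "if gs = [] then 9/16 else 5/9 :: real"
  obtain q where q: "labelled_le (S \<union> set gs \<union> {h1, h2}) q" "\<forall>e\<in>S - {a}. q e = p e" "q a = p a * ?k"
    "\<forall>g\<in>set gs \<union> {h1, h2}. q g \<le> 1/4"
    using labelled_le_fork[OF p(2,1) assms(2-7)] by blast
  have "p a * ?k \<le> c * ?k" using p(3) by (intro mult_right_mono) auto
  then have "q a \<le> c * ?k" using q(3) by simp
  moreover have "q e \<le> 1/4" if "e \<in> S \<union> set gs \<union> {h1, h2} - {a}" for e
  proof (cases "e \<in> S")
    case True
    then have "q e = p e" "p e \<le> 1/4" using that q(2) p(4) by simp_all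
    then show ?thesis by simp
  next
    case False
    then have "e \<in> set gs \<union> {h1, h2}" using that by blast
    then show ?thesis using q(4) by blast
  qed
  ultimately show ?thesis unfolding rooted_le_def using q(1) p(1) by blast
qed

lemma labelled_le_star:
  assumes S: "finite S" "S \<noteq> {}" "\<And>e. e \<in> S \<Longrightarrow> finite e \<and> v \<in> e \<and> 0 < w e"
  shows "labelled_le S (\<lambda>e. w e / sum w S)"
proof -
  have w: "weighting S w" using S by (auto simp: weighting_def)
  have "pot S w e \<le> w e / sum w S" if e: "e \<in> S" for e
  proof -
    have "{f\<in>S. v \<in> f} = S" using S by auto
    then have l: "load S w v = sum w S" by (simp add: load_def)
    have "pot S w e = w e / load S w v * (\<Prod>x\<in>e - {v}. w e / load S w x)"
      using pot_remove[of e v] S e by auto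
    also have "\<dots> \<le> w e / load S w v * 1"
    proof (rule mult_left_mono)
      show "(\<Prod>x\<in>e - {v}. w e / load S w x) \<le> 1"
        using load_ge[OF w e] load_pos[OF w e] S(3)[OF e] by (intro prod_le_1) (auto intro: less_imp_le)
      show "0 \<le> w e / load S w v" using load_pos[OF w e] S(3)[OF e] by (auto intro!: divide_nonneg_pos less_imp_le)
    qed
    finally show ?thesis by (simp add: l)
  qed
  then show ?thesis using w by (auto simp: labelled_le_def)
qed

text \<open>Two sources of strictness: a label below 1/4, or an edge outside \<open>S\<close>, which
  in a linked family can be hung on \<open>S\<close> to produce such a label.\<close>

definition supercritical :: "'a set set \<Rightarrow> bool" where
  "supercritical E \<longleftrightarrow> (\<exists>S p. S \<subseteq> E \<and> S \<noteq> {} \<and> labelled_le S p \<and> (\<forall>e\<in>S. p e \<le> 1/4) \<and>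
     (S \<noteq> E \<or> (\<exists>e\<in>S. p e < 1/4)))"

lemma spectral_radius_supercritical:
  assumes H: "r_graph r H" and r: "r \<ge> 1" and L: "linked (edges H)" and sup: "supercritical (edges H)"
  shows "rho_value r (1/4) < spectral_radius r H"
proof -
  obtain S p where S: "S \<subseteq> edges H" "S \<noteq> {}" "labelled_le S p" "\<forall>e\<in>S. p e \<le> 1/4"
     "S \<noteq> edges H \<or> (\<exists>e\<in>S. p e < 1/4)"
    using sup unfolding supercritical_def by blast
  show ?thesis
  proof (cases "\<exists>e\<in>S. p e < 1/4")
    case True
    then obtain e0 where e0: "e0 \<in> S" "p e0 < 1/4" by auto
    obtain w where w: "weighting S w" "\<forall>e\<in>S. pot S w e \<le> p e" using S(3) by (auto simp: labelled_le_def)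
    show ?thesis
    proof (rule spectral_radius_ge(2)[OF H r S(1,2) w(1) _ e0(1)])
      show "pot S w e \<le> 1/4" if "e \<in> S" for e using that w(2) S(4) by force
      show "pot S w e0 < 1/4" using e0 w(2) by force
    qed
  next
    case False
    then obtain e f where ef: "e \<in> S" "f \<in> edges H - S" "e \<inter> f \<noteq> {}"
      using linkedD[OF L S(1,2)] S(5) by blast
    \<comment> \<open>The share 4/5 balances the two edges: 1/4 times 4/5 and 1 - 4/5 are both 1/5,
      strictly below 1/4.\<close>
    have "labelled_le (insert f S) (p(f := 1 - 4/5, e := p e * (4/5)))" (is "labelled_le _ ?p")
      using ef r_graph_edgeD[OF H] by (intro labelled_le_hang S(3)) auto
    then obtain w where w: "weighting (insert f S) w" "\<forall>e\<in>insert f S. pot (insert f S) w e \<le> ?p e"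
      by (auto simp: labelled_le_def)
    have fe: "f \<noteq> e" using ef by auto
    show ?thesis
    proof (rule spectral_radius_ge(2)[OF H r _ _ w(1), of _ f])
      show "pot (insert f S) w g \<le> 1/4" if g: "g \<in> insert f S" for g
      proof -
        have "?p g \<le> 1/4"
        proof (cases "g = f \<or> g = e")
          case True
          then show ?thesis using S(4) ef(1) fe by auto
        next
          case False
          then show ?thesis using S(4) g by simp
        qed
        then show ?thesis using w(2) g by force
      qed
      have "?p f < 1/4" using fe by simp
      then show "pot (insert f S) w f < 1/4" using w(2) by force
    qed (use ef S(1) in auto)
  qed
qed

lemma rooted_le_supercritical:
  assumes "rooted_le S a c" "S \<subseteq> E" "c \<le> 1/4" "S \<noteq> E \<or> c < 1/4"
  shows "supercritical E"
proof -
  obtain p where p: "a \<in> S" "labelled_le S p" "p a \<le> c" "\<forall>e\<in>S - {a}. p e \<le> 1/4"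
    using assms(1) unfolding rooted_le_def by blast
  then have "p e \<le> 1/4" if "e \<in> S" for e using that assms(3) by (cases "e = a") auto
  moreover have "S \<noteq> E \<or> p a < 1/4" using p(3) assms(4) by linarith
  ultimately show ?thesis unfolding supercritical_def using assms(2) p(1,2) by blast
qed

text \<open>With unit weights the load is the degree, so a label is the product of the reciprocal
  degrees; vertices outside \<open>X\<close> contribute factors of at most 1.\<close>

lemma pot_one_le:
  assumes S: "finite S" "\<And>e. e \<in> S \<Longrightarrow> finite e" and e: "e \<in> S" and X: "X \<subseteq> e"
    and d: "\<And>x. x \<in> X \<Longrightarrow> d x \<le> card {f\<in>S. x \<in> f} \<and> d x > 0"
  shows "pot S (\<lambda>_. 1) e \<le> (\<Prod>x\<in>X. 1 / real (d x))"
proof -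
  have w: "weighting S (\<lambda>_. 1)" using S by (auto simp: weighting_def)
  have fe: "finite e" using S e by auto
  have fX: "finite X" using X fe by (rule finite_subset)
  have l: "load S (\<lambda>_. 1) x = real (card {f\<in>S. x \<in> f})" for x by (simp add: load_def)
  have b: "0 \<le> 1 / load S (\<lambda>_. 1) x \<and> 1 / load S (\<lambda>_. 1) x \<le> 1" if "x \<in> e" for x
    using load_ge[OF w e that] by auto
  have "pot S (\<lambda>_. 1) e = (\<Prod>x\<in>X. 1 / load S (\<lambda>_. 1) x) * (\<Prod>x\<in>e - X. 1 / load S (\<lambda>_. 1) x)"
    unfolding pot_def using prod.subset_diff[OF X fe] by (simp add: mult.commute)
  also have "\<dots> \<le> (\<Prod>x\<in>X. 1 / load S (\<lambda>_. 1) x) * 1"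
    using b X by (intro mult_left_mono prod_le_1 prod_nonneg) auto
  also have "(\<Prod>x\<in>X. 1 / load S (\<lambda>_. 1) x) \<le> (\<Prod>x\<in>X. 1 / real (d x))"
  proof (rule prod_mono)
    fix x assume x: "x \<in> X"
    show "0 \<le> 1 / load S (\<lambda>_. 1) x \<and> 1 / load S (\<lambda>_. 1) x \<le> 1 / real (d x)"
      using d[OF x] b[of x] x X by (auto simp: l intro!: divide_left_mono mult_pos_pos)
  qed
  finally show ?thesis by simp
qed

lemma card_ge_2I: "finite A \<Longrightarrow> a \<in> A \<Longrightarrow> b \<in> A \<Longrightarrow> a \<noteq> b \<Longrightarrow> 2 \<le> card A"
  using card_mono[of A "{a, b}"] by auto

lemma card_ge_3I: "finite A \<Longrightarrow> a \<in> A \<Longrightarrow> b \<in> A \<Longrightarrow> c \<in> A \<Longrightarrow> a \<noteq> b \<Longrightarrow> a \<noteq> c \<Longrightarrow> b \<noteq> c \<Longrightarrow> 3 \<le> card A"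
  using card_mono[of A "{a, b, c}"] by auto

lemma pot_one_two:
  assumes S: "finite S" "\<And>e. e \<in> S \<Longrightarrow> finite e" and e: "e \<in> S"
    and x: "x \<in> e" "x \<in> f" "f \<in> S" "f \<noteq> e" and y: "y \<in> e" "y \<in> g" "g \<in> S" "g \<noteq> e" and xy: "x \<noteq> y"
  shows "pot S (\<lambda>_. 1) e \<le> 1/4"
proof -
  have "pot S (\<lambda>_. 1) e \<le> (\<Prod>x\<in>{x, y}. 1 / real 2)"
  proof (rule pot_one_le[OF S e])
    fix z assume z: "z \<in> {x, y}"
    have "2 \<le> card {h \<in> S. z \<in> h}"
    proof (cases "z = x")
      case True
      then show ?thesis using card_ge_2I[of "{h \<in> S. z \<in> h}" e f] S(1) e x by simp
    next
      case False
      then show ?thesis using card_ge_2I[of "{h \<in> S. z \<in> h}" e g] S(1) e y z by simp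
    qed
    then show "2 \<le> card {h \<in> S. z \<in> h} \<and> (0::nat) < 2" by simp
  qed (use x y in auto)
  then show ?thesis using xy by simp
qed

section \<open>Families that are not supercritical\<close>

definition meets :: "'a set list \<Rightarrow> 'a set \<Rightarrow> nat set" where
  "meets P g = {i. i < length P \<and> P ! i \<inter> g \<noteq> {}}"

lemma meets_finite [simp]: "finite (meets P g)"
  by (simp add: meets_def)

text \<open>Having at least 20 edges ensures that any pattern with fewer edges is a proper
  subfamily, so that labels equal to 1/4 are already contradictory for it.\<close>

locale not_supercritical =
  fixes E :: "'a set set"
  assumes finite_E: "finite E" and finite_edge: "e \<in> E \<Longrightarrow> finite e" and nonempty_edge: "e \<in> E \<Longrightarrow> e \<noteq> {}"
    and linked_E: "linked E" and not_super: "\<not> supercritical E" and card_E: "card E \<ge> 20"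
begin

lemma labelled_le_False:
  assumes "labelled_le S p" "S \<subseteq> E" "S \<noteq> {}" "\<And>e. e \<in> S \<Longrightarrow> p e \<le> 1/4" "card S < 20 \<or> e0 \<in> S \<and> p e0 < 1/4"
  shows False
proof -
  have "S \<noteq> E \<or> (\<exists>e\<in>S. p e < 1/4)" using assms(5) card_E by auto
  then show False using not_super assms(1-4) unfolding supercritical_def by blast
qed

lemma rooted_le_False:
  assumes "rooted_le S a c" "S \<subseteq> E" "c \<le> 1/4" "card S < 20 \<or> c < 1/4"
  shows False
proof -
  have "S \<noteq> E \<or> c < 1/4" using assms(4) card_E by auto
  then show False using rooted_le_supercritical[OF assms(1-3)] not_super by blast
qed

lemma ones_False:
  assumes "S \<subseteq> E" "S \<noteq> {}" "\<And>e. e \<in> S \<Longrightarrow> pot S (\<lambda>_. 1) e \<le> 1/4" "card S < 20 \<or> e0 \<in> S \<and> pot S (\<lambda>_. 1) e0 < 1/4"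
  shows False
proof -
  have "finite S" using assms(1) finite_E by (rule finite_subset)
  then have "weighting S (\<lambda>_. 1)" using assms(1) finite_edge by (auto simp: weighting_def)
  then have "labelled_le S (pot S (\<lambda>_. 1))" unfolding labelled_le_def by blast
  then show False using labelled_le_False assms by blast
qed

text \<open>Two common vertices would both have degree 2 within the pair, so unit weights would give
  both edges a label of at most 1/4.\<close>

lemma linear:
  assumes "e \<in> E" "f \<in> E" "e \<noteq> f" "x \<in> e" "x \<in> f" "y \<in> e" "y \<in> f"
  shows "x = y"
proof (rule ccontr)
  assume xy: "x \<noteq> y"
  show False
  proof (rule ones_False[of "{e, f}" undefined])
    fix h assume "h \<in> {e, f}"
    then consider "h = e" | "h = f" by auto
    then show "pot {e, f} (\<lambda>_. 1) h \<le> 1/4"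
    proof cases
      case 1
      show ?thesis unfolding 1 by (rule pot_one_two[of _ _ x f y f]) (use assms xy finite_edge in auto)
    next
      case 2
      show ?thesis unfolding 2 by (rule pot_one_two[of _ _ x e y e]) (use assms xy finite_edge in auto)
    qed
  qed (use assms in auto)
qed

text \<open>Otherwise the three edges form a triangle with three different corners. Each edge
  contains two corners of degree at least 2, and unit weights give labels of at most 1/4.\<close>

lemma helly:
  assumes E: "e \<in> E" "f \<in> E" "g \<in> E" and ne: "e \<noteq> f" "e \<noteq> g" "f \<noteq> g"
    and x: "x \<in> e" "x \<in> f" and y: "y \<in> e" "y \<in> g" and z: "z \<in> f" "z \<in> g"
  shows "x = y"
proof (rule ccontr)
  assume xy: "x \<noteq> y"
  have xz: "x \<noteq> z"
    using linear[of e g x y] E ne x y z xy by auto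
  have yz: "y \<noteq> z"
    using linear[of e f x y] E ne x y z xy by auto
  let ?S = "{e, f, g}"
  have fin: "finite ?S" "\<And>h. h \<in> ?S \<Longrightarrow> finite h" using E finite_edge by auto
  show False
  proof (rule ones_False[of ?S undefined])
    fix h assume "h \<in> ?S"
    moreover have "pot ?S (\<lambda>_. 1) e \<le> 1/4"
      by (rule pot_one_two[OF fin, of _ x f y g]) (use x y ne xy in auto)
    moreover have "pot ?S (\<lambda>_. 1) f \<le> 1/4"
      by (rule pot_one_two[OF fin, of _ x e z g]) (use x z ne xz in auto)
    moreover have "pot ?S (\<lambda>_. 1) g \<le> 1/4"
      by (rule pot_one_two[OF fin, of _ y e z f]) (use y z ne yz in auto)
    ultimately show "pot ?S (\<lambda>_. 1) h \<le> 1/4" by auto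
  qed (use E ne in auto)
qed

lemma star_four_False:
  assumes "\<And>e. e \<in> {e1, e2, e3, e4} \<Longrightarrow> e \<in> E \<and> v \<in> e" "card {e1, e2, e3, e4} = 4"
  shows False
proof (rule labelled_le_False)
  show "labelled_le {e1, e2, e3, e4} (\<lambda>e. 1 / sum (\<lambda>_. 1) {e1, e2, e3, e4})"
    by (rule labelled_le_star[where w = "\<lambda>_. 1" and v = v]) (use assms finite_edge in auto)
qed (use assms in auto)

text \<open>That the two neighbours are disjoint guarantees two different vertices of
  \<open>e\<close> of degree at least 2, hence a label of at most 1/4 for unit weights. Every
  chordless closed chain of at least four edges has this property.\<close>

definition cyclic :: "'a set set \<Rightarrow> bool" where
  "cyclic S \<longleftrightarrow> S \<subseteq> E \<and> S \<noteq> {} \<and>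
     (\<forall>e\<in>S. \<exists>f\<in>S - {e}. \<exists>g\<in>S - {e}. f \<inter> e \<noteq> {} \<and> g \<inter> e \<noteq> {} \<and> f \<inter> g = {})"

text \<open>Labels of at most 1/4 leave no room for edges outside \<open>S\<close>. A third
  neighbour of \<open>e\<close> would add a third vertex of degree 2 (label at most 1/8) or raise
  one of the two degrees to 3 (label at most 1/6), and a strict label is contradictory too.\<close>

lemma cyclic_two_neighbours:
  assumes S: "cyclic S"
  shows "S = E" and "e \<in> E \<Longrightarrow> \<exists>f g. f \<noteq> g \<and> {h \<in> E - {e}. h \<inter> e \<noteq> {}} = {f, g}"
proof -
  have fS: "finite S" "\<And>h. h \<in> S \<Longrightarrow> finite h"
    using S finite_E finite_edge finite_subset[of S E] by (auto simp: cyclic_def)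
  have le: "pot S (\<lambda>_. 1) e \<le> 1/4" if e: "e \<in> S" for e
  proof -
    obtain f g where fg: "f \<in> S - {e}" "g \<in> S - {e}" "f \<inter> e \<noteq> {}" "g \<inter> e \<noteq> {}" "f \<inter> g = {}"
      using S e unfolding cyclic_def by meson
    then obtain x y where "x \<in> f" "x \<in> e" "y \<in> g" "y \<in> e" by auto
    then show ?thesis using fg by (intro pot_one_two[OF fS e, of x f y g]) auto
  qed
  have S0: "S \<subseteq> E" "S \<noteq> {}" using S by (auto simp: cyclic_def)
  show SE: "S = E"
  proof (rule ccontr)
    assume "S \<noteq> E"
    moreover have "labelled_le S (pot S (\<lambda>_. 1))"
      unfolding labelled_le_def weighting_def using fS by (intro exI[of _ "\<lambda>_. 1"]) auto
    ultimately show False using not_super le S0 unfolding supercritical_def by blast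
  qed
  assume e: "e \<in> E"
  obtain f g where fg: "f \<in> S - {e}" "g \<in> S - {e}" "f \<inter> e \<noteq> {}" "g \<inter> e \<noteq> {}" "f \<inter> g = {}"
    using S e SE unfolding cyclic_def by meson
  then obtain x y where xy: "x \<in> f" "x \<in> e" "y \<in> g" "y \<in> e" "x \<noteq> y" by auto
  have "h = f \<or> h = g" if h: "h \<in> E - {e}" "h \<inter> e \<noteq> {}" for h
  proof (rule ccontr)
    assume n: "\<not> (h = f \<or> h = g)"
    obtain z where z: "z \<in> h" "z \<in> e" using h by auto
    have d: "2 \<le> card {k \<in> S. x \<in> k}" "2 \<le> card {k \<in> S. y \<in> k}" "2 \<le> card {k \<in> S. z \<in> k}"
      using card_ge_2I[of "{k \<in> S. x \<in> k}" e f] card_ge_2I[of "{k \<in> S. y \<in> k}" e g]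
        card_ge_2I[of "{k \<in> S. z \<in> k}" e h] fS(1) fg xy z h e SE by auto
    have "pot S (\<lambda>_. 1) e < 1/4"
    proof (cases "z = x \<or> z = y")
      case True
      have "pot S (\<lambda>_. 1) e \<le> (\<Prod>v\<in>{x, y}. 1 / real (if v = z then 3 else 2))"
      proof (rule pot_one_le[OF fS])
        fix v assume v: "v \<in> {x, y}"
        have "3 \<le> card {k \<in> S. v \<in> k}" if "v = z"
        proof (cases "z = x")
          case True
          then show ?thesis using card_ge_3I[of "{k \<in> S. v \<in> k}" e f h] that fS(1) fg xy z h e SE n by auto
        next
          case False
          then have "z = y" using \<open>z = x \<or> z = y\<close> by simp
          then show ?thesis using card_ge_3I[of "{k \<in> S. v \<in> k}" e g h] that fS(1) fg xy z h e SE n by auto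
        qed
        then show "(if v = z then 3 else 2) \<le> card {k \<in> S. v \<in> k} \<and> 0 < (if v = z then 3 else 2 :: nat)"
          using v d by auto
      qed (use e SE xy in auto)
      then show ?thesis using True xy by auto
    next
      case False
      have "pot S (\<lambda>_. 1) e \<le> (\<Prod>v\<in>{x, y, z}. 1 / real 2)"
      proof (rule pot_one_le[OF fS])
        show "2 \<le> card {k \<in> S. v \<in> k} \<and> (0::nat) < 2" if "v \<in> {x, y, z}" for v
          using that d by auto
      qed (use e SE xy z in auto)
      then show ?thesis using False xy by auto
    qed
    then show False using ones_False[of S e] le S0 e SE by blast
  qed
  then have "{h \<in> E - {e}. h \<inter> e \<noteq> {}} = {f, g}" using fg[unfolded SE] by blast
  moreover have "f \<noteq> g" using fg by auto
  ultimately show "\<exists>f g. f \<noteq> g \<and> {h \<in> E - {e}. h \<inter> e \<noteq> {}} = {f, g}" by blast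
qed

text \<open>These are the induced paths of the intersection graph of \<open>E\<close>.\<close>

definition induced :: "'a set list \<Rightarrow> bool" where
  "induced P \<longleftrightarrow> distinct P \<and> set P \<subseteq> E \<and>
     (\<forall>i j. i < j \<longrightarrow> j < length P \<longrightarrow> (P ! i \<inter> P ! j \<noteq> {} \<longleftrightarrow> j = Suc i))"

lemma inducedD:
  assumes "induced P"
  shows "distinct P" "set P \<subseteq> E" "i < length P \<Longrightarrow> P ! i \<in> E"
    "i < length P \<Longrightarrow> j < length P \<Longrightarrow> i \<noteq> j \<Longrightarrow> P ! i \<inter> P ! j \<noteq> {} \<longleftrightarrow> j = Suc i \<or> i = Suc j"
proof -
  show "distinct P" "set P \<subseteq> E" "i < length P \<Longrightarrow> P ! i \<in> E" using assms by (auto simp: induced_def)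
  assume ij: "i < length P" "j < length P" "i \<noteq> j"
  show "P ! i \<inter> P ! j \<noteq> {} \<longleftrightarrow> j = Suc i \<or> i = Suc j"
  proof (cases "i < j")
    case True
    then show ?thesis using assms ij by (auto simp: induced_def)
  next
    case False
    then have "j < i" using ij by auto
    then have "P ! j \<inter> P ! i \<noteq> {} \<longleftrightarrow> i = Suc j" using assms ij unfolding induced_def by blast
    then show ?thesis using \<open>j < i\<close> by (auto simp: Int_commute)
  qed
qed

lemma induced_Cons:
  assumes "induced Q" "g \<in> E" "g \<notin> set Q" "meets Q g \<subseteq> {0}" "Q \<noteq> [] \<Longrightarrow> Q ! 0 \<inter> g \<noteq> {}"
  shows "induced (g # Q)"
  unfolding induced_def
proof (intro conjI allI impI)
  show "distinct (g # Q)" "set (g # Q) \<subseteq> E" using assms by (auto simp: induced_def)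
  fix i j assume ij: "i < j" "j < length (g # Q)"
  then obtain k where k: "j = Suc k" "k < length Q" by (cases j) auto
  show "(g # Q) ! i \<inter> (g # Q) ! j \<noteq> {} \<longleftrightarrow> j = Suc i"
  proof (cases i)
    case 0
    have "Q ! k \<inter> g \<noteq> {} \<longleftrightarrow> k = 0" using assms(4,5) k by (auto simp: meets_def)
    then show ?thesis using 0 k by (auto simp: Int_commute)
  next
    case (Suc l)
    have "Q ! l \<inter> Q ! k \<noteq> {} \<longleftrightarrow> k = Suc l" using assms(1) Suc k ij by (simp add: induced_def)
    then show ?thesis using Suc k by simp
  qed
qed

lemma induced_drop:
  assumes "induced P"
  shows "induced (drop p P)"
  unfolding induced_def
proof (intro conjI allI impI)
  show "distinct (drop p P)" using assms by (simp add: induced_def)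
  show "set (drop p P) \<subseteq> E" using assms set_drop_subset[of p P] by (auto simp: induced_def)
  fix i j assume ij: "i < j" "j < length (drop p P)"
  then show "drop p P ! i \<inter> drop p P ! j \<noteq> {} \<longleftrightarrow> j = Suc i"
    using assms unfolding induced_def by (auto simp: add.commute)
qed

lemma induced_rev:
  assumes "induced P"
  shows "induced (rev P)"
  unfolding induced_def
proof (intro conjI allI impI)
  show "distinct (rev P)" "set (rev P) \<subseteq> E" using assms by (auto simp: induced_def)
  fix i j assume ij: "i < j" "j < length (rev P)"
  have "P ! (length P - Suc i) \<inter> P ! (length P - Suc j) \<noteq> {} \<longleftrightarrow> j = Suc i"
    using inducedD(4)[OF assms, of "length P - Suc i" "length P - Suc j"] ij by auto
  then show "rev P ! i \<inter> rev P ! j \<noteq> {} \<longleftrightarrow> j = Suc i"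
    using ij by (simp add: rev_nth)
qed

lemma meets_rev: "meets (rev P) g = (\<lambda>i. length P - Suc i) ` meets P g"
proof (intro set_eqI iffI)
  fix i assume "i \<in> meets (rev P) g"
  then have "i < length P" "length P - Suc i \<in> meets P g" by (auto simp: meets_def rev_nth)
  then show "i \<in> (\<lambda>i. length P - Suc i) ` meets P g"
    by (intro image_eqI[of _ _ "length P - Suc i"]) auto
qed (auto simp: meets_def rev_nth)

lemma consecutive_induced:
  assumes "induced P" "p < length P"
  shows "consecutive (P ! p) (take m (drop (Suc p) P))"
  using assms(2)
proof (induction m arbitrary: p)
  case (Suc m)
  show ?case
  proof (cases "Suc p < length P")
    case True
    then have "drop (Suc p) P = P ! Suc p # drop (Suc (Suc p)) P" by (simp add: Cons_nth_drop_Suc)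
    moreover have "P ! p \<inter> P ! Suc p \<noteq> {}" using inducedD(4)[OF assms(1), of p "Suc p"] True by simp
    ultimately show ?thesis using Suc.IH[OF True] by simp
  qed simp
qed simp

end

section \<open>How an outside edge meets an induced path when there is no cycle\<close>

locale acyclic_family = not_supercritical +
  assumes not_cyclic: "\<not> cyclic S"
begin

text \<open>Induction on the gap. If \<open>g\<close> also meets an edge in between, the gap is 2,
  and the Helly property puts both consecutive intersections at one vertex, although the outer edges
  are disjoint. If not, \<open>g\<close> closes the segment to a cyclic family.\<close>

lemma meets_bounded:
  assumes P: "induced P" and g: "g \<in> E" "g \<notin> set P" and ij: "i \<in> meets P g" "j \<in> meets P g" "i < j"
  shows "j = Suc i"
  using ij
proof (induction "j - i" arbitrary: i j rule: less_induct)
  case less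
  note D = inducedD[OF P]
  have l: "i < length P" "j < length P" and mi: "P ! i \<inter> g \<noteq> {}" "P ! j \<inter> g \<noteq> {}"
    using less.prems by (auto simp: meets_def)
  show ?case
  proof (rule ccontr)
    assume n: "j \<noteq> Suc i"
    show False
    proof (cases "\<exists>k. i < k \<and> k < j \<and> k \<in> meets P g")
      case True
      then obtain k where k: "i < k" "k < j" "k \<in> meets P g" by auto
      have ks: "k = Suc i" using less.hyps[of k i] k less.prems by auto
      moreover have js: "j = Suc k" using less.hyps[of j k] k less.prems by auto
      ultimately have "P ! i \<inter> P ! k \<noteq> {}" "P ! k \<inter> P ! j \<noteq> {}" "P ! i \<inter> P ! j = {}"
        using D(4)[of i k] D(4)[of k j] D(4)[of i j] l k by auto
      then obtain x y where x: "x \<in> P ! i" "x \<in> P ! k" and y: "y \<in> P ! k" "y \<in> P ! j" by auto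
      obtain x' y' z' where z: "x' \<in> P ! i" "x' \<in> g" "y' \<in> P ! j" "y' \<in> g" "z' \<in> P ! k" "z' \<in> g"
        using mi k(3) by (auto simp: meets_def)
      have ne: "P ! i \<noteq> P ! k" "P ! k \<noteq> P ! j" "P ! i \<noteq> g" "P ! k \<noteq> g" "P ! j \<noteq> g"
        using D(1) l k g by (auto simp: nth_eq_iff_index_eq)
      have inE: "P ! i \<in> E" "P ! k \<in> E" "P ! j \<in> E" using D(3) l k by auto
      have "x = z'" using helly[of "P ! k" "P ! i" g x z' x'] inE g ne x z by auto
      moreover have "y = z'" using helly[of "P ! k" "P ! j" g y z' y'] inE g ne y z by auto
      ultimately show False using x y \<open>P ! i \<inter> P ! j = {}\<close> by auto
    next
      case False
      let ?S = "insert g ((!) P ` {i..j})"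
      have j2: "Suc (Suc i) \<le> j" using n less.prems by auto
      have inS: "P ! t \<in> ?S" if "i \<le> t" "t \<le> j" for t using that by auto
      have neg: "P ! t \<noteq> g" if "t \<le> j" for t using that l g by auto
      have adj: "P ! t \<inter> P ! Suc t \<noteq> {}" if "Suc t \<le> j" for t using D(4)[of t "Suc t"] that l by auto
      have neq: "P ! s \<noteq> P ! t" if "s \<noteq> t" "s \<le> j" "t \<le> j" for s t
        using that D(1) l by (auto simp: nth_eq_iff_index_eq)
      have non: "P ! t \<inter> g = {}" if "i < t" "t < j" for t using False that l by (auto simp: meets_def)
      have far: "P ! s \<inter> P ! t = {}" if "Suc s < t" "t \<le> j" for s t using D(4)[of s t] that l by auto
      \<comment> \<open>The two neighbours are the ends of the segment for \<open>g\<close>, the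
        inner neighbour and \<open>g\<close> for an end, and predecessor and successor otherwise.
        Because \<open>j\<close> is at least \<open>i + 2\<close>, they are disjoint in each
        case.\<close>
      have "cyclic ?S" unfolding cyclic_def
      proof (intro conjI ballI)
        show "?S \<subseteq> E" using g D(3) l by auto
        show "?S \<noteq> {}" by auto
        fix e assume "e \<in> ?S"
        then consider "e = g" | t where "e = P ! t" "i \<le> t" "t \<le> j" by auto
        then show "\<exists>f\<in>?S - {e}. \<exists>h\<in>?S - {e}. f \<inter> e \<noteq> {} \<and> h \<inter> e \<noteq> {} \<and> f \<inter> h = {}"
        proof cases
          case 1
          then show ?thesis using mi far[of i j] j2 neg[of i] neg[of j] less.prems
            by (intro bexI[of _ "P ! i"] bexI[of _ "P ! j"]) auto
        next
          case 2
          consider "t = i" | "t = j" | "i < t" "t < j" using 2 by linarith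
          then show ?thesis
          proof cases
            case a: 1
            then show ?thesis using 2 j2 adj[of i] mi non[of "Suc i"] neq[of i "Suc i"] neg[of i] inS[of "Suc i"]
              by (intro bexI[of _ "P ! Suc i"] bexI[of _ g]) (auto simp: Int_commute)
          next
            case b: 2
            then obtain k where k: "j = Suc k" using j2 by (cases j) auto
            then show ?thesis using 2 b j2 adj[of k] mi non[of k] neq[of k j] neg[of j] inS[of k]
              by (intro bexI[of _ "P ! k"] bexI[of _ g]) (auto simp: Int_commute)
          next
            case c: 3
            then obtain k where k: "t = Suc k" by (cases t) auto
            have "P ! k \<inter> P ! t \<noteq> {}" "P ! Suc t \<inter> P ! t \<noteq> {}" "P ! k \<inter> P ! Suc t = {}"
              using adj[of k] adj[of t] far[of k "Suc t"] k c by (auto simp: Int_commute)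
            moreover have "P ! k \<in> ?S - {P ! t}" "P ! Suc t \<in> ?S - {P ! t}"
              using inS[of k] inS[of "Suc t"] neq[of k t] neq[of "Suc t" t] k c by auto
            ultimately show ?thesis unfolding 2(1)
              by (intro bexI[of _ "P ! k"] bexI[of _ "P ! Suc t"] conjI)
          qed
        qed
      qed
      then show False using not_cyclic by blast
    qed
  qed
qed

lemma meets_cases:
  assumes P: "induced P" and g: "g \<in> E" "g \<notin> set P" and ne: "meets P g \<noteq> {}"
  obtains p where "meets P g = {p}" "p < length P"
    | p where "meets P g = {p, Suc p}" "Suc p < length P"
proof -
  define i where "i = Min (meets P g)"
  have i: "i \<in> meets P g" "\<And>j. j \<in> meets P g \<Longrightarrow> i \<le> j" using ne by (auto simp: i_def)
  have j: "j = i \<or> j = Suc i" if "j \<in> meets P g" for j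
    using meets_bounded[OF P g i(1) that] i(2)[OF that] by linarith
  have lt: "j < length P" if "j \<in> meets P g" for j using that by (auto simp: meets_def)
  show thesis
  proof (cases "Suc i \<in> meets P g")
    case True
    then have "meets P g = {i, Suc i}" using i(1) j by auto
    then show thesis using that(2) lt[OF True] by blast
  next
    case False
    then have "meets P g = {i}" using i(1) j by blast
    then show thesis using that(1) lt[OF i(1)] by blast
  qed
qed

end

section \<open>Longest induced paths\<close>

locale longest_path = acyclic_family +
  fixes P
  assumes induced_P: "induced P" and P_ne: "P \<noteq> []" and longest: "induced Q \<Longrightarrow> length Q \<le> length P"
begin

lemma rev_longest_path: "longest_path E (rev P)"
  by unfold_locales (use induced_rev[OF induced_P] P_ne longest in auto)

lemma set_P_subset: "set P \<subseteq> E" using inducedD(2)[OF induced_P] .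

text \<open>Cutting the path just before the last edge that meets \<open>g\<close> keeps it induced
  when \<open>g\<close> is put in front. Maximality then says that at least as many edges were cut
  off as were added; this gives the bounds 1, 2, 3 below for one, two or three added edges.\<close>

lemma drop_index:
  assumes "g \<in> E - set P" "p \<in> meets P g" "\<And>i. i \<in> meets P g \<Longrightarrow> i \<le> p"
  shows "induced (g # drop p P)"
proof (rule induced_Cons[OF induced_drop[OF induced_P]])
  show "meets (drop p P) g \<subseteq> {0}"
  proof
    fix i assume "i \<in> meets (drop p P) g"
    then have "p + i \<in> meets P g" by (auto simp: meets_def)
    then show "i \<in> {0}" using assms(3)[of "p + i"] by simp
  qed
  show "drop p P ! 0 \<inter> g \<noteq> {}" using assms(2) by (auto simp: meets_def)
qed (use assms set_drop_subset[of p P] in auto)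

lemma greatest_index:
  assumes "meets P g \<noteq> {}"
  obtains p where "p \<in> meets P g" "\<And>i. i \<in> meets P g \<Longrightarrow> i \<le> p" "p < length P"
proof (rule that[of "Max (meets P g)"])
  show "Max (meets P g) \<in> meets P g" using assms by (intro Max_in) auto
  then show "Max (meets P g) < length P" by (simp add: meets_def)
qed simp

lemma index1:
  assumes "g \<in> E - set P" "meets P g \<noteq> {}"
  shows "\<exists>p\<in>meets P g. 1 \<le> p"
proof -
  obtain p where p: "p \<in> meets P g" "\<And>i. i \<in> meets P g \<Longrightarrow> i \<le> p" "p < length P"
    using greatest_index[OF assms(2)] by blast
  have "length (g # drop p P) \<le> length P" using longest[OF drop_index[OF assms(1) p(1,2)]] .
  then have "1 \<le> p" using p by simp
  then show ?thesis using p by blast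
qed

lemma drop_index2:
  assumes "g \<in> E - set P" "p \<in> meets P g" "\<And>i. i \<in> meets P g \<Longrightarrow> i \<le> p"
    "h \<in> E - set P" "meets P h = {}" "h \<noteq> g" "h \<inter> g \<noteq> {}"
  shows "induced (h # g # drop p P)"
proof (rule induced_Cons[OF drop_index[OF assms(1-3)]])
  show "meets (g # drop p P) h \<subseteq> {0}"
  proof
    fix i assume i: "i \<in> meets (g # drop p P) h"
    show "i \<in> {0}"
    proof (cases i)
      case (Suc j)
      then have "p + j \<in> meets P h" using i by (auto simp: meets_def)
      then show ?thesis using assms(5) by simp
    qed simp
  qed
qed (use assms set_drop_subset[of p P] in auto)

lemma index2:
  assumes "g \<in> E - set P" "meets P g \<noteq> {}" "h \<in> E - set P" "meets P h = {}" "h \<noteq> g" "h \<inter> g \<noteq> {}"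
  shows "\<exists>p\<in>meets P g. 2 \<le> p"
proof -
  obtain p where p: "p \<in> meets P g" "\<And>i. i \<in> meets P g \<Longrightarrow> i \<le> p" "p < length P"
    using greatest_index[OF assms(2)] by blast
  have "length (h # g # drop p P) \<le> length P"
    using longest[OF drop_index2[OF assms(1) p(1,2) assms(3-6)]] .
  then have "2 \<le> p" using p by simp
  then show ?thesis using p by blast
qed

lemma index3:
  assumes "g \<in> E - set P" "meets P g \<noteq> {}" "h \<in> E - set P" "meets P h = {}" "h \<noteq> g" "h \<inter> g \<noteq> {}"
    "k \<in> E - set P" "meets P k = {}" "k \<noteq> g" "k \<noteq> h" "k \<inter> h \<noteq> {}" "k \<inter> g = {}"
  shows "\<exists>p\<in>meets P g. 3 \<le> p"
proof -
  obtain p where p: "p \<in> meets P g" "\<And>i. i \<in> meets P g \<Longrightarrow> i \<le> p" "p < length P"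
    using greatest_index[OF assms(2)] by blast
  have "induced (k # h # g # drop p P)"
  proof (rule induced_Cons[OF drop_index2[OF assms(1) p(1,2) assms(3-6)]])
    show "meets (h # g # drop p P) k \<subseteq> {0}"
    proof
      fix i assume i: "i \<in> meets (h # g # drop p P) k"
      consider "i = 0" | "i = 1" | j where "i = Suc (Suc j)" by (metis One_nat_def nat.exhaust)
      then show "i \<in> {0}"
      proof cases
        case 2
        then have "g \<inter> k \<noteq> {}" using i by (auto simp: meets_def)
        then show ?thesis using assms(12) by auto
      next
        case 3
        then have "p + j \<in> meets P k" using i by (auto simp: meets_def)
        then show ?thesis using assms(8) by simp
      qed simp
    qed
  qed (use assms set_drop_subset[of p P] in auto)
  then have "length (k # h # g # drop p P) \<le> length P" by (rule longest)
  then have "3 \<le> p" using p by simp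
  then show ?thesis using p by blast
qed

text \<open>The reversed path is again longest, so each bound from the left end yields one from the
  right end.\<close>

lemma mirror_index:
  assumes "\<exists>p\<in>meets (rev P) g. m \<le> p"
  shows "\<exists>p\<in>meets P g. p + m < length P"
proof -
  obtain p where p: "p \<in> meets P g" "m \<le> length P - Suc p" using assms unfolding meets_rev by blast
  have "p < length P" using p(1) by (simp add: meets_def)
  then show ?thesis using p by (intro bexI[of _ p]) auto
qed

lemma meets_rev_empty: "meets (rev P) g = {} \<longleftrightarrow> meets P g = {}"
  unfolding meets_rev by simp

lemma index1':
  assumes "g \<in> E - set P" "meets P g \<noteq> {}"
  shows "\<exists>p\<in>meets P g. p + 1 < length P"
proof (rule mirror_index)
  interpret R: longest_path E "rev P" by (rule rev_longest_path)
  show "\<exists>p\<in>meets (rev P) g. 1 \<le> p" by (rule R.index1) (use assms meets_rev_empty in auto)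
qed

lemma index2':
  assumes "g \<in> E - set P" "meets P g \<noteq> {}" "h \<in> E - set P" "meets P h = {}" "h \<noteq> g" "h \<inter> g \<noteq> {}"
  shows "\<exists>p\<in>meets P g. p + 2 < length P"
proof (rule mirror_index)
  interpret R: longest_path E "rev P" by (rule rev_longest_path)
  show "\<exists>p\<in>meets (rev P) g. 2 \<le> p" by (rule R.index2[of _ h]) (use assms meets_rev_empty in auto)
qed

lemma index3':
  assumes "g \<in> E - set P" "meets P g \<noteq> {}" "h \<in> E - set P" "meets P h = {}" "h \<noteq> g" "h \<inter> g \<noteq> {}"
    "k \<in> E - set P" "meets P k = {}" "k \<noteq> g" "k \<noteq> h" "k \<inter> h \<noteq> {}" "k \<inter> g = {}"
  shows "\<exists>p\<in>meets P g. p + 3 < length P"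
proof (rule mirror_index)
  interpret R: longest_path E "rev P" by (rule rev_longest_path)
  show "\<exists>p\<in>meets (rev P) g. 3 \<le> p" by (rule R.index3[of _ h k]) (use assms meets_rev_empty in auto)
qed

section \<open>Certificates: labelled patterns around one edge of the path\<close>

lemma nth_image_subset: "K \<subseteq> {..<length P} \<Longrightarrow> (!) P ` K \<subseteq> E"
  using inducedD(3)[OF induced_P] by auto

text \<open>Path edges are recorded by their indices, so that the disjointness required for hanging
  becomes a statement about intervals of natural numbers; \<open>Q\<close> collects the edges off
  the path.\<close>

definition cert :: "nat \<Rightarrow> real \<Rightarrow> nat set \<Rightarrow> 'a set set \<Rightarrow> bool" where
  "cert p c I Q \<longleftrightarrow> p < length P \<and> p \<in> I \<and> I \<subseteq> {..<length P} \<and> Q \<subseteq> E - set P \<and>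
     rooted_le ((!) P ` I \<union> Q) (P ! p) c"

lemma cert_init: "p < length P \<Longrightarrow> cert p 1 {p} {}"
  using rooted_le_single[of "P ! p"] finite_edge inducedD(3)[OF induced_P]
  by (auto simp: cert_def)

lemma nth_image_disjoint:
  assumes "I \<subseteq> {..<length P}" "K \<subseteq> {..<length P}" "I \<inter> K = {}" "Q \<subseteq> E - set P" "R \<subseteq> E - set P" "R \<inter> Q = {}"
  shows "((!) P ` K \<union> R) \<inter> ((!) P ` I \<union> Q) = {}"
proof -
  have "(!) P ` K \<inter> (!) P ` I = (!) P ` (K \<inter> I)"
    using assms inj_on_nth[OF inducedD(1)[OF induced_P], of "{..<length P}"]
    by (intro inj_on_image_Int[of _ "{..<length P}", symmetric]) auto
  then have D: "(!) P ` K \<inter> (!) P ` I = {}" using assms(3) by (simp add: Int_commute)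
  have "(!) P ` K \<subseteq> set P" "(!) P ` I \<subseteq> set P" using assms(1,2) by auto
  then have "(!) P ` K \<inter> Q = {}" "R \<inter> (!) P ` I = {}" using assms(4,5) by blast+
  then show ?thesis using D assms(6) by (simp add: Int_Un_distrib Int_Un_distrib2)
qed

lemma cert_leg:
  assumes c: "cert p c I Q" and gs: "consecutive (P ! p) gs" "distinct gs" "set gs = (!) P ` K \<union> R" "length gs = m"
    and K: "K \<subseteq> {..<length P}" "I \<inter> K = {}" and R: "R \<subseteq> E - set P" "R \<inter> Q = {}"
  shows "cert p (c * ((real m + 2) / (2 * (real m + 1)))) (I \<union> K) (Q \<union> R)"
proof -
  have D: "((!) P ` K \<union> R) \<inter> ((!) P ` I \<union> Q) = {}"
    using c K R by (intro nth_image_disjoint) (auto simp: cert_def)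
  have "rooted_le (((!) P ` I \<union> Q) \<union> set gs) (P ! p) (c * ((length gs + 2) / (2 * (length gs + 1))))"
  proof (rule rooted_le_leg[OF _ gs(1,2)])
    show "rooted_le ((!) P ` I \<union> Q) (P ! p) c" using c by (simp add: cert_def)
    show "set gs \<inter> ((!) P ` I \<union> Q) = {}" using D gs(3) by simp
    show "finite g" if "g \<in> set gs" for g
      using that gs(3) nth_image_subset[OF K(1)] R finite_edge by auto
  qed
  moreover have "((!) P ` I \<union> Q) \<union> set gs = (!) P ` (I \<union> K) \<union> (Q \<union> R)" unfolding gs(3) by blast
  ultimately show ?thesis using c K R gs(4) by (simp add: cert_def add_ac)
qed

lemma cert_fork:
  assumes c: "cert p c I Q" and gs: "consecutive (P ! p) gs" "distinct (h1 # h2 # gs)"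
      "set gs \<union> {h1, h2} = (!) P ` K \<union> R"
      "last (P ! p # gs) \<inter> h1 \<noteq> {}" "last (P ! p # gs) \<inter> h2 \<noteq> {}"
    and K: "K \<subseteq> {..<length P}" "I \<inter> K = {}" and R: "R \<subseteq> E - set P" "R \<inter> Q = {}"
  shows "cert p (c * (if gs = [] then 9/16 else 5/9)) (I \<union> K) (Q \<union> R)"
proof -
  have D: "((!) P ` K \<union> R) \<inter> ((!) P ` I \<union> Q) = {}"
    using c K R by (intro nth_image_disjoint) (auto simp: cert_def)
  have "rooted_le (((!) P ` I \<union> Q) \<union> set gs \<union> {h1, h2}) (P ! p) (c * (if gs = [] then 9/16 else 5/9))"
  proof (rule rooted_le_fork[OF _ gs(1,2) _ gs(4,5)])
    show "rooted_le ((!) P ` I \<union> Q) (P ! p) c" using c by (simp add: cert_def)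
    show "(set gs \<union> {h1, h2}) \<inter> ((!) P ` I \<union> Q) = {}" using D gs(3) by simp
    show "finite g" if "g \<in> set gs \<union> {h1, h2}" for g
      using that unfolding gs(3) using nth_image_subset[OF K(1)] R finite_edge by auto
  qed
  moreover have "((!) P ` I \<union> Q) \<union> set gs \<union> {h1, h2} = (!) P ` (I \<union> K) \<union> (Q \<union> R)" using gs(3) by blast
  ultimately show ?thesis using c K R by (simp add: cert_def)
qed

lemma right_list:
  assumes "p + m < length P"
  shows "consecutive (P ! p) (take m (drop (Suc p) P))" "distinct (take m (drop (Suc p) P))"
    "set (take m (drop (Suc p) P)) = (!) P ` {p<..p + m}" "length (take m (drop (Suc p) P)) = m"
    "last (P ! p # take m (drop (Suc p) P)) = P ! (p + m)"
proof -
  let ?L = "take m (drop (Suc p) P)"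
  show "consecutive (P ! p) ?L" by (rule consecutive_induced[OF induced_P]) (use assms in auto)
  show "distinct ?L" using inducedD(1)[OF induced_P] by simp
  show len: "length ?L = m" using assms by simp
  show "set ?L = (!) P ` {p<..p + m}"
  proof (intro set_eqI iffI)
    fix x assume "x \<in> set ?L"
    then obtain i where i: "i < m" "x = ?L ! i" using len by (metis in_set_conv_nth)
    then show "x \<in> (!) P ` {p<..p + m}" using assms by (intro image_eqI[of _ _ "Suc p + i"]) auto
  next
    fix x assume "x \<in> (!) P ` {p<..p + m}"
    then obtain i where i: "p < i" "i \<le> p + m" "x = P ! i" by auto
    then have "?L ! (i - Suc p) = x" using assms by auto
    moreover have "i - Suc p < length ?L" using i len by linarith
    ultimately show "x \<in> set ?L" by (metis nth_mem)
  qed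
  show "last (P ! p # ?L) = P ! (p + m)"
  proof (cases m)
    case (Suc k)
    have ne: "?L \<noteq> []" using len Suc by (metis Zero_not_Suc list.size(3))
    have "last ?L = ?L ! k" using last_conv_nth[OF ne] len Suc by simp
    also have "\<dots> = P ! (Suc p + k)" using assms Suc by simp
    finally show ?thesis using Suc ne by simp
  qed simp
qed

lemma left_list:
  assumes "m \<le> p" "p < length P"
  shows "\<exists>L. consecutive (P ! p) L \<and> distinct L \<and> set L = (!) P ` {p - m..<p} \<and> length L = m \<and>
    last (P ! p # L) = P ! (p - m)"
proof -
  interpret R: longest_path E "rev P" by (rule rev_longest_path)
  let ?q = "length P - Suc p"
  have q: "?q + m < length (rev P)" using assms by auto
  have a: "rev P ! ?q = P ! p" "rev P ! (?q + m) = P ! (p - m)" using assms by (auto simp: rev_nth)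
  have "(!) (rev P) ` {?q<..?q + m} = (\<lambda>i. P ! (length P - Suc i)) ` {?q<..?q + m}"
    using assms by (intro image_cong) (auto simp: rev_nth)
  also have "\<dots> = (!) P ` ((\<lambda>i. length P - Suc i) ` {?q<..?q + m})" by (simp add: image_image)
  also have "(\<lambda>i. length P - Suc i) ` {?q<..?q + m} = {p - m..<p}"
  proof (intro set_eqI iffI)
    fix i assume "i \<in> {p - m..<p}"
    then show "i \<in> (\<lambda>i. length P - Suc i) ` {?q<..?q + m}"
      using assms by (intro image_eqI[of _ _ "length P - Suc i"]) auto
  qed (use assms in auto)
  finally have I: "(!) (rev P) ` {?q<..?q + m} = (!) P ` {p - m..<p}" .
  show ?thesis using R.right_list[OF q] unfolding a I by blast
qed

lemma cert_right:
  assumes "cert p c I Q" "p + m < length P" "I \<inter> {p<..p + m} = {}"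
  shows "cert p (c * ((real m + 2) / (2 * (real m + 1)))) (I \<union> {p<..p + m}) Q"
proof -
  have "{p<..p + m} \<subseteq> {..<length P}" using assms(2) by auto
  then show ?thesis
    using cert_leg[OF assms(1) right_list(1,2)[OF assms(2)], of "{p<..p + m}" "{}" m] assms(3) right_list(3,4)[OF assms(2)]
    by simp
qed

lemma cert_left:
  assumes "cert p c I Q" "m \<le> p" "I \<inter> {p - m..<p} = {}"
  shows "cert p (c * ((real m + 2) / (2 * (real m + 1)))) (I \<union> {p - m..<p}) Q"
proof -
  have p: "p < length P" using assms(1) by (simp add: cert_def)
  obtain L where L: "consecutive (P ! p) L" "distinct L" "set L = (!) P ` {p - m..<p}" "length L = m"
    using left_list[OF assms(2) p] by blast
  have "{p - m..<p} \<subseteq> {..<length P}" using p by auto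
  then show ?thesis using cert_leg[OF assms(1) L(1,2), of "{p - m..<p}" "{}" m] assms(3) L by simp
qed

lemma cert_off:
  assumes "cert p c I Q" "consecutive (P ! p) gs" "distinct gs" "set gs \<subseteq> E - set P" "set gs \<inter> Q = {}"
  shows "cert p (c * ((real (length gs) + 2) / (2 * (real (length gs) + 1)))) I (Q \<union> set gs)"
proof -
  have "cert p (c * ((real (length gs) + 2) / (2 * (real (length gs) + 1)))) (I \<union> {}) (Q \<union> set gs)"
    by (rule cert_leg[OF assms(1-3)]) (use assms(4,5) in simp_all)
  then show ?thesis by simp
qed

text \<open>The factor 3/4 here and 2/3 in \<open>cert_hang2\<close> are the leg factors for one and
  two edges.\<close>

lemma cert_hang:
  assumes "cert p c I Q" "p \<in> meets P g" "g \<in> E - set P" "g \<notin> Q"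
  shows "cert p (c * (3/4)) I (insert g Q)"
proof -
  have "cert p (c * ((real (length [g]) + 2) / (2 * (real (length [g]) + 1)))) I (Q \<union> set [g])"
    by (rule cert_off[OF assms(1)]) (use assms(2-4) in \<open>simp_all add: meets_def\<close>)
  then show ?thesis by simp
qed

lemma cert_hang2:
  assumes "cert p c I Q" "p \<in> meets P g" "g \<in> E - set P" "g \<notin> Q" "h \<in> E - set P" "h \<notin> Q" "h \<noteq> g" "h \<inter> g \<noteq> {}"
  shows "cert p (c * (2/3)) I (insert g (insert h Q))"
proof -
  have "cert p (c * ((real (length [g, h]) + 2) / (2 * (real (length [g, h]) + 1)))) I (Q \<union> set [g, h])"
    by (rule cert_off[OF assms(1)]) (use assms(2-8) in \<open>simp_all add: meets_def Int_commute\<close>)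
  moreover have "Q \<union> set [g, h] = insert g (insert h Q)" by auto
  ultimately show ?thesis by simp
qed

text \<open>One tine of the fork is the next path edge, the other is \<open>h\<close>. For
  \<open>q = p\<close> both hang directly on the root, with factor 9/16; otherwise the path edges in
  between form the shaft, and 5/9 holds for every length of the shaft.\<close>

lemma cert_fork_right:
  assumes c: "cert p c I Q" and q: "p \<le> q" "Suc q < length P" "I \<inter> {p<..Suc q} = {}"
    and h: "h \<in> E - set P" "h \<notin> Q" "q \<in> meets P h"
  shows "cert p (c * (if q = p then 9/16 else 5/9)) (I \<union> {p<..Suc q}) (insert h Q)"
proof -
  define m where "m = q - p"
  have m: "p + m < length P" "p + m = q" using q(1,2) by (auto simp: m_def)
  let ?L = "take m (drop (Suc p) P)"
  note L = right_list[OF m(1)]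
  have D: "distinct P" using inducedD(1)[OF induced_P] .
  have "P ! Suc q \<notin> set ?L" unfolding L(3) using D q(1,2) m by (auto simp: nth_eq_iff_index_eq)
  moreover have "h \<noteq> P ! Suc q" "h \<notin> set ?L" unfolding L(3) using h(1) q(1,2) m by auto
  ultimately have d: "distinct (P ! Suc q # h # ?L)" using L(2) by auto
  have "{p<..Suc q} = insert (Suc q) {p<..p + m}" using m q(1,2) by auto
  then have s: "set ?L \<union> {P ! Suc q, h} = (!) P ` {p<..Suc q} \<union> {h}" using L(3) by auto
  have e: "?L = [] \<longleftrightarrow> q = p" unfolding length_0_conv[symmetric] L(4) using m by linarith
  have "P ! q \<inter> P ! Suc q \<noteq> {}" using inducedD(4)[OF induced_P, of q "Suc q"] q(1,2) by auto
  then have a: "last (P ! p # ?L) \<inter> P ! Suc q \<noteq> {}" "last (P ! p # ?L) \<inter> h \<noteq> {}"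
    using L(5) m h(3) by (auto simp: meets_def)
  have K: "{p<..Suc q} \<subseteq> {..<length P}" using q(1,2) by auto
  have "cert p (c * (if ?L = [] then 9/16 else 5/9)) (I \<union> {p<..Suc q}) (Q \<union> {h})"
    by (rule cert_fork[OF c L(1) d s a K q(3)]) (use h in auto)
  then show ?thesis unfolding e by simp
qed

lemma cert_fork_left:
  assumes c: "cert p c I Q" and q: "q \<le> p" "1 \<le> q" "I \<inter> {q - 1..<p} = {}"
    and h: "h \<in> E - set P" "h \<notin> Q" "q \<in> meets P h"
  shows "cert p (c * (if q = p then 9/16 else 5/9)) (I \<union> {q - 1..<p}) (insert h Q)"
proof -
  have p: "p < length P" using c unfolding cert_def by blast
  define m where "m = p - q"
  have m: "m \<le> p" "p - m = q" using q(1,2) by (auto simp: m_def)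
  obtain L where L: "consecutive (P ! p) L" "distinct L" "set L = (!) P ` {q..<p}" "length L = m" "last (P ! p # L) = P ! q"
    using left_list[OF m(1) p] unfolding m(2) by blast
  have D: "distinct P" using inducedD(1)[OF induced_P] .
  have "P ! (q - 1) \<notin> set L" unfolding L(3) using D q(1,2) m p by (auto simp: nth_eq_iff_index_eq)
  moreover have "h \<noteq> P ! (q - 1)" "h \<notin> set L" unfolding L(3) using h(1) q(1,2) m p by auto
  ultimately have d: "distinct (P ! (q - 1) # h # L)" using L(2) by auto
  have "{q - 1..<p} = insert (q - 1) {q..<p}" using m q(1,2) by auto
  then have s: "set L \<union> {P ! (q - 1), h} = (!) P ` {q - 1..<p} \<union> {h}" using L(3) by auto
  have e: "L = [] \<longleftrightarrow> q = p" unfolding length_0_conv[symmetric] L(4) using m q(1,2) by linarith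
  have "P ! q \<inter> P ! (q - 1) \<noteq> {}" using inducedD(4)[OF induced_P, of q "q - 1"] q(1,2) p by auto
  then have a: "last (P ! p # L) \<inter> P ! (q - 1) \<noteq> {}" "last (P ! p # L) \<inter> h \<noteq> {}"
    using L(5) m h(3) by (auto simp: meets_def)
  have K: "{q - 1..<p} \<subseteq> {..<length P}" using p by auto
  have "cert p (c * (if L = [] then 9/16 else 5/9)) (I \<union> {q - 1..<p}) (Q \<union> {h})"
    by (rule cert_fork[OF c L(1) d s a K q(3)]) (use h in auto)
  then show ?thesis unfolding e by simp
qed

lemma cert_False:
  assumes c: "cert p c I Q" "c \<le> 1/4" "card I + card Q < 20 \<or> c < 1/4"
  shows False
proof (rule rooted_le_False)
  show "rooted_le ((!) P ` I \<union> Q) (P ! p) c" using c by (simp add: cert_def)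
  show "(!) P ` I \<union> Q \<subseteq> E" using c nth_image_subset[of I] by (auto simp: cert_def)
  have "finite I" using c finite_subset[of I "{..<length P}"] by (auto simp: cert_def)
  then have "card ((!) P ` I \<union> Q) \<le> card I + card Q"
    by (meson add_mono_thms_linordered_semiring(3) card_Un_le card_image_le order_trans)
  then show "card ((!) P ` I \<union> Q) < 20 \<or> c < 1/4" using c(3) by linarith
qed (use c in auto)

end

section \<open>At most two edges lie off a longest induced path\<close>

context longest_path
begin

lemma nth_ne_off: "i < length P \<Longrightarrow> g \<in> E - set P \<Longrightarrow> P ! i \<noteq> g"
  by auto

lemma common_vertex:
  assumes "g \<in> E - set P" "p \<in> meets P g" "Suc p \<in> meets P g"
  obtains v where "v \<in> P ! p" "v \<in> P ! Suc p" "v \<in> g"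
proof -
  have l: "p < length P" "Suc p < length P" using assms by (auto simp: meets_def)
  have "P ! p \<inter> P ! Suc p \<noteq> {}" using inducedD(4)[OF induced_P l] by simp
  then obtain x where x: "x \<in> P ! p" "x \<in> P ! Suc p" by blast
  obtain y z where y: "y \<in> P ! p" "y \<in> g" and z: "z \<in> P ! Suc p" "z \<in> g"
    using assms(2,3) by (auto simp: meets_def)
  have "P ! p \<noteq> P ! Suc p" using inducedD(1)[OF induced_P] l by (simp add: nth_eq_iff_index_eq)
  moreover have "P ! p \<noteq> g" "P ! Suc p \<noteq> g" using nth_ne_off l assms(1) by blast+
  moreover have "P ! p \<in> E" "P ! Suc p \<in> E" "g \<in> E" using inducedD(3)[OF induced_P] l assms(1) by auto
  ultimately have "x = y" using helly[of "P ! p" "P ! Suc p" g x y z] x y z by blast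
  then show thesis using that x y by blast
qed

text \<open>The weights stay free: equal ones serve when each of the three edges carries one more
  edge, unequal ones when different loads hang on them.\<close>

lemma star_three_labelled:
  assumes "g \<in> E - set P" "p \<in> meets P g" "Suc p \<in> meets P g" "0 < a" "0 < b" "0 < (c::real)"
  shows "labelled_le {P ! p, P ! Suc p, g}
     (\<lambda>e. (if e = P ! p then a else if e = P ! Suc p then b else c) / (a + b + c))"
proof -
  obtain v where v: "v \<in> P ! p" "v \<in> P ! Suc p" "v \<in> g" using common_vertex[OF assms(1-3)] .
  have l: "p < length P" "Suc p < length P" using assms by (auto simp: meets_def)
  have d: "P ! p \<noteq> P ! Suc p" "P ! p \<noteq> g" "P ! Suc p \<noteq> g"
    using inducedD(1)[OF induced_P] l nth_ne_off[OF l(1) assms(1)] nth_ne_off[OF l(2) assms(1)]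
    by (simp_all add: nth_eq_iff_index_eq)
  let ?w = "\<lambda>e. if e = P ! p then a else if e = P ! Suc p then b else c"
  have "labelled_le {P ! p, P ! Suc p, g} (\<lambda>e. ?w e / sum ?w {P ! p, P ! Suc p, g})"
  proof (rule labelled_le_star)
    fix e assume "e \<in> {P ! p, P ! Suc p, g}"
    then show "finite e \<and> v \<in> e \<and> 0 < ?w e"
      using v finite_edge inducedD(3)[OF induced_P] l assms by auto
  qed auto
  moreover have "sum ?w {P ! p, P ! Suc p, g} = a + b + c" using d by auto
  ultimately show ?thesis by simp
qed

text \<open>The three edges at the common vertex start with the label 1/3, and one further edge is
  hung on each of them: 1/3 times 3/4 is 1/4, which is also the label of the new edges.\<close>

lemma double_index_second_level_False:
  assumes g: "g \<in> E - set P" "p \<in> meets P g" "Suc p \<in> meets P g" and p: "1 \<le> p" "Suc (Suc p) < length P"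
    and h: "h \<in> E - set P" "h \<noteq> g" "h \<inter> g \<noteq> {}"
  shows False
proof -
  let ?a = "P ! p" and ?b = "P ! Suc p" and ?c = "P ! (p - 1)" and ?d = "P ! Suc (Suc p)"
  have idx: "p - 1 < length P" "p < length P" "Suc p < length P" using p by auto
  note D = inducedD[OF induced_P]
  have ne: "?a \<noteq> ?b" "?a \<noteq> ?c" "?a \<noteq> ?d" "?b \<noteq> ?c" "?b \<noteq> ?d" "?c \<noteq> ?d"
    using D(1) p by (auto simp: nth_eq_iff_index_eq)
  have ne': "?a \<noteq> g" "?b \<noteq> g" "?c \<noteq> g" "?d \<noteq> g" "?a \<noteq> h" "?b \<noteq> h" "?c \<noteq> h" "?d \<noteq> h"
    using nth_ne_off[OF _ g(1)] nth_ne_off[OF _ h(1)] idx p(2) by blast+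
  have inE: "?a \<in> E" "?b \<in> E" "?c \<in> E" "?d \<in> E" using D(3) idx p(2) by auto
  have fin: "finite ?a" "finite ?b" "finite ?c" "finite ?d" "finite g" "finite h"
    using inE g(1) h(1) finite_edge by auto
  have adj: "?a \<inter> ?c \<noteq> {}" "?b \<inter> ?d \<noteq> {}" "g \<inter> h \<noteq> {}"
    using D(4)[of p "p - 1"] D(4)[of "Suc p" "Suc (Suc p)"] idx p h(3) by (auto simp: Int_commute)
  define q0 where "q0 = (\<lambda>e. (if e = ?a then 1 else if e = ?b then 1 else 1) / (1 + 1 + 1 :: real))"
  have L0: "labelled_le {?a, ?b, g} q0" unfolding q0_def by (rule star_three_labelled[OF g]) auto
  define q1 where "q1 = q0(?c := 1 - 3/4, ?a := q0 ?a * (3/4))"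
  have L1: "labelled_le (insert ?c {?a, ?b, g}) q1" unfolding q1_def
    by (rule labelled_le_hang[OF L0]) (use ne ne' adj fin in auto)
  define q2 where "q2 = q1(?d := 1 - 3/4, ?b := q1 ?b * (3/4))"
  have L2: "labelled_le (insert ?d (insert ?c {?a, ?b, g})) q2" unfolding q2_def
    by (rule labelled_le_hang[OF L1]) (use ne ne' adj fin in auto)
  define q3 where "q3 = q2(h := 1 - 3/4, g := q2 g * (3/4))"
  have L3: "labelled_le (insert h (insert ?d (insert ?c {?a, ?b, g}))) q3" unfolding q3_def
    by (rule labelled_le_hang[OF L2]) (use ne ne' adj fin h(2) in auto)
  have v: "q3 ?a = 1/4" "q3 ?b = 1/4" "q3 ?c = 1/4" "q3 ?d = 1/4" "q3 g = 1/4" "q3 h = 1/4"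
    using ne ne' h(2) by (simp_all add: q3_def q2_def q1_def q0_def)
  show False
  proof (rule labelled_le_False[OF L3])
    show "insert h (insert ?d (insert ?c {?a, ?b, g})) \<subseteq> E" using inE g(1) h(1) by blast
    show "q3 e \<le> 1/4" if "e \<in> insert h (insert ?d (insert ?c {?a, ?b, g}))" for e
      using that v by auto
    have "card {h, ?d, ?c, ?a, ?b, g} \<le> 6" by (intro card_insert_le_m1) auto
    then show "card (insert h (insert ?d (insert ?c {?a, ?b, g}))) < 20 \<or> h \<in> insert h (insert ?d (insert ?c {?a, ?b, g})) \<and> q3 h < 1/4"
      by simp
  qed simp
qed

text \<open>Rooted at the middle position: the edge hung there gives 3/4, and each side gives a
  fork. The product is at most 3/4 times (9/16)^2 = 243/1024, strictly below 1/4, so the shafts may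
  be arbitrarily long.\<close>

lemma three_hangs_False:
  assumes g: "g1 \<in> E - set P" "g2 \<in> E - set P" "g3 \<in> E - set P" "g1 \<noteq> g2" "g1 \<noteq> g3" "g2 \<noteq> g3"
    and p: "p1 \<in> meets P g1" "p2 \<in> meets P g2" "p3 \<in> meets P g3" "1 \<le> p1" "p1 \<le> p2" "p2 \<le> p3" "Suc p3 < length P"
  shows False
proof -
  have c0: "cert p2 1 {p2} {}" using p by (intro cert_init) auto
  have c1: "cert p2 (1 * (3/4)) {p2} (insert g2 {})" by (rule cert_hang[OF c0 p(2) g(2)]) simp
  have "cert p2 (1 * (3/4) * (if p1 = p2 then 9/16 else 5/9)) ({p2} \<union> {p1 - 1..<p2}) (insert g1 (insert g2 {}))"
    by (rule cert_fork_left[OF c1]) (use p g in auto)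
  then have "cert p2 (1 * (3/4) * (if p1 = p2 then 9/16 else 5/9) * (if p3 = p2 then 9/16 else 5/9))
     ({p2} \<union> {p1 - 1..<p2} \<union> {p2<..Suc p3}) (insert g3 (insert g1 (insert g2 {})))"
  proof (rule cert_fork_right[OF _ p(6,7) _ g(3) _ p(3)])
    show "({p2} \<union> {p1 - 1..<p2}) \<inter> {p2<..Suc p3} = {}" by auto
    show "g3 \<notin> {g1, g2}" using g(5,6) by blast
  qed
  then show False by (rule cert_False) auto
qed

text \<open>The leg \<open>g\<close>, \<open>h\<close> gives 2/3, two path edges on a side away from
  the fork give 2/3, and the fork towards \<open>k\<close> gives 9/16 or 5/9. The product is 1/4 for
  \<open>q = p\<close> and 20/81 otherwise.\<close>

lemma second_level_hang_False:
  assumes g: "g \<in> E - set P" "meets P g = {p}" "2 \<le> p" "p + 2 < length P"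
    and h: "h \<in> E - set P" "h \<noteq> g" "h \<inter> g \<noteq> {}"
    and k: "k \<in> E - set P" "k \<noteq> g" "k \<noteq> h" "q \<in> meets P k" "1 \<le> q" "Suc q < length P"
  shows False
proof -
  have c0: "cert p 1 {p} {}" using g(4) by (intro cert_init) auto
  have c1: "cert p (1 * (2/3)) {p} {g, h}" using cert_hang2[OF c0, of g h] g h by simp
  show False
  proof (cases "p \<le> q")
    case True
    have "cert p (1 * (2/3) * ((real 2 + 2) / (2 * (real 2 + 1)))) ({p} \<union> {p - 2..<p}) {g, h}"
      by (rule cert_left[OF c1 g(3)]) auto
    then have *: "cert p (1 * (2/3) * ((real 2 + 2) / (2 * (real 2 + 1))) * (if q = p then 9/16 else 5/9))
      ({p} \<union> {p - 2..<p} \<union> {p<..Suc q}) (insert k {g, h})"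
    proof (rule cert_fork_right[OF _ True k(6) _ k(1) _ k(4)])
      show "({p} \<union> {p - 2..<p}) \<inter> {p<..Suc q} = {}" by auto
      show "k \<notin> {g, h}" using k(2,3) by blast
    qed
    show False
    proof (cases "q = p")
      \<comment> \<open>Equality with 1/4 occurs only here, so the edges are counted: at most four
        on the path and three off it.\<close>
      case eq: True
      have "card ({p} \<union> {p - 2..<p} \<union> {p<..Suc q}) \<le> card {p} + card {p - 2..<p} + card {p<..Suc q}"
        by (meson add_mono card_Un_le order_refl order_trans)
      also have "\<dots> \<le> 4" using eq by simp
      finally have "card ({p} \<union> {p - 2..<p} \<union> {p<..Suc q}) + card (insert k {g, h}) < 20"
        using card_insert_le_m1[of 3 "{g,h}" k] card_insert_le_m1[of 2 "{h}" g] by simp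
      then show False using cert_False[OF *] eq by simp
    next
      case False
      then show False using cert_False[OF *] by simp
    qed
  next
    case False
    have "cert p (1 * (2/3) * ((real 2 + 2) / (2 * (real 2 + 1)))) ({p} \<union> {p<..p + 2}) {g, h}"
      by (rule cert_right[OF c1 g(4)]) auto
    then have *: "cert p (1 * (2/3) * ((real 2 + 2) / (2 * (real 2 + 1))) * (if q = p then 9/16 else 5/9))
      ({p} \<union> {p<..p + 2} \<union> {q - 1..<p}) (insert k {g, h})"
    proof (rule cert_fork_left[OF _ _ k(5) _ k(1) _ k(4)])
      show "({p} \<union> {p<..p + 2}) \<inter> {q - 1..<p} = {}" by auto
      show "k \<notin> {g, h}" using k(2,3) by blast
    qed (use False in simp)
    then show False using cert_False[OF *] False by simp
  qed
qed

lemma card_bound3: "card ({p} \<union> {p - a..<p} \<union> {p<..p + b}) \<le> 1 + a + b"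
  for p a b :: nat
proof -
  have "card ({p} \<union> {p - a..<p} \<union> {p<..p + b}) \<le> card {p} + card {p - a..<p} + card {p<..p + b}"
    by (meson add_mono card_Un_le order_refl order_trans)
  also have "\<dots> \<le> 1 + a + b" by simp
  finally show ?thesis .
qed

lemma cert_left_right:
  assumes "cert p c {p} Q" "a \<le> p" "p + b < length P"
  shows "cert p (c * ((real a + 2) / (2 * (real a + 1))) * ((real b + 2) / (2 * (real b + 1))))
     ({p} \<union> {p - a..<p} \<union> {p<..p + b}) Q"
proof -
  have "cert p (c * ((real a + 2) / (2 * (real a + 1)))) ({p} \<union> {p - a..<p}) Q"
    by (rule cert_left[OF assms(1,2)]) auto
  then show ?thesis by (rule cert_right[OF _ assms(3)]) auto
qed

lemma legs_False:
  assumes c: "cert p c {p} Q" and ab: "a \<le> p" "p + b < length P"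
    and le: "c * ((real a + 2) / (2 * (real a + 1))) * ((real b + 2) / (2 * (real b + 1))) \<le> 1/4"
    and card: "a + b + card Q < 19"
  shows False
proof (rule cert_False[OF cert_left_right[OF c ab] le])
  have "card ({p} \<union> {p - a..<p} \<union> {p<..p + b}) + card Q < 20" using card_bound3[of p a b] card by linarith
  then show "card ({p} \<union> {p - a..<p} \<union> {p<..p + b}) + card Q < 20 \<or>
    c * ((real a + 2) / (2 * (real a + 1))) * ((real b + 2) / (2 * (real b + 1))) < 1 / 4" ..
qed

text \<open>The fork with shaft \<open>g\<close> gives 5/9 and each path leg of two edges gives 2/3,
  in all 20/81.\<close>

lemma second_level_fork_False:
  assumes g: "g \<in> E - set P" "meets P g = {p}" "2 \<le> p" "p + 2 < length P"
    and h: "h \<in> E - set P" "h \<noteq> g" "h \<inter> g \<noteq> {}" and k: "k \<in> E - set P" "k \<noteq> g" "k \<noteq> h" "k \<inter> g \<noteq> {}"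
  shows False
proof -
  have c0: "cert p 1 {p} {}" using g(4) by (intro cert_init) auto
  have c1: "cert p (1 * (if [g] = [] then 9/16 else 5/9)) ({p} \<union> {}) ({} \<union> {g, h, k})"
  proof (rule cert_fork[OF c0])
    show "consecutive (P ! p) [g]" using g(2) by (auto simp: meets_def)
    show "last (P ! p # [g]) \<inter> h \<noteq> {}" "last (P ! p # [g]) \<inter> k \<noteq> {}" using h(3) k(4) by (auto simp: Int_commute)
    show "set [g] \<union> {h, k} = (!) P ` {} \<union> {g, h, k}" by auto
  qed (use g h k in auto)
  then have "cert p (5/9) {p} {g, h, k}" by simp
  then show False
  proof (rule legs_False[OF _ g(3,4)])
    show "2 + 2 + card {g, h, k} < 19"
      using card_insert_le_m1[of 3 "{h,k}" g] card_insert_le_m1[of 2 "{k}" h] by simp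
  qed simp
qed

text \<open>Three legs of three edges each: (5/8)^3 = 125/512 is below 1/4.\<close>

lemma third_level_False:
  assumes g: "g \<in> E - set P" "meets P g = {p}" "3 \<le> p" "p + 3 < length P"
    and h: "h \<in> E - set P" "h \<noteq> g" "h \<inter> g \<noteq> {}" and k: "k \<in> E - set P" "k \<noteq> g" "k \<noteq> h" "k \<inter> h \<noteq> {}"
  shows False
proof -
  have c0: "cert p 1 {p} {}" using g(4) by (intro cert_init) auto
  have "P ! p \<inter> g \<noteq> {}" using g(2) by (auto simp: meets_def)
  then have "cert p (1 * ((real (length [g, h, k]) + 2) / (2 * (real (length [g, h, k]) + 1)))) {p} ({} \<union> set [g, h, k])"
    by (intro cert_off[OF c0]) (use g h k in \<open>auto simp: Int_commute\<close>)
  then have "cert p (5/8) {p} {g, h, k}" by simp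
  then show False
  proof (rule legs_False[OF _ g(3,4)])
    show "3 + 3 + card {g, h, k} < 19"
      using card_insert_le_m1[of 3 "{h,k}" g] card_insert_le_m1[of 2 "{k}" h] by simp
  qed simp
qed

text \<open>Maximality of the path puts an index of \<open>g\<close> at distance at least 2 from
  either end. If \<open>g\<close> met two path edges, both would be inner edges, and the star of
  three edges with one more edge on each would occur.\<close>

lemma second_level_single:
  assumes g: "g \<in> E - set P" "meets P g \<noteq> {}"
    and h: "h \<in> E - set P" "meets P h = {}" "h \<noteq> g" "h \<inter> g \<noteq> {}"
  obtains p where "meets P g = {p}" "2 \<le> p" "p + 2 < length P"
proof -
  obtain a b where ab: "a \<in> meets P g" "2 \<le> a" "b \<in> meets P g" "b + 2 < length P"
    using index2[OF g h] index2'[OF g h] by blast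
  have gP: "g \<in> E" "g \<notin> set P" using g(1) by auto
  from induced_P gP g(2) show thesis
  proof (cases rule: meets_cases)
    case (1 p)
    then show thesis using that ab by auto
  next
    case (2 p)
    then have "1 \<le> p" "Suc (Suc p) < length P" using ab by auto
    then have False using double_index_second_level_False[OF g(1), of p h] 2 h by auto
    then show thesis ..
  qed
qed

lemma inner_index:
  assumes g: "g \<in> E - set P" "meets P g \<noteq> {}" and l: "3 \<le> length P"
  obtains p where "p \<in> meets P g" "1 \<le> p" "Suc p < length P"
proof -
  obtain a b where ab: "a \<in> meets P g" "1 \<le> a" "b \<in> meets P g" "b + 1 < length P"
    using index1[OF g] index1'[OF g] by blast
  have gP: "g \<in> E" "g \<notin> set P" using g(1) by auto
  from induced_P gP g(2) show thesis
  proof (cases rule: meets_cases)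
    case (1 p)
    then show thesis using that ab by auto
  next
    case (2 p)
    show thesis
    proof (cases p)
      case 0
      then show thesis using that[of 1] 2 l by simp
    next
      case (Suc q)
      then show thesis using that[of p] 2 by simp
    qed
  qed
qed

text \<open>On a path of at most two edges both outside edges meet both path edges; linearity then
  puts four edges through one vertex.\<close>

lemma short_path_unique_hang:
  assumes g: "g \<in> E - set P" "meets P g \<noteq> {}" and h: "h \<in> E - set P" "meets P h \<noteq> {}" and ne: "g \<noteq> h"
  shows "3 \<le> length P"
proof (rule ccontr)
  assume n: "\<not> 3 \<le> length P"
  have J: "0 \<in> meets P f \<and> 1 \<in> meets P f" if f: "f \<in> E - set P" "meets P f \<noteq> {}" for f
  proof -
    obtain a b where ab: "a \<in> meets P f" "1 \<le> a" "b \<in> meets P f" "b + 1 < length P"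
      using index1[OF f] index1'[OF f] by blast
    then have "a < length P" by (simp add: meets_def)
    then have "a = 1" "b = 0" using ab n by auto
    then show ?thesis using ab by simp
  qed
  obtain v where v: "v \<in> P ! 0" "v \<in> P ! Suc 0" "v \<in> g" using common_vertex[OF g(1), of 0] J[OF g] by auto
  obtain u where u: "u \<in> P ! 0" "u \<in> P ! Suc 0" "u \<in> h" using common_vertex[OF h(1), of 0] J[OF h] by auto
  have l: "0 < length P" "Suc 0 < length P" using J[OF g] by (auto simp: meets_def)
  have d: "P ! 0 \<noteq> P ! Suc 0" using inducedD(1)[OF induced_P] l by (simp add: nth_eq_iff_index_eq)
  have inE: "P ! 0 \<in> E" "P ! Suc 0 \<in> E" using inducedD(3)[OF induced_P] l by auto
  have "u = v" using linear[OF inE d] u v by blast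
  moreover have "P ! 0 \<noteq> g" "P ! Suc 0 \<noteq> g" "P ! 0 \<noteq> h" "P ! Suc 0 \<noteq> h"
    using nth_ne_off l g(1) h(1) by blast+
  ultimately show False
    using star_four_False[of "P ! 0" "P ! Suc 0" g h v] inE g(1) h(1) u v d ne by auto
qed

lemma linked_extend:
  assumes "X \<subseteq> E" "X \<noteq> {}" "X \<noteq> E"
  obtains e f where "e \<in> X" "f \<in> E" "f \<notin> X" "f \<inter> e \<noteq> {}"
  using linkedD[OF linked_E assms] by (auto simp: Int_commute)

lemma meets_nonempty: "e \<in> set P \<Longrightarrow> f \<inter> e \<noteq> {} \<Longrightarrow> meets P f \<noteq> {}"
  by (auto simp: meets_def in_set_conv_nth)

text \<open>Sort outside edges by distance from the path, \<open>L\<close> being the first level.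
  Three of them could be one of the first level with a fork or a chain behind it, two of the first
  level with one behind, or three of the first level; each arrangement is excluded above.\<close>

lemma two_off_edges: "card (E - set P) \<le> 2"
proof (rule ccontr)
  assume n: "\<not> card (E - set P) \<le> 2"
  define L where "L = {g \<in> E - set P. meets P g \<noteq> {}}"
  have fL: "finite L" "L \<subseteq> E - set P" using finite_E by (auto simp: L_def)
  have fo: "finite (E - set P)" using finite_E by simp
  \<comment> \<open>Two outside edges are not all of them, so linkedness supplies a further edge;
    being outside \<open>L\<close> it misses the path and must meet \<open>Q\<close>.\<close>
  have level: "\<exists>h e. h \<in> E - set P \<and> h \<notin> Q \<and> meets P h = {} \<and> e \<in> Q \<and> h \<inter> e \<noteq> {}"
    if Q: "Q \<subseteq> E - set P" "L \<subseteq> Q" "card Q \<le> 2" for Q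
  proof -
    have ne: "set P \<union> Q \<noteq> E"
    proof
      assume "set P \<union> Q = E"
      then have "E - set P \<subseteq> Q" by blast
      moreover have "finite Q" using Q(1) fo by (rule finite_subset)
      ultimately show False using card_mono[of Q "E - set P"] Q(3) n by linarith
    qed
    obtain e f where ef: "e \<in> set P \<union> Q" "f \<in> E" "f \<notin> set P \<union> Q" "f \<inter> e \<noteq> {}"
    proof (rule linked_extend[OF _ _ ne])
      show "set P \<union> Q \<subseteq> E" using set_P_subset Q(1) by blast
      show "set P \<union> Q \<noteq> {}" using P_ne by simp
    qed
    have "f \<notin> L" using ef(3) Q(2) by blast
    then have mf: "meets P f = {}" using ef(2,3) by (simp add: L_def)
    then have "e \<in> Q" using ef(1,4) meets_nonempty[of e f] by blast
    then show ?thesis using ef mf by blast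
  qed
  consider "card L = 0" | "card L = 1" | "card L = 2" | "3 \<le> card L" by linarith
  then show False
  proof cases
    case 1
    then have "L = {}" using fL by simp
    then show False using level[of "{}"] by simp
  next
    case 2
    then obtain g where g: "L = {g}" by (meson card_1_singletonE)
    then have g': "g \<in> E - set P" "meets P g \<noteq> {}" by (auto simp: L_def)
    obtain h where h: "h \<in> E - set P" "h \<noteq> g" "meets P h = {}" "h \<inter> g \<noteq> {}"
      using level[of "{g}"] g g'(1) by auto
    obtain p where p: "meets P g = {p}" "2 \<le> p" "p + 2 < length P"
      using second_level_single[OF g' h(1,3,2,4)] .
    have "card {g, h} \<le> 2" using h(2) by simp
    then obtain k e where k: "k \<in> E - set P" "k \<notin> {g, h}" "meets P k = {}" "e \<in> {g, h}" "k \<inter> e \<noteq> {}"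
      using level[of "{g, h}"] g g'(1) h(1) by blast
    have kne: "k \<noteq> g" "k \<noteq> h" using k(2) by auto
    show False
    proof (cases "k \<inter> g = {}")
      case False
      then show False using second_level_fork_False[OF g'(1) p h(1,2,4) k(1) kne] by blast
    next
      case True
      then have kh: "k \<inter> h \<noteq> {}" using k(4,5) by auto
      obtain a b where "a \<in> meets P g" "3 \<le> a" "b \<in> meets P g" "b + 3 < length P"
        using index3[OF g' h(1,3,2,4) k(1,3) kne kh True] index3'[OF g' h(1,3,2,4) k(1,3) kne kh True] by blast
      then have "3 \<le> p" "p + 3 < length P" using p(1) by auto
      then show False using third_level_False[OF g'(1) p(1) _ _ h(1,2,4) k(1) kne kh] by blast
    qed
  next
    case 3
    then obtain g1 g2 where g: "L = {g1, g2}" "g1 \<noteq> g2" by (meson card_2_iff)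
    then have g1: "g1 \<in> E - set P" "meets P g1 \<noteq> {}" and g2: "g2 \<in> E - set P" "meets P g2 \<noteq> {}"
      by (auto simp: L_def)
    have l3: "3 \<le> length P" using short_path_unique_hang[OF g1 g2 g(2)] .
    obtain h e where h: "h \<in> E - set P" "h \<notin> L" "meets P h = {}" "e \<in> L" "h \<inter> e \<noteq> {}"
      using level[of L] fL 3 by auto
    obtain f where f: "f \<in> L" "f \<noteq> e" using g h(4) by auto
    have e: "e \<in> E - set P" "meets P e \<noteq> {}" and f': "f \<in> E - set P" "meets P f \<noteq> {}"
      using h(4) f(1) by (auto simp: L_def)
    have he: "h \<noteq> e" "f \<noteq> h" using h f by auto
    obtain p where p: "meets P e = {p}" "2 \<le> p" "p + 2 < length P"
      using second_level_single[OF e h(1,3) he(1) h(5)] .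
    obtain q where q: "q \<in> meets P f" "1 \<le> q" "Suc q < length P" using inner_index[OF f' l3] .
    show False using second_level_hang_False[OF e(1) p h(1) he(1) h(5) f'(1) f(2) he(2) q] .
  next
    case 4
    then obtain T where T: "T \<subseteq> L" "card T = 3" by (meson obtain_subset_with_card_n)
    then obtain g1 g2 g3 where g: "T = {g1, g2, g3}" "g1 \<noteq> g2" "g1 \<noteq> g3" "g2 \<noteq> g3"
      by (auto simp: card_3_iff)
    have m: "g1 \<in> E - set P" "meets P g1 \<noteq> {}" "g2 \<in> E - set P" "meets P g2 \<noteq> {}" "g3 \<in> E - set P" "meets P g3 \<noteq> {}"
      using T(1) unfolding g(1) L_def by auto
    have l3: "3 \<le> length P" using short_path_unique_hang[OF m(1-4) g(2)] .
    obtain p1 where p1: "p1 \<in> meets P g1" "1 \<le> p1" "Suc p1 < length P" using inner_index[OF m(1,2) l3] .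
    obtain p2 where p2: "p2 \<in> meets P g2" "1 \<le> p2" "Suc p2 < length P" using inner_index[OF m(3,4) l3] .
    obtain p3 where p3: "p3 \<in> meets P g3" "1 \<le> p3" "Suc p3 < length P" using inner_index[OF m(5,6) l3] .
    note T3 = three_hangs_False
    consider "p1 \<le> p2" "p2 \<le> p3" | "p1 \<le> p3" "p3 \<le> p2" | "p2 \<le> p1" "p1 \<le> p3" | "p2 \<le> p3" "p3 \<le> p1"
      | "p3 \<le> p1" "p1 \<le> p2" | "p3 \<le> p2" "p2 \<le> p1" by linarith
    then show False
    proof cases
      case 1 then show False using T3[OF m(1,3,5) g(2,3,4) p1(1) p2(1) p3(1)] p1 p3 by simp
    next
      case 2 then show False using T3[OF m(1,5,3) g(3,2) g(4)[symmetric] p1(1) p3(1) p2(1)] p1 p2 by simp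
    next
      case 3 then show False using T3[OF m(3,1,5) g(2)[symmetric] g(4) g(3) p2(1) p1(1) p3(1)] p2 p3 by simp
    next
      case 4 then show False using T3[OF m(3,5,1) g(4) g(2)[symmetric] g(3)[symmetric] p2(1) p3(1) p1(1)] p2 p1 by simp
    next
      case 5 then show False using T3[OF m(5,1,3) g(3)[symmetric] g(4)[symmetric] g(2) p3(1) p1(1) p2(1)] p3 p2 by simp
    next
      case 6 then show False using T3[OF m(5,3,1) g(4)[symmetric] g(3)[symmetric] g(2)[symmetric] p3(1) p2(1) p1(1)] p3 p1 by simp
    qed
  qed
qed

end

section \<open>Decorated paths and the possible positions near an end\<close>

definition mirror :: "nat \<Rightarrow> nat set \<Rightarrow> nat set" where
  "mirror l J = (\<lambda>i. l - Suc i) ` J"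

definition decorated_path :: "'a set set \<Rightarrow> 'a set list \<Rightarrow> 'a set list \<Rightarrow> bool" where
  "decorated_path E P hs \<longleftrightarrow> distinct (P @ hs) \<and> set (P @ hs) = E \<and>
     (\<forall>i j. i < j \<longrightarrow> j < length P \<longrightarrow> (P ! i \<inter> P ! j \<noteq> {} \<longleftrightarrow> j = Suc i)) \<and>
     (\<forall>i j. i < j \<longrightarrow> j < length hs \<longrightarrow> hs ! i \<inter> hs ! j = {})"

text \<open>The length and the index sets determine the intersection graph: path edges meet exactly
  when consecutive, hung edges are mutually disjoint, and \<open>Js\<close> settles the mixed
  pairs.\<close>

definition shape :: "'a set set \<Rightarrow> nat \<Rightarrow> nat set list \<Rightarrow> bool" where
  "shape E l Js \<longleftrightarrow> (\<exists>P hs. decorated_path E P hs \<and> length P = l \<and> map (meets P) hs = Js)"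

lemma decorated_path_rev:
  assumes "decorated_path E P hs"
  shows "decorated_path E (rev P) (rev hs)"
  unfolding decorated_path_def
proof (intro conjI allI impI)
  show "distinct (rev P @ rev hs)" "set (rev P @ rev hs) = E"
    using assms by (auto simp: decorated_path_def)
  fix i j :: nat assume ij: "i < j"
  { assume "j < length (rev P)"
    then have l: "length P - Suc j < length P - Suc i" "length P - Suc i < length P" using ij by auto
    have "P ! (length P - Suc j) \<inter> P ! (length P - Suc i) \<noteq> {} \<longleftrightarrow> length P - Suc i = Suc (length P - Suc j)"
      using assms l unfolding decorated_path_def by blast
    moreover have "length P - Suc i = Suc (length P - Suc j) \<longleftrightarrow> j = Suc i"
      using ij \<open>j < length (rev P)\<close> by auto
    moreover have "rev P ! i \<inter> rev P ! j = P ! (length P - Suc j) \<inter> P ! (length P - Suc i)"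
      using \<open>j < length (rev P)\<close> ij by (simp add: rev_nth Int_commute)
    ultimately show "rev P ! i \<inter> rev P ! j \<noteq> {} \<longleftrightarrow> j = Suc i" by (simp only:) }
  { assume "j < length (rev hs)"
    then have l: "length hs - Suc j < length hs - Suc i" "length hs - Suc i < length hs" using ij by auto
    have "hs ! (length hs - Suc j) \<inter> hs ! (length hs - Suc i) = {}"
      using assms l unfolding decorated_path_def by blast
    moreover have "rev hs ! i \<inter> rev hs ! j = hs ! (length hs - Suc j) \<inter> hs ! (length hs - Suc i)"
      using \<open>j < length (rev hs)\<close> ij by (simp add: rev_nth Int_commute)
    ultimately show "rev hs ! i \<inter> rev hs ! j = {}" by (simp only:) }
qed

lemma mirror_mirror: "J \<subseteq> {..<l} \<Longrightarrow> mirror l (mirror l J) = J"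
proof -
  assume J: "J \<subseteq> {..<l}"
  have "(\<lambda>i. l - Suc (l - Suc i)) ` J = (\<lambda>i. i) ` J" by (rule image_cong) (use J in auto)
  then show ?thesis by (simp add: mirror_def image_image)
qed

lemma meets_rev_mirror: "meets (rev P) g = mirror (length P) (meets P g)"
proof (intro set_eqI iffI)
  fix i assume "i \<in> meets (rev P) g"
  then have "i < length P" "length P - Suc i \<in> meets P g" by (auto simp: meets_def rev_nth)
  then show "i \<in> mirror (length P) (meets P g)" unfolding mirror_def
    by (intro image_eqI[of _ _ "length P - Suc i"]) auto
qed (auto simp: meets_def rev_nth mirror_def)

lemma shape_rev:
  assumes "shape E l Js"
  shows "shape E l (rev (map (mirror l) Js))"
proof -
  obtain P hs where P: "decorated_path E P hs" "length P = l" "map (meets P) hs = Js"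
    using assms unfolding shape_def by blast
  have "map (meets (rev P)) (rev hs) = rev (map (mirror l) Js)"
    unfolding P(3)[symmetric] using P(2) by (simp add: meets_rev_mirror rev_map comp_def)
  then show ?thesis unfolding shape_def using decorated_path_rev[OF P(1)] P(2) by (metis length_rev)
qed

lemma ends_greatest:
  fixes J :: "nat set"
  assumes "J \<in> {{0, 1}, {1}, {2}}"
  obtains p where "p \<in> J" "p \<in> {1, 2}" "\<forall>i\<in>J. i \<le> p"
proof -
  consider "J = {0, 1}" | "J = {1}" | "J = {2}" using assms by blast
  then show thesis
  proof cases
    case 1 then show thesis using that[of 1] by simp
  next
    case 2 then show thesis using that[of 1] by simp
  next
    case 3 then show thesis using that[of 2] by simp
  qed
qed

context longest_path
begin

text \<open>Three legs of 2, 2 and 7 edges: 2/3 times 2/3 times 9/16 is 1/4. On a path of 18 edges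
  one side of \<open>p\<close> has seven edges, and the other has two by maximality.\<close>

lemma long_second_level_False:
  assumes l: "18 \<le> length P" and g: "g \<in> E - set P" "meets P g \<noteq> {}"
    and h: "h \<in> E - set P" "meets P h = {}" "h \<noteq> g" "h \<inter> g \<noteq> {}"
  shows False
proof -
  obtain p where p: "meets P g = {p}" "2 \<le> p" "p + 2 < length P" using second_level_single[OF g h] .
  have c0: "cert p 1 {p} {}" using p(3) by (intro cert_init) auto
  have "cert p (1 * (2/3)) {p} {g, h}" using cert_hang2[OF c0, of g h] g h p by simp
  then have c: "cert p (2/3) {p} {g, h}" by simp
  have cd: "card {g, h} \<le> 2" using h(3) by simp
  show False
  proof (cases "7 \<le> p")
    case True
    show False by (rule legs_False[OF c True p(3)]) (use cd in simp_all)
  next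
    case False
    then have "p + 7 < length P" using l by simp
    then show False by (rule legs_False[OF c p(2)]) (use cd in simp_all)
  qed
qed

text \<open>The hung edge gives 3/4, so the two path legs must contribute 1/3. The pairs (3, 14),
  (4, 8) and (5, 6) achieve this exactly, and on 18 path edges one of them, possibly reversed, fits
  around every \<open>p\<close> in question. The pair (3, 14) then uses all 18 path edges, 19 edges
  in all.\<close>

lemma middle_index_False:
  assumes l: "18 \<le> length P" and g: "g \<in> E - set P" "p \<in> meets P g" and p: "3 \<le> p" "p + 3 < length P"
  shows False
proof -
  have "cert p 1 {p} {}" using p by (intro cert_init) auto
  then have "cert p (1 * (3/4)) {p} (insert g {})" using g by (intro cert_hang) auto
  then have c: "cert p (3/4) {p} {g}" by simp
  have T: False if "a \<le> p" "p + b < length P" "a + b < 18"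
    "3/4 * ((real a + 2) / (2 * (real a + 1))) * ((real b + 2) / (2 * (real b + 1))) \<le> 1/4" for a b
    by (rule legs_False[OF c that(1,2,4)]) (use that(3) in simp)
  consider "p = 3" | "p = 4" | "5 \<le> p" "p + 6 < length P" | "5 \<le> p" "length P = p + 6"
    | "5 \<le> p" "length P = p + 5" | "5 \<le> p" "length P = p + 4" using p by linarith
  then show False
  proof cases
    case 1 then show False using T[of 3 14] l by simp
  next
    case 2 then show False using T[of 4 8] l by simp
  next
    case 3 then show False using T[of 5 6] by simp
  next
    case 4 then show False using T[of 6 5] l by simp
  next
    case 5 then show False using T[of 8 4] l by simp
  next
    case 6 then show False using T[of 14 3] l by simp
  qed
qed

lemma double_index_one_False:
  assumes l: "18 \<le> length P" and g: "g \<in> E - set P" "1 \<in> meets P g" "2 \<in> meets P g"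
  shows False
proof -
  let ?a = "P ! 1" and ?b = "P ! 2" and ?c = "P ! 0" and ?L = "take 4 (drop (Suc 2) P)"
  note D = inducedD[OF induced_P]
  have R: "consecutive ?b ?L" "distinct ?L" "set ?L = (!) P ` {2<..2 + 4}" "length ?L = 4"
    using right_list[of 2 4] l by auto
  have ne: "?a \<noteq> ?b" "?a \<noteq> ?c" "?b \<noteq> ?c" using D(1) l P_ne by (auto simp: nth_eq_iff_index_eq)
  have ne': "?a \<noteq> g" "?b \<noteq> g" "?c \<noteq> g" using nth_ne_off[OF _ g(1)] l P_ne by auto
  have inE: "?a \<in> E" "?b \<in> E" "?c \<in> E" using D(3) l P_ne by auto
  have LE: "set ?L \<subseteq> E" using set_P_subset set_take_subset[of 4 "drop (Suc 2) P"] set_drop_subset[of "Suc 2" P] by blast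
  have dj: "set ?L \<inter> {?c, ?a, ?b, g} = {}"
  proof -
    have "g \<notin> set ?L" using g(1) set_take_subset[of 4 "drop (Suc 2) P"] set_drop_subset[of "Suc 2" P] by blast
    moreover have "?c \<notin> set ?L" "?a \<notin> set ?L" "?b \<notin> set ?L"
      unfolding R(3) using D(1) l P_ne by (auto simp: nth_eq_iff_index_eq)
    ultimately show ?thesis by auto
  qed
  have adj: "?a \<inter> ?c \<noteq> {}" using D(4)[of 1 0] l P_ne by (simp add: Int_commute)
  have m: "1 \<in> meets P g" "Suc 1 \<in> meets P g" using g(2,3) by (simp_all add: numeral_2_eq_2)
  \<comment> \<open>The weights 4, 5, 3 give the labels 1/3, 5/12, 1/4. The path edge at index 0
    turns 1/3 into 1/4 by the factor 3/4, and the leg of four edges turns 5/12 into 1/4 by the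
    factor 3/5.\<close>
  define q0 where "q0 = (\<lambda>e. (if e = ?a then 4 else if e = ?b then 5 else 3) / (4 + 5 + 3 :: real))"
  have "labelled_le {P ! 1, P ! Suc 1, g} (\<lambda>e. (if e = P ! 1 then 4 else if e = P ! Suc 1 then 5 else 3) / (4 + 5 + 3 :: real))"
    by (rule star_three_labelled[OF g(1) m]) auto
  moreover have "Suc 1 = (2::nat)" by simp
  ultimately have L0: "labelled_le {?a, ?b, g} q0" unfolding q0_def by (simp only:)
  define q1 where "q1 = q0(?c := 1 - 3/4, ?a := q0 ?a * (3/4))"
  have L1: "labelled_le {?c, ?a, ?b, g} q1" unfolding q1_def
    by (rule labelled_le_hang[OF L0]) (use ne ne' adj inE finite_edge in auto)
  have "\<exists>q. labelled_le ({?c, ?a, ?b, g} \<union> set ?L) q \<and> (\<forall>e\<in>{?c, ?a, ?b, g} - {?b}. q e = q1 e) \<and>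
    q ?b = q1 ?b * ((length ?L + 2) / (2 * (length ?L + 1))) \<and> (\<forall>g\<in>set ?L. q g \<le> 1/4)"
    by (rule labelled_le_leg[OF L1 _ R(1,2) dj]) (use LE finite_edge in auto)
  then obtain q where q: "labelled_le ({?c, ?a, ?b, g} \<union> set ?L) q" "\<forall>e\<in>{?c, ?a, ?b, g} - {?b}. q e = q1 e"
    "q ?b = q1 ?b * ((length ?L + 2) / (2 * (length ?L + 1)))" "\<forall>g\<in>set ?L. q g \<le> 1/4" by blast
  have v: "q ?a = 1/4" "q ?c = 1/4" "q g = 1/4" "q ?b = 1/4"
    using q(2,3) ne ne' unfolding R(4) by (auto simp: q1_def q0_def)
  show False
  proof (rule labelled_le_False[OF q(1)])
    show "{?c, ?a, ?b, g} \<union> set ?L \<subseteq> E" using inE g(1) LE by blast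
    show "q e \<le> 1/4" if "e \<in> {?c, ?a, ?b, g} \<union> set ?L" for e
      using that q(4) v by auto
    have "card ({?c, ?a, ?b, g} \<union> set ?L) \<le> card {?c, ?a, ?b, g} + card (set ?L)" by (rule card_Un_le)
    moreover have "card {?c, ?a, ?b, g} \<le> 4" by (intro card_insert_le_m1) auto
    moreover have "card (set ?L) \<le> 4" using card_length[of ?L] R(4) by simp
    ultimately show "card ({?c, ?a, ?b, g} \<union> set ?L) < 20 \<or> g \<in> {?c, ?a, ?b, g} \<union> set ?L \<and> q g < 1/4" by simp
  qed simp
qed

text \<open>The products are 9/16 times 3/4 times 7/12 = 63/256 for both edges at index 1, 3/4 times
  5/9 times 7/12 = 35/144 for the indices 1 and 2, and 9/16 times 2/3 times 2/3 = 1/4 for both at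
  index 2.\<close>

lemma same_end_False:
  assumes l: "18 \<le> length P" and g: "g \<in> E - set P" "p \<in> meets P g" and h: "h \<in> E - set P" "q \<in> meets P h"
    and ne: "g \<noteq> h" and pq: "p \<in> {1, 2}" "q \<in> {1, 2}" "p \<le> q"
  shows False
proof -
  have cd: "card {h, g} \<le> 2" using ne by simp
  consider "p = 1" "q = 1" | "p = 1" "q = 2" | "p = 2" "q = 2" using pq by auto
  then show False
  proof cases
    case 1
    have "cert 1 1 {1} {}" using l by (intro cert_init) auto
    then have "cert 1 (1 * (3/4)) {1} (insert g {})" using g 1 by (intro cert_hang) auto
    then have "cert 1 (1 * (3/4) * (3/4)) {1} (insert h (insert g {}))" by (rule cert_hang) (use h ne 1 in auto)
    then have c: "cert 1 (9/16) {1} {h, g}" by simp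
    show False by (rule legs_False[OF c, of 1 5]) (use l cd in simp_all)
  next
    case 2
    have "cert 2 1 {2} {}" using l by (intro cert_init) auto
    then have c0: "cert 2 (1 * (3/4)) {2} (insert h {})" using h 2 by (intro cert_hang) auto
    have "cert 2 (1 * (3/4) * (if 1 = (2::nat) then 9/16 else 5/9)) ({2} \<union> {1 - 1..<2}) (insert g (insert h {}))"
      by (rule cert_fork_left[OF c0]) (use g ne 2 in auto)
    then have "cert 2 (1 * (3/4) * (if 1 = (2::nat) then 9/16 else 5/9) * ((real 5 + 2) / (2 * (real 5 + 1))))
       ({2} \<union> {1 - 1..<2} \<union> {2<..2 + 5}) (insert g (insert h {}))"
      by (rule cert_right) (use l in auto)
    then show False by (rule cert_False) auto
  next
    case 3
    have "cert 2 1 {2} {}" using l by (intro cert_init) auto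
    then have "cert 2 (1 * (3/4)) {2} (insert g {})" using g 3 by (intro cert_hang) auto
    then have "cert 2 (1 * (3/4) * (3/4)) {2} (insert h (insert g {}))" by (rule cert_hang) (use h ne 3 in auto)
    then have c: "cert 2 (9/16) {2} {h, g}" by simp
    show False by (rule legs_False[OF c, of 2 2]) (use l cd in simp_all)
  qed
qed

lemma left_meets:
  assumes l: "18 \<le> length P" and g: "g \<in> E - set P" "meets P g \<noteq> {}" and le: "\<exists>i\<in>meets P g. i \<le> 2"
  shows "meets P g \<in> {{0, 1}, {1}, {2}}"
proof -
  have gP: "g \<in> E" "g \<notin> set P" using g(1) by auto
  obtain a where a: "a \<in> meets P g" "1 \<le> a" using index1[OF g] by blast
  from induced_P gP g(2) show ?thesis
  proof (cases rule: meets_cases)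
    case (1 p)
    then show ?thesis using a le by auto
  next
    case (2 p)
    \<comment> \<open>The pair {1, 2} is excluded by the unequal star, the pair {2, 3} by its inner
      index 3; so only {0, 1} remains.\<close>
    have "p \<noteq> 1" using double_index_one_False[OF l g(1)] 2 by (auto simp: numeral_2_eq_2)
    moreover have "p \<noteq> 2" using middle_index_False[OF l g(1), of 3] 2 l by (auto simp: numeral_2_eq_2 numeral_3_eq_3)
    moreover have "p \<le> 2" using 2 le by auto
    ultimately have "p = 0" by linarith
    then show ?thesis using 2 by simp
  qed
qed

lemma meets_ends:
  assumes l: "18 \<le> length P" and g: "g \<in> E - set P" "meets P g \<noteq> {}"
  shows "meets P g \<in> {{0, 1}, {1}, {2}} \<or> mirror (length P) (meets P g) \<in> {{0, 1}, {1}, {2}}"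
proof -
  interpret R: longest_path E "rev P" by (rule rev_longest_path)
  obtain p where p: "p \<in> meets P g" using g(2) by blast
  then have pl: "p < length P" by (simp add: meets_def)
  have "p \<le> 2 \<or> length P \<le> p + 3" using middle_index_False[OF l g(1) p] by (cases "3 \<le> p"; cases "p + 3 < length P") auto
  then show ?thesis
  proof
    assume "p \<le> 2"
    then show ?thesis using left_meets[OF l g] p by blast
  next
    assume a: "length P \<le> p + 3"
    have "length P - Suc p \<in> meets (rev P) g" using p pl by (auto simp: meets_def rev_nth)
    moreover have "length P - Suc p \<le> 2" using a by simp
    ultimately have "meets (rev P) g \<in> {{0, 1}, {1}, {2}}"
    proof (intro R.left_meets bexI)
      show "18 \<le> length (rev P)" "g \<in> E - set (rev P)" using l g by simp_all
      show "meets (rev P) g \<noteq> {}" using g(2) by (simp add: meets_rev_empty)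
    qed
    then show ?thesis by (simp add: meets_rev_mirror)
  qed
qed

lemma one_left_hang:
  assumes l: "18 \<le> length P" and g: "g \<in> E - set P" "meets P g \<in> {{0, 1}, {1}, {2}}"
    and h: "h \<in> E - set P" "meets P h \<in> {{0, 1}, {1}, {2}}" and ne: "g \<noteq> h"
  shows False
proof -
  obtain p where p: "p \<in> meets P g" "p \<in> {1, 2}" by (rule ends_greatest[OF g(2)])
  obtain q where q: "q \<in> meets P h" "q \<in> {1, 2}" by (rule ends_greatest[OF h(2)])
  show False
  proof (cases "p \<le> q")
    case True
    then show False using same_end_False[OF l g(1) p(1) h(1) q(1) ne p(2) q(2)] by blast
  next
    case False
    then show False using same_end_False[OF l h(1) q(1) g(1) p(1) ne[symmetric] q(2) p(2)] by simp
  qed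
qed

text \<open>If they met, \<open>h\<close> would meet the induced path \<open>g # drop p P\<close>
  both in its first edge and far to the right, which closes a cycle.\<close>

lemma opposite_hangs_disjoint:
  assumes l: "18 \<le> length P" and g: "g \<in> E - set P" "meets P g \<in> {{0, 1}, {1}, {2}}"
    and h: "h \<in> E - set P" "q \<in> meets P h" "15 \<le> q" and ne: "g \<noteq> h"
  shows "g \<inter> h = {}"
proof (rule ccontr)
  assume gh: "g \<inter> h \<noteq> {}"
  obtain p where p: "p \<in> meets P g" "p \<in> {1, 2}" "\<forall>i\<in>meets P g. i \<le> p"
    by (rule ends_greatest[OF g(2)])
  have I: "induced (g # drop p P)" using drop_index[OF g(1) p(1)] p(3) by blast
  have q: "q < length P" using h(2) by (simp add: meets_def)
  have "0 \<in> meets (g # drop p P) h" using gh by (simp add: meets_def)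
  moreover have "Suc (q - p) \<in> meets (g # drop p P) h"
  proof -
    have "p + (q - p) = q" using p(2) h(3) by auto
    then show ?thesis using h(2) q by (simp add: meets_def)
  qed
  moreover have "h \<in> E" "h \<notin> set (g # drop p P)" using h(1) ne set_drop_subset[of p P] by auto
  ultimately have "Suc (q - p) = Suc 0" using meets_bounded[OF I, of h 0 "Suc (q - p)"] by simp
  then show False using p(2) h(3) by auto
qed

lemma shape_classification:
  defines "ends \<equiv> {{0, 1}, {1}, {2}} :: nat set set"
  shows "shape E (card E) [] \<or> (\<exists>J\<in>ends. shape E (card E - 1) [J]) \<or>
    (\<exists>J\<in>ends. \<exists>K\<in>ends. shape E (card E - 2) [J, mirror (card E - 2) K])"
proof -
  have cE: "card E = length P + card (E - set P)"
    using card_Diff_subset[of "set P" E] set_P_subset finite_E inducedD(1)[OF induced_P]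
      card_mono[OF finite_E set_P_subset] by (simp add: distinct_card)
  have l: "18 \<le> length P" using cE card_E two_off_edges by linarith
  have fo: "finite (E - set P)" using finite_E by simp
  have ind: "\<forall>i j. i < j \<longrightarrow> j < length P \<longrightarrow> (P ! i \<inter> P ! j \<noteq> {} \<longleftrightarrow> j = Suc i)"
    using induced_P by (simp add: induced_def)
  have dP: "distinct P" using inducedD(1)[OF induced_P] .
  \<comment> \<open>If some edge missed the path, linkedness would give an edge that misses the path
    but meets a hung edge, that is, one of the second level.\<close>
  have first: "meets P g \<noteq> {}" if g: "g \<in> E - set P" for g
  proof (rule ccontr)
    assume "\<not> meets P g \<noteq> {}"
    define X where "X = set P \<union> {h \<in> E - set P. meets P h \<noteq> {}}"
    have X: "X \<subseteq> E" "X \<noteq> {}" "X \<noteq> E" using set_P_subset P_ne g \<open>\<not> meets P g \<noteq> {}\<close> by (auto simp: X_def)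
    obtain e f where ef: "e \<in> X" "f \<in> E" "f \<notin> X" "f \<inter> e \<noteq> {}" using linked_extend[OF X] .
    have f: "f \<in> E - set P" "meets P f = {}" using ef(2,3) by (auto simp: X_def)
    then have "e \<notin> set P" using meets_nonempty[of e f] ef(4) by blast
    then have e: "e \<in> E - set P" "meets P e \<noteq> {}" using ef(1) by (auto simp: X_def)
    show False using long_second_level_False[OF l e f] ef by blast
  qed
  have mlt: "meets P g \<subseteq> {..<length P}" for g by (auto simp: meets_def)
  have ml: "J \<subseteq> {..<length P}" if "J \<in> ends" for J using that l by (auto simp: ends_def)
  consider "card (E - set P) = 0" | "card (E - set P) = 1" | "card (E - set P) = 2"
    using two_off_edges by linarith
  then show ?thesis
  proof cases
    case 1
    then have "set P = E" using fo set_P_subset by auto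
    then have "shape E (length P) []" unfolding shape_def decorated_path_def
      by (intro exI[of _ P] exI[of _ "[]"]) (use dP ind in simp)
    then show ?thesis using 1 cE by simp
  next
    case 2
    then obtain g where g: "E - set P = {g}" by (meson card_1_singletonE)
    then have g': "g \<in> E - set P" by simp
    have n: "length P = card E - 1" using cE 2 by simp
    have "set (P @ [g]) = E" "distinct (P @ [g])" using g set_P_subset dP by auto
    then have S: "shape E (length P) [meets P g]" unfolding shape_def decorated_path_def
      by (intro exI[of _ P] exI[of _ "[g]"]) (use ind in simp)
    from meets_ends[OF l g' first[OF g']] show ?thesis
    proof
      assume "meets P g \<in> {{0, 1}, {1}, {2}}"
      then have "meets P g \<in> ends" unfolding ends_def .
      then show ?thesis using S unfolding n by (intro disjI2 disjI1 bexI[of _ "meets P g"])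
    next
      assume m: "mirror (length P) (meets P g) \<in> {{0, 1}, {1}, {2}}"
      define K where "K = mirror (length P) (meets P g)"
      have K: "K \<in> ends" "meets P g = mirror (length P) K"
        using m mirror_mirror[OF mlt[of g]] unfolding K_def ends_def by (blast, simp)
      have "shape E (length P) [K]" using shape_rev[OF S] K(2) mirror_mirror[OF ml[OF K(1)]] by simp
      then show ?thesis using K(1) unfolding n by (intro disjI2 disjI1 bexI[of _ K])
    qed
  next
    case 3
    then obtain g h where gh: "E - set P = {g, h}" "g \<noteq> h" by (meson card_2_iff)
    have n: "length P = card E - 2" using cE 3 by simp
    have *: ?thesis if gh: "E - set P = {g, h}" "g \<noteq> h" and gl: "meets P g \<in> {{0, 1}, {1}, {2}}" for g h
    proof -
      have g': "g \<in> E - set P" and h': "h \<in> E - set P" using gh by auto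
      have "\<not> meets P h \<in> {{0, 1}, {1}, {2}}" using one_left_hang[OF l g' gl h' _ gh(2)] by blast
      then have m: "mirror (length P) (meets P h) \<in> {{0, 1}, {1}, {2}}" using meets_ends[OF l h' first[OF h']] by blast
      define K where "K = mirror (length P) (meets P h)"
      have K: "K \<in> ends" "meets P h = mirror (length P) K"
        using m mirror_mirror[OF mlt[of h]] unfolding K_def ends_def by (blast, simp)
      obtain q where q: "q \<in> meets P h" using first[OF h'] by blast
      then obtain k where "k \<in> K" "q = length P - Suc k" unfolding K(2) by (auto simp: mirror_def)
      \<comment> \<open>An index of at most 2 counted from the right end of at least 18 edges is at
        least 18 - 1 - 2.\<close>
      then have "15 \<le> q" using K(1) l by (auto simp: ends_def)
      then have "g \<inter> h = {}" using opposite_hangs_disjoint[OF l g' gl h' q _ gh(2)] by blast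
      then have "\<forall>i j. i < j \<longrightarrow> j < length [g, h] \<longrightarrow> [g, h] ! i \<inter> [g, h] ! j = {}"
        by (simp add: less_Suc_eq)
      moreover have "set (P @ [g, h]) = E" "distinct (P @ [g, h])" using gh set_P_subset dP g' h' by auto
      ultimately have "shape E (length P) [meets P g, meets P h]" unfolding shape_def decorated_path_def
        by (intro exI[of _ P] exI[of _ "[g, h]"]) (use ind in simp)
      then have "shape E (card E - 2) [meets P g, mirror (card E - 2) K]" unfolding K(2) n .
      moreover have "meets P g \<in> ends" using gl unfolding ends_def .
      ultimately show ?thesis using K(1) by (intro disjI2 bexI[of _ "meets P g"] bexI[of _ K])
    qed
    show ?thesis
    proof (cases "meets P g \<in> {{0, 1}, {1}, {2}}")
      case True
      then show ?thesis using *[OF gh] by blast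
    next
      case gF: False
      show ?thesis
      proof (cases "meets P h \<in> {{0, 1}, {1}, {2}}")
        case True
        moreover have "E - set P = {h, g}" using gh(1) by (simp add: insert_commute)
        ultimately show ?thesis using *[of h g] gh(2) by simp
      next
        case False
        interpret R: longest_path E "rev P" by (rule rev_longest_path)
        have g': "g \<in> E - set P" and h': "h \<in> E - set P" using gh by auto
        have "meets (rev P) g \<in> {{0, 1}, {1}, {2}}"
          using meets_ends[OF l g' first[OF g']] gF unfolding meets_rev_mirror by argo
        moreover have "meets (rev P) h \<in> {{0, 1}, {1}, {2}}"
          using meets_ends[OF l h' first[OF h']] False unfolding meets_rev_mirror by argo
        moreover have "18 \<le> length (rev P)" "g \<in> E - set (rev P)" "h \<in> E - set (rev P)" using l g' h' by simp_all
        ultimately have False using R.one_left_hang[of g h] gh(2) by blast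
        then show ?thesis ..
      qed
    qed
  qed
qed

end

section \<open>Reconstruction from the intersection graph\<close>

definition linear_helly :: "'a set set \<Rightarrow> bool" where
  "linear_helly E \<longleftrightarrow>
     (\<forall>e\<in>E. \<forall>f\<in>E. e \<noteq> f \<longrightarrow> (\<forall>x\<in>e \<inter> f. \<forall>y\<in>e \<inter> f. x = y)) \<and>
     (\<forall>e\<in>E. \<forall>f\<in>E. \<forall>g\<in>E. e \<noteq> f \<longrightarrow> e \<noteq> g \<longrightarrow> f \<noteq> g \<longrightarrow>
        e \<inter> f \<noteq> {} \<longrightarrow> e \<inter> g \<noteq> {} \<longrightarrow> f \<inter> g \<noteq> {} \<longrightarrow> e \<inter> f \<inter> g \<noteq> {})"

lemma linear_helly_linear:
  "linear_helly E \<Longrightarrow> e \<in> E \<Longrightarrow> f \<in> E \<Longrightarrow> e \<noteq> f \<Longrightarrow> x \<in> e \<Longrightarrow> x \<in> f \<Longrightarrow> y \<in> e \<Longrightarrow> y \<in> f \<Longrightarrow> x = y"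
  unfolding linear_helly_def by (meson IntI)

lemma linear_helly_helly:
  assumes "linear_helly E" "e \<in> E" "f \<in> E" "g \<in> E" "e \<noteq> f" "e \<noteq> g" "f \<noteq> g"
    "x \<in> e" "x \<in> f" "e \<inter> g \<noteq> {}" "f \<inter> g \<noteq> {}"
  shows "x \<in> g"
proof -
  have "e \<inter> f \<noteq> {}" using assms(8,9) by blast
  then have "e \<inter> f \<inter> g \<noteq> {}" using assms(1-7,10,11) unfolding linear_helly_def by meson
  then obtain y where "y \<in> e" "y \<in> f" "y \<in> g" by blast
  then show ?thesis using linear_helly_linear[OF assms(1,2,3,5) assms(8,9), of y] by simp
qed

lemma bij_betw_extend:
  assumes "finite A" "finite B" "card A = card B" "C \<subseteq> A" "inj_on \<psi> C" "\<psi> ` C \<subseteq> B"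
  obtains h where "bij_betw h A B" "\<forall>c\<in>C. h c = \<psi> c"
proof -
  have fC: "finite C" using assms(1,4) finite_subset by blast
  have "card (A - C) = card (B - \<psi> ` C)"
    using assms fC by (simp add: card_Diff_subset card_image)
  then obtain g where g: "bij_betw g (A - C) (B - \<psi> ` C)"
    using finite_same_card_bij[of "A - C" "B - \<psi> ` C"] assms(1,2) by auto
  let ?h = "\<lambda>x. if x \<in> C then \<psi> x else g x"
  have "bij_betw ?h C (\<psi> ` C)" using assms(5) by (auto simp: bij_betw_def inj_on_def)
  moreover have "bij_betw ?h (A - C) (B - \<psi> ` C)"
    using g by (subst bij_betw_cong[of _ _ g]) auto
  ultimately have "bij_betw ?h (C \<union> (A - C)) (\<psi> ` C \<union> (B - \<psi> ` C))"
    by (rule bij_betw_combine) auto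
  moreover have "C \<union> (A - C) = A" "\<psi> ` C \<union> (B - \<psi> ` C) = B" using assms(4,6) by auto
  ultimately show thesis using that[of ?h] by simp
qed

text \<open>
  In a linear hypergraph with the Helly property the vertices of degree at least two correspond to
  the maximal cliques of at least two edges in the intersection graph, and the vertices of degree
  one only fill up the edges. Hence the intersection graph determines the hypergraph.
\<close>
lemma hypergraph_iso_intersection_graph:
  fixes G :: "'a hypergraph" and K :: "'b hypergraph"
  assumes G: "r_graph r G" "verts G = \<Union>(edges G)" "linear_helly (edges G)"
    and K: "r_graph r K" "verts K = \<Union>(edges K)" "linear_helly (edges K)"
    and \<phi>: "bij_betw \<phi> (edges G) (edges K)"
      "\<And>e f. e \<in> edges G \<Longrightarrow> f \<in> edges G \<Longrightarrow> e \<noteq> f \<Longrightarrow> \<phi> e \<inter> \<phi> f \<noteq> {} \<longleftrightarrow> e \<inter> f \<noteq> {}"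
  shows "hypergraph_iso G K"
proof -
  let ?E = "edges G" and ?F = "edges K"
  have inj: "\<phi> e \<noteq> \<phi> f" if "e \<in> ?E" "f \<in> ?E" "e \<noteq> f" for e f
    using \<phi>(1) that by (auto simp: bij_betw_def inj_on_def)
  have \<phi>F: "\<phi> e \<in> ?F" if "e \<in> ?E" for e using \<phi>(1) that by (auto simp: bij_betw_def)
  define core where "core v \<longleftrightarrow> (\<exists>e\<in>?E. \<exists>f\<in>?E. e \<noteq> f \<and> v \<in> e \<and> v \<in> f)" for v
  \<comment> \<open>Two edges at a core vertex determine it by linearity, and their images meet in
    some \<open>u\<close>. The Helly property on both sides shows that the edges at \<open>v\<close>
    correspond exactly to the edges at \<open>u\<close>.\<close>
  have ex: "\<exists>u. \<forall>e\<in>?E. v \<in> e \<longleftrightarrow> u \<in> \<phi> e" if cv: "core v" for v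
  proof -
    obtain a b where ab: "a \<in> ?E" "b \<in> ?E" "a \<noteq> b" "v \<in> a" "v \<in> b" using cv unfolding core_def by blast
    have "\<phi> a \<inter> \<phi> b \<noteq> {}" using \<phi>(2)[OF ab(1-3)] ab(4,5) by blast
    then obtain u where u: "u \<in> \<phi> a" "u \<in> \<phi> b" by blast
    have "v \<in> e \<longleftrightarrow> u \<in> \<phi> e" if e: "e \<in> ?E" for e
    proof (cases "e = a \<or> e = b")
      case True
      then show ?thesis using ab u by blast
    next
      case False
      show ?thesis
      proof
        assume v: "v \<in> e"
        have "\<phi> a \<inter> \<phi> e \<noteq> {}" "\<phi> b \<inter> \<phi> e \<noteq> {}"
          using \<phi>(2)[OF ab(1) e] \<phi>(2)[OF ab(2) e] ab v False by blast+
        then show "u \<in> \<phi> e"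
          using linear_helly_helly[OF K(3), of "\<phi> a" "\<phi> b" "\<phi> e"] \<phi>F ab e inj u False by auto
      next
        assume v: "u \<in> \<phi> e"
        have "a \<inter> e \<noteq> {}" "b \<inter> e \<noteq> {}"
          using \<phi>(2)[OF ab(1) e] \<phi>(2)[OF ab(2) e] u v False by blast+
        then show "v \<in> e"
          using linear_helly_helly[OF G(3), of a b e] ab e False by auto
      qed
    qed
    then show ?thesis by blast
  qed
  define \<psi> where "\<psi> v = (SOME u. \<forall>e\<in>?E. v \<in> e \<longleftrightarrow> u \<in> \<phi> e)" for v
  have \<psi>: "v \<in> e \<longleftrightarrow> \<psi> v \<in> \<phi> e" if "core v" "e \<in> ?E" for v e
    using someI_ex[OF ex[OF that(1)]] that(2) unfolding \<psi>_def by blast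
  have "\<exists>h. bij_betw h e (\<phi> e) \<and> (\<forall>v\<in>{v\<in>e. core v}. h v = \<psi> v)" if e: "e \<in> ?E" for e
  proof -
    have fin: "finite e" "finite (\<phi> e)" "card e = card (\<phi> e)"
      using r_graph_edgeD[OF G(1) e] r_graph_edgeD[OF K(1) \<phi>F[OF e]] by auto
    have "inj_on \<psi> {v\<in>e. core v}"
    proof (rule inj_onI)
      fix v w assume vw: "v \<in> {v\<in>e. core v}" "w \<in> {v\<in>e. core v}" "\<psi> v = \<psi> w"
      then obtain a b where ab: "a \<in> ?E" "b \<in> ?E" "a \<noteq> b" "v \<in> a" "v \<in> b" unfolding core_def by blast
      have "core v" "core w" using vw by auto
      then have "w \<in> a" "w \<in> b" using \<psi> ab vw(3) by metis+
      then show "v = w" using linear_helly_linear[OF G(3) ab] by blast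
    qed
    moreover have "\<psi> ` {v\<in>e. core v} \<subseteq> \<phi> e" using \<psi> e by blast
    ultimately obtain h where "bij_betw h e (\<phi> e)" "\<forall>v\<in>{v\<in>e. core v}. h v = \<psi> v"
      using bij_betw_extend[OF fin, of "{v\<in>e. core v}" \<psi>] by blast
    then show ?thesis by blast
  qed
  then obtain h where h: "\<And>e. e \<in> ?E \<Longrightarrow> bij_betw (h e) e (\<phi> e)"
      "\<And>e v. e \<in> ?E \<Longrightarrow> v \<in> e \<Longrightarrow> core v \<Longrightarrow> h e v = \<psi> v"
    by (metis (mono_tags, lifting) mem_Collect_eq)
  \<comment> \<open>The choice of the edge has no influence: a vertex in two edges is a core vertex,
    and there all the local bijections \<open>h e\<close> agree with \<open>\<psi>\<close>.\<close>
  define f where "f v = h (SOME e. e \<in> ?E \<and> v \<in> e) v" for v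
  have f: "f v = h e v" if e: "e \<in> ?E" "v \<in> e" for e v
  proof -
    define d where "d = (SOME e. e \<in> ?E \<and> v \<in> e)"
    have d: "d \<in> ?E" "v \<in> d" using someI[of "\<lambda>e. e \<in> ?E \<and> v \<in> e" e] e unfolding d_def by blast+
    show ?thesis
    proof (cases "d = e")
      case True
      then show ?thesis by (simp add: f_def d_def)
    next
      case False
      then have "core v" using d e unfolding core_def by blast
      then have "h d v = h e v" using h(2) d e by simp
      then show ?thesis by (simp add: f_def d_def)
    qed
  qed
  have fe: "f ` e = \<phi> e" if "e \<in> ?E" for e
    using h(1)[OF that] f[OF that] by (auto simp: bij_betw_def image_iff)
  have "inj_on f (verts G)"
  proof (rule inj_onI)
    fix v w assume vw: "v \<in> verts G" "w \<in> verts G" "f v = f w"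
    obtain a b where ab: "a \<in> ?E" "v \<in> a" "b \<in> ?E" "w \<in> b" using vw(1,2) G(2) by auto
    have hinj: "x = y" if "e \<in> ?E" "x \<in> e" "y \<in> e" "f x = f y" for e x y
      using h(1)[OF that(1)] that f by (auto simp: bij_betw_def inj_on_def)
    show "v = w"
    proof (cases "a = b")
      case True
      then show ?thesis using hinj ab vw(3) by blast
    next
      case False
      \<comment> \<open>Points of different edges with the same image: the image lies in both image
        edges, hence it is the image of the common vertex of \<open>a\<close> and \<open>b\<close>,
        and injectivity on each edge identifies \<open>v\<close> and \<open>w\<close> with that
        vertex.\<close>
      have u: "f v \<in> \<phi> a" "f v \<in> \<phi> b" using fe[OF ab(1)] fe[OF ab(3)] ab(2,4) vw(3) by (metis imageI)+
      then have "a \<inter> b \<noteq> {}" using \<phi>(2)[OF ab(1,3) False] by blast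
      then obtain x where x: "x \<in> a" "x \<in> b" by blast
      have "f x \<in> \<phi> a" "f x \<in> \<phi> b" using fe[OF ab(1)] fe[OF ab(3)] x by blast+
      then have "f v = f x" using linear_helly_linear[OF K(3) \<phi>F[OF ab(1)] \<phi>F[OF ab(3)] inj[OF ab(1,3) False] u] by blast
      then have "v = x" "w = x" using hinj ab x vw(3) by metis+
      then show ?thesis by simp
    qed
  qed
  moreover have "f ` verts G = verts K"
  proof -
    have "f ` verts G = (\<Union>e\<in>?E. f ` e)" unfolding G(2) by blast
    also have "\<dots> = \<Union>(\<phi> ` ?E)" using fe by simp
    also have "\<dots> = verts K" using \<phi>(1) K(2) by (simp add: bij_betw_def)
    finally show ?thesis .
  qed
  moreover have "edges K = (\<lambda>e. f ` e) ` ?E"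
  proof -
    have "(\<lambda>e. f ` e) ` ?E = \<phi> ` ?E" using fe by simp
    then show ?thesis using \<phi>(1) by (simp add: bij_betw_def)
  qed
  ultimately show ?thesis unfolding hypergraph_iso_def bij_betw_def by blast
qed

lemma hypergraph_iso_lists:
  fixes G :: "'a hypergraph" and K :: "'b hypergraph"
  assumes G: "r_graph r G" "verts G = \<Union>(edges G)" "linear_helly (edges G)"
    and K: "r_graph r K" "verts K = \<Union>(edges K)" "linear_helly (edges K)"
    and L: "distinct L" "set L = edges G" "distinct M" "set M = edges K" "length L = length M"
    and adj: "\<And>i j. i < j \<Longrightarrow> j < length L \<Longrightarrow> L ! i \<inter> L ! j \<noteq> {} \<longleftrightarrow> M ! i \<inter> M ! j \<noteq> {}"
  shows "hypergraph_iso G K"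
proof -
  have bL: "bij_betw ((!) L) {..<length L} (edges G)" using bij_betw_nth[OF L(1) refl] L(2) by simp
  have bM: "bij_betw ((!) M) {..<length L} (edges K)" using bij_betw_nth[OF L(3), of "{..<length L}"] L(4,5) by simp
  define \<phi> where "\<phi> = (!) M \<circ> inv_into {..<length L} ((!) L)"
  have b: "bij_betw \<phi> (edges G) (edges K)" unfolding \<phi>_def
    by (rule bij_betw_trans[OF bij_betw_inv_into[OF bL] bM])
  have v: "\<phi> (L ! i) = M ! i" if "i < length L" for i
    using bL that unfolding \<phi>_def by (simp add: bij_betw_def inv_into_f_f)
  have "\<phi> e \<inter> \<phi> f \<noteq> {} \<longleftrightarrow> e \<inter> f \<noteq> {}" if ef: "e \<in> edges G" "f \<in> edges G" "e \<noteq> f" for e f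
  proof -
    obtain i j where ij: "i < length L" "e = L ! i" "j < length L" "f = L ! j"
      using ef(1,2) L(2) by (metis in_set_conv_nth)
    have "i \<noteq> j" using ef(3) ij by auto
    then consider "i < j" | "j < i" by linarith
    then show ?thesis
    proof cases
      case 1
      then show ?thesis using adj[OF 1 ij(3)] v ij by simp
    next
      case 2
      then show ?thesis using adj[OF 2 ij(1)] v ij by (simp add: Int_commute)
    qed
  qed
  then show ?thesis using hypergraph_iso_intersection_graph[OF G K b] by blast
qed

lemma decorated_pathD:
  assumes "decorated_path E P hs"
  shows "distinct (P @ hs)" "set (P @ hs) = E"
    "i < j \<Longrightarrow> j < length P \<Longrightarrow> P ! i \<inter> P ! j \<noteq> {} \<longleftrightarrow> j = Suc i"
    "i < j \<Longrightarrow> j < length hs \<Longrightarrow> hs ! i \<inter> hs ! j = {}"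
proof -
  note a = assms[unfolded decorated_path_def]
  show "distinct (P @ hs)" using a[THEN conjunct1] .
  show "set (P @ hs) = E" using a[THEN conjunct2, THEN conjunct1] .
  show "i < j \<Longrightarrow> j < length P \<Longrightarrow> P ! i \<inter> P ! j \<noteq> {} \<longleftrightarrow> j = Suc i"
    using a[THEN conjunct2, THEN conjunct2, THEN conjunct1, rule_format] .
  show "i < j \<Longrightarrow> j < length hs \<Longrightarrow> hs ! i \<inter> hs ! j = {}"
    using a[THEN conjunct2, THEN conjunct2, THEN conjunct2, rule_format] .
qed

lemma shape_iso:
  fixes G :: "'a hypergraph" and K :: "'b hypergraph"
  assumes G: "r_graph r G" "verts G = \<Union>(edges G)" "linear_helly (edges G)"
    and K: "r_graph r K" "verts K = \<Union>(edges K)" "linear_helly (edges K)"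
    and S: "shape (edges G) l Js" "shape (edges K) l Js"
  shows "hypergraph_iso G K"
proof -
  obtain P hs where P: "decorated_path (edges G) P hs" "length P = l" "map (meets P) hs = Js"
    using S(1) unfolding shape_def by blast
  obtain Q ks where Q: "decorated_path (edges K) Q ks" "length Q = l" "map (meets Q) ks = Js"
    using S(2) unfolding shape_def by blast
  have len: "length ks = length hs" using P(3) Q(3) map_eq_imp_length_eq by metis
  note dP = decorated_pathD(1,2)[OF P(1)] and dQ = decorated_pathD(1,2)[OF Q(1)]
  have pP: "P ! i \<inter> P ! j \<noteq> {} \<longleftrightarrow> j = Suc i" if "i < j" "j < l" for i j
    using decorated_pathD(3)[OF P(1) that(1)] that(2) P(2) by simp
  have pQ: "Q ! i \<inter> Q ! j \<noteq> {} \<longleftrightarrow> j = Suc i" if "i < j" "j < l" for i j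
    using decorated_pathD(3)[OF Q(1) that(1)] that(2) Q(2) by simp
  have hP: "hs ! i \<inter> hs ! j = {}" if "i < j" "j < length hs" for i j
    using decorated_pathD(4)[OF P(1) that] .
  have hQ: "ks ! i \<inter> ks ! j = {}" if "i < j" "j < length hs" for i j
    using decorated_pathD(4)[OF Q(1) that(1)] that(2) len by simp
  have m: "P ! i \<inter> hs ! j \<noteq> {} \<longleftrightarrow> Q ! i \<inter> ks ! j \<noteq> {}" if "i < l" "j < length hs" for i j
  proof -
    have "meets P (hs ! j) = meets Q (ks ! j)" using P(3) Q(3) that len by (metis nth_map)
    then have "i \<in> meets P (hs ! j) \<longleftrightarrow> i \<in> meets Q (ks ! j)" by simp
    then show ?thesis using that P(2) Q(2) by (simp add: meets_def)
  qed
  show ?thesis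
  proof (rule hypergraph_iso_lists[OF G K dP dQ])
    show "length (P @ hs) = length (Q @ ks)" using P(2) Q(2) len by simp
    fix i j assume ij: "i < j" "j < length (P @ hs)"
    consider "j < l" | "i < l" "\<not> j < l" | "\<not> i < l" by linarith
    then show "(P @ hs) ! i \<inter> (P @ hs) ! j \<noteq> {} \<longleftrightarrow> (Q @ ks) ! i \<inter> (Q @ ks) ! j \<noteq> {}"
    proof cases
      case 1
      then show ?thesis using pP[OF ij(1)] pQ[OF ij(1)] ij P(2) Q(2) by (simp add: nth_append)
    next
      case 2
      then show ?thesis using m[of i "j - l"] ij P(2) Q(2) by (simp add: nth_append)
    next
      case 3
      then have "hs ! (i - l) \<inter> hs ! (j - l) = {}" "ks ! (i - l) \<inter> ks ! (j - l) = {}"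
        using hP[of "i - l" "j - l"] hQ[of "i - l" "j - l"] ij P(2) by auto
      then show ?thesis using 3 ij P(2) Q(2) by (simp add: nth_append)
    qed
  qed
qed

definition cycle_shape :: "'a set set \<Rightarrow> nat \<Rightarrow> bool" where
  "cycle_shape E n \<longleftrightarrow> (\<exists>L. distinct L \<and> set L = E \<and> length L = n \<and>
     (\<forall>i j. i < j \<longrightarrow> j < n \<longrightarrow> (L ! i \<inter> L ! j \<noteq> {} \<longleftrightarrow> j = Suc i \<or> i = 0 \<and> j = n - 1)))"

lemma cycle_shape_iso:
  fixes G :: "'a hypergraph" and K :: "'b hypergraph"
  assumes G: "r_graph r G" "verts G = \<Union>(edges G)" "linear_helly (edges G)"
    and K: "r_graph r K" "verts K = \<Union>(edges K)" "linear_helly (edges K)"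
    and S: "cycle_shape (edges G) n" "cycle_shape (edges K) n"
  shows "hypergraph_iso G K"
proof -
  obtain L where L: "distinct L" "set L = edges G" "length L = n"
    "\<forall>i j. i < j \<longrightarrow> j < n \<longrightarrow> (L ! i \<inter> L ! j \<noteq> {} \<longleftrightarrow> j = Suc i \<or> i = 0 \<and> j = n - 1)"
    using S(1) unfolding cycle_shape_def by (elim exE conjE) (rule that)
  obtain M where M: "distinct M" "set M = edges K" "length M = n"
    "\<forall>i j. i < j \<longrightarrow> j < n \<longrightarrow> (M ! i \<inter> M ! j \<noteq> {} \<longleftrightarrow> j = Suc i \<or> i = 0 \<and> j = n - 1)"
    using S(2) unfolding cycle_shape_def by (elim exE conjE) (rule that)
  show ?thesis
    by (rule hypergraph_iso_lists[OF G K L(1,2) M(1,2)]) (use L(3,4) M(3,4) in simp_all)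
qed

section \<open>The cyclic case and the classification\<close>

context not_supercritical
begin

lemma linear_helly_E: "linear_helly E"
  unfolding linear_helly_def
proof (intro conjI ballI impI)
  show "x = y" if "e \<in> E" "f \<in> E" "e \<noteq> f" "x \<in> e \<inter> f" "y \<in> e \<inter> f" for e f x y
    using linear[of e f x y] that by blast
  show "e \<inter> f \<inter> g \<noteq> {}" if a: "e \<in> E" "f \<in> E" "g \<in> E" "e \<noteq> f" "e \<noteq> g" "f \<noteq> g"
    and b: "e \<inter> f \<noteq> {}" "e \<inter> g \<noteq> {}" "f \<inter> g \<noteq> {}" for e f g
  proof -
    obtain x y z where xyz: "x \<in> e" "x \<in> f" "y \<in> e" "y \<in> g" "z \<in> f" "z \<in> g" using b by blast
    have "x = y" using helly[OF a xyz] .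
    then show ?thesis using xyz by blast
  qed
qed

text \<open>The intersection graph is 2-regular and connected. In a longest walk without repetition,
  the second neighbour of the first edge lies on the walk; inner edges have both their neighbours
  next to them, so it is the last edge and the walk closes. It then contains all neighbours of its
  edges, hence everything.\<close>

lemma cyclic_cycle_shape:
  assumes S: "cyclic S"
  shows "cycle_shape E (card E)"
proof -
  define nb where "nb e = {h \<in> E - {e}. h \<inter> e \<noteq> {}}" for e
  have nb2: "\<exists>f g. f \<noteq> g \<and> nb e = {f, g}" if "e \<in> E" for e
    using cyclic_two_neighbours(2)[OF S that] unfolding nb_def .
  have nbI: "f \<in> nb e" if "e \<in> E" "f \<in> E" "e \<noteq> f" "e \<inter> f \<noteq> {}" for e f
    using that by (auto simp: nb_def)
  have nb_full: "nb e = {f, g}" if fg: "e \<in> E" "f \<in> nb e" "g \<in> nb e" "f \<noteq> g" for e f g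
  proof -
    obtain a b where ab: "a \<noteq> b" "nb e = {a, b}" using nb2[OF fg(1)] by blast
    show ?thesis using fg(2-4) unfolding ab(2) by blast
  qed
  define walk where "walk L \<longleftrightarrow> distinct L \<and> set L \<subseteq> E \<and> (\<forall>i. Suc i < length L \<longrightarrow> L ! i \<inter> L ! Suc i \<noteq> {})" for L
  have E0: "E \<noteq> {}" using card_E by auto
  have bound: "length L \<le> card E" if "walk L" for L
    using that card_mono[OF finite_E, of "set L"] by (simp add: walk_def distinct_card)
  obtain e0 where e0: "e0 \<in> E" using E0 by blast
  obtain f0 g0 where fg0: "f0 \<noteq> g0" "nb e0 = {f0, g0}" using nb2[OF e0] by blast
  have fg0': "f0 \<in> E" "g0 \<in> E" "f0 \<noteq> e0" "g0 \<noteq> e0" "f0 \<inter> e0 \<noteq> {}" "g0 \<inter> e0 \<noteq> {}"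
    using fg0(2) unfolding nb_def by blast+
  have w3: "walk [f0, e0, g0]" unfolding walk_def
    using fg0(1) fg0' e0 by (auto simp: less_Suc_eq Int_commute)
  obtain L where L: "walk L" "\<And>M. walk M \<Longrightarrow> length M \<le> length L"
    using ex_has_greatest_nat[of walk "[f0, e0, g0]" length "Suc (card E)"] w3 bound by (metis le_imp_less_Suc)
  define m where "m = length L"
  have m3: "3 \<le> m" using L(2)[OF w3] by (simp add: m_def)
  have dL: "distinct L" and LE: "\<And>i. i < m \<Longrightarrow> L ! i \<in> E" and adj: "\<And>i. Suc i < m \<Longrightarrow> L ! i \<inter> L ! Suc i \<noteq> {}"
    using L(1) by (auto simp: walk_def m_def)
  have ne: "L ! i \<noteq> L ! j" if "i < m" "j < m" "i \<noteq> j" for i j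
    using dL that by (simp add: nth_eq_iff_index_eq m_def)
  have nxt: "L ! Suc i \<in> nb (L ! i)" "L ! i \<in> nb (L ! Suc i)" if "Suc i < m" for i
    using nbI[OF LE[of i] LE[of "Suc i"]] nbI[OF LE[of "Suc i"] LE[of i]] adj[of i] ne[of i "Suc i"] that
    by (auto simp: Int_commute)
  have mid: "nb (L ! Suc i) = {L ! i, L ! Suc (Suc i)}" if "Suc (Suc i) < m" for i
    using nb_full[OF LE[of "Suc i"], of "L ! i" "L ! Suc (Suc i)"] nxt[of i] nxt[of "Suc i"] ne[of i "Suc (Suc i)"] that by simp
  obtain z where z: "nb (L ! 0) = {L ! 1, z}" "z \<noteq> L ! 1"
  proof -
    obtain a b where ab: "a \<noteq> b" "nb (L ! 0) = {a, b}" using nb2[OF LE[of 0]] m3 by auto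
    have "L ! 1 \<in> nb (L ! 0)" using nxt(1)[of 0] m3 by simp
    then show thesis using that[of a] that[of b] ab by auto
  qed
  have z': "z \<in> E" "z \<noteq> L ! 0" "z \<inter> L ! 0 \<noteq> {}" using z(1) unfolding nb_def by blast+
  have "z \<in> set L"
  proof (rule ccontr)
    assume "z \<notin> set L"
    then have "walk (z # L)" using L(1) z' m3 unfolding walk_def m_def
      by (auto simp: nth_Cons split: nat.split)
    then show False using L(2)[of "z # L"] by simp
  qed
  then obtain j where j: "j < m" "z = L ! j" by (metis in_set_conv_nth m_def)
  have j2: "j \<noteq> 0" "j \<noteq> 1" using j z(2) z'(2) by auto
  have jm: "j = m - 1"
  proof (rule ccontr)
    assume "j \<noteq> m - 1"
    obtain i where i: "j = Suc i" using j2 by (cases j) auto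
    have "nb (L ! j) = {L ! i, L ! Suc j}" using mid[of i] i j \<open>j \<noteq> m - 1\<close> by simp
    moreover have "L ! 0 \<in> nb (L ! j)" using nbI[OF LE[of j] LE[of 0]] z' j m3 by auto
    moreover have "L ! 0 \<noteq> L ! i" "L ! 0 \<noteq> L ! Suc j" using ne[of 0 i] ne[of 0 "Suc j"] i j j2 \<open>j \<noteq> m - 1\<close> by auto
    ultimately show False by blast
  qed
  have first: "nb (L ! 0) = {L ! 1, L ! (m - 1)}" using z(1) j jm by simp
  have last: "nb (L ! (m - 1)) = {L ! (m - 2), L ! 0}"
  proof (rule nb_full)
    show "L ! (m - 1) \<in> E" using LE m3 by simp
    have "Suc (m - 2) = m - 1" using m3 by simp
    then show "L ! (m - 2) \<in> nb (L ! (m - 1))" using nxt(2)[of "m - 2"] m3 by simp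
    show "L ! 0 \<in> nb (L ! (m - 1))" using nbI[OF LE[of j] LE[of 0]] z' j jm m3 by auto
    show "L ! (m - 2) \<noteq> L ! 0" using ne[of "m - 2" 0] m3 by simp
  qed
  have nbL: "nb (L ! i) = (if i = 0 then {L ! 1, L ! (m - 1)} else if i = m - 1 then {L ! (m - 2), L ! 0}
       else {L ! (i - 1), L ! Suc i})" if im: "i < m" for i
  proof -
    consider "i = 0" | "i \<noteq> 0" "i = m - 1" | "i \<noteq> 0" "Suc i < m" using im by linarith
    then show ?thesis
    proof cases
      case 1 then show ?thesis using first by simp
    next
      case 2 then show ?thesis using last by simp
    next
      case 3
      then have "i \<noteq> m - 1" by linarith
      then show ?thesis using 3 mid[of "i - 1"] by simp
    qed
  qed
  have setE: "set L = E"
  proof (rule ccontr)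
    assume n: "set L \<noteq> E"
    have "set L \<subseteq> E" "set L \<noteq> {}" using L(1) m3 by (auto simp: walk_def m_def)
    then obtain e f where ef: "e \<in> set L" "f \<in> E - set L" "e \<inter> f \<noteq> {}"
      using linkedD[OF linked_E, of "set L"] n by blast
    obtain i where i: "i < m" "e = L ! i" using ef(1) by (metis in_set_conv_nth m_def)
    have "f \<in> nb e" using nbI[of e f] ef LE i by auto
    moreover have inL: "L ! k \<in> set L" if "k < m" for k using that by (simp add: m_def)
    have "nb e \<subseteq> set L" unfolding i(2) nbL[OF i(1)]
      using i(1) m3 inL[of 0] inL[of 1] inL[of "m - 1"] inL[of "m - 2"] inL[of "i - 1"] inL[of "Suc i"] by auto
    ultimately show False using ef(2) by blast
  qed
  have cm: "card E = m" using setE dL by (metis distinct_card m_def)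
  have "L ! i \<inter> L ! j \<noteq> {} \<longleftrightarrow> j = Suc i \<or> i = 0 \<and> j = m - 1" if ij: "i < j" "j < m" for i j
  proof -
    have "L ! i \<inter> L ! j \<noteq> {} \<longleftrightarrow> L ! j \<in> nb (L ! i)"
      using LE ne[of i j] ij by (auto simp: nb_def Int_commute)
    also have "\<dots> \<longleftrightarrow> j = Suc i \<or> i = 0 \<and> j = m - 1"
    proof -
      have eq: "L ! a = L ! b \<longleftrightarrow> a = b" if "a < m" "b < m" for a b using ne that by blast
      have im: "i \<noteq> m - 1" using ij by linarith
      have e: "L ! j = L ! 1 \<longleftrightarrow> j = 1" "L ! j = L ! (m - 1) \<longleftrightarrow> j = m - 1"
        "L ! j = L ! (i - 1) \<longleftrightarrow> j = i - 1" "L ! j = L ! Suc i \<longleftrightarrow> j = Suc i"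
        by (intro eq; use ij m3 in linarith)+
      show ?thesis
      proof (cases "i = 0")
        case True
        then show ?thesis unfolding nbL[OF less_trans[OF ij]] using e(1,2) by simp
      next
        case False
        have "j \<noteq> i - 1" using ij by linarith
        then show ?thesis unfolding nbL[OF less_trans[OF ij]] using False im e(3,4) by simp
      qed
    qed
    finally show ?thesis .
  qed
  then show ?thesis unfolding cycle_shape_def cm using dL setE
    by (intro exI[of _ L]) (simp add: m_def)
qed

theorem classification:
  defines "ends \<equiv> {{0, 1}, {1}, {2}} :: nat set set"
  shows "cycle_shape E (card E) \<or> shape E (card E) [] \<or> (\<exists>J\<in>ends. shape E (card E - 1) [J]) \<or>
    (\<exists>J\<in>ends. \<exists>K\<in>ends. shape E (card E - 2) [J, mirror (card E - 2) K])"
proof (cases "\<exists>S. cyclic S")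
  case True
  then show ?thesis using cyclic_cycle_shape by blast
next
  case False
  interpret A: acyclic_family E by unfold_locales (use False in blast)
  have E0: "E \<noteq> {}" using card_E by auto
  then obtain e where e: "e \<in> E" by blast
  have "induced [e]" using e by (auto simp: induced_def)
  moreover have "length L \<le> card E" if "induced L" for L
    using that card_mono[OF finite_E, of "set L"] by (simp add: induced_def distinct_card)
  ultimately obtain P where P: "induced P" "\<And>Q. induced Q \<Longrightarrow> length Q \<le> length P"
    using ex_has_greatest_nat[of induced "[e]" length "Suc (card E)"] by (metis le_imp_less_Suc)
  have "length [e] \<le> length P" using P(2)[OF \<open>induced [e]\<close>] .
  then have "P \<noteq> []" by auto
  interpret L: longest_path E P by unfold_locales (use P \<open>P \<noteq> []\<close> in blast)+
  show ?thesis using L.shape_classification unfolding ends_def by blast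
qed

end

text \<open>If no edge of \<open>S\<close> met an edge outside \<open>S\<close>, a chain of vertices
  starting in the union of \<open>S\<close> could never leave it, but it must reach a vertex of an
  edge outside \<open>S\<close>.\<close>

lemma connected_linked:
  assumes "r_graph r G" "r \<ge> 1" "connected_hypergraph G"
  shows "linked (edges G)"
  unfolding linked_def
proof (intro allI impI, elim conjE, rule ccontr)
  fix S assume S: "S \<subseteq> edges G" "S \<noteq> {}" "S \<noteq> edges G" and n: "\<not> (\<exists>e\<in>S. \<exists>f\<in>edges G - S. e \<inter> f \<noteq> {})"
  have nonempty: "e \<noteq> {}" if "e \<in> edges G" for e using r_graph_edgeD[OF assms(1) that] assms(2) by auto
  obtain e f where e: "e \<in> S" and f: "f \<in> edges G" "f \<notin> S" using S by blast
  obtain u v where u: "u \<in> e" and v: "v \<in> f" using nonempty e f S(1) by blast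
  have "u \<in> verts G" "v \<in> verts G" using r_graph_edgeD(1)[OF assms(1)] e f S(1) u v by blast+
  then have "(u, v) \<in> {(x, y). \<exists>e\<in>edges G. x \<in> e \<and> y \<in> e}\<^sup>*"
    using assms(3) by (simp add: connected_hypergraph_def)
  then have "v \<in> \<Union>S"
  proof (induction rule: rtrancl_induct)
    case base
    then show ?case using u e by blast
  next
    case (step y z)
    then obtain g h where "g \<in> edges G" "y \<in> g" "z \<in> g" "h \<in> S" "y \<in> h" by blast
    then show ?case using n by blast
  qed
  then show False using n f v by blast
qed

text \<open>A vertex is joined to a vertex of some edge; either it is that vertex or the first step
  of the chain takes place inside an edge containing it.\<close>

lemma connected_verts:
  assumes "r_graph r G" "r \<ge> 1" "connected_hypergraph G" "edges G \<noteq> {}"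
  shows "verts G = \<Union>(edges G)"
proof
  show "\<Union>(edges G) \<subseteq> verts G" using r_graph_edgeD(1)[OF assms(1)] by blast
  show "verts G \<subseteq> \<Union>(edges G)"
  proof
    fix v assume v: "v \<in> verts G"
    obtain e where e: "e \<in> edges G" using assms(4) by blast
    have "e \<noteq> {}" using r_graph_edgeD[OF assms(1) e] assms(2) by auto
    then obtain u where u: "u \<in> e" by blast
    have "u \<in> verts G" using r_graph_edgeD(1)[OF assms(1) e] u by blast
    then have "(v, u) \<in> {(x, y). \<exists>e\<in>edges G. x \<in> e \<and> y \<in> e}\<^sup>*"
      using assms(3) v by (simp add: connected_hypergraph_def)
    then show "v \<in> \<Union>(edges G)"
      by (cases rule: converse_rtranclE) (use u e in auto)
  qed
qed

section \<open>Attached paths and extension\<close>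

text \<open>The next edge hangs on a vertex \<open>u\<close> of \<open>g\<close> other than
  \<open>v\<close>. As \<open>g\<close> meets the older edges in \<open>v\<close> only,
  \<open>u\<close> belongs to no other edge so far, and the list is a loose path starting at
  \<open>v\<close>.\<close>

fun attached :: "'a set set \<Rightarrow> 'a \<Rightarrow> 'a set list \<Rightarrow> bool" where
  "attached E v [] \<longleftrightarrow> True"
| "attached E v (g # gs) \<longleftrightarrow> finite g \<and> g \<inter> \<Union>E = {v} \<and> (\<exists>u\<in>g - {v}. attached (insert g E) u gs)"

lemma attached_Cons_notin:
  assumes "attached E v (g # gs)"
  shows "g \<notin> E"
proof
  assume "g \<in> E"
  then have "g \<subseteq> \<Union>E" by blast
  then have "g = {v}" using assms by auto
  then show False using assms by auto
qed

text \<open>Whatever involves the new edge happens at \<open>v\<close>: an old edge that meets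
  \<open>g\<close> contains \<open>v\<close> and shares nothing else with \<open>g\<close>.\<close>

lemma linear_helly_insert:
  assumes E: "linear_helly E" and g: "g \<inter> \<Union>E = {v}"
  shows "linear_helly (insert g E)"
proof -
  have m: "v \<in> e" if "e \<in> E" "e \<inter> g \<noteq> {}" for e
  proof -
    obtain x where x: "x \<in> e" "x \<in> g" using \<open>e \<inter> g \<noteq> {}\<close> by blast
    then have "x \<in> g \<inter> \<Union>E" using \<open>e \<in> E\<close> by blast
    then show ?thesis using x g by simp
  qed
  have s: "x = v" if "x \<in> g" "x \<in> e" "e \<in> E" for x e using that g by blast
  have vg: "v \<in> g" using g by blast
  show ?thesis unfolding linear_helly_def
  proof (intro conjI ballI impI)
    fix e f x y assume a: "e \<in> insert g E" "f \<in> insert g E" "e \<noteq> f" "x \<in> e \<inter> f" "y \<in> e \<inter> f"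
    consider "e = g" "f \<in> E" | "f = g" "e \<in> E" | "e \<in> E" "f \<in> E" using a(1-3) by blast
    then show "x = y"
    proof cases
      case 1 then show ?thesis using s a(4,5) by blast
    next
      case 2 then show ?thesis using s a(4,5) by blast
    next
      case 3 then show ?thesis using linear_helly_linear[OF E 3 a(3)] a(4,5) by blast
    qed
  next
    fix e f h assume a: "e \<in> insert g E" "f \<in> insert g E" "h \<in> insert g E" "e \<noteq> f" "e \<noteq> h" "f \<noteq> h"
      and b: "e \<inter> f \<noteq> {}" "e \<inter> h \<noteq> {}" "f \<inter> h \<noteq> {}"
    consider "e = g" "f \<in> E" "h \<in> E" | "f = g" "e \<in> E" "h \<in> E" | "h = g" "e \<in> E" "f \<in> E" | "e \<in> E" "f \<in> E" "h \<in> E"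
      using a by blast
    then show "e \<inter> f \<inter> h \<noteq> {}"
    proof cases
      case 1
      then have "v \<in> f" "v \<in> h" using m b by (auto simp: Int_commute)
      then show ?thesis using 1 vg by blast
    next
      case 2
      then have "v \<in> e" "v \<in> h" using m b by (auto simp: Int_commute)
      then show ?thesis using 2 vg by blast
    next
      case 3
      then have "v \<in> e" "v \<in> f" using m b by (auto simp: Int_commute)
      then show ?thesis using 3 vg by blast
    next
      case 4
      obtain x where x: "x \<in> e" "x \<in> f" using b(1) by blast
      then have "x \<in> h" using linear_helly_helly[OF E 4 a(4-6) x b(2,3)] by blast
      then show ?thesis using x by blast
    qed
  qed
qed

lemma linear_helly_attached: "linear_helly E \<Longrightarrow> attached E v gs \<Longrightarrow> linear_helly (E \<union> set gs)"
proof (induction gs arbitrary: E v)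
  case (Cons g gs)
  then obtain u where "attached (insert g E) u gs" by auto
  moreover have "linear_helly (insert g E)" using Cons.prems by (intro linear_helly_insert[of E g v]) auto
  ultimately show ?case using Cons.IH[of "insert g E" u] by simp
qed simp

lemma linked_insert:
  assumes E: "linked E" and g: "g \<inter> \<Union>E \<noteq> {}"
  shows "linked (insert g E)"
  unfolding linked_def
proof (intro allI impI, elim conjE)
  fix S assume S: "S \<subseteq> insert g E" "S \<noteq> {}" "S \<noteq> insert g E"
  obtain a where a: "a \<in> E" "a \<inter> g \<noteq> {}" using g by blast
  consider "S \<inter> E = {}" | "E \<subseteq> S" | "S \<inter> E \<noteq> {}" "S \<inter> E \<noteq> E" by blast
  then show "\<exists>e\<in>S. \<exists>f\<in>insert g E - S. e \<inter> f \<noteq> {}"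
  proof cases
    case 1
    then have "g \<in> S" "a \<in> insert g E - S" using S a by blast+
    then show ?thesis using a(2) by (metis Int_commute)
  next
    case 2
    then have "a \<in> S" "g \<in> insert g E - S" using S a by blast+
    then show ?thesis using a(2) by blast
  next
    case 3
    then obtain e f where "e \<in> S \<inter> E" "f \<in> E - S \<inter> E" "e \<inter> f \<noteq> {}"
      using linkedD[OF E, of "S \<inter> E"] by blast
    then show ?thesis by blast
  qed
qed

lemma linked_attached: "linked E \<Longrightarrow> attached E v gs \<Longrightarrow> linked (E \<union> set gs)"
proof (induction gs arbitrary: E v)
  case (Cons g gs)
  then obtain u where "attached (insert g E) u gs" by auto
  moreover have "linked (insert g E)" using Cons.prems by (intro linked_insert) auto
  ultimately show ?case using Cons.IH[of "insert g E" u] by simp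
qed simp

lemma linear_helly_single: "linear_helly {e}"
  by (auto simp: linear_helly_def)

lemma linked_single: "linked {e}"
  by (auto simp: linked_def)

lemma labelled_eq_hang1:
  assumes "labelled_eq E p" "attached E v [g]" "0 < b" "b < 1"
  shows "labelled_eq (insert g E) (\<lambda>e. if e = g then 1 - b else if v \<in> e then p e * b else p e)"
  by (rule labelled_eq_hang) (use assms attached_Cons_notin[OF assms(2)] in auto)

text \<open>\<open>f j\<close> is the share that a leg of \<open>j\<close> edges takes away from its
  root. The first edge is hung with the share \<open>f (Suc m)\<close>, where m is the length of the
  rest, and the rest lowers its label by the factor \<open>1 - f m\<close> to \<alpha>; no older
  edge contains the next hanging point.\<close>

lemma labelled_eq_attached:
  assumes "labelled_eq E p" "attached E v gs" "f 0 = 0"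
    "\<And>j. j < length gs \<Longrightarrow> 0 < f (Suc j) \<and> f (Suc j) < 1 \<and> f (Suc j) * (1 - f j) = (\<alpha> :: real)"
  shows "\<exists>q. labelled_eq (E \<union> set gs) q \<and> (\<forall>e\<in>E. q e = (if v \<in> e then p e * (1 - f (length gs)) else p e)) \<and>
    (\<forall>g\<in>set gs. q g = \<alpha>)"
  using assms(1,2,4)
proof (induction gs arbitrary: E p v)
  case Nil
  then show ?case using assms(3) by (intro exI[of _ p]) auto
next
  case (Cons g gs)
  let ?m = "length gs"
  obtain u where u: "u \<in> g" "u \<noteq> v" "attached (insert g E) u gs" using Cons.prems(2) by auto
  have g: "g \<inter> \<Union>E = {v}" "g \<notin> E" using Cons.prems(2) attached_Cons_notin[OF Cons.prems(2)] by auto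
  have f: "0 < f (Suc ?m)" "f (Suc ?m) < 1" "f (Suc ?m) * (1 - f ?m) = \<alpha>" using Cons.prems(3)[of ?m] by auto
  define p' where "p' = (\<lambda>e. if e = g then f (Suc ?m) else if v \<in> e then p e * (1 - f (Suc ?m)) else p e)"
  have "attached E v [g]" using Cons.prems(2) by auto
  then have L: "labelled_eq (insert g E) p'"
    using labelled_eq_hang1[OF Cons.prems(1), of v g "1 - f (Suc ?m)"] f by (simp add: p'_def cong: if_cong)
  have "\<exists>q. labelled_eq (insert g E \<union> set gs) q \<and> (\<forall>e\<in>insert g E. q e = (if u \<in> e then p' e * (1 - f (length gs)) else p' e)) \<and>
    (\<forall>g\<in>set gs. q g = \<alpha>)"
    by (rule Cons.IH[OF L u(3)]) (use Cons.prems(3) in auto)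
  then obtain q where q: "labelled_eq (insert g E \<union> set gs) q"
    "\<forall>e\<in>insert g E. q e = (if u \<in> e then p' e * (1 - f (length gs)) else p' e)" "\<forall>g\<in>set gs. q g = \<alpha>" by blast
  have "q g = \<alpha>" using q(2) u(1) f(3) by (simp add: p'_def)
  moreover have "q e = (if v \<in> e then p e * (1 - f (length (g # gs))) else p e)" if e: "e \<in> E" for e
  proof -
    have "u \<notin> e" "e \<noteq> g" using e u(1,2) g by blast+
    then show ?thesis using q(2) e by (simp add: p'_def)
  qed
  ultimately show ?case using q(1,3) by (intro exI[of _ q]) simp
qed

lemma attached_props:
  assumes "attached E v gs"
  shows "distinct gs" "set gs \<inter> E = {}"
    "i < length gs \<Longrightarrow> w \<in> \<Union>E \<Longrightarrow> w \<in> gs ! i \<longleftrightarrow> i = 0 \<and> w = v"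
    "i < j \<Longrightarrow> j < length gs \<Longrightarrow> gs ! i \<inter> gs ! j \<noteq> {} \<longleftrightarrow> j = Suc i"
proof -
  have "distinct gs \<and> set gs \<inter> E = {} \<and>
    (\<forall>i w. i < length gs \<longrightarrow> w \<in> \<Union>E \<longrightarrow> (w \<in> gs ! i \<longleftrightarrow> i = 0 \<and> w = v)) \<and>
    (\<forall>i j. i < j \<longrightarrow> j < length gs \<longrightarrow> (gs ! i \<inter> gs ! j \<noteq> {} \<longleftrightarrow> j = Suc i))"
    using assms
  proof (induction gs arbitrary: E v)
    case (Cons g gs)
    obtain u where u: "u \<in> g" "u \<noteq> v" "attached (insert g E) u gs" using Cons.prems by auto
    have g: "g \<inter> \<Union>E = {v}" "g \<notin> E" using Cons.prems attached_Cons_notin[OF Cons.prems] by auto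
    note IH = Cons.IH[OF u(3)]
    have D: "distinct gs" "set gs \<inter> insert g E = {}"
      using IH[THEN conjunct1] IH[THEN conjunct2, THEN conjunct1] .
    have M: "w \<in> gs ! i \<longleftrightarrow> i = 0 \<and> w = u" if "i < length gs" "w \<in> \<Union>(insert g E)" for i w
      using IH[THEN conjunct2, THEN conjunct2, THEN conjunct1, rule_format, OF that] .
    have A: "gs ! i \<inter> gs ! j \<noteq> {} \<longleftrightarrow> j = Suc i" if "i < j" "j < length gs" for i j
      using IH[THEN conjunct2, THEN conjunct2, THEN conjunct2, rule_format, OF that] .
    show ?case
    proof (intro conjI allI impI)
      show "distinct (g # gs)" "set (g # gs) \<inter> E = {}" using D g(2) by auto
    next
      fix i w assume iw: "i < length (g # gs)" "w \<in> \<Union>E"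
      show "w \<in> (g # gs) ! i \<longleftrightarrow> i = 0 \<and> w = v"
      proof (cases i)
        case 0
        have "w \<in> g \<longleftrightarrow> w \<in> g \<inter> \<Union>E" using iw(2) by blast
        then show ?thesis using 0 g(1) by simp
      next
        case (Suc k)
        have "w \<noteq> u" using iw(2) u(1,2) g(1) by blast
        moreover have "w \<in> \<Union>(insert g E)" using iw(2) by blast
        ultimately show ?thesis using M[of k w] Suc iw(1) by simp
      qed
    next
      fix i j assume ij: "i < j" "j < length (g # gs)"
      then obtain k where k: "j = Suc k" by (cases j) auto
      show "(g # gs) ! i \<inter> (g # gs) ! j \<noteq> {} \<longleftrightarrow> j = Suc i"
      proof (cases i)
        case 0
        have "g \<inter> gs ! k \<noteq> {} \<longleftrightarrow> k = 0"
        proof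
          assume "g \<inter> gs ! k \<noteq> {}"
          then obtain w where "w \<in> g" "w \<in> gs ! k" by blast
          then show "k = 0" using M[of k w] ij k by simp
        next
          assume "k = 0"
          then have "u \<in> gs ! k" using M[of k u] u(1) ij k by simp
          then show "g \<inter> gs ! k \<noteq> {}" using u(1) by blast
        qed
        then show ?thesis using 0 k by simp
      next
        case (Suc l)
        then show ?thesis using A[of l k] k ij by simp
      qed
    qed
  qed simp
  note P = this
  show "distinct gs" using P[THEN conjunct1] .
  show "set gs \<inter> E = {}" using P[THEN conjunct2, THEN conjunct1] .
  show "i < length gs \<Longrightarrow> w \<in> \<Union>E \<Longrightarrow> w \<in> gs ! i \<longleftrightarrow> i = 0 \<and> w = v"
    using P[THEN conjunct2, THEN conjunct2, THEN conjunct1, rule_format] .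
  show "i < j \<Longrightarrow> j < length gs \<Longrightarrow> gs ! i \<inter> gs ! j \<noteq> {} \<longleftrightarrow> j = Suc i"
    using P[THEN conjunct2, THEN conjunct2, THEN conjunct2, rule_format] .
qed

text \<open>One statement for two uses: with \<open>s = 0\<close> the path hangs on \<open>E\<close>
  at \<open>a 0\<close>, and with \<open>s > 0\<close> its first \<open>s\<close> edges are already
  there and \<open>E\<close> may be empty. The induction descends from \<open>s = k\<close> because
  \<open>attached\<close> unfolds at the front of the list.\<close>

lemma path_attached:
  assumes v: "0 < s \<or> a 0 \<in> \<Union>E" and s: "s \<le> k"
    and new: "\<And>i. i < k \<Longrightarrow> a (Suc i) \<notin> \<Union>E \<and> t i \<notin> \<Union>E"
    and inj: "inj_on a {..k}" "inj_on t {..<k}" "\<And>i j. i \<le> k \<Longrightarrow> j < k \<Longrightarrow> a i \<noteq> t j"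
  shows "attached (E \<union> (\<lambda>i. {a i, a (Suc i), t i}) ` {..<s}) (a s) (map (\<lambda>i. {a i, a (Suc i), t i}) [s..<k])"
  using s v
proof (induction s rule: inc_induct)
  case base
  show ?case by simp
next
  case (step s)
  let ?e = "\<lambda>i. {a i, a (Suc i), t i}"
  have neq: "a i \<noteq> a j" if "i \<le> k" "j \<le> k" "i \<noteq> j" for i j using inj(1) that by (auto simp: inj_on_def)
  have neqt: "t i \<noteq> t j" if "i < k" "j < k" "i \<noteq> j" for i j using inj(2) that by (auto simp: inj_on_def)
  have u: "[s..<k] = s # [Suc s..<k]" using step.hyps by (simp add: upt_rec)
  have n1: "a (Suc s) \<notin> \<Union>(E \<union> ?e ` {..<s})"
  proof -
    have "a (Suc s) \<notin> ?e i" if "i < s" for i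
      using neq[of "Suc s" i] neq[of "Suc s" "Suc i"] inj(3)[of "Suc s" i] that step.hyps by auto
    then show ?thesis using new[OF step.hyps(2)] by auto
  qed
  have n2: "t s \<notin> \<Union>(E \<union> ?e ` {..<s})"
  proof -
    have "t s \<notin> ?e i" if "i < s" for i
      using neqt[of s i] inj(3)[of i s] inj(3)[of "Suc i" s] that step.hyps by auto
    then show ?thesis using new[OF step.hyps(2)] by auto
  qed
  have n3: "a s \<in> \<Union>(E \<union> ?e ` {..<s})"
  proof (cases s)
    case 0
    then show ?thesis using step.prems by auto
  next
    case (Suc i)
    then have "a s \<in> ?e i" "i \<in> {..<s}" by auto
    then show ?thesis by blast
  qed
  have I: "?e s \<inter> \<Union>(E \<union> ?e ` {..<s}) = {a s}" using n1 n2 n3 by blast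
  have "E \<union> ?e ` {..<Suc s} = insert (?e s) (E \<union> ?e ` {..<s})" by (auto simp: lessThan_Suc)
  then have "attached (insert (?e s) (E \<union> ?e ` {..<s})) (a (Suc s)) (map ?e [Suc s..<k])"
    using step.IH by simp
  moreover have "a (Suc s) \<in> ?e s - {a s}" using neq[of "Suc s" s] step.hyps by auto
  ultimately show ?case unfolding u using I by (simp only: list.map attached.simps) blast
qed

text \<open>At the vertex \<open>a i\<close> the share \<open>b i\<close> stays with the earlier
  edge and \<open>1 - b i\<close> goes to the edge \<open>i\<close>; an end edge keeps the full
  share at its free end.\<close>

lemma path_labels:
  assumes inj: "inj_on a {..k}" "inj_on t {..<k}" "\<And>i j. i \<le> k \<Longrightarrow> j < k \<Longrightarrow> a i \<noteq> t j"
    and b: "\<And>i. 0 < i \<Longrightarrow> i < k \<Longrightarrow> 0 < b i \<and> b i < (1::real)" and k: "1 \<le> m" "m \<le> k"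
  shows "\<exists>p. labelled_eq ((\<lambda>i. {a i, a (Suc i), t i}) ` {..<m}) p \<and>
    (\<forall>i<m. p {a i, a (Suc i), t i} = (if i = 0 then 1 else 1 - b i) * (if Suc i < m then b (Suc i) else 1))"
  using k
proof (induction m rule: dec_induct)
  case base
  have "(\<lambda>i. {a i, a (Suc i), t i}) ` {..<1} = {{a 0, a 1, t 0}}" by (auto simp: lessThan_Suc)
  moreover have "labelled_eq {{a 0, a 1, t 0}} (\<lambda>_. 1)" by (rule labelled_eq_single) simp
  ultimately show ?case by (intro exI[of _ "\<lambda>_. 1"]) simp
next
  case (step m)
  let ?e = "\<lambda>i. {a i, a (Suc i), t i}"
  have mk: "m < k" using step.prems by simp
  obtain p where p: "labelled_eq (?e ` {..<m}) p"
    "\<forall>i<m. p (?e i) = (if i = 0 then 1 else 1 - b i) * (if Suc i < m then b (Suc i) else 1)"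
    using step.IH mk by auto
  have "attached ({} \<union> ?e ` {..<m}) (a m) (map ?e [m..<Suc m])"
    by (rule path_attached) (use step.hyps mk inj in \<open>auto intro: inj_on_subset\<close>)
  then have A: "attached (?e ` {..<m}) (a m) [?e m]" by simp
  have bm: "0 < b m" "b m < 1" using b[of m] step.hyps mk by auto
  define q where "q = (\<lambda>e. if e = ?e m then 1 - b m else if a m \<in> e then p e * b m else p e)"
  have "labelled_eq (insert (?e m) (?e ` {..<m})) q" unfolding q_def by (rule labelled_eq_hang1[OF p(1) A bm])
  moreover have "insert (?e m) (?e ` {..<m}) = ?e ` {..<Suc m}" by (auto simp: lessThan_Suc)
  moreover have "q (?e i) = (if i = 0 then 1 else 1 - b i) * (if Suc i < Suc m then b (Suc i) else 1)" if i: "i < Suc m" for i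
  proof (cases "i = m")
    case True
    then show ?thesis using step.hyps by (simp add: q_def)
  next
    case False
    then have im: "i < m" using i by simp
    have "?e m \<notin> ?e ` {..<m}" using attached_Cons_notin[OF A] .
    then have ne: "?e i \<noteq> ?e m" using im by blast
    have am: "a m \<in> ?e i \<longleftrightarrow> Suc i = m"
    proof -
      have "a m \<noteq> a i" "a m \<noteq> t i" "a m = a (Suc i) \<longleftrightarrow> m = Suc i"
        using inj_on_eq_iff[OF inj(1), of m i] inj_on_eq_iff[OF inj(1), of m "Suc i"] inj(3)[of m i] im mk by auto
      then show ?thesis by auto
    qed
    show ?thesis
    proof (cases "Suc i = m")
      case True
      have 1: "p (?e i) = (if i = 0 then 1 else 1 - b i)" using p(2)[rule_format, OF im] True by simp
      have "a m \<in> ?e i" using am True by blast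
      then have 2: "q (?e i) = p (?e i) * b m" using ne by (simp only: q_def if_False if_True)
      show ?thesis unfolding 2 1 using True im by simp
    next
      case False
      then have "a m \<notin> ?e i" using am by blast
      then have "q (?e i) = p (?e i)" using ne by (simp add: q_def)
      then show ?thesis using p(2) im False by simp
    qed
  qed
  ultimately show ?case by (intro exI[of _ q]) simp
qed

text \<open>The invariant of all constructions: it contains what reconstruction from the
  intersection graph requires and, with \<open>linked\<close>, what the strict upper bound
  requires.\<close>

definition proper :: "nat \<Rightarrow> 'a hypergraph \<Rightarrow> bool" where
  "proper r H \<longleftrightarrow> r_graph r H \<and> verts H = \<Union>(edges H) \<and> edges H \<noteq> {} \<and>
     linear_helly (edges H) \<and> linked (edges H)"

section \<open>Extension preserves intersections, labels and shapes\<close>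

definition ext_edge :: "nat hypergraph \<Rightarrow> nat set \<Rightarrow> nat set" where
  "ext_edge H e = insert (new_vertex H e) e"

lemma edges_extend: "edges (extend H) = ext_edge H ` edges H"
  by (simp add: extend_def ext_edge_def)

lemma ext_edge_props:
  assumes H: "r_graph r H"
  shows "e \<in> edges H \<Longrightarrow> v \<in> verts H \<Longrightarrow> v \<in> ext_edge H e \<longleftrightarrow> v \<in> e"
    "e \<in> edges H \<Longrightarrow> f \<in> edges H \<Longrightarrow> new_vertex H e \<in> ext_edge H f \<longleftrightarrow> e = f"
    "e \<in> edges H \<Longrightarrow> f \<in> edges H \<Longrightarrow> e \<noteq> f \<Longrightarrow> ext_edge H e \<inter> ext_edge H f = e \<inter> f"
    "inj_on (ext_edge H) (edges H)"
proof -
  have fV: "finite (verts H)" using H by (simp add: r_graph_def)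
  note fresh = new_vertex_fresh[OF fV]
  have sub: "e \<subseteq> verts H" if "e \<in> edges H" for e using r_graph_edgeD[OF H that] by simp
  have ninj: "new_vertex H e = new_vertex H f \<longleftrightarrow> e = f" if "e \<in> edges H" "f \<in> edges H" for e f
    using inj_on_new_vertex[OF H] that by (auto simp: inj_on_def)
  show "v \<in> ext_edge H e \<longleftrightarrow> v \<in> e" if "e \<in> edges H" "v \<in> verts H"
    using fresh[of e] that by (auto simp: ext_edge_def)
  show 2: "new_vertex H e \<in> ext_edge H f \<longleftrightarrow> e = f" if "e \<in> edges H" "f \<in> edges H" for e f
    using fresh[of e] sub[of f] ninj[of e f] that by (auto simp: ext_edge_def)
  show 3: "ext_edge H e \<inter> ext_edge H f = e \<inter> f" if "e \<in> edges H" "f \<in> edges H" "e \<noteq> f" for e f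
    using fresh[of e] fresh[of f] sub[of e] sub[of f] ninj[of e f] that by (auto simp: ext_edge_def)
  show "inj_on (ext_edge H) (edges H)"
  proof (rule inj_onI)
    fix e f assume ef: "e \<in> edges H" "f \<in> edges H" "ext_edge H e = ext_edge H f"
    have "new_vertex H e \<in> ext_edge H e" by (simp add: ext_edge_def)
    then show "e = f" using 2[of e f] ef by simp
  qed
qed

lemma proper_extend:
  assumes "proper r H"
  shows "proper (Suc r) (extend H)"
proof -
  have H: "r_graph r H" "verts H = \<Union>(edges H)" "edges H \<noteq> {}" "linear_helly (edges H)" "linked (edges H)"
    using assms by (auto simp: proper_def)
  note X = ext_edge_props[OF H(1)]
  have ne: "ext_edge H e \<noteq> ext_edge H f \<longleftrightarrow> e \<noteq> f" if "e \<in> edges H" "f \<in> edges H" for e f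
    using X(4) that by (auto simp: inj_on_def)
  have "linear_helly (edges (extend H))" unfolding linear_helly_def edges_extend ball_simps
  proof (intro conjI ballI impI)
    fix e f x y assume a: "e \<in> edges H" "f \<in> edges H" "ext_edge H e \<noteq> ext_edge H f"
      "x \<in> ext_edge H e \<inter> ext_edge H f" "y \<in> ext_edge H e \<inter> ext_edge H f"
    then have "e \<noteq> f" by blast
    then show "x = y" using linear_helly_linear[OF H(4) a(1,2)] a(4,5) X(3)[OF a(1,2)] by blast
  next
    fix e f g assume a: "e \<in> edges H" "f \<in> edges H" "g \<in> edges H"
      and b: "ext_edge H e \<noteq> ext_edge H f" "ext_edge H e \<noteq> ext_edge H g" "ext_edge H f \<noteq> ext_edge H g"
      and c: "ext_edge H e \<inter> ext_edge H f \<noteq> {}" "ext_edge H e \<inter> ext_edge H g \<noteq> {}" "ext_edge H f \<inter> ext_edge H g \<noteq> {}"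
    have d: "e \<noteq> f" "e \<noteq> g" "f \<noteq> g" using b by blast+
    have i: "e \<inter> f \<noteq> {}" "e \<inter> g \<noteq> {}" "f \<inter> g \<noteq> {}"
      using c X(3)[OF a(1,2) d(1)] X(3)[OF a(1,3) d(2)] X(3)[OF a(2,3) d(3)] by simp_all
    obtain x where x: "x \<in> e" "x \<in> f" using i(1) by blast
    have "x \<in> g" using linear_helly_helly[OF H(4) a d x i(2,3)] .
    then show "ext_edge H e \<inter> ext_edge H f \<inter> ext_edge H g \<noteq> {}" using x by (auto simp: ext_edge_def)
  qed
  moreover have "linked (edges (extend H))" unfolding linked_def edges_extend
  proof (intro allI impI, elim conjE)
    fix S assume S: "S \<subseteq> ext_edge H ` edges H" "S \<noteq> {}" "S \<noteq> ext_edge H ` edges H"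
    obtain T where T: "T \<subseteq> edges H" "S = ext_edge H ` T" using S(1) by (meson subset_imageE)
    have "T \<noteq> {}" "T \<noteq> edges H" using S(2,3) T(2) by auto
    then obtain e f where ef: "e \<in> T" "f \<in> edges H - T" "e \<inter> f \<noteq> {}" using linkedD[OF H(5) T(1)] by blast
    have "ext_edge H f \<notin> S" unfolding T(2) using ef(2) T(1) X(4) by (auto simp: inj_on_def)
    moreover have "ext_edge H e \<inter> ext_edge H f \<noteq> {}" using ef(3) by (auto simp: ext_edge_def)
    ultimately show "\<exists>e\<in>S. \<exists>f\<in>ext_edge H ` edges H - S. e \<inter> f \<noteq> {}" using ef T(2) by blast
  qed
  moreover have "verts (extend H) = \<Union>(edges (extend H))"
    using H(2) by (auto simp: extend_def)
  moreover have "edges (extend H) \<noteq> {}" using H(3) by (simp add: edges_extend)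
  ultimately show ?thesis using r_graph_extend(1)[OF H(1)] by (simp add: proper_def)
qed

text \<open>The weights are carried over along \<open>ext_edge\<close>. Loads at old vertices do not
  change, and the new vertex of \<open>e\<close> has the load \<open>w e\<close>.\<close>

lemma labelled_eq_extend:
  assumes H: "r_graph r H" and p: "labelled_eq (edges H) p"
  shows "\<exists>q. labelled_eq (edges (extend H)) q \<and> (\<forall>e\<in>edges H. q (ext_edge H e) = p e)"
proof -
  let ?E = "edges H" and ?x = "ext_edge H"
  note X = ext_edge_props[OF H]
  obtain w where w: "weighting ?E w" "\<And>e. e \<in> ?E \<Longrightarrow> pot ?E w e = p e" using p by (auto simp: labelled_eq_def)
  define iv where "iv = inv_into ?E ?x"
  have iv: "iv (?x e) = e" if "e \<in> ?E" for e using X(4) that by (simp add: iv_def)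
  define w' where "w' = w \<circ> iv"
  define q where "q = p \<circ> iv"
  have fr: "finite e" if "e \<in> ?E" for e using w(1) that by (simp add: weighting_def)
  have W: "weighting (?x ` ?E) w'" using w(1) iv by (auto simp: weighting_def w'_def ext_edge_def)
  have loadI: "load (?x ` ?E) w' v = (\<Sum>e\<in>{e\<in>?E. v \<in> ?x e}. w e)" for v
  proof -
    have "{e \<in> ?x ` ?E. v \<in> e} = ?x ` {e\<in>?E. v \<in> ?x e}" by blast
    then have "load (?x ` ?E) w' v = (\<Sum>e\<in>{e\<in>?E. v \<in> ?x e}. w' (?x e))"
      unfolding load_def by (simp add: sum.reindex[OF inj_on_subset[OF X(4)]])
    also have "\<dots> = (\<Sum>e\<in>{e\<in>?E. v \<in> ?x e}. w e)" using iv by (intro sum.cong) (auto simp: w'_def)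
    finally show ?thesis .
  qed
  have old: "load (?x ` ?E) w' v = load ?E w v" if "v \<in> verts H" for v
  proof -
    have "{e\<in>?E. v \<in> ?x e} = {e\<in>?E. v \<in> e}" using X(1) that by blast
    then show ?thesis unfolding loadI by (simp only: load_def)
  qed
  have new: "load (?x ` ?E) w' (new_vertex H e) = w e" if e: "e \<in> ?E" for e
  proof -
    have "{f\<in>?E. new_vertex H e \<in> ?x f} = {e}" using X(2) e by blast
    then show ?thesis by (simp add: loadI)
  qed
  have "pot (?x ` ?E) w' (?x e) = p e" if e: "e \<in> ?E" for e
  proof -
    have nv: "new_vertex H e \<notin> e"
      using new_vertex_fresh[of H e] r_graph_edgeD(1)[OF H e] H by (auto simp: r_graph_def)
    have we: "w' (?x e) = w e" using iv e by (simp add: w'_def)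
    have wp: "w e \<noteq> 0" using w(1) e by (auto simp: weighting_def)
    have "pot (?x ` ?E) w' (?x e) = (w e / w e) * (\<Prod>v\<in>e. w e / load (?x ` ?E) w' v)"
      using fr[OF e] nv new[OF e] unfolding pot_def we by (simp add: ext_edge_def)
    also have "(\<Prod>v\<in>e. w e / load (?x ` ?E) w' v) = pot ?E w e"
      unfolding pot_def using old r_graph_edgeD(1)[OF H e] by (intro prod.cong) auto
    finally show ?thesis using w(2)[OF e] wp by simp
  qed
  then have "labelled_eq (?x ` ?E) q" unfolding labelled_eq_def using W iv
    by (intro exI[of _ w']) (auto simp: q_def)
  then show ?thesis unfolding edges_extend using iv by (intro exI[of _ q]) (simp add: q_def)
qed

lemma nth_map_ext_edge_meet:
  assumes "r_graph r H" "set L \<subseteq> edges H" "set M \<subseteq> edges H" "i < length L" "j < length M" "L ! i \<noteq> M ! j"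
  shows "map (ext_edge H) L ! i \<inter> map (ext_edge H) M ! j = L ! i \<inter> M ! j"
  using ext_edge_props(3)[OF assms(1), of "L ! i" "M ! j"] assms by (auto simp: subset_iff)

lemma shape_extend:
  assumes H: "r_graph r H" and S: "shape (edges H) l Js"
  shows "shape (edges (extend H)) l Js"
proof -
  obtain P hs where P: "decorated_path (edges H) P hs" "length P = l" "map (meets P) hs = Js"
    using S unfolding shape_def by blast
  note D = decorated_pathD[OF P(1)]
  let ?x = "ext_edge H"
  have sub: "set P \<subseteq> edges H" "set hs \<subseteq> edges H" using D(2) by auto
  have dj: "P ! i \<noteq> hs ! j" if "i < length P" "j < length hs" for i j
    using D(1) that by (auto simp: in_set_conv_nth disjoint_iff)
  have ne: "P ! i \<noteq> P ! j" if "i < j" "j < length P" for i j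
    using D(1) that by (simp add: nth_eq_iff_index_eq)
  have ne': "hs ! i \<noteq> hs ! j" if "i < j" "j < length hs" for i j
    using D(1) that by (simp add: nth_eq_iff_index_eq)
  have "decorated_path (edges (extend H)) (map ?x P) (map ?x hs)"
    unfolding decorated_path_def edges_extend
  proof (intro conjI allI impI)
    have "distinct (map ?x (P @ hs))"
      unfolding distinct_map using D(1,2) ext_edge_props(4)[OF H] by simp
    then show "distinct (map ?x P @ map ?x hs)" by simp
    show "set (map ?x P @ map ?x hs) = ?x ` edges H" using D(2) by auto
  next
    fix i j :: nat assume ij: "i < j" "j < length (map ?x P)"
    then show "map ?x P ! i \<inter> map ?x P ! j \<noteq> {} \<longleftrightarrow> j = Suc i"
      using nth_map_ext_edge_meet[OF H sub(1) sub(1), of i j] ne[of i j] D(3)[of i j] by simp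
  next
    fix i j :: nat assume ij: "i < j" "j < length (map ?x hs)"
    then show "map ?x hs ! i \<inter> map ?x hs ! j = {}"
      using nth_map_ext_edge_meet[OF H sub(2) sub(2), of i j] ne'[of i j] D(4)[of i j] by simp
  qed
  moreover have "map (meets (map ?x P)) (map ?x hs) = Js"
  proof -
    have "meets (map ?x P) (?x h) = meets P h" if h: "h \<in> set hs" for h
    proof -
      obtain j where j: "j < length hs" "h = hs ! j" using h by (metis in_set_conv_nth)
      have "map ?x P ! i \<inter> ?x h = P ! i \<inter> h" if "i < length P" for i
        using nth_map_ext_edge_meet[OF H sub(1) sub(2) that j(1)] dj[OF that j(1)] j by simp
      then show ?thesis unfolding meets_def by (intro Collect_cong conj_cong) simp_all
    qed
    then show ?thesis unfolding P(3)[symmetric] by simp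
  qed
  ultimately show ?thesis unfolding shape_def using P(2) by (metis length_map)
qed

lemma cycle_shape_extend:
  assumes H: "r_graph r H" and S: "cycle_shape (edges H) n"
  shows "cycle_shape (edges (extend H)) n"
proof -
  obtain L where L: "distinct L" "set L = edges H" "length L = n"
    "\<forall>i j. i < j \<longrightarrow> j < n \<longrightarrow> (L ! i \<inter> L ! j \<noteq> {} \<longleftrightarrow> j = Suc i \<or> i = 0 \<and> j = n - 1)"
    using S unfolding cycle_shape_def by (elim exE conjE) (rule that)
  let ?x = "ext_edge H"
  have "map ?x L ! i \<inter> map ?x L ! j \<noteq> {} \<longleftrightarrow> j = Suc i \<or> i = 0 \<and> j = n - 1" if ij: "i < j" "j < n" for i j
  proof -
    have "L ! i \<noteq> L ! j" using L(1,3) ij by (simp add: nth_eq_iff_index_eq)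
    then show ?thesis using nth_map_ext_edge_meet[OF H, of L L i j] L(2-4) ij by simp
  qed
  moreover have "distinct (map ?x L)" unfolding distinct_map using L(1,2) ext_edge_props(4)[OF H] by simp
  moreover have "set (map ?x L) = edges (extend H)" by (simp add: L(2) edges_extend)
  ultimately show ?thesis unfolding cycle_shape_def using L(3) by (intro exI[of _ "map ?x L"]) simp
qed

section \<open>Shapes of hypergraphs with attached paths\<close>

lemma attached_meets:
  assumes "attached E v gs" "e \<in> E" "i < length gs"
  shows "e \<inter> gs ! i \<noteq> {} \<longleftrightarrow> i = 0 \<and> v \<in> e"
proof
  assume "e \<inter> gs ! i \<noteq> {}"
  then obtain w where w: "w \<in> e" "w \<in> gs ! i" by blast
  then have "w \<in> \<Union>E" using assms(2) by blast
  then show "i = 0 \<and> v \<in> e" using attached_props(3)[OF assms(1,3)] w by blast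
next
  assume a: "i = 0 \<and> v \<in> e"
  then have "v \<in> \<Union>E" using assms(2) by blast
  then have "v \<in> gs ! i" using attached_props(3)[OF assms(1,3)] a by blast
  then show "e \<inter> gs ! i \<noteq> {}" using a by blast
qed

definition positions :: "'a set list \<Rightarrow> 'a \<Rightarrow> nat set" where
  "positions P v = {i. i < length P \<and> v \<in> P ! i}"

lemma decorated_path_hang:
  assumes D: "decorated_path E P hs" and A: "attached E v [g]" and h: "\<forall>h\<in>set hs. v \<notin> h"
  shows "decorated_path (insert g E) P (hs @ [g])" "meets P g = positions P v"
proof -
  note DD = decorated_pathD[OF D]
  have g: "g \<notin> E" using attached_Cons_notin[OF A] .
  have m: "e \<inter> g \<noteq> {} \<longleftrightarrow> v \<in> e" if "e \<in> E" for e using attached_meets[OF A that, of 0] by simp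
  have PE: "P ! i \<in> E" if "i < length P" for i using that nth_mem[OF that] DD(2) by auto
  show "decorated_path (insert g E) P (hs @ [g])" unfolding decorated_path_def
  proof (intro conjI allI impI)
    show "distinct (P @ hs @ [g])" using DD(1,2) g by auto
    show "set (P @ hs @ [g]) = insert g E" using DD(2) by auto
    show "P ! i \<inter> P ! j \<noteq> {} \<longleftrightarrow> j = Suc i" if "i < j" "j < length P" for i j using DD(3)[OF that] .
    fix i j assume ij: "i < j" "j < length (hs @ [g])"
    show "(hs @ [g]) ! i \<inter> (hs @ [g]) ! j = {}"
    proof (cases "j < length hs")
      case True
      then show ?thesis using DD(4)[of i j] ij by (simp add: nth_append)
    next
      case False
      then have "i < length hs" "j = length hs" using ij by auto
      moreover have "hs ! i \<inter> g = {}" using m[of "hs ! i"] h \<open>i < length hs\<close> DD(2) by force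
      ultimately show ?thesis by (simp add: nth_append)
    qed
  qed
  show "meets P g = positions P v" unfolding meets_def positions_def using m PE by blast
qed

text \<open>A vertex that lies in the last path edge only is a place where the path can be
  prolonged; hung edges avoid it, so their index sets stay the same.\<close>

lemma decorated_path_append:
  assumes D: "decorated_path E P hs" and A: "attached E v gs" and h: "\<forall>h\<in>set hs. v \<notin> h"
    and p: "positions P v = {length P - 1}"
  shows "decorated_path (E \<union> set gs) (P @ gs) hs" "\<forall>h\<in>set hs. meets (P @ gs) h = meets P h"
proof -
  note DD = decorated_pathD[OF D]
  note AA = attached_props[OF A]
  have m: "e \<inter> gs ! i \<noteq> {} \<longleftrightarrow> i = 0 \<and> v \<in> e" if "e \<in> E" "i < length gs" for e i using attached_meets[OF A that] .
  have PE: "P ! i \<in> E" if "i < length P" for i using that nth_mem[OF that] DD(2) by auto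
  have hE: "h \<in> E" if "h \<in> set hs" for h using that DD(2) by auto
  have vP: "v \<in> P ! i \<longleftrightarrow> i = length P - 1" if "i < length P" for i
    using p that unfolding positions_def by (metis (mono_tags, lifting) mem_Collect_eq singleton_iff)
  show "decorated_path (E \<union> set gs) (P @ gs) hs" unfolding decorated_path_def
  proof (intro conjI allI impI)
    show "distinct ((P @ gs) @ hs)" using DD(1,2) AA(1,2) by auto
    show "set ((P @ gs) @ hs) = E \<union> set gs" using DD(2) by auto
    show "hs ! i \<inter> hs ! j = {}" if "i < j" "j < length hs" for i j using DD(4)[OF that] .
    fix i j assume ij: "i < j" "j < length (P @ gs)"
    consider "j < length P" | "i < length P" "length P \<le> j" | "length P \<le> i" by linarith
    then show "(P @ gs) ! i \<inter> (P @ gs) ! j \<noteq> {} \<longleftrightarrow> j = Suc i"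
    proof cases
      case 1
      then show ?thesis using DD(3)[OF ij(1)] ij by (simp add: nth_append)
    next
      case 2
      then have "P ! i \<inter> gs ! (j - length P) \<noteq> {} \<longleftrightarrow> j - length P = 0 \<and> i = length P - 1"
        using m[OF PE, of i "j - length P"] vP[of i] ij by auto
      also have "\<dots> \<longleftrightarrow> j = Suc i" using 2 by auto
      finally show ?thesis using 2 by (simp add: nth_append)
    next
      case 3
      then show ?thesis using AA(4)[of "i - length P" "j - length P"] ij by (auto simp: nth_append)
    qed
  qed
  show "\<forall>h\<in>set hs. meets (P @ gs) h = meets P h"
  proof
    fix x assume x: "x \<in> set hs"
    show "meets (P @ gs) x = meets P x"
    proof (intro set_eqI iffI)
      fix i assume i: "i \<in> meets (P @ gs) x"
      show "i \<in> meets P x"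
      proof (cases "i < length P")
        case True
        then show ?thesis using i by (simp add: meets_def nth_append)
      next
        case False
        then have "x \<inter> gs ! (i - length P) \<noteq> {}" "i - length P < length gs"
          using i by (auto simp: meets_def nth_append Int_commute)
        then show ?thesis using m[OF hE[OF x]] h x by blast
      qed
    next
      fix i assume "i \<in> meets P x"
      then show "i \<in> meets (P @ gs) x" by (simp add: meets_def nth_append)
    qed
  qed
qed

lemma positions_append:
  assumes A: "attached E v gs" and P: "set P \<subseteq> E" and w: "w \<in> \<Union>E"
  shows "positions (P @ gs) w = positions P w \<union> (if w = v \<and> gs \<noteq> [] then {length P} else {})"
proof (intro set_eqI)
  fix i
  consider "i < length P" | "length P \<le> i" "i < length (P @ gs)" | "\<not> i < length (P @ gs)" by linarith
  then show "i \<in> positions (P @ gs) w \<longleftrightarrow> i \<in> positions P w \<union> (if w = v \<and> gs \<noteq> [] then {length P} else {})"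
  proof cases
    case 1
    then show ?thesis by (auto simp: positions_def nth_append)
  next
    case 2
    then have "w \<in> gs ! (i - length P) \<longleftrightarrow> i - length P = 0 \<and> w = v"
      using attached_props(3)[OF A, of "i - length P" w] w by auto
    then show ?thesis using 2 by (auto simp: positions_def nth_append)
  next
    case 3
    then show ?thesis by (auto simp: positions_def)
  qed
qed

lemma positions_rev: "positions (rev P) w = mirror (length P) (positions P w)"
proof (intro set_eqI iffI)
  fix i assume "i \<in> positions (rev P) w"
  then have "i < length P" "length P - Suc i \<in> positions P w" by (auto simp: positions_def rev_nth)
  then show "i \<in> mirror (length P) (positions P w)" unfolding mirror_def
    by (intro image_eqI[of _ _ "length P - Suc i"]) auto
qed (auto simp: positions_def rev_nth mirror_def)

text \<open>Appending to the reversed path; mirroring twice at different lengths is a shift by the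
  length of the new part.\<close>

lemma decorated_path_prepend:
  assumes D: "decorated_path E P hs" and A: "attached E v gs" and h: "\<forall>h\<in>set hs. v \<notin> h"
    and p: "positions P v = {0}"
  shows "decorated_path (E \<union> set gs) (rev gs @ P) hs"
    "\<forall>h\<in>set hs. meets (rev gs @ P) h = (+) (length gs) ` meets P h"
proof -
  have "positions (rev P) v = {length (rev P) - 1}"
    unfolding positions_rev p by (simp add: mirror_def)
  note a = decorated_path_append[OF decorated_path_rev[OF D] A _ this]
  have h': "\<forall>h\<in>set (rev hs). v \<notin> h" using h by simp
  show "decorated_path (E \<union> set gs) (rev gs @ P) hs"
    using decorated_path_rev[OF a(1)[OF h']] by simp
  show "\<forall>h\<in>set hs. meets (rev gs @ P) h = (+) (length gs) ` meets P h"
  proof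
    fix x assume x: "x \<in> set hs"
    have "meets (rev (rev gs @ P)) x = meets (rev P) x" using a(2)[OF h'] x by simp
    then have "mirror (length (rev gs @ P)) (meets (rev gs @ P) x) = mirror (length P) (meets P x)"
      unfolding meets_rev_mirror .
    then have "mirror (length (rev gs @ P)) (mirror (length (rev gs @ P)) (meets (rev gs @ P) x))
        = mirror (length (rev gs @ P)) (mirror (length P) (meets P x))" by simp
    moreover have "meets (rev gs @ P) x \<subseteq> {..<length (rev gs @ P)}" by (auto simp: meets_def)
    ultimately have "meets (rev gs @ P) x = mirror (length (rev gs @ P)) (mirror (length P) (meets P x))"
      using mirror_mirror by metis
    also have "\<dots> = (+) (length gs) ` meets P x"
      unfolding mirror_def image_image by (intro image_cong) (auto simp: meets_def)
    finally show "meets (rev gs @ P) x = (+) (length gs) ` meets P x" .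
  qed
qed

lemma positions_prepend:
  assumes A: "attached E v gs" and P: "set P \<subseteq> E" and w: "w \<in> \<Union>E"
  shows "positions (rev gs @ P) w =
    (+) (length gs) ` positions P w \<union> (if w = v \<and> gs \<noteq> [] then {length gs - 1} else {})"
proof (intro set_eqI)
  fix i
  consider "i < length gs" | "length gs \<le> i" "i < length (gs @ P)" | "\<not> i < length (gs @ P)" by linarith
  then show "i \<in> positions (rev gs @ P) w \<longleftrightarrow>
    i \<in> (+) (length gs) ` positions P w \<union> (if w = v \<and> gs \<noteq> [] then {length gs - 1} else {})"
  proof cases
    case 1
    then have "w \<in> gs ! (length gs - Suc i) \<longleftrightarrow> length gs - Suc i = 0 \<and> w = v"
      using attached_props(3)[OF A, of "length gs - Suc i" w] w by auto
    then show ?thesis using 1 by (auto simp: positions_def nth_append rev_nth)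
  next
    case 2
    have "i \<in> (+) (length gs) ` positions P w \<longleftrightarrow> i - length gs \<in> positions P w"
      using 2 by (metis (no_types, lifting) add_diff_cancel_left' image_iff le_add_diff_inverse)
    moreover have "i \<in> (if w = v \<and> gs \<noteq> [] then {length gs - 1} else {}) \<longleftrightarrow> False"
      using 2 by (cases gs) auto
    moreover have "i - length gs < length P" using 2 by auto
    ultimately show ?thesis using 2 by (simp add: positions_def nth_append)
  next
    case 3
    then have "i \<in> (if w = v \<and> gs \<noteq> [] then {length gs - 1} else {}) \<longleftrightarrow> False" by (cases gs) auto
    moreover have "i \<in> (+) (length gs) ` positions P w \<longleftrightarrow> False" using 3 by (auto simp: positions_def)
    ultimately show ?thesis using 3 by (simp add: positions_def)
  qed
qed

lemma verts_A_hyp: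
  "verts (A_hyp 3 m) = {..m} \<union> (\<lambda>i. new_vertex (path_graph m) {i, Suc i}) ` {..<m}"
proof -
  have "verts (path_graph m) = {..m}" "edges (path_graph m) = (\<lambda>i. {i, Suc i}) ` {..<m}"
    by (auto simp: path_graph_def)
  moreover have "A_hyp 3 m = extend (path_graph m)" by (simp add: A_hyp_def)
  ultimately show ?thesis by (simp add: extend_def image_image)
qed

lemma attach_path_edges:
  assumes fin: "finite (verts H)" and sub: "\<Union>(edges H) \<subseteq> verts H" and v: "v \<in> \<Union>(edges H)"
  shows "\<exists>gs. attached (edges H) v gs \<and> length gs = k \<and>
    edges (attach_path 3 k v H) = edges H \<union> set gs \<and>
    (1 \<le> k \<longrightarrow> verts (attach_path 3 k v H) = verts H \<union> \<Union>(set gs)) \<and> (\<forall>g\<in>set gs. card g = 3)"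
proof -
  \<comment> \<open>All vertices of the path except the end 0 are moved beyond those of
    \<open>H\<close>. The map \<open>\<phi>\<close> is injective because its value \<open>v\<close>
    at 0 lies below \<open>M\<close>.\<close>
  define M where "M = Suc (Max (verts H))"
  define \<phi> where "\<phi> w = (if w = 0 then v else M + w)" for w
  define nv where "nv i = new_vertex (path_graph k) {i, Suc i}" for i
  define e where "e i = {\<phi> i, \<phi> (Suc i), \<phi> (nv i)}" for i
  have vM: "v < M" using Max_ge[OF fin, of v] v sub by (auto simp: M_def)
  have big: "w < M" if "w \<in> \<Union>(edges H)" for w using Max_ge[OF fin, of w] that sub by (auto simp: M_def)
  have nk: "k < nv i" for i by (simp add: nv_def new_vertex_path_graph_gt)
  have ninj: "nv i = nv j \<longleftrightarrow> i = j" for i j by (simp add: nv_def new_vertex_path_graph_eq)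
  have \<phi>inj: "\<phi> i = \<phi> j \<longleftrightarrow> i = j" for i j using vM by (auto simp: \<phi>_def)
  have n0: "nv i \<noteq> 0" for i using nk[of i] by simp
  have "attached (edges H \<union> (\<lambda>i. {\<phi> i, \<phi> (Suc i), (\<phi> \<circ> nv) i}) ` {..<0}) (\<phi> 0) (map (\<lambda>i. {\<phi> i, \<phi> (Suc i), (\<phi> \<circ> nv) i}) [0..<k])"
  proof (rule path_attached)
    show "0 < (0::nat) \<or> \<phi> 0 \<in> \<Union>(edges H)" using v by (simp add: \<phi>_def)
    show "\<phi> (Suc i) \<notin> \<Union>(edges H) \<and> (\<phi> \<circ> nv) i \<notin> \<Union>(edges H)" for i
    proof -
      have "\<not> \<phi> (Suc i) < M" "\<not> \<phi> (nv i) < M" using n0[of i] by (simp_all add: \<phi>_def)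
      then show ?thesis unfolding comp_def using big by blast
    qed
    show "inj_on \<phi> {..k}" "inj_on (\<phi> \<circ> nv) {..<k}" using \<phi>inj ninj by (auto simp: inj_on_def)
    show "\<phi> i \<noteq> (\<phi> \<circ> nv) j" if "i \<le> k" for i j using \<phi>inj nk[of j] that by auto
  qed simp
  then have A: "attached (edges H) v (map e [0..<k])" by (simp add: \<phi>_def e_def[abs_def] comp_def)
  have E: "(\<lambda>x. \<phi> ` x) ` edges (A_hyp 3 k) = set (map e [0..<k])"
    unfolding edges_A_hyp_3 by (auto simp: e_def nv_def image_image)
  have V: "\<phi> ` verts (A_hyp 3 k) = \<phi> ` {..k} \<union> (\<lambda>i. \<phi> (nv i)) ` {..<k}"
    unfolding verts_A_hyp image_Un image_image nv_def ..
  have def: "attach_path 3 k v H = \<lparr>verts = verts H \<union> \<phi> ` verts (A_hyp 3 k),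
       edges = edges H \<union> (\<lambda>e. \<phi> ` e) ` edges (A_hyp 3 k)\<rparr>"
    unfolding attach_path_def Let_def \<phi>_def[abs_def] M_def ..
  have "verts (attach_path 3 k v H) = verts H \<union> \<Union>(set (map e [0..<k]))" if k: "1 \<le> k"
  proof -
    have "\<phi> ` {..k} \<union> (\<lambda>i. \<phi> (nv i)) ` {..<k} = \<Union>(set (map e [0..<k]))"
    proof (intro set_eqI iffI)
      fix x assume "x \<in> \<phi> ` {..k} \<union> (\<lambda>i. \<phi> (nv i)) ` {..<k}"
      then consider i where "x = \<phi> i" "i \<le> k" | i where "x = \<phi> (nv i)" "i < k" by auto
      then show "x \<in> \<Union>(set (map e [0..<k]))"
      proof cases
        case (1 i)
        show ?thesis
        proof (cases "i < k")
          case True then show ?thesis using 1 by (auto simp: e_def)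
        next
          case False
          then have "i = Suc (k - 1)" "k - 1 < k" using 1 k by auto
          then have "x \<in> e (k - 1)" "e (k - 1) \<in> set (map e [0..<k])" using 1 by (auto simp: e_def)
          then show ?thesis by blast
        qed
      next
        case (2 i) then show ?thesis by (auto simp: e_def)
      qed
    next
      fix x assume "x \<in> \<Union>(set (map e [0..<k]))"
      then obtain i where i: "i < k" "x \<in> e i" by auto
      then have "x = \<phi> i \<or> x = \<phi> (Suc i) \<or> x = \<phi> (nv i)" by (simp add: e_def)
      moreover have "i \<le> k" "Suc i \<le> k" using i by auto
      ultimately show "x \<in> \<phi> ` {..k} \<union> (\<lambda>i. \<phi> (nv i)) ` {..<k}" using i(1) by auto
    qed
    then show ?thesis unfolding def using V by simp
  qed
  moreover have "card (e i) = 3" if "i < k" for i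
    using \<phi>inj nk[of i] that by (auto simp: e_def)
  moreover have "edges (attach_path 3 k v H) = edges H \<union> set (map e [0..<k])" unfolding def using E by simp
  ultimately show ?thesis using A by (intro exI[of _ "map e [0..<k]"]) auto
qed

lemma proper_attach_path:
  assumes H: "proper 3 H" and v: "v \<in> verts H" and k: "1 \<le> k"
  obtains gs where "attached (edges H) v gs" "length gs = k"
    "edges (attach_path 3 k v H) = edges H \<union> set gs" "proper 3 (attach_path 3 k v H)"
    "verts H \<subseteq> verts (attach_path 3 k v H)"
proof -
  have P: "r_graph 3 H" "verts H = \<Union>(edges H)" "edges H \<noteq> {}" "linear_helly (edges H)" "linked (edges H)"
    using H by (auto simp: proper_def)
  have fin: "finite (verts H)" using P(1) by (simp add: r_graph_def)
  obtain gs where gs: "attached (edges H) v gs" "length gs = k"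
    "edges (attach_path 3 k v H) = edges H \<union> set gs"
    "verts (attach_path 3 k v H) = verts H \<union> \<Union>(set gs)" "\<forall>g\<in>set gs. card g = 3"
    using attach_path_edges[of H v k] fin P(2) v k by auto
  have "finite g" if "g \<in> set gs" for g using gs(5) that by (metis card.infinite zero_neq_numeral)
  then have "r_graph 3 (attach_path 3 k v H)"
    using P(1) gs(3-5) by (auto simp: r_graph_def)
  moreover have "linear_helly (edges H \<union> set gs)" "linked (edges H \<union> set gs)"
    using linear_helly_attached[OF P(4) gs(1)] linked_attached[OF P(5) gs(1)] .
  ultimately have "proper 3 (attach_path 3 k v H)"
    using gs(3,4) P(2,3) by (auto simp: proper_def)
  then show thesis using that gs by blast
qed

lemma shape_path:
  assumes "attached {c} u gs" "u \<in> c" "finite c"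
  shows "decorated_path ({c} \<union> set gs) (c # gs) []"
proof -
  have "decorated_path {c} [c] []" by (simp add: decorated_path_def)
  moreover have "positions [c] u = {length [c] - 1}" using assms(2) by (auto simp: positions_def)
  ultimately have "decorated_path ({c} \<union> set gs) ([c] @ gs) []"
    using assms(1) by (intro decorated_path_append(1)[of _ _ _ u]) auto
  then show ?thesis by simp
qed

section \<open>The base path of the special hypergraphs\<close>

definition base_edge :: "nat \<Rightarrow> nat \<Rightarrow> nat set" where
  "base_edge m i = {i, Suc i, new_vertex (path_graph m) {i, Suc i}}"

definition base_path :: "nat \<Rightarrow> nat set list" where
  "base_path m = map (base_edge m) [0..<m]"

lemma base_path_simps [simp]:
  "length (base_path m) = m" "i < m \<Longrightarrow> base_path m ! i = base_edge m i"
  by (simp_all add: base_path_def)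

lemma edges_A_hyp_base: "edges (A_hyp 3 m) = base_edge m ` {..<m}"
  unfolding edges_A_hyp_3 base_edge_def atLeast0LessThan ..

lemma base_edge_mem:
  assumes "i < m"
  shows "w \<le> m \<Longrightarrow> w \<in> base_edge m i \<longleftrightarrow> w = i \<or> w = Suc i"
    "new_vertex (path_graph m) {j, Suc j} \<in> base_edge m i \<longleftrightarrow> i = j"
proof -
  have gt: "m < new_vertex (path_graph m) {l, Suc l}" for l by (rule new_vertex_path_graph_gt)
  show "w \<le> m \<Longrightarrow> w \<in> base_edge m i \<longleftrightarrow> w = i \<or> w = Suc i"
    using gt[of i] by (auto simp: base_edge_def)
  show "new_vertex (path_graph m) {j, Suc j} \<in> base_edge m i \<longleftrightarrow> i = j"
    using gt[of j] assms by (auto simp: base_edge_def new_vertex_path_graph_eq)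
qed

lemma base_inj:
  "inj_on (\<lambda>i. i) {..m}" "inj_on (\<lambda>i. new_vertex (path_graph m) {i, Suc i}) {..<m}"
  "i \<le> m \<Longrightarrow> i \<noteq> new_vertex (path_graph m) {j, Suc j}"
  using new_vertex_path_graph_gt[of m "{j, Suc j}"] by (auto simp: inj_on_def new_vertex_path_graph_eq)

lemma base_attached:
  assumes "1 \<le> m"
  shows "attached {base_edge m 0} 1 (map (base_edge m) [1..<m])"
proof -
  have "attached ({} \<union> base_edge m ` {..<1}) 1 (map (base_edge m) [1..<m])"
    unfolding base_edge_def by (rule path_attached[where a = "\<lambda>i. i"]) (use assms base_inj in auto)
  moreover have "base_edge m ` {..<1} = {base_edge m 0}" by (auto simp: lessThan_Suc)
  ultimately show ?thesis by simp
qed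

lemma base_path_Cons: "1 \<le> m \<Longrightarrow> base_path m = base_edge m 0 # map (base_edge m) [1..<m]"
  by (simp add: base_path_def upt_rec)

lemma set_base_path: "set (base_path m) = edges (A_hyp 3 m)"
  unfolding edges_A_hyp_base by (auto simp: base_path_def)

lemma edges_A_hyp_Cons:
  "1 \<le> m \<Longrightarrow> edges (A_hyp 3 m) = {base_edge m 0} \<union> set (map (base_edge m) [1..<m])"
  unfolding set_base_path[symmetric] base_path_Cons by simp

lemma base_decorated:
  assumes "1 \<le> m"
  shows "decorated_path (edges (A_hyp 3 m)) (base_path m) []"
  unfolding edges_A_hyp_Cons[OF assms] base_path_Cons[OF assms]
  by (rule shape_path[OF base_attached[OF assms]]) (simp_all add: base_edge_def)

lemma card_base_edge: "i < m \<Longrightarrow> card (base_edge m i) = 3"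
  using new_vertex_path_graph_gt[of m "{i, Suc i}"] by (auto simp: base_edge_def)

lemma proper_A_hyp:
  assumes "1 \<le> m"
  shows "proper 3 (A_hyp 3 m)"
proof -
  note V = verts_A_hyp[of m]
  have U: "verts (A_hyp 3 m) = \<Union>(edges (A_hyp 3 m))"
  proof (intro set_eqI iffI)
    fix x assume "x \<in> verts (A_hyp 3 m)"
    then consider "x < m" | "x = m" | i where "x = new_vertex (path_graph m) {i, Suc i}" "i < m"
      unfolding V by force
    then show "x \<in> \<Union>(edges (A_hyp 3 m))"
    proof cases
      case 1 then show ?thesis unfolding edges_A_hyp_base by (auto simp: base_edge_def)
    next
      case 2
      then have "x \<in> base_edge m (m - 1)" "m - 1 < m" using assms by (auto simp: base_edge_def)
      then show ?thesis unfolding edges_A_hyp_base by blast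
    next
      case 3 then show ?thesis unfolding edges_A_hyp_base by (auto simp: base_edge_def)
    qed
  next
    fix x assume "x \<in> \<Union>(edges (A_hyp 3 m))"
    then obtain i where "i < m" "x \<in> base_edge m i" unfolding edges_A_hyp_base by blast
    then show "x \<in> verts (A_hyp 3 m)" unfolding V by (auto simp: base_edge_def)
  qed
  have "r_graph 3 (A_hyp 3 m)" unfolding r_graph_def
  proof (intro conjI ballI)
    show "finite (verts (A_hyp 3 m))" unfolding V by simp
    fix e assume e: "e \<in> edges (A_hyp 3 m)"
    then show "e \<subseteq> verts (A_hyp 3 m)" unfolding U by blast
    show "card e = 3" using e card_base_edge unfolding edges_A_hyp_base by auto
  qed
  moreover have "linear_helly (edges (A_hyp 3 m))" "linked (edges (A_hyp 3 m))"
    unfolding edges_A_hyp_Cons[OF assms]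
    using linear_helly_attached[OF linear_helly_single base_attached[OF assms]]
      linked_attached[OF linked_single base_attached[OF assms]] by simp_all
  moreover have "edges (A_hyp 3 m) \<noteq> {}" unfolding edges_A_hyp_Cons[OF assms] by simp
  ultimately show ?thesis using U by (simp add: proper_def)
qed

lemma verts_A_hyp_mem:
  assumes "1 \<le> m"
  shows "w \<le> m \<Longrightarrow> w \<in> verts (A_hyp 3 m)" "first_tip m \<in> verts (A_hyp 3 m)" "last_tip m \<in> verts (A_hyp 3 m)"
proof -
  note V = verts_A_hyp[of m]
  show "w \<le> m \<Longrightarrow> w \<in> verts (A_hyp 3 m)" unfolding V by simp
  show "first_tip m \<in> verts (A_hyp 3 m)" unfolding V first_tip_def using assms by force
  have "Suc (m - 1) = m" "m - 1 < m" using assms by auto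
  then have "last_tip m = new_vertex (path_graph m) {m - 1, Suc (m - 1)}" by (simp add: last_tip_def)
  then show "last_tip m \<in> verts (A_hyp 3 m)" unfolding V using \<open>m - 1 < m\<close> by blast
qed

lemma base_mem:
  assumes "1 \<le> m" "i < m"
  shows "0 \<in> base_edge m i \<longleftrightarrow> i = 0" "m \<in> base_edge m i \<longleftrightarrow> i = m - 1"
    "first_tip m \<in> base_edge m i \<longleftrightarrow> i = 0" "last_tip m \<in> base_edge m i \<longleftrightarrow> i = m - 1"
proof -
  show "0 \<in> base_edge m i \<longleftrightarrow> i = 0" "m \<in> base_edge m i \<longleftrightarrow> i = m - 1"
    using base_edge_mem(1)[OF assms(2), of 0] base_edge_mem(1)[OF assms(2), of m] assms by auto
  show "first_tip m \<in> base_edge m i \<longleftrightarrow> i = 0"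
    using base_edge_mem(2)[OF assms(2), of 0] by (simp add: first_tip_def)
  have "Suc (m - 1) = m" using assms by auto
  then have "last_tip m = new_vertex (path_graph m) {m - 1, Suc (m - 1)}" by (simp add: last_tip_def)
  then show "last_tip m \<in> base_edge m i \<longleftrightarrow> i = m - 1" using base_edge_mem(2)[OF assms(2), of "m - 1"] by auto
qed

lemma base_positions:
  assumes "1 \<le> m"
  shows "positions (base_path m) 0 = {0}" "positions (base_path m) m = {m - 1}"
    "positions (base_path m) (first_tip m) = {0}" "positions (base_path m) (last_tip m) = {m - 1}"
  using assms base_mem[OF assms] unfolding positions_def by auto

lemma tips_distinct:
  assumes "2 \<le> m"
  shows "0 \<noteq> first_tip m" "0 \<noteq> m" "0 \<noteq> last_tip m" "first_tip m \<noteq> m" "first_tip m \<noteq> last_tip m" "m \<noteq> last_tip m"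
proof -
  have gt: "m < first_tip m" "m < last_tip m"
    unfolding first_tip_def last_tip_def by (rule new_vertex_path_graph_gt)+
  then show "0 \<noteq> first_tip m" "0 \<noteq> m" "0 \<noteq> last_tip m" "first_tip m \<noteq> m" "m \<noteq> last_tip m" using assms by auto
  have "first_tip m \<in> base_edge m 0" "last_tip m \<notin> base_edge m 0" using base_mem[of m 0] assms by auto
  then show "first_tip m \<noteq> last_tip m" by auto
qed

section \<open>Labels of attached paths\<close>

lemma attached_notin:
  assumes "attached E v gs" "w \<in> \<Union>E" "w \<noteq> v" "g \<in> set gs"
  shows "w \<notin> g"
  using attached_props(3)[OF assms(1) _ assms(2)] assms(3,4) by (metis in_set_conv_nth)

lemma decorated_path_subset: "decorated_path E P hs \<Longrightarrow> set P \<subseteq> E"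
  using decorated_pathD(2) by auto

text \<open>The first pendant edge prolongs the path to the left, and the second becomes the hung
  edge, at the old first edge, which now has index 1.\<close>

lemma left_end_1_1:
  assumes D: "decorated_path E B []" and A: "attached E v gs" "attached (E \<union> set gs) w hs" "length gs = 1" "length hs = 1"
    and p: "positions B v = {0}" "positions B w = {0}" "v \<in> \<Union>E" "w \<in> \<Union>E" "v \<noteq> w"
  shows "\<exists>L h. decorated_path (E \<union> set gs \<union> set hs) (L @ B) [h] \<and> length L = 1 \<and> meets (L @ B) h = {1} \<and>
    (\<forall>u\<in>\<Union>E. u \<noteq> v \<longrightarrow> u \<noteq> w \<longrightarrow> positions (L @ B) u = (+) 1 ` positions B u \<and> u \<notin> h)"
proof -
  obtain h where h: "hs = [h]" using A(4) by (auto simp: length_Suc_conv)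
  have D1: "decorated_path (E \<union> set gs) (rev gs @ B) []" using decorated_path_prepend(1)[OF D A(1) _ p(1)] by simp
  have pos: "positions (rev gs @ B) u = (+) 1 ` positions B u" if "u \<in> \<Union>E" "u \<noteq> v" for u
    using positions_prepend[OF A(1) decorated_path_subset[OF D] that(1)] that(2) A(3) by simp
  have A2: "attached (E \<union> set gs) w [h]" using A(2) h by simp
  note H = decorated_path_hang[OF D1 A2]
  have "decorated_path (E \<union> set gs \<union> set hs) (rev gs @ B) [h]" using H(1) h by simp
  moreover have "meets (rev gs @ B) h = {1}" using H(2) pos[OF p(4)] p(2,5) by simp
  moreover have "u \<notin> h" if "u \<in> \<Union>E" "u \<noteq> w" for u
    using attached_notin[OF A2, of u h] that by auto
  ultimately show ?thesis using pos A(3) by (intro exI[of _ "rev gs"] exI[of _ h]) simp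
qed

text \<open>Here the leg of two edges prolongs the path, and the pendant edge stays on the old first
  edge, which moves to index 2; this matches the position {2} of the classification.\<close>

lemma left_end_1_2:
  assumes D: "decorated_path E B []" and A: "attached E v gs" "attached (E \<union> set gs) w hs" "length gs = 1" "length hs = 2"
    and p: "positions B v = {0}" "positions B w = {0}" "v \<in> \<Union>E" "w \<in> \<Union>E" "v \<noteq> w"
  shows "\<exists>L h. decorated_path (E \<union> set gs \<union> set hs) (L @ B) [h] \<and> length L = 2 \<and> meets (L @ B) h = {2} \<and>
    (\<forall>u\<in>\<Union>E. u \<noteq> v \<longrightarrow> u \<noteq> w \<longrightarrow> positions (L @ B) u = (+) 2 ` positions B u \<and> u \<notin> h)"
proof -
  obtain h where h: "gs = [h]" using A(3) by (auto simp: length_Suc_conv)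
  have A1: "attached E v [h]" using A(1) h by simp
  note H = decorated_path_hang[OF D A1]
  have D1: "decorated_path (E \<union> set gs) B [h]" using H(1) h by simp
  have n: "u \<notin> h" if "u \<in> \<Union>E" "u \<noteq> v" for u using attached_notin[OF A1, of u h] that by auto
  have wh: "\<forall>x\<in>set [h]. w \<notin> x" using n p(4,5) by simp
  note Q = decorated_path_prepend[OF D1 A(2) wh p(2)]
  have "meets (rev hs @ B) h = {2}" using Q(2) H(2) p(1) A(4) by simp
  moreover have "positions (rev hs @ B) u = (+) 2 ` positions B u" if "u \<in> \<Union>E" "u \<noteq> w" for u
  proof -
    have "set B \<subseteq> E \<union> set gs" "u \<in> \<Union>(E \<union> set gs)" using decorated_path_subset[OF D] that(1) by auto
    then show ?thesis using positions_prepend[OF A(2)] that(2) A(4) by simp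
  qed
  ultimately show ?thesis using Q(1) n A(4) by (intro exI[of _ "rev hs"] exI[of _ h]) simp
qed

text \<open>Both pendant edges contain \<open>v\<close>. Once the first has prolonged the path, the
  second meets it as well as the old first edge, hence the double index.\<close>

lemma left_end_double:
  assumes D: "decorated_path E B []" and A: "attached E v gs" "attached (E \<union> set gs) v hs" "length gs = 1" "length hs = 1"
    and p: "positions B v = {0}" "v \<in> \<Union>E"
  shows "\<exists>L h. decorated_path (E \<union> set gs \<union> set hs) (L @ B) [h] \<and> length L = 1 \<and> meets (L @ B) h = {0, 1} \<and>
    (\<forall>u\<in>\<Union>E. u \<noteq> v \<longrightarrow> positions (L @ B) u = (+) 1 ` positions B u \<and> u \<notin> h)"
proof -
  obtain h where h: "hs = [h]" using A(4) by (auto simp: length_Suc_conv)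
  have D1: "decorated_path (E \<union> set gs) (rev gs @ B) []" using decorated_path_prepend(1)[OF D A(1) _ p(1)] by simp
  have A2: "attached (E \<union> set gs) v [h]" using A(2) h by simp
  note H = decorated_path_hang[OF D1 A2]
  have pos: "positions (rev gs @ B) u = (+) 1 ` positions B u \<union> (if u = v then {0} else {})" if "u \<in> \<Union>E" for u
    using positions_prepend[OF A(1) decorated_path_subset[OF D] that] A(3) by auto
  have "decorated_path (E \<union> set gs \<union> set hs) (rev gs @ B) [h]" using H(1) h by simp
  moreover have "meets (rev gs @ B) h = {0, 1}" using H(2) pos[OF p(2)] p(1) by auto
  moreover have "u \<notin> h" if "u \<in> \<Union>E" "u \<noteq> v" for u
    using attached_notin[OF A2, of u h] that by auto
  ultimately show ?thesis using pos A(3) by (intro exI[of _ "rev gs"] exI[of _ h]) simp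
qed

lemma right_end_1_1:
  assumes D: "decorated_path E P [g]" and A: "attached E v gs" "attached (E \<union> set gs) w hs" "length gs = 1" "length hs = 1"
    and p: "positions P v = {length P - 1}" "positions P w = {length P - 1}" "v \<in> \<Union>E" "w \<in> \<Union>E" "v \<noteq> w" "v \<notin> g" "w \<notin> g"
  shows "\<exists>R h. decorated_path (E \<union> set gs \<union> set hs) (P @ R) [g, h] \<and> length R = 1 \<and>
    meets (P @ R) g = meets P g \<and> meets (P @ R) h = {length P - 1}"
proof -
  obtain h where h: "hs = [h]" using A(4) by (auto simp: length_Suc_conv)
  have vg: "\<forall>x\<in>set [g]. v \<notin> x" and wg: "\<forall>x\<in>set [g]. w \<notin> x" using p(6,7) by simp_all
  note Q = decorated_path_append[OF D A(1) vg p(1)]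
  have A2: "attached (E \<union> set gs) w [h]" using A(2) h by simp
  note H = decorated_path_hang[OF Q(1) A2 wg]
  have "positions (P @ gs) w = positions P w"
    using positions_append[OF A(1) decorated_path_subset[OF D] p(4)] p(5) by simp
  then show ?thesis using H Q(2) A(3) p(2) h by (intro exI[of _ gs] exI[of _ h]) simp
qed

lemma right_end_1_2:
  assumes D: "decorated_path E P [g]" and A: "attached E v gs" "attached (E \<union> set gs) w hs" "length gs = 1" "length hs = 2"
    and p: "positions P v = {length P - 1}" "positions P w = {length P - 1}" "v \<in> \<Union>E" "w \<in> \<Union>E" "v \<noteq> w" "v \<notin> g" "w \<notin> g"
  shows "\<exists>R h. decorated_path (E \<union> set gs \<union> set hs) (P @ R) [g, h] \<and> length R = 2 \<and>
    meets (P @ R) g = meets P g \<and> meets (P @ R) h = {length P - 1}"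
proof -
  obtain h where h: "gs = [h]" using A(3) by (auto simp: length_Suc_conv)
  have vg: "\<forall>x\<in>set [g]. v \<notin> x" using p(6) by simp
  have A1: "attached E v [h]" using A(1) h by simp
  note H = decorated_path_hang[OF D A1 vg]
  have "w \<notin> h" using attached_notin[OF A1, of w h] p(4,5) by auto
  then have wg: "\<forall>x\<in>set ([g] @ [h]). w \<notin> x" using p(7) by simp
  have A2: "attached (insert h E) w hs" using A(2) h by simp
  note Q = decorated_path_append[OF H(1) A2 wg p(2)]
  have "insert h E \<union> set hs = E \<union> set gs \<union> set hs" using h by auto
  then show ?thesis using Q H(2) p(1) A(4) by (intro exI[of _ hs] exI[of _ h]) simp
qed

lemma right_end_double:
  assumes D: "decorated_path E P [g]" and A: "attached E v gs" "attached (E \<union> set gs) v hs" "length gs = 1" "length hs = 1"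
    and p: "positions P v = {length P - 1}" "v \<in> \<Union>E" "v \<notin> g"
  shows "\<exists>R h. decorated_path (E \<union> set gs \<union> set hs) (P @ R) [g, h] \<and> length R = 1 \<and>
    meets (P @ R) g = meets P g \<and> meets (P @ R) h = {length P - 1, length P}"
proof -
  obtain h where h: "hs = [h]" using A(4) by (auto simp: length_Suc_conv)
  have vg: "\<forall>x\<in>set [g]. v \<notin> x" using p(3) by simp
  note Q = decorated_path_append[OF D A(1) vg p(1)]
  have A2: "attached (E \<union> set gs) v [h]" using A(2) h by simp
  note H = decorated_path_hang[OF Q(1) A2 vg]
  have "positions (P @ gs) v = {length P - 1, length P}"
    using positions_append[OF A(1) decorated_path_subset[OF D] p(2)] p(1) A(3) by auto
  then show ?thesis using H Q(2) A(3) h by (intro exI[of _ gs] exI[of _ h]) simp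
qed

text \<open>Bookkeeping for a labelling under construction: edges outside \<open>F\<close> have
  received their final label \<alpha>, those of the core \<open>F\<close> are still affected by what
  is attached next.\<close>

definition lab :: "'a set set \<Rightarrow> 'a set set \<Rightarrow> real \<Rightarrow> ('a set \<Rightarrow> real) \<Rightarrow> bool" where
  "lab E F \<alpha> r \<longleftrightarrow> F \<subseteq> E \<and> labelled_eq E (\<lambda>e. if e \<in> F then r e else \<alpha>)"

lemma lab_init: "labelled_eq E p \<Longrightarrow> lab E E \<alpha> p"
  unfolding lab_def by (auto elim: labelled_eq_cong)

lemma lab_leg:
  assumes L: "lab E F \<alpha> r" and A: "attached E v gs" "length gs = k" and v: "\<And>e. e \<in> E - F \<Longrightarrow> v \<notin> e"
    and f: "f 0 = 0" "\<And>j. j < k \<Longrightarrow> 0 < f (Suc j) \<and> f (Suc j) < 1 \<and> f (Suc j) * (1 - f j) = \<alpha>"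
  shows "lab (E \<union> set gs) F \<alpha> (\<lambda>e. if v \<in> e then r e * (1 - f k) else r e)"
proof -
  have F: "F \<subseteq> E" and p: "labelled_eq E (\<lambda>e. if e \<in> F then r e else \<alpha>)" using L by (auto simp: lab_def)
  obtain q where q: "labelled_eq (E \<union> set gs) q"
    "\<forall>e\<in>E. q e = (if v \<in> e then (if e \<in> F then r e else \<alpha>) * (1 - f (length gs)) else (if e \<in> F then r e else \<alpha>))"
    "\<forall>g\<in>set gs. q g = \<alpha>"
    using labelled_eq_attached[OF p A(1), of f \<alpha>] f A(2) by auto
  have "set gs \<inter> E = {}" using attached_props(2)[OF A(1)] .
  then have "labelled_eq (E \<union> set gs) (\<lambda>e. if e \<in> F then if v \<in> e then r e * (1 - f k) else r e else \<alpha>)"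
  proof (intro labelled_eq_cong[OF q(1)])
    fix e assume d: "set gs \<inter> E = {}" and e: "e \<in> E \<union> set gs"
    consider "e \<in> F" | "e \<in> E" "e \<notin> F" | "e \<in> set gs" "e \<notin> F" "e \<notin> E" using e d F by blast
    then show "q e = (if e \<in> F then if v \<in> e then r e * (1 - f k) else r e else \<alpha>)"
    proof cases
      case 1 then show ?thesis using q(2) F A(2) by auto
    next
      case 2 then show ?thesis using q(2) v by simp
    next
      case 3 then show ?thesis using q(3) by simp
    qed
  qed
  then show ?thesis using F by (auto simp: lab_def)
qed

text \<open>
  The first of two pendant edges at the same vertex \<open>v\<close> gets the label \<open>\<alpha> / (1 - \<alpha>)\<close> there, so
  that the second one turns it into \<open>\<alpha>\<close>; the old edges at \<open>v\<close> are left with \<open>1 - 2 \<alpha>\<close>.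
\<close>
lemma lab_double:
  assumes L: "lab E F \<alpha> r" and A: "attached E v gs" "attached (E \<union> set gs) v hs" "length gs = 1" "length hs = 1"
    and v: "\<And>e. e \<in> E - F \<Longrightarrow> v \<notin> e" and \<alpha>: "0 < \<alpha>" "\<alpha> < 1/2"
  shows "lab (E \<union> set gs \<union> set hs) F \<alpha> (\<lambda>e. if v \<in> e then r e * (1 - 2 * \<alpha>) else r e)"
proof -
  obtain g h where gh: "gs = [g]" "hs = [h]" using A(3,4) by (auto simp: length_Suc_conv)
  have F: "F \<subseteq> E" and p: "labelled_eq E (\<lambda>e. if e \<in> F then r e else \<alpha>)" using L by (auto simp: lab_def)
  define b where "b = (1 - 2 * \<alpha>) / (1 - \<alpha>)"
  have b: "0 < b" "b < 1" "b * (1 - \<alpha>) = 1 - 2 * \<alpha>" "(1 - b) * (1 - \<alpha>) = \<alpha>"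
    using \<alpha> by (auto simp: b_def field_simps)
  have A1: "attached E v [g]" and A2: "attached (insert g E) v [h]" using A(1,2) gh by auto
  have g: "g \<notin> E" "v \<in> g" and h: "h \<notin> insert g E" using attached_Cons_notin[OF A1] attached_Cons_notin[OF A2] A1 by auto
  define p1 where "p1 = (\<lambda>e. if e = g then 1 - b else if v \<in> e then (if e \<in> F then r e else \<alpha>) * b else (if e \<in> F then r e else \<alpha>))"
  have L1: "labelled_eq (insert g E) p1" unfolding p1_def by (rule labelled_eq_hang1[OF p A1 b(1,2)])
  define p2 where "p2 = (\<lambda>e. if e = h then 1 - (1 - \<alpha>) else if v \<in> e then p1 e * (1 - \<alpha>) else p1 e)"
  have L2: "labelled_eq (insert h (insert g E)) p2" unfolding p2_def
    by (rule labelled_eq_hang1[OF L1 A2]) (use \<alpha> in auto)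
  have "labelled_eq (insert h (insert g E)) (\<lambda>e. if e \<in> F then if v \<in> e then r e * (1 - 2 * \<alpha>) else r e else \<alpha>)"
  proof (rule labelled_eq_cong[OF L2])
    fix e assume e: "e \<in> insert h (insert g E)"
    consider "e = h" "e \<notin> F" | "e = g" "e \<notin> F" "e \<noteq> h" | "e \<in> F" "e \<noteq> g" "e \<noteq> h" | "e \<in> E - F" "e \<noteq> g" "e \<noteq> h"
      using e g h F by blast
    then show "p2 e = (if e \<in> F then if v \<in> e then r e * (1 - 2 * \<alpha>) else r e else \<alpha>)"
    proof cases
      case 1 then show ?thesis by (simp add: p2_def)
    next
      case 2 then show ?thesis using g(2) b(4) by (simp add: p2_def p1_def)
    next
      case 3
      then have "r e * b * (1 - \<alpha>) = r e * (1 - 2 * \<alpha>)" using b(3) by (simp add: mult.assoc)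
      then show ?thesis using 3 by (simp add: p2_def p1_def)
    next
      case 4 then show ?thesis using v[of e] by (simp add: p2_def p1_def)
    qed
  qed
  moreover have "insert h (insert g E) = E \<union> set gs \<union> set hs" using gh by auto
  ultimately show ?thesis using F by (auto simp: lab_def)
qed

lemma base_lab:
  assumes m: "1 \<le> m" and b: "\<And>i. 0 < i \<Longrightarrow> i < m \<Longrightarrow> 0 < b i \<and> b i < (1::real)"
  shows "\<exists>r. lab (edges (A_hyp 3 m)) (edges (A_hyp 3 m)) \<alpha> r \<and>
    (\<forall>i<m. r (base_edge m i) = (if i = 0 then 1 else 1 - b i) * (if Suc i < m then b (Suc i) else 1))"
proof -
  have "\<exists>p. labelled_eq ((\<lambda>i. {i, Suc i, new_vertex (path_graph m) {i, Suc i}}) ` {..<m}) p \<and>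
    (\<forall>i<m. p {i, Suc i, new_vertex (path_graph m) {i, Suc i}} = (if i = 0 then 1 else 1 - b i) * (if Suc i < m then b (Suc i) else 1))"
    by (rule path_labels[where a = "\<lambda>i. i" and k = m]) (use m b base_inj in auto)
  then show ?thesis unfolding edges_A_hyp_base base_edge_def using lab_init by blast
qed

section \<open>The special hypergraphs\<close>

lemma two_attached_paths:
  assumes H: "proper 3 H" and v: "v \<in> verts H" "w \<in> verts H" and k: "1 \<le> i" "1 \<le> j"
  obtains gs hs where "attached (edges H) v gs" "attached (edges H \<union> set gs) w hs" "length gs = i" "length hs = j"
    "edges (attach_path 3 j w (attach_path 3 i v H)) = edges H \<union> set gs \<union> set hs"
    "proper 3 (attach_path 3 j w (attach_path 3 i v H))"
    "verts H \<subseteq> verts (attach_path 3 j w (attach_path 3 i v H))"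
proof -
  let ?K = "attach_path 3 i v H"
  obtain gs where gs: "attached (edges H) v gs" "length gs = i" "edges ?K = edges H \<union> set gs" "proper 3 ?K" "verts H \<subseteq> verts ?K"
    by (rule proper_attach_path[OF H v(1) k(1)])
  have w: "w \<in> verts ?K" using gs(5) v(2) by blast
  obtain hs where hs: "attached (edges ?K) w hs" "length hs = j" "edges (attach_path 3 j w ?K) = edges ?K \<union> set hs"
    "proper 3 (attach_path 3 j w ?K)" "verts ?K \<subseteq> verts (attach_path 3 j w ?K)"
    by (rule proper_attach_path[OF gs(4) w k(2)])
  show thesis
    by (rule that[of gs hs]) (use gs hs in auto)
qed

text \<open>This is what the right end needs to know about a finished left end: where its attaching
  vertices \<open>m\<close> and \<open>last_tip m\<close> lie on the prolonged path, and that the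
  hung edge avoids them.\<close>

definition left_end :: "nat set set \<Rightarrow> nat \<Rightarrow> nat \<Rightarrow> nat set \<Rightarrow> bool" where
  "left_end E m a J \<longleftrightarrow> (\<exists>L h. decorated_path E (L @ base_path m) [h] \<and> length L = a \<and>
     meets (L @ base_path m) h = J \<and>
     (\<forall>u\<in>{m, last_tip m}. positions (L @ base_path m) u = {a + m - 1} \<and> u \<notin> h))"

lemma proper_verts: "proper r H \<Longrightarrow> verts H = \<Union>(edges H)"
  by (simp add: proper_def)

lemma A_hyp_mem:
  assumes "1 \<le> m"
  shows "0 \<in> \<Union>(edges (A_hyp 3 m))" "m \<in> \<Union>(edges (A_hyp 3 m))"
    "first_tip m \<in> \<Union>(edges (A_hyp 3 m))" "last_tip m \<in> \<Union>(edges (A_hyp 3 m))"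
  using verts_A_hyp_mem[OF assms] unfolding proper_verts[OF proper_A_hyp[OF assms]] by simp_all

lemma left_endI:
  assumes m: "2 \<le> m" and ex: "\<exists>L h. decorated_path E (L @ base_path m) [h] \<and> length L = a \<and> meets (L @ base_path m) h = J \<and>
    (\<forall>u\<in>\<Union>(edges (A_hyp 3 m)). Q u \<longrightarrow> positions (L @ base_path m) u = (+) a ` positions (base_path m) u \<and> u \<notin> h)"
    and Q: "Q m" "Q (last_tip m)"
  shows "left_end E m a J"
proof -
  obtain L h where Lh: "decorated_path E (L @ base_path m) [h]" "length L = a" "meets (L @ base_path m) h = J"
    "\<forall>u\<in>\<Union>(edges (A_hyp 3 m)). Q u \<longrightarrow> positions (L @ base_path m) u = (+) a ` positions (base_path m) u \<and> u \<notin> h"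
    using ex by (elim exE conjE) (rule that)
  have m1: "1 \<le> m" using m by simp
  have am: "a + (m - 1) = a + m - 1" using m by simp
  have "positions (L @ base_path m) m = {a + m - 1} \<and> m \<notin> h"
    using Lh(4)[rule_format, OF A_hyp_mem(2)[OF m1] Q(1)] base_positions(2)[OF m1] am by simp
  moreover have "positions (L @ base_path m) (last_tip m) = {a + m - 1} \<and> last_tip m \<notin> h"
    using Lh(4)[rule_format, OF A_hyp_mem(4)[OF m1] Q(2)] base_positions(4)[OF m1] am by simp
  ultimately have X: "\<forall>u\<in>{m, last_tip m}. positions (L @ base_path m) u = {a + m - 1} \<and> u \<notin> h" by blast
  show ?thesis unfolding left_end_def by (rule exI[of _ L], rule exI[of _ h], intro conjI Lh(1-3) X)
qed

lemma left_end_base: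
  assumes m: "2 \<le> m"
  shows "attached (edges (A_hyp 3 m)) 0 gs \<Longrightarrow> attached (edges (A_hyp 3 m) \<union> set gs) (first_tip m) hs \<Longrightarrow>
      length gs = 1 \<Longrightarrow> length hs = 1 \<Longrightarrow> left_end (edges (A_hyp 3 m) \<union> set gs \<union> set hs) m 1 {1}"
    and "attached (edges (A_hyp 3 m)) 0 gs \<Longrightarrow> attached (edges (A_hyp 3 m) \<union> set gs) (first_tip m) hs \<Longrightarrow>
      length gs = 1 \<Longrightarrow> length hs = 2 \<Longrightarrow> left_end (edges (A_hyp 3 m) \<union> set gs \<union> set hs) m 2 {2}"
    and "attached (edges (A_hyp 3 m)) 0 gs \<Longrightarrow> attached (edges (A_hyp 3 m) \<union> set gs) 0 hs \<Longrightarrow>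
      length gs = 1 \<Longrightarrow> length hs = 1 \<Longrightarrow> left_end (edges (A_hyp 3 m) \<union> set gs \<union> set hs) m 1 {0, 1}"
proof -
  have m1: "1 \<le> m" using m by simp
  note D = base_decorated[OF m1] and p = base_positions[OF m1] and M = A_hyp_mem[OF m1] and t = tips_distinct[OF m]
  assume A: "attached (edges (A_hyp 3 m)) 0 gs"
  { assume "attached (edges (A_hyp 3 m) \<union> set gs) (first_tip m) hs" "length gs = 1" "length hs = 1"
    from left_end_1_1[OF D A this p(1,3) M(1,3) t(1)]
    have "\<exists>L h. decorated_path (edges (A_hyp 3 m) \<union> set gs \<union> set hs) (L @ base_path m) [h] \<and> length L = 1 \<and> meets (L @ base_path m) h = {1} \<and>
      (\<forall>u\<in>\<Union>(edges (A_hyp 3 m)). u \<noteq> 0 \<and> u \<noteq> first_tip m \<longrightarrow> positions (L @ base_path m) u = (+) 1 ` positions (base_path m) u \<and> u \<notin> h)"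
      unfolding imp_conjL .
    then show "left_end (edges (A_hyp 3 m) \<union> set gs \<union> set hs) m 1 {1}"
      by (rule left_endI[OF m]) (use t in auto) }
  { assume "attached (edges (A_hyp 3 m) \<union> set gs) (first_tip m) hs" "length gs = 1" "length hs = 2"
    from left_end_1_2[OF D A this p(1,3) M(1,3) t(1)]
    have "\<exists>L h. decorated_path (edges (A_hyp 3 m) \<union> set gs \<union> set hs) (L @ base_path m) [h] \<and> length L = 2 \<and> meets (L @ base_path m) h = {2} \<and>
      (\<forall>u\<in>\<Union>(edges (A_hyp 3 m)). u \<noteq> 0 \<and> u \<noteq> first_tip m \<longrightarrow> positions (L @ base_path m) u = (+) 2 ` positions (base_path m) u \<and> u \<notin> h)"
      unfolding imp_conjL .
    then show "left_end (edges (A_hyp 3 m) \<union> set gs \<union> set hs) m 2 {2}"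
      by (rule left_endI[OF m]) (use t in auto) }
  { assume "attached (edges (A_hyp 3 m) \<union> set gs) 0 hs" "length gs = 1" "length hs = 1"
    from left_end_double[OF D A this p(1) M(1)]
    show "left_end (edges (A_hyp 3 m) \<union> set gs \<union> set hs) m 1 {0, 1}"
      by (rule left_endI[OF m]) (use t in auto) }
qed

lemma right_end_shape:
  assumes m: "2 \<le> m" and E: "left_end E m a J" "edges (A_hyp 3 m) \<subseteq> E"
  shows "attached E m gs \<Longrightarrow> attached (E \<union> set gs) (last_tip m) hs \<Longrightarrow> length gs = 1 \<Longrightarrow> length hs = 1 \<Longrightarrow>
      shape (E \<union> set gs \<union> set hs) (a + m + 1) [J, {a + m - 1}]"
    and "attached E m gs \<Longrightarrow> attached (E \<union> set gs) (last_tip m) hs \<Longrightarrow> length gs = 1 \<Longrightarrow> length hs = 2 \<Longrightarrow>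
      shape (E \<union> set gs \<union> set hs) (a + m + 2) [J, {a + m - 1}]"
    and "attached E m gs \<Longrightarrow> attached (E \<union> set gs) m hs \<Longrightarrow> length gs = 1 \<Longrightarrow> length hs = 1 \<Longrightarrow>
      shape (E \<union> set gs \<union> set hs) (a + m + 1) [J, {a + m - 1, a + m}]"
proof -
  obtain L g where L: "decorated_path E (L @ base_path m) [g]" "length L = a" "meets (L @ base_path m) g = J"
     "\<forall>u\<in>{m, last_tip m}. positions (L @ base_path m) u = {a + m - 1} \<and> u \<notin> g"
    using E(1) unfolding left_end_def by (elim exE conjE) (rule that)
  let ?P = "L @ base_path m"
  have m1: "1 \<le> m" using m by simp
  have len: "length ?P = a + m" using L(2) by simp
  have p: "positions ?P m = {length ?P - 1}" "positions ?P (last_tip m) = {length ?P - 1}" "m \<notin> g" "last_tip m \<notin> g"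
    using L(4) len by auto
  have M: "m \<in> \<Union>E" "last_tip m \<in> \<Union>E" using A_hyp_mem(2,4)[OF m1] E(2) by blast+
  note t = tips_distinct[OF m]
  assume A: "attached E m gs"
  { assume "attached (E \<union> set gs) (last_tip m) hs" "length gs = 1" "length hs = 1"
    from right_end_1_1[OF L(1) A this p(1,2) M t(6) p(3,4)]
    obtain R h where "decorated_path (E \<union> set gs \<union> set hs) (?P @ R) [g, h]" "length R = 1"
      "meets (?P @ R) g = meets ?P g" "meets (?P @ R) h = {length ?P - 1}"
      by (elim exE conjE) (rule that)
    then show "shape (E \<union> set gs \<union> set hs) (a + m + 1) [J, {a + m - 1}]"
      unfolding shape_def using len L(3) by (intro exI[of _ "?P @ R"] exI[of _ "[g, h]"]) simp }
  { assume "attached (E \<union> set gs) (last_tip m) hs" "length gs = 1" "length hs = 2"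
    from right_end_1_2[OF L(1) A this p(1,2) M t(6) p(3,4)]
    obtain R h where "decorated_path (E \<union> set gs \<union> set hs) (?P @ R) [g, h]" "length R = 2"
      "meets (?P @ R) g = meets ?P g" "meets (?P @ R) h = {length ?P - 1}"
      by (elim exE conjE) (rule that)
    then show "shape (E \<union> set gs \<union> set hs) (a + m + 2) [J, {a + m - 1}]"
      unfolding shape_def using len L(3) by (intro exI[of _ "?P @ R"] exI[of _ "[g, h]"]) simp }
  { assume "attached (E \<union> set gs) m hs" "length gs = 1" "length hs = 1"
    from right_end_double[OF L(1) A this p(1) M(1) p(3)]
    obtain R h where "decorated_path (E \<union> set gs \<union> set hs) (?P @ R) [g, h]" "length R = 1"
      "meets (?P @ R) g = meets ?P g" "meets (?P @ R) h = {length ?P - 1, length ?P}"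
      by (elim exE conjE) (rule that)
    then show "shape (E \<union> set gs \<union> set hs) (a + m + 1) [J, {a + m - 1, a + m}]"
      unfolding shape_def using len L(3) by (intro exI[of _ "?P @ R"] exI[of _ "[g, h]"]) simp }
qed

text \<open>Hanging a path at such a vertex changes labels of core edges only, so the finished
  labels stay equal to \<alpha>.\<close>

definition avoids :: "'a set set \<Rightarrow> 'a set set \<Rightarrow> 'a \<Rightarrow> bool" where
  "avoids E F w \<longleftrightarrow> (\<forall>e\<in>E - F. w \<notin> e)"

lemma avoids_attached:
  assumes "avoids E F w" "attached E v gs" "w \<in> \<Union>E" "w \<noteq> v"
  shows "avoids (E \<union> set gs) F w"
  unfolding avoids_def
proof
  fix e assume e: "e \<in> E \<union> set gs - F"
  show "w \<notin> e"
  proof (cases "e \<in> set gs")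
    case True
    then show ?thesis by (rule attached_notin[OF assms(2-4)])
  next
    case False
    then show ?thesis using e assms(1) by (simp add: avoids_def)
  qed
qed

lemma avoids_refl: "avoids E E w"
  by (simp add: avoids_def)

text \<open>
  \<open>A\<close> and \<open>Z\<close> collect the factors that the attached paths contribute to the first and to the last
  edge of the base path.
\<close>
definition base_labelled :: "nat set set \<Rightarrow> nat \<Rightarrow> real \<Rightarrow> real \<Rightarrow> real \<Rightarrow> (nat \<Rightarrow> real) \<Rightarrow> bool" where
  "base_labelled E m \<alpha> A Z b \<longleftrightarrow> (\<exists>r. lab E (edges (A_hyp 3 m)) \<alpha> r \<and>
     (\<forall>i<m. r (base_edge m i) = (if i = 0 then A else 1 - b i) * (if Suc i < m then b (Suc i) else Z)))"

definition leg_labels :: "(nat \<Rightarrow> real) \<Rightarrow> nat \<Rightarrow> real \<Rightarrow> bool" where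
  "leg_labels f k \<alpha> \<longleftrightarrow> f 0 = 0 \<and> (\<forall>j<k. 0 < f (Suc j) \<and> f (Suc j) < 1 \<and> f (Suc j) * (1 - f j) = \<alpha>)"

lemma base_labelled_left:
  assumes B: "base_labelled E m \<alpha> A Z b" and m: "2 \<le> m" and v: "v \<in> {0, first_tip m}" "avoids E (edges (A_hyp 3 m)) v"
  shows "attached E v gs \<Longrightarrow> length gs = k \<Longrightarrow> leg_labels f k \<alpha> \<Longrightarrow> base_labelled (E \<union> set gs) m \<alpha> (A * (1 - f k)) Z b"
    and "attached E v gs \<Longrightarrow> attached (E \<union> set gs) v hs \<Longrightarrow> length gs = 1 \<Longrightarrow> length hs = 1 \<Longrightarrow> 0 < \<alpha> \<Longrightarrow> \<alpha> < 1/2 \<Longrightarrow>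
      base_labelled (E \<union> set gs \<union> set hs) m \<alpha> (A * (1 - 2 * \<alpha>)) Z b"
proof -
  obtain r where r: "lab E (edges (A_hyp 3 m)) \<alpha> r"
    "\<forall>i<m. r (base_edge m i) = (if i = 0 then A else 1 - b i) * (if Suc i < m then b (Suc i) else Z)"
    using B by (auto simp: base_labelled_def)
  have mem: "v \<in> base_edge m i \<longleftrightarrow> i = 0" if "i < m" for i using base_mem[of m i] that m v(1) by auto
  have val: "\<forall>i<m. (\<lambda>e. if v \<in> e then r e * c else r e) (base_edge m i) =
    (if i = 0 then A * c else 1 - b i) * (if Suc i < m then b (Suc i) else Z)" for c
    using r(2) mem m by simp
  have av: "\<And>e. e \<in> E - edges (A_hyp 3 m) \<Longrightarrow> v \<notin> e" using v(2) by (auto simp: avoids_def)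
  show "base_labelled (E \<union> set gs) m \<alpha> (A * (1 - f k)) Z b" if "attached E v gs" "length gs = k" "leg_labels f k \<alpha>"
  proof -
    have "lab (E \<union> set gs) (edges (A_hyp 3 m)) \<alpha> (\<lambda>e. if v \<in> e then r e * (1 - f k) else r e)"
      by (rule lab_leg[OF r(1) that(1,2) av]) (use that(3) in \<open>auto simp: leg_labels_def\<close>)
    then show ?thesis using val[of "1 - f k"] unfolding base_labelled_def by (intro exI conjI)
  qed
  show "base_labelled (E \<union> set gs \<union> set hs) m \<alpha> (A * (1 - 2 * \<alpha>)) Z b"
    if "attached E v gs" "attached (E \<union> set gs) v hs" "length gs = 1" "length hs = 1" "0 < \<alpha>" "\<alpha> < 1/2"
    using lab_double[OF r(1) that(1-4) av that(5,6)] val[of "1 - 2 * \<alpha>"] unfolding base_labelled_def by (intro exI conjI)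
qed

lemma base_labelled_right:
  assumes B: "base_labelled E m \<alpha> A Z b" and m: "2 \<le> m" and v: "v \<in> {m, last_tip m}" "avoids E (edges (A_hyp 3 m)) v"
  shows "attached E v gs \<Longrightarrow> length gs = k \<Longrightarrow> leg_labels f k \<alpha> \<Longrightarrow> base_labelled (E \<union> set gs) m \<alpha> A (Z * (1 - f k)) b"
    and "attached E v gs \<Longrightarrow> attached (E \<union> set gs) v hs \<Longrightarrow> length gs = 1 \<Longrightarrow> length hs = 1 \<Longrightarrow> 0 < \<alpha> \<Longrightarrow> \<alpha> < 1/2 \<Longrightarrow>
      base_labelled (E \<union> set gs \<union> set hs) m \<alpha> A (Z * (1 - 2 * \<alpha>)) b"
proof -
  obtain r where r: "lab E (edges (A_hyp 3 m)) \<alpha> r"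
    "\<forall>i<m. r (base_edge m i) = (if i = 0 then A else 1 - b i) * (if Suc i < m then b (Suc i) else Z)"
    using B by (auto simp: base_labelled_def)
  have mem: "v \<in> base_edge m i \<longleftrightarrow> \<not> Suc i < m" if "i < m" for i using base_mem[of m i] that m v(1) by auto
  have val: "\<forall>i<m. (\<lambda>e. if v \<in> e then r e * c else r e) (base_edge m i) =
    (if i = 0 then A else 1 - b i) * (if Suc i < m then b (Suc i) else Z * c)" for c
    using r(2) mem m by simp
  have av: "\<And>e. e \<in> E - edges (A_hyp 3 m) \<Longrightarrow> v \<notin> e" using v(2) by (auto simp: avoids_def)
  show "base_labelled (E \<union> set gs) m \<alpha> A (Z * (1 - f k)) b" if "attached E v gs" "length gs = k" "leg_labels f k \<alpha>"
  proof -
    have "lab (E \<union> set gs) (edges (A_hyp 3 m)) \<alpha> (\<lambda>e. if v \<in> e then r e * (1 - f k) else r e)"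
      by (rule lab_leg[OF r(1) that(1,2) av]) (use that(3) in \<open>auto simp: leg_labels_def\<close>)
    then show ?thesis using val[of "1 - f k"] unfolding base_labelled_def by (intro exI conjI)
  qed
  show "base_labelled (E \<union> set gs \<union> set hs) m \<alpha> A (Z * (1 - 2 * \<alpha>)) b"
    if "attached E v gs" "attached (E \<union> set gs) v hs" "length gs = 1" "length hs = 1" "0 < \<alpha>" "\<alpha> < 1/2"
    using lab_double[OF r(1) that(1-4) av that(5,6)] val[of "1 - 2 * \<alpha>"] unfolding base_labelled_def by (intro exI conjI)
qed

lemma base_labelled_base:
  assumes "1 \<le> m" "\<And>i. 0 < i \<Longrightarrow> i < m \<Longrightarrow> 0 < b i \<and> b i < (1::real)"
  shows "base_labelled (edges (A_hyp 3 m)) m \<alpha> 1 1 b"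
  using base_lab[OF assms] unfolding base_labelled_def .

lemma base_labelled_left_legs:
  assumes m: "2 \<le> m" and b: "\<And>i. 0 < i \<Longrightarrow> i < m \<Longrightarrow> 0 < b i \<and> b i < (1::real)"
    and A: "attached (edges (A_hyp 3 m)) 0 gs" "attached (edges (A_hyp 3 m) \<union> set gs) (first_tip m) hs"
    and f: "leg_labels f (length gs) \<alpha>" "leg_labels f (length hs) \<alpha>"
  shows "base_labelled (edges (A_hyp 3 m) \<union> set gs \<union> set hs) m \<alpha> ((1 - f (length gs)) * (1 - f (length hs))) 1 b"
    and "u \<in> {m, last_tip m} \<Longrightarrow> avoids (edges (A_hyp 3 m) \<union> set gs \<union> set hs) (edges (A_hyp 3 m)) u"
proof -
  have m1: "1 \<le> m" using m by simp
  note M = A_hyp_mem[OF m1] and t = tips_distinct[OF m]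
  note B0 = base_labelled_base[OF m1 b, where \<alpha> = \<alpha>]
  have "base_labelled (edges (A_hyp 3 m) \<union> set gs) m \<alpha> (1 * (1 - f (length gs))) 1 b"
    by (rule base_labelled_left(1)[OF B0 m _ avoids_refl A(1) refl f(1)]) simp_all
  then have "base_labelled (edges (A_hyp 3 m) \<union> set gs \<union> set hs) m \<alpha> (1 * (1 - f (length gs)) * (1 - f (length hs))) 1 b"
    by (rule base_labelled_left(1)[OF _ m _ avoids_attached[OF avoids_refl A(1) M(3)] A(2) refl f(2)]) (use t in auto)
  then show "base_labelled (edges (A_hyp 3 m) \<union> set gs \<union> set hs) m \<alpha> ((1 - f (length gs)) * (1 - f (length hs))) 1 b" by simp
  assume u: "u \<in> {m, last_tip m}"
  have uM: "u \<in> \<Union>(edges (A_hyp 3 m))" using u M by auto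
  have "avoids (edges (A_hyp 3 m) \<union> set gs) (edges (A_hyp 3 m)) u"
    by (rule avoids_attached[OF avoids_refl A(1) uM]) (use u t in auto)
  then show "avoids (edges (A_hyp 3 m) \<union> set gs \<union> set hs) (edges (A_hyp 3 m)) u"
    by (rule avoids_attached[OF _ A(2)]) (use u t uM in auto)
qed

lemma base_labelled_left_double:
  assumes m: "2 \<le> m" and b: "\<And>i. 0 < i \<Longrightarrow> i < m \<Longrightarrow> 0 < b i \<and> b i < (1::real)"
    and A: "attached (edges (A_hyp 3 m)) 0 gs" "attached (edges (A_hyp 3 m) \<union> set gs) 0 hs" "length gs = 1" "length hs = 1"
    and \<alpha>: "0 < \<alpha>" "\<alpha> < 1/2"
  shows "base_labelled (edges (A_hyp 3 m) \<union> set gs \<union> set hs) m \<alpha> (1 - 2 * \<alpha>) 1 b"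
    and "u \<in> {m, last_tip m} \<Longrightarrow> avoids (edges (A_hyp 3 m) \<union> set gs \<union> set hs) (edges (A_hyp 3 m)) u"
proof -
  have m1: "1 \<le> m" using m by simp
  note M = A_hyp_mem[OF m1] and t = tips_distinct[OF m]
  note B0 = base_labelled_base[OF m1 b, where \<alpha> = \<alpha>]
  have "base_labelled (edges (A_hyp 3 m) \<union> set gs \<union> set hs) m \<alpha> (1 * (1 - 2 * \<alpha>)) 1 b"
    by (rule base_labelled_left(2)[OF B0 m _ avoids_refl A \<alpha>]) simp_all
  then show "base_labelled (edges (A_hyp 3 m) \<union> set gs \<union> set hs) m \<alpha> (1 - 2 * \<alpha>) 1 b" by simp
  assume u: "u \<in> {m, last_tip m}"
  have uM: "u \<in> \<Union>(edges (A_hyp 3 m))" using u M by auto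
  have "avoids (edges (A_hyp 3 m) \<union> set gs) (edges (A_hyp 3 m)) u"
    by (rule avoids_attached[OF avoids_refl A(1) uM]) (use u t in auto)
  then show "avoids (edges (A_hyp 3 m) \<union> set gs \<union> set hs) (edges (A_hyp 3 m)) u"
    by (rule avoids_attached[OF _ A(2)]) (use u t uM in auto)
qed

lemma base_labelled_right_legs:
  assumes m: "2 \<le> m" and E: "base_labelled E m \<alpha> A 1 b" "edges (A_hyp 3 m) \<subseteq> E"
    "\<And>u. u \<in> {m, last_tip m} \<Longrightarrow> avoids E (edges (A_hyp 3 m)) u"
    and A: "attached E m gs" "attached (E \<union> set gs) (last_tip m) hs"
    and f: "leg_labels f (length gs) \<alpha>" "leg_labels f (length hs) \<alpha>"
  shows "base_labelled (E \<union> set gs \<union> set hs) m \<alpha> A ((1 - f (length gs)) * (1 - f (length hs))) b"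
proof -
  have m1: "1 \<le> m" using m by simp
  have M: "last_tip m \<in> \<Union>E" using A_hyp_mem(4)[OF m1] E(2) by blast
  note t = tips_distinct[OF m]
  have "base_labelled (E \<union> set gs) m \<alpha> A (1 * (1 - f (length gs))) b"
    by (rule base_labelled_right(1)[OF E(1) m _ E(3) A(1) refl f(1)]) simp_all
  moreover have "avoids (E \<union> set gs) (edges (A_hyp 3 m)) (last_tip m)"
    by (rule avoids_attached[OF E(3) A(1) M]) (use t in auto)
  ultimately have "base_labelled (E \<union> set gs \<union> set hs) m \<alpha> A (1 * (1 - f (length gs)) * (1 - f (length hs))) b"
    by (intro base_labelled_right(1)[OF _ m _ _ A(2) refl f(2)]) simp_all
  then show ?thesis by simp
qed

lemma base_labelled_right_double:
  assumes m: "2 \<le> m" and E: "base_labelled E m \<alpha> A 1 b" "avoids E (edges (A_hyp 3 m)) m"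
    and A: "attached E m gs" "attached (E \<union> set gs) m hs" "length gs = 1" "length hs = 1"
    and \<alpha>: "0 < \<alpha>" "\<alpha> < 1/2"
  shows "base_labelled (E \<union> set gs \<union> set hs) m \<alpha> A (1 - 2 * \<alpha>) b"
  using base_labelled_right(2)[OF E(1) m _ E(2) A \<alpha>] by simp

section \<open>Comparing the spectral radius with the value of a common label\<close>

definition normal :: "'a set set \<Rightarrow> real \<Rightarrow> bool" where
  "normal E \<alpha> \<longleftrightarrow> (\<exists>q. labelled_eq E q \<and> (\<forall>e\<in>E. q e = \<alpha>))"

text \<open>Small labels mean a large spectral radius, so \<open>supernormal\<close> puts it
  strictly above \<open>rho_value r \<alpha>\<close> and \<open>subnormal\<close> strictly
  below.\<close>

definition supernormal :: "'a set set \<Rightarrow> real \<Rightarrow> bool" where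
  "supernormal E \<alpha> \<longleftrightarrow> (\<exists>q. labelled_eq E q \<and> (\<forall>e\<in>E. q e \<le> \<alpha>) \<and> (\<exists>e\<in>E. q e < \<alpha>))"

definition subnormal :: "'a set set \<Rightarrow> real \<Rightarrow> bool" where
  "subnormal E \<alpha> \<longleftrightarrow> (\<exists>q. labelled_eq E q \<and> (\<forall>e\<in>E. \<alpha> \<le> q e) \<and> (\<exists>e\<in>E. \<alpha> < q e))"

lemma lab_normal:
  assumes "lab E F \<alpha> r" "\<And>e. e \<in> F \<Longrightarrow> r e = \<alpha>"
  shows "normal E \<alpha>"
proof -
  have "labelled_eq E (\<lambda>e. if e \<in> F then r e else \<alpha>)" using assms(1) by (simp add: lab_def)
  then show ?thesis unfolding normal_def using assms(2) by (intro exI conjI) auto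
qed

lemma lab_supernormal:
  assumes "lab E F \<alpha> r" "\<And>e. e \<in> F \<Longrightarrow> r e \<le> \<alpha>" "e0 \<in> F" "r e0 < \<alpha>"
  shows "supernormal E \<alpha>"
proof -
  have "labelled_eq E (\<lambda>e. if e \<in> F then r e else \<alpha>)" "e0 \<in> E" using assms(1,3) by (auto simp: lab_def)
  then show ?thesis unfolding supernormal_def using assms(2-4)
    by (intro exI[of _ "\<lambda>e. if e \<in> F then r e else \<alpha>"] conjI bexI[of _ e0]) auto
qed

lemma lab_subnormal:
  assumes "lab E F \<alpha> r" "\<And>e. e \<in> F \<Longrightarrow> \<alpha> \<le> r e" "e0 \<in> F" "\<alpha> < r e0"
  shows "subnormal E \<alpha>"
proof -
  have "labelled_eq E (\<lambda>e. if e \<in> F then r e else \<alpha>)" "e0 \<in> E" using assms(1,3) by (auto simp: lab_def)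
  then show ?thesis unfolding subnormal_def using assms(2-4)
    by (intro exI[of _ "\<lambda>e. if e \<in> F then r e else \<alpha>"] conjI bexI[of _ e0]) auto
qed

lemma base_labelled_normal:
  assumes "base_labelled E m \<alpha> A Z b" "\<And>i. i < m \<Longrightarrow> (if i = 0 then A else 1 - b i) * (if Suc i < m then b (Suc i) else Z) = \<alpha>"
  shows "normal E \<alpha>"
proof -
  obtain r where r: "lab E (edges (A_hyp 3 m)) \<alpha> r"
    "\<forall>i<m. r (base_edge m i) = (if i = 0 then A else 1 - b i) * (if Suc i < m then b (Suc i) else Z)"
    using assms(1) unfolding base_labelled_def by (elim exE conjE) (rule that)
  show ?thesis by (rule lab_normal[OF r(1)]) (use r(2) assms(2) edges_A_hyp_base in auto)
qed

lemma base_labelled_supernormal: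
  assumes "base_labelled E m \<alpha> A Z b"
    "\<And>i. i < m \<Longrightarrow> (if i = 0 then A else 1 - b i) * (if Suc i < m then b (Suc i) else Z) \<le> \<alpha>"
    "j < m" "(if j = 0 then A else 1 - b j) * (if Suc j < m then b (Suc j) else Z) < \<alpha>"
  shows "supernormal E \<alpha>"
proof -
  obtain r where r: "lab E (edges (A_hyp 3 m)) \<alpha> r"
    "\<forall>i<m. r (base_edge m i) = (if i = 0 then A else 1 - b i) * (if Suc i < m then b (Suc i) else Z)"
    using assms(1) unfolding base_labelled_def by (elim exE conjE) (rule that)
  show ?thesis
    by (rule lab_supernormal[OF r(1), of "base_edge m j"]) (use r(2) assms(2-4) edges_A_hyp_base in auto)
qed

lemma base_labelled_subnormal:
  assumes "base_labelled E m \<alpha> A Z b"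
    "\<And>i. i < m \<Longrightarrow> \<alpha> \<le> (if i = 0 then A else 1 - b i) * (if Suc i < m then b (Suc i) else Z)"
    "j < m" "\<alpha> < (if j = 0 then A else 1 - b j) * (if Suc j < m then b (Suc j) else Z)"
  shows "subnormal E \<alpha>"
proof -
  obtain r where r: "lab E (edges (A_hyp 3 m)) \<alpha> r"
    "\<forall>i<m. r (base_edge m i) = (if i = 0 then A else 1 - b i) * (if Suc i < m then b (Suc i) else Z)"
    using assms(1) unfolding base_labelled_def by (elim exE conjE) (rule that)
  show ?thesis
    by (rule lab_subnormal[OF r(1), of "base_edge m j"]) (use r(2) assms(2-4) edges_A_hyp_base in auto)
qed

lemma proper_iter: "proper s H \<Longrightarrow> proper (s + k) ((extend ^^ k) H)"
  by (induction k) (auto intro: proper_extend)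

lemma shape_iter: "proper s H \<Longrightarrow> shape (edges H) l Js \<Longrightarrow> shape (edges ((extend ^^ k) H)) l Js"
proof (induction k)
  case (Suc k)
  have "r_graph (s + k) ((extend ^^ k) H)" using proper_iter[OF Suc.prems(1)] by (simp add: proper_def)
  then show ?case using shape_extend Suc by simp
qed simp

lemma cycle_shape_iter: "proper s H \<Longrightarrow> cycle_shape (edges H) n \<Longrightarrow> cycle_shape (edges ((extend ^^ k) H)) n"
proof (induction k)
  case (Suc k)
  have "r_graph (s + k) ((extend ^^ k) H)" using proper_iter[OF Suc.prems(1)] by (simp add: proper_def)
  then show ?case using cycle_shape_extend Suc by simp
qed simp

text \<open>Every extension renames the edges. Keeping only the set of occurring labels removes the
  names, and the three criteria depend on nothing more.\<close>

lemma labelled_eq_iter: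
  assumes "proper s H" "labelled_eq (edges H) p"
  shows "\<exists>q. labelled_eq (edges ((extend ^^ k) H)) q \<and> q ` edges ((extend ^^ k) H) = p ` edges H"
proof (induction k)
  case 0
  show ?case using assms(2) by auto
next
  case (Suc k)
  let ?K = "(extend ^^ k) H"
  have r: "r_graph (s + k) ?K" using proper_iter[OF assms(1)] by (simp add: proper_def)
  obtain q where q: "labelled_eq (edges ?K) q" "q ` edges ?K = p ` edges H" using Suc.IH by blast
  obtain q' where q': "labelled_eq (edges (extend ?K)) q'" "\<forall>e\<in>edges ?K. q' (ext_edge ?K e) = q e"
    using labelled_eq_extend[OF r q(1)] by blast
  have "q' ` edges (extend ?K) = q ` edges ?K" unfolding edges_extend image_image using q'(2) by simp
  then show ?case using q' q(2) by (intro exI[of _ q']) simp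
qed

lemma spectral_radius_iter:
  assumes H: "proper s H" and r: "s + k = r" "1 \<le> r" and \<alpha>: "0 < \<alpha>"
  shows "normal (edges H) \<alpha> \<Longrightarrow> spectral_radius r ((extend ^^ k) H) = rho_value r \<alpha>"
    and "supernormal (edges H) \<alpha> \<Longrightarrow> rho_value r \<alpha> < spectral_radius r ((extend ^^ k) H)"
    and "subnormal (edges H) \<alpha> \<Longrightarrow> spectral_radius r ((extend ^^ k) H) < rho_value r \<alpha>"
proof -
  let ?K = "(extend ^^ k) H"
  have "proper r ?K" using proper_iter[OF H, of k] r by simp
  then have K: "r_graph r ?K" "edges ?K \<noteq> {}" "linked (edges ?K)" "verts ?K = \<Union>(edges ?K)" by (auto simp: proper_def)
  have ne: "verts ?K \<noteq> {}"
  proof -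
    obtain e where e: "e \<in> edges ?K" using K(2) by blast
    have "e \<noteq> {}" using r_graph_edgeD[OF K(1) e] r(2) by auto
    then show ?thesis unfolding K(4) using e by blast
  qed
  have L: "\<exists>w. weighting (edges ?K) w \<and> pot (edges ?K) w ` edges ?K = q ` edges H" if q: "labelled_eq (edges H) q" for q
  proof -
    obtain p where p: "labelled_eq (edges ?K) p" "p ` edges ?K = q ` edges H"
      using labelled_eq_iter[OF H q] by blast
    then obtain w where w: "weighting (edges ?K) w" "\<forall>e\<in>edges ?K. pot (edges ?K) w e = p e"
      by (auto simp: labelled_eq_def)
    have "pot (edges ?K) w ` edges ?K = p ` edges ?K" using w(2) by simp
    then show ?thesis using w(1) p(2) by auto
  qed
  have mem: "pot (edges ?K) w e \<in> q ` edges H" if "pot (edges ?K) w ` edges ?K = q ` edges H" "e \<in> edges ?K" for w q e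
    using that by blast
  show "spectral_radius r ?K = rho_value r \<alpha>" if n: "normal (edges H) \<alpha>"
  proof -
    obtain q where q: "labelled_eq (edges H) q" "\<forall>e\<in>edges H. q e = \<alpha>" using n by (auto simp: normal_def)
    obtain w where w: "weighting (edges ?K) w" "pot (edges ?K) w ` edges ?K = q ` edges H" using L[OF q(1)] by blast
    have v: "pot (edges ?K) w e = \<alpha>" if "e \<in> edges ?K" for e using mem[OF w(2) that] q(2) by auto
    have "rho_value r \<alpha> \<le> spectral_radius r ?K"
      using v by (intro spectral_radius_ge(1)[OF K(1) r(2) _ K(2) w(1)]) auto
    moreover have "spectral_radius r ?K \<le> rho_value r \<alpha>"
      using v \<alpha> by (intro spectral_radius_le(1)[OF K(1) r(2) ne w(1)]) auto
    ultimately show ?thesis by simp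
  qed
  show "rho_value r \<alpha> < spectral_radius r ?K" if n: "supernormal (edges H) \<alpha>"
  proof -
    obtain q e0 where q: "labelled_eq (edges H) q" "\<forall>e\<in>edges H. q e \<le> \<alpha>" "e0 \<in> edges H" "q e0 < \<alpha>"
      using n by (auto simp: supernormal_def)
    obtain w where w: "weighting (edges ?K) w" "pot (edges ?K) w ` edges ?K = q ` edges H" using L[OF q(1)] by blast
    have v: "pot (edges ?K) w e \<le> \<alpha>" if "e \<in> edges ?K" for e using mem[OF w(2) that] q(2) by auto
    have "q e0 \<in> pot (edges ?K) w ` edges ?K" using w(2) q(3) by blast
    then obtain e where e: "e \<in> edges ?K" "pot (edges ?K) w e = q e0" by auto
    show ?thesis
      using v e q(4) by (intro spectral_radius_ge(2)[OF K(1) r(2) _ K(2) w(1), of _ e]) auto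
  qed
  show "spectral_radius r ?K < rho_value r \<alpha>" if n: "subnormal (edges H) \<alpha>"
  proof -
    obtain q e0 where q: "labelled_eq (edges H) q" "\<forall>e\<in>edges H. \<alpha> \<le> q e" "e0 \<in> edges H" "\<alpha> < q e0"
      using n by (auto simp: subnormal_def)
    obtain w where w: "weighting (edges ?K) w" "pot (edges ?K) w ` edges ?K = q ` edges H" using L[OF q(1)] by blast
    have v: "\<alpha> \<le> pot (edges ?K) w e" if "e \<in> edges ?K" for e using mem[OF w(2) that] q(2) by auto
    have "q e0 \<in> pot (edges ?K) w ` edges ?K" using w(2) q(3) by blast
    then obtain e where e: "e \<in> edges ?K" "pot (edges ?K) w e = q e0" by auto
    show ?thesis
      using v e q(4) \<alpha> by (intro spectral_radius_le(2)[OF K(1) r(2) ne w(1) _ _ K(3), of _ e]) auto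
  qed
qed

lemma G3_proper:
  assumes "1 \<le> i" "1 \<le> j" "1 \<le> l" "1 \<le> p"
  obtains gs hs gs' hs' where "attached (edges (A_hyp 3 (k + 2))) 0 gs"
    "attached (edges (A_hyp 3 (k + 2)) \<union> set gs) (first_tip (k + 2)) hs" "length gs = i" "length hs = j"
    "attached (edges (A_hyp 3 (k + 2)) \<union> set gs \<union> set hs) (k + 2) gs'"
    "attached (edges (A_hyp 3 (k + 2)) \<union> set gs \<union> set hs \<union> set gs') (last_tip (k + 2)) hs'" "length gs' = l" "length hs' = p"
    "edges (G3 i j k l p) = edges (A_hyp 3 (k + 2)) \<union> set gs \<union> set hs \<union> set gs' \<union> set hs'" "proper 3 (G3 i j k l p)"
proof -
  let ?B = "A_hyp 3 (k + 2)"
  have m1: "1 \<le> k + 2" by simp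
  note P = proper_A_hyp[OF m1] and V = verts_A_hyp_mem[OF m1]
  obtain gs hs where L: "attached (edges ?B) 0 gs" "attached (edges ?B \<union> set gs) (first_tip (k + 2)) hs" "length gs = i" "length hs = j"
    "edges (attach_path 3 j (first_tip (k + 2)) (attach_path 3 i 0 ?B)) = edges ?B \<union> set gs \<union> set hs"
    "proper 3 (attach_path 3 j (first_tip (k + 2)) (attach_path 3 i 0 ?B))"
    "verts ?B \<subseteq> verts (attach_path 3 j (first_tip (k + 2)) (attach_path 3 i 0 ?B))"
    using two_attached_paths[OF P V(1)[of 0] V(2) assms(1,2)] by auto
  let ?H = "attach_path 3 j (first_tip (k + 2)) (attach_path 3 i 0 ?B)"
  have v: "k + 2 \<in> verts ?H" "last_tip (k + 2) \<in> verts ?H" using L(7) V(1)[of "k + 2"] V(3) by auto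
  obtain gs' hs' where R: "attached (edges ?H) (k + 2) gs'" "attached (edges ?H \<union> set gs') (last_tip (k + 2)) hs'" "length gs' = l" "length hs' = p"
    "edges (attach_path 3 p (last_tip (k + 2)) (attach_path 3 l (k + 2) ?H)) = edges ?H \<union> set gs' \<union> set hs'"
    "proper 3 (attach_path 3 p (last_tip (k + 2)) (attach_path 3 l (k + 2) ?H))"
    by (rule two_attached_paths[OF L(6) v assms(3,4)])
  have e: "edges (G3 i j k l p) = edges ?B \<union> set gs \<union> set hs \<union> set gs' \<union> set hs'"
    unfolding G3_def using R(5)[unfolded L(5)] .
  have pr: "proper 3 (G3 i j k l p)" unfolding G3_def using R(6) .
  show thesis by (rule that[OF L(1-4) R(1,2)[unfolded L(5)] R(3,4) e pr])
qed

lemma G3_labelled: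
  assumes "1 \<le> i" "1 \<le> j" "1 \<le> l" "1 \<le> p"
    and f: "leg_labels f i \<alpha>" "leg_labels f j \<alpha>" "leg_labels f l \<alpha>" "leg_labels f p \<alpha>"
    and b: "\<And>i. 0 < i \<Longrightarrow> i < k + 2 \<Longrightarrow> 0 < b i \<and> b i < (1::real)"
  shows "base_labelled (edges (G3 i j k l p)) (k + 2) \<alpha> ((1 - f i) * (1 - f j)) ((1 - f l) * (1 - f p)) b"
proof -
  obtain gs hs gs' hs' where L: "attached (edges (A_hyp 3 (k + 2))) 0 gs"
    "attached (edges (A_hyp 3 (k + 2)) \<union> set gs) (first_tip (k + 2)) hs" "length gs = i" "length hs = j"
    "attached (edges (A_hyp 3 (k + 2)) \<union> set gs \<union> set hs) (k + 2) gs'"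
    "attached (edges (A_hyp 3 (k + 2)) \<union> set gs \<union> set hs \<union> set gs') (last_tip (k + 2)) hs'" "length gs' = l" "length hs' = p"
    "edges (G3 i j k l p) = edges (A_hyp 3 (k + 2)) \<union> set gs \<union> set hs \<union> set gs' \<union> set hs'"
    by (rule G3_proper[OF assms(1-4), of k])
  have m: "2 \<le> k + 2" by simp
  have f': "leg_labels f (length gs) \<alpha>" "leg_labels f (length hs) \<alpha>" "leg_labels f (length gs') \<alpha>" "leg_labels f (length hs') \<alpha>"
    using f L by simp_all
  note B = base_labelled_left_legs[OF m b L(1,2) f'(1,2)]
  have sub: "edges (A_hyp 3 (k + 2)) \<subseteq> edges (A_hyp 3 (k + 2)) \<union> set gs \<union> set hs" by blast
  show ?thesis using base_labelled_right_legs[OF m B(1) sub B(2) L(5,6) f'(3,4)] unfolding L(9) L(3,4,7,8) .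
qed

lemma G3_shape:
  "shape (edges (G3 1 1 k 1 1)) (k + 4) [{1}, {k + 2}]"
  "shape (edges (G3 1 2 k 1 1)) (k + 5) [{2}, {k + 3}]"
  "shape (edges (G3 1 2 k 1 2)) (k + 6) [{2}, {k + 3}]"
proof -
  let ?B = "A_hyp 3 (k + 2)"
  have m: "2 \<le> k + 2" by simp
  have S: "left_end (edges ?B \<union> set gs \<union> set hs) (k + 2) a J \<Longrightarrow> edges ?B \<subseteq> edges ?B \<union> set gs \<union> set hs" for gs hs a J by blast
  { obtain gs hs gs' hs' where L: "attached (edges ?B) 0 gs" "attached (edges ?B \<union> set gs) (first_tip (k + 2)) hs" "length gs = 1" "length hs = 1"
      "attached (edges ?B \<union> set gs \<union> set hs) (k + 2) gs'" "attached (edges ?B \<union> set gs \<union> set hs \<union> set gs') (last_tip (k + 2)) hs'"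
      "length gs' = 1" "length hs' = 1" "edges (G3 1 1 k 1 1) = edges ?B \<union> set gs \<union> set hs \<union> set gs' \<union> set hs'"
      by (rule G3_proper[of 1 1 1 1 k]) simp_all
    note E = left_end_base(1)[OF m L(1-4)]
    have "shape (edges (G3 1 1 k 1 1)) (1 + (k + 2) + 1) [{1}, {1 + (k + 2) - 1}]"
      unfolding L(9) by (rule right_end_shape(1)[OF m E S[OF E] L(5-8)])
    moreover have "1 + (k + 2) + 1 = k + 4" "1 + (k + 2) - 1 = k + 2" by simp_all
    ultimately show "shape (edges (G3 1 1 k 1 1)) (k + 4) [{1}, {k + 2}]" by (simp only:) }
  { obtain gs hs gs' hs' where L: "attached (edges ?B) 0 gs" "attached (edges ?B \<union> set gs) (first_tip (k + 2)) hs" "length gs = 1" "length hs = 2"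
      "attached (edges ?B \<union> set gs \<union> set hs) (k + 2) gs'" "attached (edges ?B \<union> set gs \<union> set hs \<union> set gs') (last_tip (k + 2)) hs'"
      "length gs' = 1" "length hs' = 1" "edges (G3 1 2 k 1 1) = edges ?B \<union> set gs \<union> set hs \<union> set gs' \<union> set hs'"
      by (rule G3_proper[of 1 2 1 1 k]) simp_all
    note E = left_end_base(2)[OF m L(1-4)]
    have "shape (edges (G3 1 2 k 1 1)) (2 + (k + 2) + 1) [{2}, {2 + (k + 2) - 1}]"
      unfolding L(9) by (rule right_end_shape(1)[OF m E S[OF E] L(5-8)])
    moreover have "2 + (k + 2) + 1 = k + 5" "2 + (k + 2) - 1 = k + 3" by simp_all
    ultimately show "shape (edges (G3 1 2 k 1 1)) (k + 5) [{2}, {k + 3}]" by (simp only:) }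
  { obtain gs hs gs' hs' where L: "attached (edges ?B) 0 gs" "attached (edges ?B \<union> set gs) (first_tip (k + 2)) hs" "length gs = 1" "length hs = 2"
      "attached (edges ?B \<union> set gs \<union> set hs) (k + 2) gs'" "attached (edges ?B \<union> set gs \<union> set hs \<union> set gs') (last_tip (k + 2)) hs'"
      "length gs' = 1" "length hs' = 2" "edges (G3 1 2 k 1 2) = edges ?B \<union> set gs \<union> set hs \<union> set gs' \<union> set hs'"
      by (rule G3_proper[of 1 2 1 2 k]) simp_all
    note E = left_end_base(2)[OF m L(1-4)]
    have "shape (edges (G3 1 2 k 1 2)) (2 + (k + 2) + 2) [{2}, {2 + (k + 2) - 1}]"
      unfolding L(9) by (rule right_end_shape(2)[OF m E S[OF E] L(5-8)])
    moreover have "2 + (k + 2) + 2 = k + 6" "2 + (k + 2) - 1 = k + 3" by simp_all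
    ultimately show "shape (edges (G3 1 2 k 1 2)) (k + 6) [{2}, {k + 3}]" by (simp only:) }
qed

lemma double_end_proper:
  fixes m i j :: nat
  assumes m: "2 \<le> m" and ij: "1 \<le> i" "1 \<le> j" and w: "w \<in> {0, first_tip m}"
  defines "K \<equiv> attach_path 3 1 m (attach_path 3 1 m (attach_path 3 j w (attach_path 3 i 0 (A_hyp 3 m))))"
  obtains gs hs gs' hs' where "attached (edges (A_hyp 3 m)) 0 gs"
    "attached (edges (A_hyp 3 m) \<union> set gs) w hs" "length gs = i" "length hs = j"
    "attached (edges (A_hyp 3 m) \<union> set gs \<union> set hs) m gs'"
    "attached (edges (A_hyp 3 m) \<union> set gs \<union> set hs \<union> set gs') m hs'" "length gs' = 1" "length hs' = 1"
    "edges K = edges (A_hyp 3 m) \<union> set gs \<union> set hs \<union> set gs' \<union> set hs'" "proper 3 K"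
proof -
  let ?B = "A_hyp 3 m" and ?H = "attach_path 3 j w (attach_path 3 i 0 (A_hyp 3 m))"
  have m1: "1 \<le> m" using m by simp
  note P = proper_A_hyp[OF m1] and V = verts_A_hyp_mem[OF m1]
  have w': "w \<in> verts ?B" using w V(1)[of 0] V(2) by auto
  obtain gs hs where L: "attached (edges ?B) 0 gs" "attached (edges ?B \<union> set gs) w hs" "length gs = i" "length hs = j"
    "edges ?H = edges ?B \<union> set gs \<union> set hs" "proper 3 ?H" "verts ?B \<subseteq> verts ?H"
    using two_attached_paths[OF P V(1)[of 0] w' ij] by auto
  have v: "m \<in> verts ?H" using L(7) V(1)[of m] by auto
  obtain gs' hs' where R: "attached (edges ?H) m gs'" "attached (edges ?H \<union> set gs') m hs'" "length gs' = 1" "length hs' = 1"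
    "edges K = edges ?H \<union> set gs' \<union> set hs'" "proper 3 K"
    using two_attached_paths[OF L(6) v v order_refl order_refl] unfolding K_def by metis
  show thesis by (rule that[OF L(1-4) R(1,2)[unfolded L(5)] R(3,4) R(5)[unfolded L(5)] R(6)])
qed

text \<open>One construction for three hypergraphs with two pendant edges at \<open>m\<close>:
  \<open>K 1 1 (first_tip m)\<close> gives \<open>BD3\<close>, \<open>K 1 2 (first_tip m)\<close>
  gives \<open>BDtilde3\<close>, and \<open>K 1 1 0\<close> gives \<open>Dtilde3\<close>.\<close>

lemma double_end_facts:
  fixes m :: nat
  assumes m: "2 \<le> m"
  defines "K \<equiv> \<lambda>i j w. attach_path 3 1 m (attach_path 3 1 m (attach_path 3 j w (attach_path 3 i 0 (A_hyp 3 m))))"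
  shows "shape (edges (K 1 1 (first_tip m))) (m + 2) [{1}, {m, m + 1}]"
    and "shape (edges (K 1 2 (first_tip m))) (m + 3) [{2}, {m + 1, m + 2}]"
    and "shape (edges (K 1 1 0)) (m + 2) [{0, 1}, {m, m + 1}]"
    and "1 \<le> i \<Longrightarrow> 1 \<le> j \<Longrightarrow> leg_labels f i \<alpha> \<Longrightarrow> leg_labels f j \<alpha> \<Longrightarrow> (\<And>i. 0 < i \<Longrightarrow> i < m \<Longrightarrow> 0 < b i \<and> b i < (1::real)) \<Longrightarrow>
      0 < \<alpha> \<Longrightarrow> \<alpha> < 1/2 \<Longrightarrow> base_labelled (edges (K i j (first_tip m))) m \<alpha> ((1 - f i) * (1 - f j)) (1 - 2 * \<alpha>) b"
    and "(\<And>i. 0 < i \<Longrightarrow> i < m \<Longrightarrow> 0 < b i \<and> b i < (1::real)) \<Longrightarrow>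
      0 < \<alpha> \<Longrightarrow> \<alpha> < 1/2 \<Longrightarrow> base_labelled (edges (K 1 1 0)) m \<alpha> (1 - 2 * \<alpha>) (1 - 2 * \<alpha>) b"
proof -
  let ?B = "A_hyp 3 m"
  have S: "left_end (edges ?B \<union> set gs \<union> set hs) m a J \<Longrightarrow> edges ?B \<subseteq> edges ?B \<union> set gs \<union> set hs" for gs hs a J by blast
  { obtain gs hs gs' hs' where L: "attached (edges ?B) 0 gs" "attached (edges ?B \<union> set gs) (first_tip m) hs" "length gs = 1" "length hs = 1"
      "attached (edges ?B \<union> set gs \<union> set hs) m gs'" "attached (edges ?B \<union> set gs \<union> set hs \<union> set gs') m hs'"
      "length gs' = 1" "length hs' = 1" "edges (K 1 1 (first_tip m)) = edges ?B \<union> set gs \<union> set hs \<union> set gs' \<union> set hs'"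
      unfolding K_def by (rule double_end_proper[OF m order_refl order_refl, of "first_tip m"]) simp_all
    note E = left_end_base(1)[OF m L(1-4)]
    have "shape (edges (K 1 1 (first_tip m))) (1 + m + 1) [{1}, {1 + m - 1, 1 + m}]"
      unfolding L(9) by (rule right_end_shape(3)[OF m E S[OF E] L(5-8)])
    moreover have "1 + m + 1 = m + 2" "1 + m - 1 = m" "1 + m = m + 1" by simp_all
    ultimately show "shape (edges (K 1 1 (first_tip m))) (m + 2) [{1}, {m, m + 1}]" by (simp only:) }
  { obtain gs hs gs' hs' where L: "attached (edges ?B) 0 gs" "attached (edges ?B \<union> set gs) (first_tip m) hs" "length gs = 1" "length hs = 2"
      "attached (edges ?B \<union> set gs \<union> set hs) m gs'" "attached (edges ?B \<union> set gs \<union> set hs \<union> set gs') m hs'"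
      "length gs' = 1" "length hs' = 1" "edges (K 1 2 (first_tip m)) = edges ?B \<union> set gs \<union> set hs \<union> set gs' \<union> set hs'"
      unfolding K_def by (rule double_end_proper[OF m order_refl one_le_numeral, of "first_tip m"]) simp_all
    note E = left_end_base(2)[OF m L(1-4)]
    have "shape (edges (K 1 2 (first_tip m))) (2 + m + 1) [{2}, {2 + m - 1, 2 + m}]"
      unfolding L(9) by (rule right_end_shape(3)[OF m E S[OF E] L(5-8)])
    moreover have "2 + m + 1 = m + 3" "2 + m - 1 = m + 1" "2 + m = m + 2" by simp_all
    ultimately show "shape (edges (K 1 2 (first_tip m))) (m + 3) [{2}, {m + 1, m + 2}]" by (simp only:) }
  { obtain gs hs gs' hs' where L: "attached (edges ?B) 0 gs" "attached (edges ?B \<union> set gs) 0 hs" "length gs = 1" "length hs = 1"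
      "attached (edges ?B \<union> set gs \<union> set hs) m gs'" "attached (edges ?B \<union> set gs \<union> set hs \<union> set gs') m hs'"
      "length gs' = 1" "length hs' = 1" "edges (K 1 1 0) = edges ?B \<union> set gs \<union> set hs \<union> set gs' \<union> set hs'"
      unfolding K_def by (rule double_end_proper[OF m order_refl order_refl, of 0]) simp_all
    note E = left_end_base(3)[OF m L(1-4)]
    have "shape (edges (K 1 1 0)) (1 + m + 1) [{0, 1}, {1 + m - 1, 1 + m}]"
      unfolding L(9) by (rule right_end_shape(3)[OF m E S[OF E] L(5-8)])
    moreover have "1 + m + 1 = m + 2" "1 + m - 1 = m" "1 + m = m + 1" by simp_all
    ultimately show "shape (edges (K 1 1 0)) (m + 2) [{0, 1}, {m, m + 1}]" by (simp only:)
    assume b: "\<And>i. 0 < i \<Longrightarrow> i < m \<Longrightarrow> 0 < b i \<and> b i < (1::real)" and \<alpha>: "0 < \<alpha>" "\<alpha> < 1/2"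
    note B = base_labelled_left_double[OF m b L(1-4) \<alpha>]
    show "base_labelled (edges (K 1 1 0)) m \<alpha> (1 - 2 * \<alpha>) (1 - 2 * \<alpha>) b"
      unfolding L(9) by (rule base_labelled_right_double[OF m B(1) B(2) L(5-8) \<alpha>]) simp_all }
  { assume ij: "1 \<le> i" "1 \<le> j" and f: "leg_labels f i \<alpha>" "leg_labels f j \<alpha>"
      and b: "\<And>i. 0 < i \<Longrightarrow> i < m \<Longrightarrow> 0 < b i \<and> b i < (1::real)" and \<alpha>: "0 < \<alpha>" "\<alpha> < 1/2"
    obtain gs hs gs' hs' where L: "attached (edges ?B) 0 gs" "attached (edges ?B \<union> set gs) (first_tip m) hs" "length gs = i" "length hs = j"
      "attached (edges ?B \<union> set gs \<union> set hs) m gs'" "attached (edges ?B \<union> set gs \<union> set hs \<union> set gs') m hs'"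
      "length gs' = 1" "length hs' = 1" "edges (K i j (first_tip m)) = edges ?B \<union> set gs \<union> set hs \<union> set gs' \<union> set hs'"
      unfolding K_def by (rule double_end_proper[OF m ij, of "first_tip m"]) simp_all
    have f': "leg_labels f (length gs) \<alpha>" "leg_labels f (length hs) \<alpha>" using f L by simp_all
    note B = base_labelled_left_legs[OF m b L(1,2) f'(1,2)]
    have "base_labelled (edges (K i j (first_tip m))) m \<alpha> ((1 - f (length gs)) * (1 - f (length hs))) (1 - 2 * \<alpha>) b"
      unfolding L(9) by (rule base_labelled_right_double[OF m B(1) B(2) L(5-8) \<alpha>]) simp_all
    then show "base_labelled (edges (K i j (first_tip m))) m \<alpha> ((1 - f i) * (1 - f j)) (1 - 2 * \<alpha>) b"
      unfolding L(3,4) . }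
qed

section \<open>The hypergraphs with a single branching place\<close>

lemma proper_single_edge:
  assumes "card c = 3"
  shows "proper 3 \<lparr>verts = c, edges = {c}\<rparr>"
  using assms linear_helly_single linked_single card.infinite[of c]
  by (auto simp: proper_def r_graph_def)

lemma F3_structure:
  assumes "1 \<le> i" "1 \<le> j" "1 \<le> k"
  obtains gs hs ks where "attached {{0, 1, 2}} (0::nat) gs" "attached ({{0, 1, 2}} \<union> set gs) 1 hs"
    "attached ({{0, 1, 2}} \<union> set gs \<union> set hs) 2 ks" "length gs = i" "length hs = j" "length ks = k"
    "edges (F3 i j k) = {{0, 1, 2}} \<union> set gs \<union> set hs \<union> set ks" "proper 3 (F3 i j k)"
proof -
  let ?H = "\<lparr>verts = {0, 1, 2}, edges = {{0, 1, 2}}\<rparr> :: nat hypergraph"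
  have P: "proper 3 ?H" by (rule proper_single_edge) simp
  have v: "0 \<in> verts ?H" "1 \<in> verts ?H" "2 \<in> verts ?H" by simp_all
  obtain gs hs where L: "attached (edges ?H) 0 gs" "attached (edges ?H \<union> set gs) 1 hs" "length gs = i" "length hs = j"
    "edges (attach_path 3 j 1 (attach_path 3 i 0 ?H)) = edges ?H \<union> set gs \<union> set hs"
    "proper 3 (attach_path 3 j 1 (attach_path 3 i 0 ?H))"
    "verts ?H \<subseteq> verts (attach_path 3 j 1 (attach_path 3 i 0 ?H))"
    by (rule two_attached_paths[OF P v(1,2) assms(1,2)])
  let ?K = "attach_path 3 j 1 (attach_path 3 i 0 ?H)"
  have v2: "2 \<in> verts ?K" using L(7) v(3) by blast
  obtain ks where R: "attached (edges ?K) 2 ks" "length ks = k" "edges (attach_path 3 k 2 ?K) = edges ?K \<union> set ks"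
    "proper 3 (attach_path 3 k 2 ?K)"
    by (rule proper_attach_path[OF L(6) v2 assms(3)])
  have E: "edges ?H = {{0, 1, 2}}" by simp
  have e: "edges (F3 i j k) = {{0, 1, 2}} \<union> set gs \<union> set hs \<union> set ks"
    unfolding F3_def using R(3)[unfolded L(5) E] .
  have pr: "proper 3 (F3 i j k)" unfolding F3_def using R(4) .
  show thesis by (rule that[OF L(1,2)[unfolded E] R(1)[unfolded L(5) E] L(3,4) R(2) e pr])
qed

lemma F3_labelled:
  assumes "1 \<le> i" "1 \<le> j" "1 \<le> k"
    and f: "leg_labels f i \<alpha>" "leg_labels f j \<alpha>" "leg_labels f k \<alpha>"
  shows "\<exists>r. lab (edges (F3 i j k)) {{0, 1, 2}} \<alpha> r \<and> r {0, 1, 2} = (1 - f i) * (1 - f j) * (1 - f k)"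
proof -
  obtain gs hs ks where L: "attached {{0, 1, 2}} (0::nat) gs" "attached ({{0, 1, 2}} \<union> set gs) 1 hs"
    "attached ({{0, 1, 2}} \<union> set gs \<union> set hs) 2 ks" "length gs = i" "length hs = j" "length ks = k"
    "edges (F3 i j k) = {{0, 1, 2}} \<union> set gs \<union> set hs \<union> set ks"
    by (rule F3_structure[OF assms(1-3)])
  let ?c = "{0, 1, 2} :: nat set"
  have l0: "lab {?c} {?c} \<alpha> (\<lambda>_. 1)" by (rule lab_init[OF labelled_eq_single]) simp
  have av: "avoids {?c} {?c} w" for w by (rule avoids_refl)
  have a1: "avoids ({?c} \<union> set gs) {?c} 1" "avoids ({?c} \<union> set gs) {?c} 2"
    by (rule avoids_attached[OF av L(1)]; simp)+
  have a2: "avoids ({?c} \<union> set gs \<union> set hs) {?c} 2" by (rule avoids_attached[OF a1(2) L(2)]) simp_all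
  have ff: "f 0 = 0" "\<And>n j. leg_labels f n \<alpha> \<Longrightarrow> j < n \<Longrightarrow> 0 < f (Suc j) \<and> f (Suc j) < 1 \<and> f (Suc j) * (1 - f j) = \<alpha>"
    using f by (auto simp: leg_labels_def)
  define r1 where "r1 = (\<lambda>e::nat set. if 0 \<in> e then 1 * (1 - f i) else 1)"
  define r2 where "r2 = (\<lambda>e::nat set. if 1 \<in> e then r1 e * (1 - f j) else r1 e)"
  define r3 where "r3 = (\<lambda>e::nat set. if 2 \<in> e then r2 e * (1 - f k) else r2 e)"
  have "lab ({?c} \<union> set gs) {?c} \<alpha> r1" unfolding r1_def
    by (rule lab_leg[OF l0 L(1,4) _ ff(1) ff(2)[OF f(1)]]) auto
  then have "lab ({?c} \<union> set gs \<union> set hs) {?c} \<alpha> r2" unfolding r2_def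
    by (rule lab_leg[OF _ L(2,5) _ ff(1) ff(2)[OF f(2)]]) (use a1(1) in \<open>auto simp: avoids_def\<close>)
  then have "lab ({?c} \<union> set gs \<union> set hs \<union> set ks) {?c} \<alpha> r3" unfolding r3_def
    by (rule lab_leg[OF _ L(3,6) _ ff(1) ff(2)[OF f(3)]]) (use a2 in \<open>auto simp: avoids_def\<close>)
  then show ?thesis unfolding L(7) by (intro exI[of _ r3]) (simp add: r3_def r2_def r1_def)
qed

lemma F3_shape:
  assumes k: "1 \<le> k"
  shows "shape (edges (F3 1 1 k)) (k + 2) [{1}]" "shape (edges (F3 1 2 k)) (k + 3) [{2}]"
proof -
  let ?c = "{0, 1, 2} :: nat set"
  have D: "decorated_path {?c} [?c] []" by (simp add: decorated_path_def)
  have p: "positions [?c] v = {0}" if "v \<in> ?c" for v using that by (auto simp: positions_def)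
  have R: "shape (E \<union> set ks) (a + 1 + k) [{a}]"
    if ex: "\<exists>L h. decorated_path E (L @ [?c]) [h] \<and> length L = a \<and> meets (L @ [?c]) h = {a} \<and>
      (\<forall>u\<in>\<Union>{?c}. u \<noteq> 0 \<longrightarrow> u \<noteq> 1 \<longrightarrow> positions (L @ [?c]) u = (+) a ` positions [?c] u \<and> u \<notin> h)"
    and A: "attached E 2 ks" "length ks = k" for E ks a
  proof -
    obtain L h where L: "decorated_path E (L @ [?c]) [h]" "length L = a" "meets (L @ [?c]) h = {a}"
      "\<forall>u\<in>\<Union>{?c}. u \<noteq> 0 \<longrightarrow> u \<noteq> 1 \<longrightarrow> positions (L @ [?c]) u = (+) a ` positions [?c] u \<and> u \<notin> h"
      using ex by (elim exE conjE) (rule that)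
    have "positions (L @ [?c]) 2 = {length (L @ [?c]) - 1}" "\<forall>x\<in>set [h]. 2 \<notin> x"
      using L(4)[rule_format, of 2] p[of 2] L(2) by simp_all
    then have "decorated_path (E \<union> set ks) ((L @ [?c]) @ ks) [h]" "meets ((L @ [?c]) @ ks) h = {a}"
      using decorated_path_append[OF L(1) A(1)] L(3) by simp_all
    then show ?thesis unfolding shape_def using L(2) A(2)
      by (intro exI[of _ "(L @ [?c]) @ ks"] exI[of _ "[h]"]) simp
  qed
  { obtain gs hs ks where L: "attached {?c} (0::nat) gs" "attached ({?c} \<union> set gs) 1 hs"
      "attached ({?c} \<union> set gs \<union> set hs) 2 ks" "length gs = 1" "length hs = 1" "length ks = k"
      "edges (F3 1 1 k) = {?c} \<union> set gs \<union> set hs \<union> set ks"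
      by (rule F3_structure[OF order_refl order_refl k])
    have "shape (edges (F3 1 1 k)) (1 + 1 + k) [{1}]" unfolding L(7)
      by (rule R[OF left_end_1_1[OF D L(1,2,4,5)] L(3,6)]) (use p in auto)
    then show "shape (edges (F3 1 1 k)) (k + 2) [{1}]" by (simp add: add.commute) }
  { obtain gs hs ks where L: "attached {?c} (0::nat) gs" "attached ({?c} \<union> set gs) 1 hs"
      "attached ({?c} \<union> set gs \<union> set hs) 2 ks" "length gs = 1" "length hs = 2" "length ks = k"
      "edges (F3 1 2 k) = {?c} \<union> set gs \<union> set hs \<union> set ks"
      by (rule F3_structure[OF order_refl one_le_numeral k])
    have "shape (edges (F3 1 2 k)) (2 + 1 + k) [{2}]" unfolding L(7)
      by (rule R[OF left_end_1_2[OF D L(1,2,4,5)] L(3,6)]) (use p in auto)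
    moreover have "2 + 1 + k = k + 3" by simp
    ultimately show "shape (edges (F3 1 2 k)) (k + 3) [{2}]" by (simp only:) }
qed

text \<open>The construction of \<open>E3\<close> starts without edges, whereas
  \<open>attach_path_edges\<close> is about a vertex inside an edge; the first pendant edge is
  therefore computed by hand and serves as the start.\<close>

lemma attach_single_vertex:
  "\<exists>c. card c = 3 \<and> 0 \<in> c \<and> attach_path 3 1 0 \<lparr>verts = {0}, edges = {}\<rparr> = \<lparr>verts = c, edges = {c}\<rparr>"
proof -
  define x where "x = new_vertex (path_graph 1) {0, Suc 0}"
  have x: "1 < x" unfolding x_def by (rule new_vertex_path_graph_gt)
  define \<phi> where "\<phi> = (\<lambda>w::nat. if w = 0 then 0 else Suc (Max {0::nat}) + w)"
  have E: "edges (A_hyp 3 1) = {{0, 1, x}}" unfolding edges_A_hyp_3 by (simp add: x_def)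
  have V: "verts (A_hyp 3 1) = {0, 1, x}" unfolding verts_A_hyp by (auto simp: x_def lessThan_Suc)
  have "attach_path 3 1 0 \<lparr>verts = {0}, edges = {}\<rparr> =
      \<lparr>verts = {0} \<union> \<phi> ` verts (A_hyp 3 1), edges = {} \<union> (\<lambda>e. \<phi> ` e) ` edges (A_hyp 3 1)\<rparr>"
    by (simp add: attach_path_def Let_def \<phi>_def)
  also have "\<dots> = \<lparr>verts = \<phi> ` {0, 1, x}, edges = {\<phi> ` {0, 1, x}}\<rparr>"
    unfolding E V by (simp add: \<phi>_def)
  finally have "attach_path 3 1 0 \<lparr>verts = {0}, edges = {}\<rparr> = \<lparr>verts = \<phi> ` {0, 1, x}, edges = {\<phi> ` {0, 1, x}}\<rparr>" .
  moreover have "card (\<phi> ` {0, 1, x}) = 3" "0 \<in> \<phi> ` {0, 1, x}" using x by (auto simp: \<phi>_def)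
  ultimately show ?thesis by blast
qed

lemma E3_structure:
  assumes "1 \<le> k"
  obtains c g gs where "card c = 3" "0 \<in> c" "attached {c} 0 [g]" "attached {c, g} 0 gs" "length gs = k"
    "edges (E3 1 1 k) = {c, g} \<union> set gs" "proper 3 (E3 1 1 k)"
proof -
  obtain c where c: "card c = 3" "0 \<in> c" "attach_path 3 1 0 \<lparr>verts = {0}, edges = {}\<rparr> = \<lparr>verts = c, edges = {c}\<rparr>"
    using attach_single_vertex by blast
  let ?H = "\<lparr>verts = c, edges = {c}\<rparr>"
  have v: "0 \<in> verts ?H" using c(2) by simp
  obtain hs gs where L: "attached (edges ?H) 0 hs" "attached (edges ?H \<union> set hs) 0 gs" "length hs = 1" "length gs = k"
    "edges (attach_path 3 k 0 (attach_path 3 1 0 ?H)) = edges ?H \<union> set hs \<union> set gs"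
    "proper 3 (attach_path 3 k 0 (attach_path 3 1 0 ?H))"
    by (rule two_attached_paths[OF proper_single_edge[OF c(1)] v v order_refl assms])
  obtain g where g: "hs = [g]" using L(3) by (auto simp: length_Suc_conv)
  have K: "E3 1 1 k = attach_path 3 k 0 (attach_path 3 1 0 ?H)" unfolding E3_def c(3) ..
  have s: "edges ?H \<union> set hs = {c, g}" unfolding g by auto
  have A: "attached {c} 0 [g]" using L(1) unfolding g by simp
  show thesis
    by (rule that[OF c(1,2) A L(2)[unfolded s] L(4)]) (use L(5,6) in \<open>simp_all only: K s\<close>)
qed

text \<open>The two pendant edges divide the load at 0 evenly, with label 1/2 each, and the long leg
  then takes the share \<open>f k\<close> from both alike.\<close>

lemma E3_labelled:
  assumes k: "1 \<le> k" and f: "leg_labels f k \<alpha>"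
  shows "\<exists>F r. lab (edges (E3 1 1 k)) F \<alpha> r \<and> (\<forall>e\<in>F. r e = (1 - f k) / 2) \<and> F \<noteq> {}"
proof -
  obtain c g gs where L: "card c = 3" "0 \<in> c" "attached {c} 0 [g]" "attached {c, g} 0 gs" "length gs = k"
    "edges (E3 1 1 k) = {c, g} \<union> set gs"
    by (rule E3_structure[OF k])
  have fc: "finite c" using L(1) card.infinite by fastforce
  have gm: "0 \<in> g" "g \<noteq> c" using L(3) attached_Cons_notin[OF L(3)] by auto
  have "labelled_eq (insert g {c}) (\<lambda>e. if e = g then 1 - 1/2 else if 0 \<in> e then 1 * (1/2) else 1)"
    by (rule labelled_eq_hang1[OF labelled_eq_single[OF fc] L(3)]) simp_all
  then have "labelled_eq {c, g} (\<lambda>e. 1/2)"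
    unfolding insert_commute[of g c] by (rule labelled_eq_cong) (use L(2) gm in auto)
  then have "lab {c, g} {c, g} \<alpha> (\<lambda>e. 1/2)" by (rule lab_init)
  then have "lab ({c, g} \<union> set gs) {c, g} \<alpha> (\<lambda>e. if 0 \<in> e then 1/2 * (1 - f k) else 1/2)"
    by (rule lab_leg[OF _ L(4,5)]) (use f in \<open>auto simp: leg_labels_def\<close>)
  then show ?thesis unfolding L(6)
    by (intro exI[of _ "{c, g}"] exI[of _ "\<lambda>e. if 0 \<in> e then 1/2 * (1 - f k) else 1/2"]) (use L(2) gm in auto)
qed

text \<open>One pendant edge followed by the long leg is the path; the other pendant edge passes
  through the common vertex of the first two path edges.\<close>

lemma E3_shape:
  assumes k: "1 \<le> k"
  shows "shape (edges (E3 1 1 k)) (k + 1) [{0, 1}]"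
proof -
  obtain c g gs where L: "card c = 3" "0 \<in> c" "attached {c} 0 [g]" "attached {c, g} 0 gs" "length gs = k"
    "edges (E3 1 1 k) = {c, g} \<union> set gs"
    by (rule E3_structure[OF k])
  have gm: "0 \<in> g" "g \<noteq> c" using L(3) attached_Cons_notin[OF L(3)] by auto
  note A = attached_props[OF L(4)]
  have m: "e \<inter> gs ! i \<noteq> {} \<longleftrightarrow> i = 0" if "e \<in> {c, g}" "i < k" for e i
    using attached_meets[OF L(4) that(1), of i] that L(2,5) gm(1) by auto
  have "decorated_path ({c, g} \<union> set gs) (c # gs) [g]" unfolding decorated_path_def
  proof (intro conjI allI impI)
    show "distinct ((c # gs) @ [g])" using A(1,2) gm(2) by auto
    show "set ((c # gs) @ [g]) = {c, g} \<union> set gs" by auto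
    show "[g] ! i \<inter> [g] ! j = {}" if "i < j" "j < length [g]" for i j using that by simp
    fix i j assume ij: "i < j" "j < length (c # gs)"
    then obtain l where l: "j = Suc l" by (cases j) auto
    show "(c # gs) ! i \<inter> (c # gs) ! j \<noteq> {} \<longleftrightarrow> j = Suc i"
    proof (cases i)
      case 0
      then show ?thesis using m[of c l] l ij L(5) by simp
    next
      case (Suc h)
      then show ?thesis using A(4)[of h l] l ij by simp
    qed
  qed
  moreover have "meets (c # gs) g = {0, 1}"
  proof (intro set_eqI)
    fix i
    show "i \<in> meets (c # gs) g \<longleftrightarrow> i \<in> {0, 1}"
    proof (cases i)
      case 0
      have "c \<inter> g \<noteq> {}" using L(2) gm(1) by blast
      then show ?thesis using 0 by (simp add: meets_def)
    next
      case (Suc l)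
      have a: "Suc l \<in> meets (c # gs) g \<longleftrightarrow> l < k \<and> gs ! l \<inter> g \<noteq> {}" by (simp add: meets_def L(5))
      have "l < k \<and> gs ! l \<inter> g \<noteq> {} \<longleftrightarrow> l = 0"
      proof (cases "l < k")
        case True
        then show ?thesis using m[of g l] by (simp add: Int_commute)
      next
        case False
        then show ?thesis using k by simp
      qed
      then show ?thesis unfolding Suc a by simp
    qed
  qed
  ultimately show ?thesis unfolding shape_def L(6)
    by (intro exI[of _ "c # gs"] exI[of _ "[g]"]) (simp add: L(5))
qed

lemma A_hyp_shape: "1 \<le> n \<Longrightarrow> shape (edges (A_hyp 3 n)) n []"
  unfolding shape_def using base_decorated[of n] by (intro exI[of _ "base_path n"] exI[of _ "[]"]) simp

section \<open>Cycles\<close>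

lemma edges_cycle_graph: "edges (cycle_graph n) = (\<lambda>i. {i, Suc i mod n}) ` {..<n}"
  by (simp add: cycle_graph_def atLeast0LessThan)

lemma cycle_edge_meets:
  assumes n: "4 \<le> n" and ij: "i < j" "j < n"
  shows "{i, Suc i mod n} \<inter> {j, Suc j mod n} \<noteq> {} \<longleftrightarrow> j = Suc i \<or> i = 0 \<and> j = n - 1"
proof (cases "j = n - 1")
  case True
  then have "Suc j mod n = 0" "Suc i mod n = Suc i" using n ij by simp_all
  then show ?thesis using True ij n by auto
next
  case False
  then have "Suc j mod n = Suc j" "Suc i mod n = Suc i" using n ij by simp_all
  then show ?thesis using False ij n by auto
qed

lemma cycle_edge_inj:
  assumes n: "4 \<le> n"
  shows "inj_on (\<lambda>i. {i, Suc i mod n}) {..<n}"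
proof -
  have "{i, Suc i mod n} \<noteq> {j, Suc j mod n}" if ij: "i < j" "j < n" for i j
  proof (cases "j = n - 1")
    case True
    then have "Suc j mod n = 0" "Suc i mod n = Suc i" using n ij by simp_all
    then show ?thesis using True ij n by (auto simp: doubleton_eq_iff)
  next
    case False
    then have "Suc j mod n = Suc j" "Suc i mod n = Suc i" using n ij by simp_all
    then show ?thesis using ij by (auto simp: doubleton_eq_iff)
  qed
  then show ?thesis by (intro linorder_inj_onI') (auto simp: lessThan_iff)
qed

lemma cycle_graph_shape:
  assumes n: "4 \<le> n"
  shows "cycle_shape (edges (cycle_graph n)) n"
  unfolding cycle_shape_def
proof (intro exI conjI allI impI)
  let ?L = "map (\<lambda>i. {i, Suc i mod n}) [0..<n]"
  show "distinct ?L" using cycle_edge_inj[OF n] by (simp add: distinct_map atLeast0LessThan)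
  show "set ?L = edges (cycle_graph n)" by (simp add: edges_cycle_graph atLeast0LessThan)
  show "length ?L = n" by simp
  show "?L ! i \<inter> ?L ! j \<noteq> {} \<longleftrightarrow> j = Suc i \<or> i = 0 \<and> j = n - 1" if "i < j" "j < n" for i j
    using cycle_edge_meets[OF n that] that by simp
qed

lemma cycle_shape_no_triangle:
  assumes n: "4 \<le> n" and S: "cycle_shape E n" and E: "e \<in> E" "f \<in> E" "g \<in> E" "e \<noteq> f" "e \<noteq> g" "f \<noteq> g"
    and m: "e \<inter> f \<noteq> {}" "e \<inter> g \<noteq> {}" "f \<inter> g \<noteq> {}"
  shows False
proof -
  obtain L where L: "distinct L" "set L = E" "length L = n"
    "\<forall>i j. i < j \<longrightarrow> j < n \<longrightarrow> (L ! i \<inter> L ! j \<noteq> {} \<longleftrightarrow> j = Suc i \<or> i = 0 \<and> j = n - 1)"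
    using S unfolding cycle_shape_def by (elim exE conjE) (rule that)
  obtain a b c where abc: "a < n" "e = L ! a" "b < n" "f = L ! b" "c < n" "g = L ! c"
    using E(1-3) L(2,3) by (metis in_set_conv_nth)
  have ne: "a \<noteq> b" "a \<noteq> c" "b \<noteq> c" using E(4-6) abc by auto
  have adj: "(j = Suc i \<or> i = 0 \<and> j = n - 1) \<or> (i = Suc j \<or> j = 0 \<and> i = n - 1)"
    if "i < n" "j < n" "i \<noteq> j" "L ! i \<inter> L ! j \<noteq> {}" for i j
  proof (cases "i < j")
    case True
    then show ?thesis using L(4) that by blast
  next
    case False
    then have "j < i" "L ! j \<inter> L ! i \<noteq> {}" using that by (auto simp: Int_commute)
    then show ?thesis using L(4) that by blast
  qed
  show False using adj[of a b] adj[of a c] adj[of b c] m abc ne n by auto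
qed

lemma cycle_edge_mem:
  assumes n: "2 \<le> n" and v: "v < n" and i: "i < n"
  shows "v \<in> {i, Suc i mod n} \<longleftrightarrow> i = v \<or> i = (if v = 0 then n - 1 else v - 1)"
proof (cases "i = n - 1")
  case True
  then have "Suc i mod n = 0" using n by simp
  then show ?thesis using True v i by auto
next
  case False
  then have "Suc i mod n = Suc i" using i by simp
  then show ?thesis using False v i by auto
qed

lemma proper_cycle_graph:
  assumes n: "4 \<le> n"
  shows "proper 2 (cycle_graph n)"
proof -
  let ?e = "\<lambda>i. {i, Suc i mod n}"
  have ne: "i \<noteq> Suc i mod n" if "i < n" for i
    using that n by (cases "Suc i = n") auto
  have U: "verts (cycle_graph n) = \<Union>(edges (cycle_graph n))"
  proof -
    have "verts (cycle_graph n) = {..<n}" by (simp add: cycle_graph_def atLeast0LessThan)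
    moreover have "\<Union>(?e ` {..<n}) = {..<n}" using n by auto
    ultimately show ?thesis by (simp only: edges_cycle_graph)
  qed
  have R: "r_graph 2 (cycle_graph n)" unfolding r_graph_def
  proof (intro conjI ballI)
    show "finite (verts (cycle_graph n))" by (simp add: cycle_graph_def)
    fix e assume e: "e \<in> edges (cycle_graph n)"
    then show "e \<subseteq> verts (cycle_graph n)" unfolding U by blast
    show "card e = 2" using e ne unfolding edges_cycle_graph by auto
  qed
  have lin: "linear_helly (edges (cycle_graph n))" unfolding linear_helly_def
  proof (intro conjI ballI impI)
    fix e f x y assume a: "e \<in> edges (cycle_graph n)" "f \<in> edges (cycle_graph n)" "e \<noteq> f" "x \<in> e \<inter> f" "y \<in> e \<inter> f"
    show "x = y"
    proof (rule ccontr)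
      assume xy: "x \<noteq> y"
      have c: "card e = 2" "card f = 2" using R a(1,2) by (auto simp: r_graph_def)
      have fin: "finite e" "finite f" using c card.infinite by fastforce+
      have "{x, y} = e" "{x, y} = f"
        using card_subset_eq[OF fin(1), of "{x, y}"] card_subset_eq[OF fin(2), of "{x, y}"] a(4,5) xy c by auto
      then show False using a(3) by simp
    qed
  next
    fix e f g assume "e \<in> edges (cycle_graph n)" "f \<in> edges (cycle_graph n)" "g \<in> edges (cycle_graph n)"
      "e \<noteq> f" "e \<noteq> g" "f \<noteq> g" "e \<inter> f \<noteq> {}" "e \<inter> g \<noteq> {}" "f \<inter> g \<noteq> {}"
    then show "e \<inter> f \<inter> g \<noteq> {}" using cycle_shape_no_triangle[OF n cycle_graph_shape[OF n]] by blast
  qed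
  have "linked (?e ` {..<Suc m})" if "Suc m \<le> n" for m
    using that
  proof (induction m)
    case 0
    have e: "?e ` {..<Suc 0} = {?e 0}" by auto
    show ?case unfolding e by (rule linked_single)
  next
    case (Suc m)
    have "?e ` {..<Suc (Suc m)} = insert (?e (Suc m)) (?e ` {..<Suc m})" by (simp only: lessThan_Suc image_insert)
    moreover have "Suc m \<in> ?e m" "m \<in> {..<Suc m}" using Suc.prems by auto
    then have "?e (Suc m) \<inter> \<Union>(?e ` {..<Suc m}) \<noteq> {}" by blast
    ultimately show ?case using linked_insert[OF Suc.IH] Suc.prems by simp
  qed
  from this[of "n - 1"] have "linked (edges (cycle_graph n))" unfolding edges_cycle_graph using n by simp
  moreover have "edges (cycle_graph n) \<noteq> {}" unfolding edges_cycle_graph using n by (auto simp: lessThan_empty_iff)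
  ultimately show ?thesis using R U lin by (simp add: proper_def)
qed

text \<open>With unit weights every vertex has load 2, and an edge of the graph has two
  vertices.\<close>

lemma normal_cycle_graph:
  assumes n: "4 \<le> n"
  shows "normal (edges (cycle_graph n)) (1/4)"
proof -
  let ?e = "\<lambda>i. {i, Suc i mod n}" and ?E = "edges (cycle_graph n)"
  have fin: "finite ?E" "\<And>e. e \<in> ?E \<Longrightarrow> finite e" unfolding edges_cycle_graph by auto
  have w: "weighting ?E (\<lambda>_. 1)" using fin by (simp add: weighting_def)
  have load: "load ?E (\<lambda>_. 1) v = 2" if v: "v < n" for v
  proof -
    let ?p = "if v = 0 then n - 1 else v - 1"
    have "{e\<in>?E. v \<in> e} = ?e ` {v, ?p}"
    proof -
      have "{e\<in>?E. v \<in> e} = ?e ` {i. i < n \<and> v \<in> ?e i}" unfolding edges_cycle_graph by blast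
      also have "{i. i < n \<and> v \<in> ?e i} = {v, ?p}"
      proof (rule set_eqI)
        fix i
        have p: "?p < n" "2 \<le> n" using n v by auto
        show "i \<in> {i. i < n \<and> v \<in> ?e i} \<longleftrightarrow> i \<in> {v, ?p}"
        proof (cases "i < n")
          case True
          then show ?thesis unfolding mem_Collect_eq cycle_edge_mem[OF p(2) v True] by blast
        next
          case False
          then have "i \<noteq> v" "i \<noteq> ?p" using v p(1) by blast+
          then show ?thesis using False by blast
        qed
      qed
      finally show ?thesis .
    qed
    moreover have "card (?e ` {v, ?p}) = card {v, ?p}"
      using v n by (intro card_image inj_on_subset[OF cycle_edge_inj[OF n]]) auto
    moreover have "card {v, ?p} = 2" using n by auto
    ultimately show ?thesis by (simp add: load_def)
  qed
  have "pot ?E (\<lambda>_. 1) e = 1/4" if e: "e \<in> ?E" for e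
  proof -
    have c: "card e = 2" "e \<subseteq> verts (cycle_graph n)" using proper_cycle_graph[OF n] e by (auto simp: proper_def r_graph_def)
    have "pot ?E (\<lambda>_. 1) e = (\<Prod>v\<in>e. 1 / 2)" unfolding pot_def
      using load c(2) by (intro prod.cong) (auto simp: cycle_graph_def)
    then show ?thesis using c(1) by (simp add: power2_eq_square)
  qed
  then have "labelled_eq ?E (\<lambda>_. 1/4)" unfolding labelled_eq_def using w by (intro exI[of _ "\<lambda>_. 1"]) simp
  then show ?thesis unfolding normal_def by (intro exI[of _ "\<lambda>_. 1/4"]) simp
qed

section \<open>Labels as phases\<close>

text \<open>
  For \<open>\<alpha> = 1 / (4 cos\<^sup>2 \<theta>)\<close> the label recursion \<open>y \<mapsto> \<alpha> / (1 - y)\<close> along a path becomes the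
  rotation \<open>\<phi> \<mapsto> \<phi> + \<theta>\<close> in the following phase coordinate.
\<close>
definition phase_label :: "real \<Rightarrow> real \<Rightarrow> real" where
  "phase_label \<theta> \<phi> = sin \<phi> / (2 * cos \<theta> * sin (\<phi> + \<theta>))"

definition alpha :: "real \<Rightarrow> real" where
  "alpha \<theta> = 1 / (4 * (cos \<theta>)\<^sup>2)"

text \<open>The sum formula sin (\<phi> + 2\<theta>) + sin \<phi> = 2 cos \<theta> sin (\<phi> +
  \<theta>) makes the complement a quotient of the same kind, with the numerator moved on by
  2\<theta>. This is why the label recursion is a rotation.\<close>

lemma one_minus_phase_label:
  assumes "0 < \<theta>" "\<theta> < pi/2" "0 \<le> \<phi>" "\<phi> + \<theta> < pi"
  shows "1 - phase_label \<theta> \<phi> = sin (\<phi> + 2 * \<theta>) / (2 * cos \<theta> * sin (\<phi> + \<theta>))"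
proof -
  have c: "cos \<theta> > 0" using assms by (intro cos_gt_zero_pi) auto
  have s: "sin (\<phi> + \<theta>) > 0" using assms by (intro sin_gt_zero) auto
  have "sin (\<phi> + 2 * \<theta>) + sin \<phi> = 2 * cos \<theta> * sin (\<phi> + \<theta>)"
    using sin_add[of "\<phi> + \<theta>" \<theta>] sin_diff[of "\<phi> + \<theta>" \<theta>] by (simp add: algebra_simps)
  then show ?thesis using c s unfolding phase_label_def by (simp add: field_simps)
qed

lemma phase_label_step:
  assumes "0 < \<theta>" "\<theta> < pi/2" "0 \<le> \<phi>" "\<phi> + 2 * \<theta> < pi"
  shows "phase_label \<theta> (\<phi> + \<theta>) * (1 - phase_label \<theta> \<phi>) = alpha \<theta>"
proof -
  have c: "cos \<theta> > 0" using assms by (intro cos_gt_zero_pi) auto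
  have s: "sin (\<phi> + \<theta>) > 0" "sin (\<phi> + 2 * \<theta>) > 0" using assms by (auto intro!: sin_gt_zero)
  have "phase_label \<theta> (\<phi> + \<theta>) = sin (\<phi> + \<theta>) / (2 * cos \<theta> * sin (\<phi> + 2 * \<theta>))"
    unfolding phase_label_def by (simp add: algebra_simps)
  then show ?thesis using c s one_minus_phase_label[of \<theta> \<phi>] assms
    by (simp add: alpha_def power2_eq_square)
qed

lemma phase_label_bounds:
  assumes "0 < \<theta>" "\<theta> < pi/2" "0 < \<phi>" "\<phi> + 2 * \<theta> < pi"
  shows "0 < phase_label \<theta> \<phi>" "phase_label \<theta> \<phi> < 1"
proof -
  have c: "cos \<theta> > 0" using assms by (intro cos_gt_zero_pi) auto
  have s: "sin \<phi> > 0" "sin (\<phi> + \<theta>) > 0" "sin (\<phi> + 2 * \<theta>) > 0" using assms by (auto intro!: sin_gt_zero)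
  show "0 < phase_label \<theta> \<phi>" unfolding phase_label_def using c s by simp
  have "1 - phase_label \<theta> \<phi> > 0" using one_minus_phase_label[of \<theta> \<phi>] assms c s by simp
  then show "phase_label \<theta> \<phi> < 1" by simp
qed

text \<open>The symmetry of the sine about pi/2: the complementary share at a vertex is again a
  phase, counted from the other end of the path.\<close>

lemma phase_label_reflect:
  assumes "0 < \<theta>" "\<theta> < pi/2" "0 \<le> \<phi>" "\<phi> + \<theta> < pi" "\<phi> + \<psi> + 2 * \<theta> = pi"
  shows "1 - phase_label \<theta> \<phi> = phase_label \<theta> \<psi>"
proof -
  have p: "\<psi> = pi - (\<phi> + 2 * \<theta>)" "\<psi> + \<theta> = pi - (\<phi> + \<theta>)" using assms(5) by auto
  show ?thesis unfolding one_minus_phase_label[OF assms(1-4)]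
    unfolding phase_label_def p(2) sin_pi_minus unfolding p(1) sin_pi_minus ..
qed

lemma alpha_bounds:
  assumes "0 \<le> \<theta>" "\<theta> < pi/4"
  shows "0 < alpha \<theta>" "alpha \<theta> < 1/2" "cos (2 * \<theta>) > 0" "cos \<theta> > 0" "1 - 2 * alpha \<theta> = cos (2 * \<theta>) / (2 * (cos \<theta>)\<^sup>2)"
proof -
  show c2: "cos (2 * \<theta>) > 0" using assms by (intro cos_gt_zero_pi) auto
  show c: "cos \<theta> > 0" using assms by (intro cos_gt_zero_pi) auto
  have e: "cos (2 * \<theta>) = 2 * (cos \<theta>)\<^sup>2 - 1" by (rule cos_double_cos)
  show "0 < alpha \<theta>" unfolding alpha_def using c by simp
  show f: "1 - 2 * alpha \<theta> = cos (2 * \<theta>) / (2 * (cos \<theta>)\<^sup>2)"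
    unfolding alpha_def e using c by (simp add: field_simps)
  have "1 - 2 * alpha \<theta> > 0" unfolding f using c c2 by simp
  then show "alpha \<theta> < 1/2" by simp
qed

text \<open>The exact phases of ends: \<theta> for a free end, pi/2 for a leg that leaves 2\<alpha>
  to be divided by two pendant edges, and pi/2 + \<theta> for every end with the factor 1 -
  2\<alpha>. The phase 2\<theta> is the share of a leg of two edges.\<close>

lemma phase_label_special:
  assumes "0 < \<theta>" "\<theta> < pi/4"
  shows "phase_label \<theta> \<theta> = alpha \<theta>" "phase_label \<theta> (2 * \<theta>) * (1 - alpha \<theta>) = alpha \<theta>"
    "phase_label \<theta> (pi/2) = 2 * alpha \<theta>" "(1 - 2 * alpha \<theta>) * phase_label \<theta> (pi/2 + \<theta>) = alpha \<theta>"
proof -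
  note b = alpha_bounds[of \<theta>]
  have c: "cos \<theta> > 0" "cos (2 * \<theta>) > 0" using b assms by auto
  have s: "sin \<theta> > 0" using assms by (intro sin_gt_zero) auto
  show 1: "phase_label \<theta> \<theta> = alpha \<theta>"
    using phase_label_step[of \<theta> 0] assms by (simp add: phase_label_def)
  have "phase_label \<theta> (\<theta> + \<theta>) * (1 - phase_label \<theta> \<theta>) = alpha \<theta>"
    using assms by (intro phase_label_step) auto
  moreover have "\<theta> + \<theta> = 2 * \<theta>" by simp
  ultimately show "phase_label \<theta> (2 * \<theta>) * (1 - alpha \<theta>) = alpha \<theta>"
    unfolding 1 by metis
  have "phase_label \<theta> (pi/2) = 1 / (2 * cos \<theta> * cos \<theta>)"
    unfolding phase_label_def sin_add by simp
  then show "phase_label \<theta> (pi/2) = 2 * alpha \<theta>"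
    using c by (simp add: alpha_def power2_eq_square)
  have e: "pi/2 + \<theta> + \<theta> = pi/2 + 2 * \<theta>" by simp
  have "phase_label \<theta> (pi/2 + \<theta>) = 1 / (2 * cos (2 * \<theta>))"
    unfolding phase_label_def e unfolding sin_add using c by simp
  moreover have "1 - 2 * alpha \<theta> = cos (2 * \<theta>) / (2 * (cos \<theta>)\<^sup>2)"
    using assms by (intro b(5)) auto
  ultimately show "(1 - 2 * alpha \<theta>) * phase_label \<theta> (pi/2 + \<theta>) = alpha \<theta>"
    using c by (simp add: alpha_def)
qed

lemma leg_labels_phase:
  assumes "0 < \<theta>" "\<theta> < pi/2" "(real k + 2) * \<theta> < pi"
  shows "leg_labels (\<lambda>j. phase_label \<theta> (real j * \<theta>)) k (alpha \<theta>)"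
  unfolding leg_labels_def
proof (intro conjI allI impI)
  show "phase_label \<theta> (real 0 * \<theta>) = 0" by (simp add: phase_label_def)
  fix j assume j: "j < k"
  have "real (Suc j) * \<theta> + 2 * \<theta> \<le> (real k + 2) * \<theta>"
    using j assms(1) unfolding distrib_right[symmetric] by (intro mult_right_mono) auto
  then have b: "real (Suc j) * \<theta> + 2 * \<theta> < pi" using assms(3) by simp
  moreover have "0 < real (Suc j) * \<theta>" using assms(1) by simp
  ultimately show "0 < phase_label \<theta> (real (Suc j) * \<theta>)" "phase_label \<theta> (real (Suc j) * \<theta>) < 1"
    using phase_label_bounds[OF assms(1,2)] by auto
  have "real j * \<theta> + 2 * \<theta> < pi" "0 \<le> real j * \<theta>" using b assms(1) by (auto simp: algebra_simps)
  then show "phase_label \<theta> (real (Suc j) * \<theta>) * (1 - phase_label \<theta> (real j * \<theta>)) = alpha \<theta>"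
    using phase_label_step[OF assms(1,2), of "real j * \<theta>"] by (simp add: algebra_simps)
qed

text \<open>Clearing the positive denominators turns the balance at such an end into a comparison of
  sines, which can be decided when \<omega> is a small multiple of \<theta>.\<close>

lemma double_pendant_end_iff:
  assumes "0 < \<theta>" "\<theta> < pi/4" "0 < \<omega>" "\<omega> + \<theta> < pi"
  shows "(1 - alpha \<theta>)\<^sup>2 * phase_label \<theta> \<omega> < alpha \<theta> \<longleftrightarrow> sin (\<omega> - 4 * \<theta>) < 2 * sin (2 * \<theta>) * cos \<omega>"
    and "alpha \<theta> < (1 - alpha \<theta>)\<^sup>2 * phase_label \<theta> \<omega> \<longleftrightarrow> 2 * sin (2 * \<theta>) * cos \<omega> < sin (\<omega> - 4 * \<theta>)"
proof -
  define c where "c = cos \<theta>"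
  define s where "s = sin \<theta>"
  have c: "c > 0" using alpha_bounds[of \<theta>] assms by (auto simp: c_def)
  have S: "sin (\<omega> + \<theta>) > 0" using assms by (intro sin_gt_zero) auto
  have cs: "s\<^sup>2 = 1 - c\<^sup>2" unfolding s_def c_def by (rule sin_squared_eq)
  have d2: "sin (2 * \<theta>) = 2 * s * c" "cos (2 * \<theta>) = 2 * c\<^sup>2 - 1"
    unfolding s_def c_def by (rule sin_double, rule cos_double_cos)
  have "sin (4 * \<theta>) = 2 * sin (2 * \<theta>) * cos (2 * \<theta>)" "cos (4 * \<theta>) = 2 * (cos (2 * \<theta>))\<^sup>2 - 1"
    using sin_double[of "2 * \<theta>"] cos_double_cos[of "2 * \<theta>"] by simp_all
  then have d4: "sin (4 * \<theta>) = 4 * s * c * (2 * c\<^sup>2 - 1)" "cos (4 * \<theta>) = 8 * c^4 - 8 * c\<^sup>2 + 1"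
    unfolding d2 by (simp_all add: algebra_simps power2_eq_square power4_eq_xxxx)
  have A: "alpha \<theta> = 1 / (4 * c\<^sup>2)" by (simp add: alpha_def c_def)
  \<comment> \<open>In terms of \<open>c\<close> and \<open>s\<close>, both sides are (8 c^4 - 8 c^2
    + 1) sin \<omega> - 8 s c^3 cos \<omega>.\<close>
  have num: "(4 * c\<^sup>2 - 1)\<^sup>2 * sin \<omega> - 8 * c^3 * sin (\<omega> + \<theta>) = sin (\<omega> - 4 * \<theta>) - 2 * sin (2 * \<theta>) * cos \<omega>"
    unfolding sin_add sin_diff d2 d4 s_def[symmetric] c_def[symmetric]
    by (simp add: algebra_simps power2_eq_square power3_eq_cube power4_eq_xxxx)
  have "(1 - alpha \<theta>)\<^sup>2 * phase_label \<theta> \<omega> - alpha \<theta>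
      = ((4 * c\<^sup>2 - 1)\<^sup>2 * sin \<omega> - 8 * c^3 * sin (\<omega> + \<theta>)) / (32 * c^5 * sin (\<omega> + \<theta>))"
    unfolding A phase_label_def c_def[symmetric] using c S
    by (simp add: field_simps eval_nat_numeral)
  then have sub: "(1 - alpha \<theta>)\<^sup>2 * phase_label \<theta> \<omega> - alpha \<theta>
      = (sin (\<omega> - 4 * \<theta>) - 2 * sin (2 * \<theta>) * cos \<omega>) / (32 * c^5 * sin (\<omega> + \<theta>))" (is "?l = ?r / ?d")
    unfolding num .
  have sign: "x / d < 0 \<longleftrightarrow> x < 0" "0 < x / d \<longleftrightarrow> 0 < x" if "0 < d" for x d :: real
    using that by (auto simp: divide_less_0_iff zero_less_divide_iff)
  have "?d > 0" using c S by simp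
  then have "?l < 0 \<longleftrightarrow> ?r < 0" "0 < ?l \<longleftrightarrow> 0 < ?r"
    unfolding sub by (rule sign(1), rule sign(2))
  then show "(1 - alpha \<theta>)\<^sup>2 * phase_label \<theta> \<omega> < alpha \<theta> \<longleftrightarrow> sin (\<omega> - 4 * \<theta>) < 2 * sin (2 * \<theta>) * cos \<omega>"
    "alpha \<theta> < (1 - alpha \<theta>)\<^sup>2 * phase_label \<theta> \<omega> \<longleftrightarrow> 2 * sin (2 * \<theta>) * cos \<omega> < sin (\<omega> - 4 * \<theta>)" by simp_all
qed

text \<open>For \<omega> = k\<theta> the two sides behave like (k - 4)\<theta> and 4\<theta> near 0,
  so the balance tends to k = 8. For k = 3, 4 the left side is not positive; for k = 6 the claim
  reads 1/2 < cos 6\<theta>; k = 7 combines sin 3\<theta> <= (3/2) sin 2\<theta> with cos 7\<theta>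
  > 3/4.\<close>

lemma double_pendant_end_less:
  assumes \<theta>: "0 < \<theta>"
  shows "\<omega> \<in> {3 * \<theta>, 4 * \<theta>} \<Longrightarrow> \<theta> < pi/8 \<Longrightarrow> (1 - alpha \<theta>)\<^sup>2 * phase_label \<theta> \<omega> < alpha \<theta>"
    and "\<omega> = 6 * \<theta> \<Longrightarrow> \<theta> < pi/18 \<Longrightarrow> (1 - alpha \<theta>)\<^sup>2 * phase_label \<theta> \<omega> < alpha \<theta>"
    and "\<omega> = 7 * \<theta> \<Longrightarrow> \<theta> \<le> pi/42 \<Longrightarrow> (1 - alpha \<theta>)\<^sup>2 * phase_label \<theta> \<omega> < alpha \<theta>"
proof -
  show "(1 - alpha \<theta>)\<^sup>2 * phase_label \<theta> \<omega> < alpha \<theta>" if \<omega>: "\<omega> \<in> {3 * \<theta>, 4 * \<theta>}" and t: "\<theta> < pi/8"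
  proof -
    have s: "sin (2 * \<theta>) > 0" "sin \<theta> \<ge> 0" using \<theta> t by (auto intro!: sin_gt_zero sin_ge_zero)
    have c: "cos \<omega> > 0" using \<theta> t \<omega> by (intro cos_gt_zero_pi) auto
    have "sin (\<omega> - 4 * \<theta>) \<le> 0" using \<omega> s(2) by auto
    moreover have "0 < 2 * sin (2 * \<theta>) * cos \<omega>" using s c by simp
    ultimately have "sin (\<omega> - 4 * \<theta>) < 2 * sin (2 * \<theta>) * cos \<omega>" by linarith
    then show ?thesis using double_pendant_end_iff(1)[of \<theta> \<omega>] \<theta> t \<omega> by auto
  qed
  show "(1 - alpha \<theta>)\<^sup>2 * phase_label \<theta> \<omega> < alpha \<theta>" if \<omega>: "\<omega> = 6 * \<theta>" and t: "\<theta> < pi/18"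
  proof -
    have s: "sin (2 * \<theta>) > 0" using \<theta> t by (intro sin_gt_zero) auto
    have "cos (pi/3) < cos (6 * \<theta>)" using \<theta> t by (intro cos_monotone_0_pi) auto
    then have "1/2 < cos \<omega>" unfolding \<omega> by (simp add: cos_60)
    then have "sin (2 * \<theta>) * 1 < sin (2 * \<theta>) * (2 * cos \<omega>)" using s by (intro mult_strict_left_mono) auto
    then have "sin (\<omega> - 4 * \<theta>) < 2 * sin (2 * \<theta>) * cos \<omega>" unfolding \<omega> by (simp add: mult_ac)
    then show ?thesis using double_pendant_end_iff(1)[of \<theta> \<omega>] \<theta> t \<omega> by auto
  qed
  show "(1 - alpha \<theta>)\<^sup>2 * phase_label \<theta> \<omega> < alpha \<theta>" if \<omega>: "\<omega> = 7 * \<theta>" and t: "\<theta> \<le> pi/42"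
  proof -
    have s: "sin (2 * \<theta>) > 0" "sin \<theta> > 0" using \<theta> t by (auto intro!: sin_gt_zero)
    have "cos (pi/6) \<le> cos (7 * \<theta>)" using \<theta> t by (intro cos_monotone_0_pi_le) auto
    moreover have "3/2 < sqrt 3" by (rule real_less_rsqrt) (simp add: power2_eq_square)
    ultimately have c7: "3/4 < cos \<omega>" unfolding \<omega> cos_30 by simp
    have c1: "0 < cos \<theta>" "cos \<theta> \<le> 1" using \<theta> t by (auto intro!: cos_gt_zero_pi)
    have "sin (3 * \<theta>) = sin (2 * \<theta> + \<theta>)" by (simp add: algebra_simps)
    also have "\<dots> = sin \<theta> * (4 * (cos \<theta>)\<^sup>2 - 1)"
      unfolding sin_add sin_double cos_double_cos by (simp add: algebra_simps power2_eq_square)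
    also have "\<dots> \<le> sin \<theta> * (3 * cos \<theta>)"
    proof (rule mult_left_mono)
      have "(1 - cos \<theta>) * (1 + 4 * cos \<theta>) \<ge> 0" using c1 by (intro mult_nonneg_nonneg) auto
      then show "4 * (cos \<theta>)\<^sup>2 - 1 \<le> 3 * cos \<theta>" by (simp add: algebra_simps power2_eq_square)
    qed (use s in simp)
    also have "\<dots> = sin (2 * \<theta>) * (3/2)" unfolding sin_double by simp
    also have "\<dots> < sin (2 * \<theta>) * (2 * cos \<omega>)" using s c7 by (intro mult_strict_left_mono) auto
    finally have "sin (\<omega> - 4 * \<theta>) < 2 * sin (2 * \<theta>) * cos \<omega>" unfolding \<omega> by (simp add: mult_ac)
    then show ?thesis using double_pendant_end_iff(1)[of \<theta> \<omega>] \<theta> t \<omega> by auto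
  qed
qed

text \<open>Replacing cos \<omega> by the larger cos 2\<theta> turns the right side into sin
  4\<theta>, and from 8\<theta> on this is at most sin (\<omega> - 4\<theta>).\<close>

lemma double_pendant_end_greater:
  assumes \<theta>: "0 < \<theta>" and \<omega>: "8 * \<theta> \<le> \<omega>" "\<omega> \<le> pi/2"
  shows "alpha \<theta> < (1 - alpha \<theta>)\<^sup>2 * phase_label \<theta> \<omega>"
proof -
  have s: "sin (2 * \<theta>) > 0" using \<theta> \<omega> by (intro sin_gt_zero) auto
  have "cos \<omega> < cos (2 * \<theta>)" using \<theta> \<omega> by (intro cos_monotone_0_pi) auto
  then have "2 * sin (2 * \<theta>) * cos \<omega> < 2 * sin (2 * \<theta>) * cos (2 * \<theta>)" using s by (intro mult_strict_left_mono) auto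
  also have "\<dots> = sin (4 * \<theta>)" using sin_double[of "2 * \<theta>"] by simp
  also have "\<dots> \<le> sin (\<omega> - 4 * \<theta>)" using \<theta> \<omega> by (intro sin_monotone_2pi_le) auto
  finally show ?thesis using double_pendant_end_iff(2)[of \<theta> \<omega>] \<theta> \<omega> by auto
qed

text \<open>
  Labelling of the base path by consecutive phases, starting with \<open>\<omega>\<close> at the last edge; then the
  first edge sees the phase \<open>\<omega>'\<close>.
\<close>
lemma phase_path:
  assumes \<theta>: "0 < \<theta>" "\<theta> < pi/2" and \<omega>: "0 < \<omega>" "0 < \<omega>'" "\<omega> + \<omega>' + real m * \<theta> = pi" and m: "2 \<le> m"
  defines "b \<equiv> \<lambda>i. 1 - phase_label \<theta> (\<omega> + real (m - 1 - i) * \<theta>)"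
  shows "0 < i \<Longrightarrow> i < m \<Longrightarrow> 0 < b i \<and> b i < 1"
    and "i < m \<Longrightarrow> (if i = 0 then A else 1 - b i) * (if Suc i < m then b (Suc i) else Z) =
      (if i = 0 then A * phase_label \<theta> \<omega>' else if i = m - 1 then Z * phase_label \<theta> \<omega> else alpha \<theta>)"
proof -
  have lim: "\<omega> + real j * \<theta> + 2 * \<theta> < pi" if "j + 2 \<le> m" for j
  proof -
    have "real j * \<theta> + 2 * \<theta> = (real j + 2) * \<theta>" by (simp add: algebra_simps)
    also have "\<dots> \<le> real m * \<theta>" using that \<theta> by (intro mult_right_mono) auto
    finally show ?thesis using \<omega> by linarith
  qed
  have pos: "0 < \<omega> + real j * \<theta>" for j using \<omega> \<theta> by (intro add_pos_nonneg) auto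
  show "0 < b i \<and> b i < 1" if "0 < i" "i < m"
    using phase_label_bounds[OF \<theta> pos[of "m - 1 - i"] lim[of "m - 1 - i"]] that unfolding b_def by auto
  show "(if i = 0 then A else 1 - b i) * (if Suc i < m then b (Suc i) else Z) =
      (if i = 0 then A * phase_label \<theta> \<omega>' else if i = m - 1 then Z * phase_label \<theta> \<omega> else alpha \<theta>)" if i: "i < m"
  proof -
    consider "i = 0" | "i \<noteq> 0" "i = m - 1" | "i \<noteq> 0" "Suc i < m" using i by linarith
    then show ?thesis
    proof cases
      case 1
      have "\<omega> + real (m - 2) * \<theta> + \<omega>' + 2 * \<theta> = pi"
        using \<omega>(3) m by (simp add: of_nat_diff algebra_simps)
      moreover have "\<omega> + real (m - 2) * \<theta> + 2 * \<theta> < pi" using lim[of "m - 2"] m by simp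
      ultimately have "1 - phase_label \<theta> (\<omega> + real (m - 2) * \<theta>) = phase_label \<theta> \<omega>'"
        using pos[of "m - 2"] \<theta> by (intro phase_label_reflect) linarith+
      then have "b (Suc 0) = phase_label \<theta> \<omega>'" unfolding b_def using m by (simp add: numeral_2_eq_2)
      then show ?thesis using 1 m by simp
    next
      case 2
      then show ?thesis using m by (simp add: b_def)
    next
      case 3
      define j where "j = m - 1 - Suc i"
      have e: "m - 1 - i = Suc j" using 3 by (simp add: j_def)
      have "phase_label \<theta> ((\<omega> + real j * \<theta>) + \<theta>) * (1 - phase_label \<theta> (\<omega> + real j * \<theta>)) = alpha \<theta>"
        using lim[of j] pos[of j] 3 \<theta> by (intro phase_label_step) (auto simp: j_def)
      moreover have "(\<omega> + real j * \<theta>) + \<theta> = \<omega> + real (Suc j) * \<theta>" by (simp add: algebra_simps)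
      ultimately have "phase_label \<theta> (\<omega> + real (Suc j) * \<theta>) * (1 - phase_label \<theta> (\<omega> + real j * \<theta>)) = alpha \<theta>" by metis
      then have "(1 - b i) * b (Suc i) = alpha \<theta>" unfolding b_def e j_def[symmetric] by simp
      then show ?thesis using 3 by auto
    qed
  qed
qed

text \<open>All inner labels of the base path equal \<open>alpha \<theta>\<close>, so only the
  conditions at its two ends remain, coupled by the sum of their phases.\<close>

lemma phase_base:
  assumes bl: "\<And>b. (\<And>i. 0 < i \<Longrightarrow> i < m \<Longrightarrow> 0 < b i \<and> b i < (1::real)) \<Longrightarrow> base_labelled E m (alpha \<theta>) A Z b"
    and \<theta>: "0 < \<theta>" "\<theta> < pi/2" and \<omega>: "0 < \<omega>" "0 < \<omega>'" "\<omega> + \<omega>' + real m * \<theta> = pi" and m: "2 \<le> m"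
  shows "A * phase_label \<theta> \<omega>' = alpha \<theta> \<Longrightarrow> Z * phase_label \<theta> \<omega> = alpha \<theta> \<Longrightarrow> normal E (alpha \<theta>)"
    and "A * phase_label \<theta> \<omega>' \<le> alpha \<theta> \<Longrightarrow> Z * phase_label \<theta> \<omega> \<le> alpha \<theta> \<Longrightarrow>
      A * phase_label \<theta> \<omega>' < alpha \<theta> \<or> Z * phase_label \<theta> \<omega> < alpha \<theta> \<Longrightarrow> supernormal E (alpha \<theta>)"
    and "alpha \<theta> \<le> A * phase_label \<theta> \<omega>' \<Longrightarrow> alpha \<theta> \<le> Z * phase_label \<theta> \<omega> \<Longrightarrow>
      alpha \<theta> < A * phase_label \<theta> \<omega>' \<or> alpha \<theta> < Z * phase_label \<theta> \<omega> \<Longrightarrow> subnormal E (alpha \<theta>)"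
proof -
  define b where "b = (\<lambda>i. 1 - phase_label \<theta> (\<omega> + real (m - 1 - i) * \<theta>))"
  have E: "base_labelled E m (alpha \<theta>) A Z b"
    by (rule bl) (unfold b_def, rule phase_path(1)[OF \<theta> \<omega> m])
  have path: "(if i = 0 then A else 1 - b i) * (if Suc i < m then b (Suc i) else Z) =
      (if i = 0 then A * phase_label \<theta> \<omega>' else if i = m - 1 then Z * phase_label \<theta> \<omega> else alpha \<theta>)" if "i < m" for i
    unfolding b_def by (rule phase_path(2)[OF \<theta> \<omega> m that])
  have m': "m - 1 < m" "m - 1 \<noteq> 0" "0 < m" using m by auto
  show "normal E (alpha \<theta>)" if "A * phase_label \<theta> \<omega>' = alpha \<theta>" "Z * phase_label \<theta> \<omega> = alpha \<theta>"
    by (rule base_labelled_normal[OF E]) (simp only: path that if_cancel)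
  show "supernormal E (alpha \<theta>)" if h: "A * phase_label \<theta> \<omega>' \<le> alpha \<theta>" "Z * phase_label \<theta> \<omega> \<le> alpha \<theta>"
    "A * phase_label \<theta> \<omega>' < alpha \<theta> \<or> Z * phase_label \<theta> \<omega> < alpha \<theta>"
  proof -
    note sup = base_labelled_supernormal[OF E]
    have le: "(if i = 0 then A else 1 - b i) * (if Suc i < m then b (Suc i) else Z) \<le> alpha \<theta>" if "i < m" for i
      unfolding path[OF that] using h(1,2) by simp
    from h(3) show ?thesis
    proof
      assume "A * phase_label \<theta> \<omega>' < alpha \<theta>"
      then show ?thesis by (intro sup[of 0, OF le]) (assumption, rule m', unfold path[OF m'(3)], simp)
    next
      assume "Z * phase_label \<theta> \<omega> < alpha \<theta>"
      then show ?thesis by (intro sup[of "m - 1", OF le]) (assumption, rule m', unfold path[OF m'(1)], insert m, auto)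
    qed
  qed
  show "subnormal E (alpha \<theta>)" if h: "alpha \<theta> \<le> A * phase_label \<theta> \<omega>'" "alpha \<theta> \<le> Z * phase_label \<theta> \<omega>"
    "alpha \<theta> < A * phase_label \<theta> \<omega>' \<or> alpha \<theta> < Z * phase_label \<theta> \<omega>"
  proof -
    note sub = base_labelled_subnormal[OF E]
    have le: "alpha \<theta> \<le> (if i = 0 then A else 1 - b i) * (if Suc i < m then b (Suc i) else Z)" if "i < m" for i
      unfolding path[OF that] using h(1,2) by simp
    from h(3) show ?thesis
    proof
      assume "alpha \<theta> < A * phase_label \<theta> \<omega>'"
      then show ?thesis by (intro sub[of 0, OF le]) (assumption, rule m', unfold path[OF m'(3)], simp)
    next
      assume "alpha \<theta> < Z * phase_label \<theta> \<omega>"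
      then show ?thesis by (intro sub[of "m - 1", OF le]) (assumption, rule m', unfold path[OF m'(1)], insert m, auto)
    qed
  qed
qed

lemma phase_legs:
  assumes "0 < \<theta>" "\<theta> < pi/4"
  defines "f \<equiv> \<lambda>j. phase_label \<theta> (real j * \<theta>)"
  shows "leg_labels f 1 (alpha \<theta>)" "leg_labels f 2 (alpha \<theta>)"
    "(1 - f 1) * (1 - f 1) = (1 - alpha \<theta>)\<^sup>2" "(1 - f 1) * (1 - f 2) = 1 - 2 * alpha \<theta>"
    "(real k + 2) * \<theta> < pi \<Longrightarrow> leg_labels f k (alpha \<theta>)"
    "(real k + 2) * \<theta> < pi \<Longrightarrow> 1 - f k = phase_label \<theta> (pi - (real k + 2) * \<theta>)"
proof -
  have t: "\<theta> < pi/2" using assms by linarith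
  show "leg_labels f 1 (alpha \<theta>)" "leg_labels f 2 (alpha \<theta>)"
    unfolding f_def using leg_labels_phase[OF assms(1) t, of 1] leg_labels_phase[OF assms(1) t, of 2] assms by auto
  note sp = phase_label_special[OF assms(1,2)]
  show "(1 - f 1) * (1 - f 1) = (1 - alpha \<theta>)\<^sup>2" unfolding f_def by (simp add: sp(1) power2_eq_square)
  \<comment> \<open>By the recursion \<open>f 2 * (1 - f 1) = alpha \<theta>\<close>, and
    \<open>f 1 = alpha \<theta>\<close>. So a pendant edge beside a leg of two edges costs the same
    factor as two pendant edges at one vertex.\<close>
  show "(1 - f 1) * (1 - f 2) = 1 - 2 * alpha \<theta>" unfolding f_def using sp(1,2) by (simp add: algebra_simps)
  show "(real k + 2) * \<theta> < pi \<Longrightarrow> leg_labels f k (alpha \<theta>)"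
    unfolding f_def by (rule leg_labels_phase[OF assms(1) t])
  show "(real k + 2) * \<theta> < pi \<Longrightarrow> 1 - f k = phase_label \<theta> (pi - (real k + 2) * \<theta>)"
    unfolding f_def using assms t by (intro phase_label_reflect) (auto simp: algebra_simps)
qed

section \<open>The special hypergraphs at the separating angles\<close>

lemma F3_phase:
  assumes \<theta>: "0 < \<theta>" "\<theta> < pi/4" and k: "1 \<le> k" "(real k + 2) * \<theta> < pi"
  shows "\<exists>r. lab (edges (F3 1 1 k)) {{0, 1, 2}} (alpha \<theta>) r \<and>
      r {0, 1, 2} = (1 - alpha \<theta>)\<^sup>2 * phase_label \<theta> (pi - (real k + 2) * \<theta>)"
    and "\<exists>r. lab (edges (F3 1 2 k)) {{0, 1, 2}} (alpha \<theta>) r \<and>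
      r {0, 1, 2} = (1 - 2 * alpha \<theta>) * phase_label \<theta> (pi - (real k + 2) * \<theta>)"
proof -
  note legs = phase_legs[OF \<theta>]
  show "\<exists>r. lab (edges (F3 1 1 k)) {{0, 1, 2}} (alpha \<theta>) r \<and>
      r {0, 1, 2} = (1 - alpha \<theta>)\<^sup>2 * phase_label \<theta> (pi - (real k + 2) * \<theta>)"
    using F3_labelled[OF _ _ k(1) legs(1) legs(1) legs(5)[OF k(2)]] unfolding legs(3) legs(6)[OF k(2)] by simp
  show "\<exists>r. lab (edges (F3 1 2 k)) {{0, 1, 2}} (alpha \<theta>) r \<and>
      r {0, 1, 2} = (1 - 2 * alpha \<theta>) * phase_label \<theta> (pi - (real k + 2) * \<theta>)"
    using F3_labelled[OF _ _ k(1) legs(1) legs(2) legs(5)[OF k(2)]] unfolding legs(4) legs(6)[OF k(2)] by simp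
qed

lemma G3_phase:
  assumes \<theta>: "0 < \<theta>" "\<theta> < pi/4" and b: "\<And>i. 0 < i \<Longrightarrow> i < k + 2 \<Longrightarrow> 0 < b i \<and> b i < (1::real)"
  shows "base_labelled (edges (G3 1 1 k 1 1)) (k + 2) (alpha \<theta>) ((1 - alpha \<theta>)\<^sup>2) ((1 - alpha \<theta>)\<^sup>2) b"
    and "base_labelled (edges (G3 1 2 k 1 1)) (k + 2) (alpha \<theta>) (1 - 2 * alpha \<theta>) ((1 - alpha \<theta>)\<^sup>2) b"
proof -
  note legs = phase_legs[OF \<theta>]
  show "base_labelled (edges (G3 1 1 k 1 1)) (k + 2) (alpha \<theta>) ((1 - alpha \<theta>)\<^sup>2) ((1 - alpha \<theta>)\<^sup>2) b"
    using G3_labelled[OF _ _ _ _ legs(1) legs(1) legs(1) legs(1) b] unfolding legs(3) by simp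
  show "base_labelled (edges (G3 1 2 k 1 1)) (k + 2) (alpha \<theta>) (1 - 2 * alpha \<theta>) ((1 - alpha \<theta>)\<^sup>2) b"
    using G3_labelled[OF _ _ _ _ legs(1) legs(2) legs(1) legs(1) b] unfolding legs(3,4) by simp
qed

lemma BD3_phase:
  assumes \<theta>: "0 < \<theta>" "\<theta> < pi/4" and n: "6 \<le> n"
    and b: "\<And>i. 0 < i \<Longrightarrow> i < n - 4 \<Longrightarrow> 0 < b i \<and> b i < (1::real)"
  shows "base_labelled (edges (BD3 n)) (n - 4) (alpha \<theta>) ((1 - alpha \<theta>)\<^sup>2) (1 - 2 * alpha \<theta>) b"
proof -
  note legs = phase_legs[OF \<theta>]
  have m: "2 \<le> n - 4" using n by simp
  show ?thesis
    using double_end_facts(4)[OF m _ _ legs(1) legs(1) b] alpha_bounds(1,2)[of \<theta>] \<theta>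
    unfolding legs(3) BD3_def by simp
qed

text \<open>The angle is exact for the path, whose two free ends have phase \<theta> each. The
  central edge of the other hypergraph sees the phase 3\<theta>, well below the balance.\<close>

lemma normality_at_pi_over_n_plus_2:
  assumes n: "20 \<le> n" and \<theta>: "(real n + 2) * \<theta> = pi"
  shows "normal (edges (A_hyp 3 n)) (alpha \<theta>)" "supernormal (edges (F3 1 1 (n - 3))) (alpha \<theta>)"
proof -
  have pos: "0 < \<theta>" using \<theta> pi_gt_zero by (metis add_nonneg_pos of_nat_0_le_iff zero_less_mult_pos zero_less_numeral)
  have n\<theta>: "20 * \<theta> \<le> real n * \<theta>" using n pos by (intro mult_right_mono) auto
  have e: "real n * \<theta> + 2 * \<theta> = pi" using \<theta> by (simp add: algebra_simps)
  have s: "\<theta> < pi/4" using e n\<theta> pos by linarith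
  show "normal (edges (A_hyp 3 n)) (alpha \<theta>)"
  proof (rule phase_base(1)[of n _ \<theta> 1 1 \<theta> \<theta>])
    show "base_labelled (edges (A_hyp 3 n)) n (alpha \<theta>) 1 1 b" if "\<And>i. 0 < i \<Longrightarrow> i < n \<Longrightarrow> 0 < b i \<and> b i < (1::real)" for b
      using base_labelled_base[of n b "alpha \<theta>"] that n by simp
  qed (use phase_label_special(1)[OF pos s] pos s e n in auto)
  have k: "(real (n - 3) + 2) * \<theta> = real n * \<theta> - \<theta>" using n by (simp add: of_nat_diff algebra_simps)
  obtain r where r: "lab (edges (F3 1 1 (n - 3))) {{0, 1, 2}} (alpha \<theta>) r"
    "r {0, 1, 2} = (1 - alpha \<theta>)\<^sup>2 * phase_label \<theta> (pi - (real (n - 3) + 2) * \<theta>)"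
    using F3_phase(1)[OF pos s, of "n - 3"] n e k pos by force
  have "pi - (real (n - 3) + 2) * \<theta> = 3 * \<theta>" using k e by linarith
  then have "r {0, 1, 2} < alpha \<theta>"
    unfolding r(2) using double_pendant_end_less(1)[OF pos, of "3 * \<theta>"] n\<theta> e pos by simp
  then show "supernormal (edges (F3 1 1 (n - 3))) (alpha \<theta>)"
    by (intro lab_supernormal[OF r(1), of "{0, 1, 2}"]) auto
qed

text \<open>The central edge of \<open>F3\<close> sees 9\<theta>, above the balance near 8\<theta>,
  while the two equal ends of \<open>G3\<close> have to divide 12\<theta> and get 6\<theta> each,
  below it.\<close>

lemma normality_at_pi_over_n_plus_8:
  assumes n: "20 \<le> n" and \<theta>: "(real n + 8) * \<theta> = pi"
  shows "subnormal (edges (F3 1 1 (n - 3))) (alpha \<theta>)" "supernormal (edges (G3 1 1 (n - 6) 1 1)) (alpha \<theta>)"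
proof -
  have pos: "0 < \<theta>" using \<theta> pi_gt_zero by (metis add_nonneg_pos of_nat_0_le_iff zero_less_mult_pos zero_less_numeral)
  have n\<theta>: "20 * \<theta> \<le> real n * \<theta>" using n pos by (intro mult_right_mono) auto
  have e: "real n * \<theta> + 8 * \<theta> = pi" using \<theta> by (simp add: algebra_simps)
  have s: "\<theta> < pi/4" using e n\<theta> pos by linarith
  have k: "(real (n - 3) + 2) * \<theta> = real n * \<theta> - \<theta>" using n by (simp add: of_nat_diff algebra_simps)
  obtain r where r: "lab (edges (F3 1 1 (n - 3))) {{0, 1, 2}} (alpha \<theta>) r"
    "r {0, 1, 2} = (1 - alpha \<theta>)\<^sup>2 * phase_label \<theta> (pi - (real (n - 3) + 2) * \<theta>)"
    using F3_phase(1)[OF pos s, of "n - 3"] n e k pos by force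
  have "pi - (real (n - 3) + 2) * \<theta> = 9 * \<theta>" using k e by linarith
  then have "alpha \<theta> < r {0, 1, 2}"
    unfolding r(2) using double_pendant_end_greater[OF pos, of "9 * \<theta>"] n\<theta> e pos by simp
  then show "subnormal (edges (F3 1 1 (n - 3))) (alpha \<theta>)"
    by (intro lab_subnormal[OF r(1), of "{0, 1, 2}"]) auto
  have "(1 - alpha \<theta>)\<^sup>2 * phase_label \<theta> (6 * \<theta>) < alpha \<theta>"
    using double_pendant_end_less(2)[OF pos refl] n\<theta> e pos by simp
  moreover have "6 * \<theta> + 6 * \<theta> + real (n - 6 + 2) * \<theta> = pi" using n e by (simp add: of_nat_diff algebra_simps)
  ultimately show "supernormal (edges (G3 1 1 (n - 6) 1 1)) (alpha \<theta>)"
    using pos s by (intro phase_base(2)[OF G3_phase(1)[OF pos s], of "n - 6" "6 * \<theta>" "6 * \<theta>"]) auto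
qed

text \<open>Here (n - 1)\<theta> = pi/2, so the long leg of \<open>F3\<close> presents the phase
  n\<theta> = pi/2 + \<theta>, the exact partner of the factor 1 - 2\<alpha>. The two ends of
  \<open>G3\<close> divide (n + 2)\<theta>, at least 11\<theta> each.\<close>

lemma normality_at_pi_over_2n_minus_2:
  assumes n: "20 \<le> n" and \<theta>: "(2 * real n - 2) * \<theta> = pi"
  shows "subnormal (edges (G3 1 1 (n - 6) 1 1)) (alpha \<theta>)" "normal (edges (F3 1 2 (n - 4))) (alpha \<theta>)"
proof -
  have "0 < 2 * real n - 2" using n by simp
  then have pos: "0 < \<theta>" using \<theta> pi_gt_zero by (metis zero_less_mult_pos)
  have n\<theta>: "20 * \<theta> \<le> real n * \<theta>" using n pos by (intro mult_right_mono) auto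
  have e: "2 * (real n * \<theta>) - 2 * \<theta> = pi" using \<theta> by (simp add: algebra_simps)
  have s: "\<theta> < pi/4" using e n\<theta> pos by linarith
  define \<omega> where "\<omega> = (real n * \<theta> + 2 * \<theta>) / 2"
  have w: "2 * \<omega> = real n * \<theta> + 2 * \<theta>" by (simp add: \<omega>_def)
  have "8 * \<theta> \<le> \<omega>" "\<omega> \<le> pi/2" using w n\<theta> e pos by linarith+
  then have "alpha \<theta> < (1 - alpha \<theta>)\<^sup>2 * phase_label \<theta> \<omega>" by (rule double_pendant_end_greater[OF pos])
  moreover have "\<omega> + \<omega> + real (n - 6 + 2) * \<theta> = pi" using n e by (simp add: \<omega>_def of_nat_diff algebra_simps)
  moreover have "0 < \<omega>" using w pos n\<theta> by linarith
  ultimately show "subnormal (edges (G3 1 1 (n - 6) 1 1)) (alpha \<theta>)"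
    using pos s by (intro phase_base(3)[OF G3_phase(1)[OF pos s], of "n - 6" \<omega> \<omega>]) auto
  have k: "(real (n - 4) + 2) * \<theta> = real n * \<theta> - 2 * \<theta>" using n by (simp add: of_nat_diff algebra_simps)
  have pre: "1 \<le> n - 4" "(real (n - 4) + 2) * \<theta> < pi" using k e n\<theta> pos n by (simp, linarith)
  obtain r where r: "lab (edges (F3 1 2 (n - 4))) {{0, 1, 2}} (alpha \<theta>) r"
    "r {0, 1, 2} = (1 - 2 * alpha \<theta>) * phase_label \<theta> (pi - (real (n - 4) + 2) * \<theta>)"
    using F3_phase(2)[OF pos s pre] by (elim exE conjE) (rule that)
  have "pi - (real (n - 4) + 2) * \<theta> = pi/2 + \<theta>" using k e by linarith
  then have "r {0, 1, 2} = alpha \<theta>" unfolding r(2) using phase_label_special(4)[OF pos s] by simp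
  then show "normal (edges (F3 1 2 (n - 4))) (alpha \<theta>)" by (intro lab_normal[OF r(1)]) auto
qed

text \<open>With n\<theta> = pi/2 the leg of \<open>E3\<close> leaves 2\<alpha>, which the two
  pendant edges halve. In \<open>G3\<close> the end with legs 1 and 2 takes its exact phase pi/2 +
  \<theta>, and 4\<theta> is left for the other end.\<close>

lemma normality_at_pi_over_2n:
  assumes n: "20 \<le> n" and \<theta>: "2 * real n * \<theta> = pi"
  shows "normal (edges (E3 1 1 (n - 2))) (alpha \<theta>)" "supernormal (edges (G3 1 2 (n - 7) 1 1)) (alpha \<theta>)"
proof -
  have "0 < 2 * real n" using n by simp
  then have pos: "0 < \<theta>" using \<theta> pi_gt_zero by (metis zero_less_mult_pos)
  have n\<theta>: "20 * \<theta> \<le> real n * \<theta>" using n pos by (intro mult_right_mono) auto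
  have e: "2 * (real n * \<theta>) = pi" using \<theta> by simp
  have s: "\<theta> < pi/4" using e n\<theta> pos by linarith
  have k: "(real (n - 2) + 2) * \<theta> = real n * \<theta>" using n by (simp add: of_nat_diff algebra_simps)
  note legs = phase_legs(5,6)[OF pos s, of "n - 2"]
  have k': "(real (n - 2) + 2) * \<theta> < pi" "pi - (real (n - 2) + 2) * \<theta> = pi/2"
    unfolding k using e n\<theta> pos by linarith+
  have "1 \<le> n - 2" using n by simp
  note E3_labelled[OF this legs(1)[OF k'(1)], unfolded legs(2)[OF k'(1)] k'(2) phase_label_special(3)[OF pos s]]
  then obtain F r where r: "lab (edges (E3 1 1 (n - 2))) F (alpha \<theta>) r" "\<forall>e\<in>F. r e = 2 * alpha \<theta> / 2" by auto
  then show "normal (edges (E3 1 1 (n - 2))) (alpha \<theta>)" by (intro lab_normal[OF r(1)]) auto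
  have "(1 - alpha \<theta>)\<^sup>2 * phase_label \<theta> (4 * \<theta>) < alpha \<theta>"
    using double_pendant_end_less(1)[OF pos, of "4 * \<theta>"] n\<theta> e pos by simp
  moreover have "4 * \<theta> + (pi/2 + \<theta>) + real (n - 7 + 2) * \<theta> = pi" using n e by (simp add: of_nat_diff algebra_simps)
  ultimately show "supernormal (edges (G3 1 2 (n - 7) 1 1)) (alpha \<theta>)"
    using pos s phase_label_special(4)[OF pos s] pi_gt_zero
    by (intro phase_base(2)[OF G3_phase(2)[OF pos s], of "n - 7" "4 * \<theta>" "pi/2 + \<theta>"]) (auto simp: add_pos_pos)
qed

text \<open>One end of either hypergraph takes its exact phase pi/2 + \<theta>. The other end is
  left with 8\<theta> in \<open>G3\<close> and with 7\<theta> in \<open>BD3\<close>, the consecutive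
  multiples on the two sides of the balance.\<close>

lemma normality_at_pi_over_2n_plus_8:
  assumes n: "20 \<le> n" and \<theta>: "(2 * real n + 8) * \<theta> = pi"
  shows "subnormal (edges (G3 1 2 (n - 7) 1 1)) (alpha \<theta>)" "supernormal (edges (BD3 n)) (alpha \<theta>)"
proof -
  have "0 < 2 * real n + 8" using n by simp
  then have pos: "0 < \<theta>" using \<theta> pi_gt_zero by (metis zero_less_mult_pos)
  have n\<theta>: "20 * \<theta> \<le> real n * \<theta>" using n pos by (intro mult_right_mono) auto
  have e: "2 * (real n * \<theta>) + 8 * \<theta> = pi" using \<theta> by (simp add: algebra_simps)
  have s: "\<theta> < pi/4" using e n\<theta> pos by linarith
  have "alpha \<theta> < (1 - alpha \<theta>)\<^sup>2 * phase_label \<theta> (8 * \<theta>)"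
    by (rule double_pendant_end_greater[OF pos]; use n\<theta> e pos in linarith)
  moreover have "8 * \<theta> + (pi/2 + \<theta>) + real (n - 7 + 2) * \<theta> = pi" using n e by (simp add: of_nat_diff algebra_simps)
  ultimately show "subnormal (edges (G3 1 2 (n - 7) 1 1)) (alpha \<theta>)"
    using pos s phase_label_special(4)[OF pos s] pi_gt_zero
    by (intro phase_base(3)[OF G3_phase(2)[OF pos s], of "n - 7" "8 * \<theta>" "pi/2 + \<theta>"]) (auto simp: add_pos_pos)
  have "(1 - alpha \<theta>)\<^sup>2 * phase_label \<theta> (7 * \<theta>) < alpha \<theta>"
    using double_pendant_end_less(3)[OF pos refl] n\<theta> e pos by simp
  moreover have "(pi/2 + \<theta>) + 7 * \<theta> + real (n - 4) * \<theta> = pi" using n e by (simp add: of_nat_diff algebra_simps)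
  ultimately show "supernormal (edges (BD3 n)) (alpha \<theta>)"
    using pos s phase_label_special(4)[OF pos s] pi_gt_zero n
    by (intro phase_base(2)[OF BD3_phase[OF pos s], of n "pi/2 + \<theta>" "7 * \<theta>"]) (auto simp: add_pos_pos)
qed

lemma normality_at_quarter:
  assumes n: "20 \<le> n"
  shows "subnormal (edges (BD3 n)) (1/4)" "normal (edges (Dtilde3 n)) (1/4)"
    "normal (edges (G3 1 2 (n - 8) 1 2)) (1/4)" "normal (edges (BDtilde3 n)) (1/4)"
proof -
  \<comment> \<open>The limits for \<theta> tending to 0: sin (j\<theta>) / (2 cos \<theta> sin
    ((j+1)\<theta>)) tends to j / (2 (j + 1)), and shares inside the base path become 1/2. All
    labels are then 1/4, except that the first base edge of \<open>BD3\<close> has 9/16 times 1/2 =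
    9/32.\<close>
  define f where "f = (\<lambda>j::nat. real j / (2 * (real j + 1)))"
  define b where "b = (\<lambda>j::nat. 1/2 :: real)"
  have f: "leg_labels f 1 (1/4)" "leg_labels f 2 (1/4)"
    unfolding leg_labels_def by (auto simp: f_def less_Suc_eq numeral_2_eq_2)
  have f': "(1 - f 1) * (1 - f 1) = 9/16" "(1 - f 1) * (1 - f 2) = 1/2" by (simp_all add: f_def)
  have m: "2 \<le> n - 4" "2 \<le> n - 5" using n by auto
  have bd: "base_labelled (edges (BD3 n)) (n - 4) (1/4) (9/16) (1 - 2 * (1/4)) b"
    unfolding BD3_def f'(1)[symmetric]
    by (rule double_end_facts(4)[OF m(1) _ _ f(1) f(1)]) (auto simp: b_def)
  show "subnormal (edges (BD3 n)) (1/4)"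
    by (rule base_labelled_subnormal[OF bd, of 0]) (use m in \<open>auto simp: b_def\<close>)
  have "base_labelled (edges (Dtilde3 n)) (n - 4) (1/4) (1 - 2 * (1/4)) (1 - 2 * (1/4)) b"
    unfolding Dtilde3_def by (rule double_end_facts(5)[OF m(1)]) (auto simp: b_def)
  then show "normal (edges (Dtilde3 n)) (1/4)" by (rule base_labelled_normal) (auto simp: b_def)
  have "base_labelled (edges (G3 1 2 (n - 8) 1 2)) (n - 8 + 2) (1/4) (1/2) (1/2) b"
    unfolding f'(2)[symmetric] by (rule G3_labelled) (use f in \<open>auto simp: b_def\<close>)
  then show "normal (edges (G3 1 2 (n - 8) 1 2)) (1/4)" by (rule base_labelled_normal) (auto simp: b_def)
  have "base_labelled (edges (BDtilde3 n)) (n - 5) (1/4) (1/2) (1 - 2 * (1/4)) b"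
    unfolding BDtilde3_def f'(2)[symmetric]
    by (rule double_end_facts(4)[OF m(2) _ _ f(1) f(2)]) (auto simp: b_def)
  then show "normal (edges (BDtilde3 n)) (1/4)" by (rule base_labelled_normal) (auto simp: b_def)
qed

section \<open>Classification and comparison\<close>

lemma proper_special:
  assumes n: "20 \<le> n"
  shows "proper 3 (A_hyp 3 n)" "proper 3 (F3 1 1 (n - 3))" "proper 3 (F3 1 2 (n - 4))" "proper 3 (E3 1 1 (n - 2))"
    "proper 3 (G3 1 1 (n - 6) 1 1)" "proper 3 (G3 1 2 (n - 7) 1 1)" "proper 3 (G3 1 2 (n - 8) 1 2)"
    "proper 3 (BD3 n)" "proper 3 (Dtilde3 n)" "proper 3 (BDtilde3 n)"
proof -
  have le: "(1::nat) \<le> 1" "(1::nat) \<le> 2" "1 \<le> n - 3" "1 \<le> n - 4" "1 \<le> n - 2" "2 \<le> n - 4" "2 \<le> n - 5" using n by auto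
  show "proper 3 (A_hyp 3 n)" using n by (intro proper_A_hyp) simp
  show "proper 3 (F3 1 1 (n - 3))" by (rule F3_structure[OF le(1,1,3)])
  show "proper 3 (F3 1 2 (n - 4))" by (rule F3_structure[OF le(1,2,4)])
  show "proper 3 (E3 1 1 (n - 2))" by (rule E3_structure[OF le(5)])
  show "proper 3 (G3 1 1 (n - 6) 1 1)" by (rule G3_proper[OF le(1,1,1,1)])
  show "proper 3 (G3 1 2 (n - 7) 1 1)" by (rule G3_proper[OF le(1,2,1,1)])
  show "proper 3 (G3 1 2 (n - 8) 1 2)" by (rule G3_proper[OF le(1,2,1,2)])
  show "proper 3 (BD3 n)" unfolding BD3_def by (rule double_end_proper[OF le(6) le(1) le(1) insertI2[OF singletonI]])
  show "proper 3 (Dtilde3 n)" unfolding Dtilde3_def by (rule double_end_proper[OF le(6) le(1) le(1) insertI1])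
  show "proper 3 (BDtilde3 n)" unfolding BDtilde3_def by (rule double_end_proper[OF le(7) le(1) le(2) insertI2[OF singletonI]])
qed

lemma shape_special:
  assumes n: "20 \<le> n"
  shows "shape (edges (A_hyp 3 n)) n []"
    "shape (edges (F3 1 1 (n - 3))) (n - 1) [{1}]"
    "shape (edges (F3 1 2 (n - 4))) (n - 1) [{2}]"
    "shape (edges (E3 1 1 (n - 2))) (n - 1) [{0, 1}]"
    "shape (edges (G3 1 1 (n - 6) 1 1)) (n - 2) [{1}, mirror (n - 2) {1}]"
    "shape (edges (G3 1 2 (n - 7) 1 1)) (n - 2) [{2}, mirror (n - 2) {1}]"
    "shape (edges (G3 1 2 (n - 8) 1 2)) (n - 2) [{2}, mirror (n - 2) {2}]"
    "shape (edges (BD3 n)) (n - 2) [{1}, mirror (n - 2) {0, 1}]"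
    "shape (edges (Dtilde3 n)) (n - 2) [{0, 1}, mirror (n - 2) {0, 1}]"
    "shape (edges (BDtilde3 n)) (n - 2) [{2}, mirror (n - 2) {0, 1}]"
proof -
  have m: "mirror (n - 2) {1} = {n - 4}" "mirror (n - 2) {2} = {n - 5}" "mirror (n - 2) {0, 1} = {n - 4, n - 3}"
    by (auto simp: mirror_def)
  have e: "n - 3 + 2 = n - 1" "n - 4 + 3 = n - 1" "n - 2 + 1 = n - 1" "n - 6 + 4 = n - 2" "n - 6 + 2 = n - 4"
    "n - 7 + 5 = n - 2" "n - 7 + 3 = n - 4" "n - 8 + 6 = n - 2" "n - 8 + 3 = n - 5" "n - 4 + 2 = n - 2" "n - 4 + 1 = n - 3"
    "n - 5 + 3 = n - 2" "n - 5 + 1 = n - 4" "n - 5 + 2 = n - 3" using n by auto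
  have le: "1 \<le> n - 3" "1 \<le> n - 4" "1 \<le> n - 2" "2 \<le> n - 4" "2 \<le> n - 5" "1 \<le> n" using n by auto
  show "shape (edges (A_hyp 3 n)) n []" by (rule A_hyp_shape[OF le(6)])
  show "shape (edges (F3 1 1 (n - 3))) (n - 1) [{1}]" using F3_shape(1)[OF le(1)] unfolding e .
  show "shape (edges (F3 1 2 (n - 4))) (n - 1) [{2}]" using F3_shape(2)[OF le(2)] unfolding e .
  show "shape (edges (E3 1 1 (n - 2))) (n - 1) [{0, 1}]" using E3_shape[OF le(3)] unfolding e .
  show "shape (edges (G3 1 1 (n - 6) 1 1)) (n - 2) [{1}, mirror (n - 2) {1}]" using G3_shape(1)[of "n - 6"] unfolding e m .
  show "shape (edges (G3 1 2 (n - 7) 1 1)) (n - 2) [{2}, mirror (n - 2) {1}]" using G3_shape(2)[of "n - 7"] unfolding e m .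
  show "shape (edges (G3 1 2 (n - 8) 1 2)) (n - 2) [{2}, mirror (n - 2) {2}]" using G3_shape(3)[of "n - 8"] unfolding e m .
  show "shape (edges (BD3 n)) (n - 2) [{1}, mirror (n - 2) {0, 1}]"
    using double_end_facts(1)[OF le(4)] unfolding e m BD3_def .
  show "shape (edges (Dtilde3 n)) (n - 2) [{0, 1}, mirror (n - 2) {0, 1}]"
    using double_end_facts(3)[OF le(4)] unfolding e m Dtilde3_def .
  show "shape (edges (BDtilde3 n)) (n - 2) [{2}, mirror (n - 2) {0, 1}]"
    using double_end_facts(2)[OF le(5)] unfolding e m BDtilde3_def .
qed

lemma A_hyp_iter:
  assumes "3 \<le> r"
  shows "A_hyp r n = (extend ^^ (r - 3)) (A_hyp 3 n)"
proof -
  have "r - 2 = Suc (r - 3)" using assms by simp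
  then have "A_hyp r n = (extend ^^ (r - 3)) (extend (path_graph n))"
    by (simp only: A_hyp_def funpow_Suc_right o_apply)
  moreover have "A_hyp 3 n = extend (path_graph n)" by (simp add: A_hyp_def)
  ultimately show ?thesis by simp
qed

lemma not_supercritical_iso:
  fixes G :: "'a hypergraph"
  assumes r: "3 \<le> r" and n: "20 \<le> n" and G: "G \<in> connected_r_graphs r n" and sup: "\<not> supercritical (edges G)"
  shows "\<exists>K \<in> {A_hyp r n, F_hyp r 1 1 (n - 3), G_hyp r 1 1 (n - 6) 1 1,
                   F_hyp r 1 2 (n - 4), E_hyp r 1 1 (n - 2), G_hyp r 1 2 (n - 7) 1 1,
                   BD_hyp r n, C_hyp r n, Dtilde_hyp r n, G_hyp r 1 2 (n - 8) 1 2,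
                   BDtilde_hyp r n}. hypergraph_iso G K"
proof -
  have rG: "r_graph r G" and cG: "connected_hypergraph G" and card: "card (edges G) = n"
    using G by (auto simp: connected_r_graphs_def)
  have r1: "r \<ge> 1" using r by simp
  interpret not_supercritical "edges G"
  proof
    show "finite (edges G)" by (rule finite_edges[OF rG])
    show "finite e" if "e \<in> edges G" for e using r_graph_edgeD(3)[OF rG that] .
    show "e \<noteq> {}" if "e \<in> edges G" for e using r_graph_edgeD(2)[OF rG that] r by auto
    show "linked (edges G)" by (rule connected_linked[OF rG r1 cG])
    show "20 \<le> card (edges G)" using card n by simp
  qed (rule sup)
  have ne: "edges G \<noteq> {}" using card n by auto
  have vG: "verts G = \<Union>(edges G)" by (rule connected_verts[OF rG r1 cG ne])
  have iso: "hypergraph_iso G ((extend ^^ (r - 3)) K)"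
    if K: "proper 3 K" "shape (edges K) l Js" and S: "shape (edges G) l Js" for K l Js
  proof -
    have "3 + (r - 3) = r" using r by simp
    then have "proper r ((extend ^^ (r - 3)) K)" using proper_iter[OF K(1), of "r - 3"] by simp
    then show ?thesis
      unfolding proper_def by (elim conjE) (rule shape_iso[OF rG vG linear_helly_E _ _ _ S shape_iter[OF K]])
  qed
  note P = proper_special[OF n] and Sh = shape_special[OF n]
  define B where "B = {1::nat}"
  define B' where "B' = {2::nat}"
  define D where "D = {0, 1::nat}"
  define S where "S = (\<lambda>J K. shape (edges G) (n - 2) [J, mirror (n - 2) K])"
  \<comment> \<open>Reading the path backwards exchanges its ends, so the nine pairs of end
    positions reduce to six, one for each special hypergraph with two hung edges.\<close>
  have S_sym: "S J K \<Longrightarrow> S K J" if "K \<in> {D, B, B'}" for J K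
  proof -
    have "K \<subseteq> {..<n - 2}" using that n by (auto simp: B_def B'_def D_def)
    then show "S J K \<Longrightarrow> S K J" unfolding S_def using shape_rev[of "edges G" "n - 2" "[J, mirror (n - 2) K]"] by (simp add: mirror_mirror)
  qed
  from classification consider "cycle_shape (edges G) n" | "shape (edges G) n []"
    | J where "J \<in> {D, B, B'}" "shape (edges G) (n - 1) [J]"
    | J K where "J \<in> {D, B, B'}" "K \<in> {D, B, B'}" "S J K"
    unfolding card S_def B_def B'_def D_def by (elim disjE bexE) assumption+
  then show ?thesis
  proof cases
    case 1
    have e: "4 \<le> n" "2 + (r - 2) = r" using n r by simp_all
    have "proper r (C_hyp r n)" using proper_iter[OF proper_cycle_graph[OF e(1)], of "r - 2"] e(2) by (simp add: C_hyp_def)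
    moreover have "cycle_shape (edges (C_hyp r n)) n"
      unfolding C_hyp_def by (rule cycle_shape_iter[OF proper_cycle_graph[OF e(1)] cycle_graph_shape[OF e(1)]])
    ultimately have "hypergraph_iso G (C_hyp r n)"
      unfolding proper_def by (elim conjE) (rule cycle_shape_iso[OF rG vG linear_helly_E _ _ _ 1])
    then show ?thesis by blast
  next
    case 2
    then have "hypergraph_iso G (A_hyp r n)" unfolding A_hyp_iter[OF r] by (rule iso[OF P(1) Sh(1)])
    then show ?thesis by blast
  next
    case 3
    then have "shape (edges G) (n - 1) [B] \<or> shape (edges G) (n - 1) [B'] \<or> shape (edges G) (n - 1) [D]" by auto
    then have "hypergraph_iso G (F_hyp r 1 1 (n - 3)) \<or> hypergraph_iso G (F_hyp r 1 2 (n - 4)) \<or>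
        hypergraph_iso G (E_hyp r 1 1 (n - 2))"
      unfolding F_hyp_def E_hyp_def B_def B'_def D_def
      using iso[OF P(2) Sh(2)] iso[OF P(3) Sh(3)] iso[OF P(4) Sh(4)] by (elim disjE) simp_all
    then show ?thesis by blast
  next
    case 4
    then have "S B B \<or> S B' B \<or> S B' B' \<or> S B D \<or> S D D \<or> S B' D"
      using S_sym by auto
    then have "hypergraph_iso G (G_hyp r 1 1 (n - 6) 1 1) \<or> hypergraph_iso G (G_hyp r 1 2 (n - 7) 1 1) \<or>
        hypergraph_iso G (G_hyp r 1 2 (n - 8) 1 2) \<or> hypergraph_iso G (BD_hyp r n) \<or>
        hypergraph_iso G (Dtilde_hyp r n) \<or> hypergraph_iso G (BDtilde_hyp r n)"
      unfolding G_hyp_def BD_hyp_def Dtilde_hyp_def BDtilde_hyp_def B_def B'_def D_def S_def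
      using iso[OF P(5) Sh(5)] iso[OF P(6) Sh(6)] iso[OF P(7) Sh(7)] iso[OF P(8) Sh(8)] iso[OF P(9) Sh(9)] iso[OF P(10) Sh(10)]
      by (elim disjE) simp_all
    then show ?thesis by blast
  qed
qed

lemma alpha_less:
  assumes "0 < \<theta>" "\<theta> < \<phi>" "\<phi> < pi/2"
  shows "alpha \<theta> < alpha \<phi>"
proof -
  have c: "0 < cos \<phi>" "cos \<phi> < cos \<theta>"
    using assms by (auto intro!: cos_gt_zero_pi cos_monotone_0_pi)
  then have "(cos \<phi>)\<^sup>2 < (cos \<theta>)\<^sup>2" by (intro power_strict_mono) auto
  then show ?thesis unfolding alpha_def using c by (intro divide_strict_left_mono) auto
qed

theorem theorem4p4:
  fixes r n :: nat
  assumes "r \<ge> 3" and "n \<ge> 20"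
  shows "(\<forall>G :: 'a hypergraph. G \<in> connected_r_graphs r n \<longrightarrow>
           (\<forall>K \<in> {A_hyp r n, F_hyp r 1 1 (n - 3), G_hyp r 1 1 (n - 6) 1 1,
                   F_hyp r 1 2 (n - 4), E_hyp r 1 1 (n - 2), G_hyp r 1 2 (n - 7) 1 1,
                   BD_hyp r n, C_hyp r n, Dtilde_hyp r n, G_hyp r 1 2 (n - 8) 1 2,
                   BDtilde_hyp r n}. \<not> hypergraph_iso G K) \<longrightarrow>
           spectral_radius r G > fact (r - 1) * root r 4)
       \<and> spectral_radius r (A_hyp r n) < spectral_radius r (F_hyp r 1 1 (n - 3))
       \<and> spectral_radius r (F_hyp r 1 1 (n - 3)) < spectral_radius r (G_hyp r 1 1 (n - 6) 1 1)
       \<and> spectral_radius r (G_hyp r 1 1 (n - 6) 1 1) < spectral_radius r (F_hyp r 1 2 (n - 4))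
       \<and> spectral_radius r (F_hyp r 1 2 (n - 4)) < spectral_radius r (E_hyp r 1 1 (n - 2))
       \<and> spectral_radius r (E_hyp r 1 1 (n - 2)) < spectral_radius r (G_hyp r 1 2 (n - 7) 1 1)
       \<and> spectral_radius r (G_hyp r 1 2 (n - 7) 1 1) < spectral_radius r (BD_hyp r n)
       \<and> spectral_radius r (BD_hyp r n) < spectral_radius r (C_hyp r n)
       \<and> spectral_radius r (C_hyp r n) = spectral_radius r (Dtilde_hyp r n)
       \<and> spectral_radius r (Dtilde_hyp r n) = spectral_radius r (G_hyp r 1 2 (n - 8) 1 2)
       \<and> spectral_radius r (G_hyp r 1 2 (n - 8) 1 2) = spectral_radius r (BDtilde_hyp r n)
       \<and> spectral_radius r (BDtilde_hyp r n) = fact (r - 1) * root r 4"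
proof -
  have r: "3 + (r - 3) = r" "2 + (r - 2) = r" "1 \<le> r" using assms by auto
  note n = assms(2)
  have crit: "rho_value r (1/4) = fact (r - 1) * root r 4" by (simp add: rho_value_def)
  have \<rho>_G: "spectral_radius r G > rho_value r (1/4)"
    if G: "G \<in> connected_r_graphs r n" and not_iso: "\<forall>K \<in> {A_hyp r n, F_hyp r 1 1 (n - 3), G_hyp r 1 1 (n - 6) 1 1,
                   F_hyp r 1 2 (n - 4), E_hyp r 1 1 (n - 2), G_hyp r 1 2 (n - 7) 1 1,
                   BD_hyp r n, C_hyp r n, Dtilde_hyp r n, G_hyp r 1 2 (n - 8) 1 2,
                   BDtilde_hyp r n}. \<not> hypergraph_iso G K" for G :: "'a hypergraph"
  proof -
    have rG: "r_graph r G" "connected_hypergraph G" using G by (auto simp: connected_r_graphs_def)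
    have "supercritical (edges G)"
    proof (rule ccontr)
      assume "\<not> supercritical (edges G)"
      show False
        by (rule bexE[OF not_supercritical_iso[OF assms G \<open>\<not> supercritical (edges G)\<close>]])
          (drule bspec[OF not_iso], erule (1) notE)
    qed
    then show ?thesis by (rule spectral_radius_supercritical[OF rG(1) r(3) connected_linked[OF rG(1) r(3) rG(2)]])
  qed
  define \<theta>\<^sub>1 \<theta>\<^sub>2 \<theta>\<^sub>3 \<theta>\<^sub>4 \<theta>\<^sub>5 where "\<theta>\<^sub>1 = pi / (real n + 2)" and "\<theta>\<^sub>2 = pi / (real n + 8)"
    and "\<theta>\<^sub>3 = pi / (2 * real n - 2)" and "\<theta>\<^sub>4 = pi / (2 * real n)" and "\<theta>\<^sub>5 = pi / (2 * real n + 8)"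
  note \<theta>_defs = \<theta>\<^sub>1_def \<theta>\<^sub>2_def \<theta>\<^sub>3_def \<theta>\<^sub>4_def \<theta>\<^sub>5_def
  have rn: "20 \<le> real n" using n by simp
  have eqs: "(real n + 2) * \<theta>\<^sub>1 = pi" "(real n + 8) * \<theta>\<^sub>2 = pi" "(2 * real n - 2) * \<theta>\<^sub>3 = pi"
    "2 * real n * \<theta>\<^sub>4 = pi" "(2 * real n + 8) * \<theta>\<^sub>5 = pi" using rn by (simp_all add: \<theta>_defs)
  have alpha_pos: "0 < alpha (pi / x)" if "4 < x" for x
  proof (rule alpha_bounds(1))
    show "pi / x < pi / 4" using that by (intro divide_strict_left_mono) auto
  qed (use that in auto)
  have a: "0 < alpha \<theta>\<^sub>1" "0 < alpha \<theta>\<^sub>2" "0 < alpha \<theta>\<^sub>3" "0 < alpha \<theta>\<^sub>4" "0 < alpha \<theta>\<^sub>5"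
    unfolding \<theta>_defs using rn by (auto intro!: alpha_pos)
  have "\<theta>\<^sub>4 < \<theta>\<^sub>3" unfolding \<theta>_defs by (rule divide_strict_left_mono) (use rn in auto)
  moreover have "\<theta>\<^sub>3 < pi/2" unfolding \<theta>_defs by (rule divide_strict_left_mono) (use rn in auto)
  moreover have "0 < \<theta>\<^sub>4" unfolding \<theta>_defs using rn by simp
  \<comment> \<open>The two hypergraphs in the middle of the chain are evaluated exactly, but at
    different angles, so here two values have to be compared; each other strict inequality uses one
    angle or the critical value for both sides.\<close>
  ultimately have a43: "rho_value r (alpha \<theta>\<^sub>3) < rho_value r (alpha \<theta>\<^sub>4)"
    using a(4) r(3) by (intro rho_value_less alpha_less) auto
  note P = proper_special[OF n]
  note \<rho> = spectral_radius_iter[OF _ r(1,3)]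
  note N1 = normality_at_pi_over_n_plus_2[OF n eqs(1)] and N2 = normality_at_pi_over_n_plus_8[OF n eqs(2)]
    and N3 = normality_at_pi_over_2n_minus_2[OF n eqs(3)] and N4 = normality_at_pi_over_2n[OF n eqs(4)]
    and N5 = normality_at_pi_over_2n_plus_8[OF n eqs(5)] and N6 = normality_at_quarter[OF n]
  have q: "(0::real) < 1/4" by simp
  have "4 \<le> n" using n by simp
  then have C: "spectral_radius r (C_hyp r n) = rho_value r (1/4)"
    unfolding C_hyp_def by (intro spectral_radius_iter(1)[OF _ r(2,3) q] proper_cycle_graph normal_cycle_graph)
  note vals = \<rho>(1)[OF P(1) a(1) N1(1)] \<rho>(2)[OF P(2) a(1) N1(2)] \<rho>(3)[OF P(2) a(2) N2(1)] \<rho>(2)[OF P(5) a(2) N2(2)]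
    \<rho>(3)[OF P(5) a(3) N3(1)] \<rho>(1)[OF P(3) a(3) N3(2)] \<rho>(1)[OF P(4) a(4) N4(1)] \<rho>(2)[OF P(6) a(4) N4(2)]
    \<rho>(3)[OF P(6) a(5) N5(1)] \<rho>(2)[OF P(8) a(5) N5(2)] \<rho>(3)[OF P(8) q N6(1)] \<rho>(1)[OF P(9) q N6(2)]
    \<rho>(1)[OF P(7) q N6(3)] \<rho>(1)[OF P(10) q N6(4)]
  note vals' = vals[folded A_hyp_iter[OF assms(1)] F_hyp_def G_hyp_def E_hyp_def BD_hyp_def Dtilde_hyp_def BDtilde_hyp_def]
  show ?thesis
  proof (intro conjI allI impI)
    show "fact (r - 1) * root r 4 < spectral_radius r G"
      if "G \<in> connected_r_graphs r n" "\<forall>K \<in> {A_hyp r n, F_hyp r 1 1 (n - 3), G_hyp r 1 1 (n - 6) 1 1,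
                   F_hyp r 1 2 (n - 4), E_hyp r 1 1 (n - 2), G_hyp r 1 2 (n - 7) 1 1,
                   BD_hyp r n, C_hyp r n, Dtilde_hyp r n, G_hyp r 1 2 (n - 8) 1 2,
                   BDtilde_hyp r n}. \<not> hypergraph_iso G K" for G :: "'a hypergraph"
      using \<rho>_G[OF that] unfolding crit .
  qed (use vals' C a43 crit in linarith)+
qed

end
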